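(* Suppose we are given samples of the form $y = Ax+\eta$, where $x$ is uniform on $\{+1,-1\}^n$, $A$ is an (unknown) $n\times n$ matrix, and $\eta$ is an $n$-dimensional Gaussian random variable independent of $x$ with unknown covariance matrix $\Sigma$. There is an algorithm that with high probability recovers $\widehat{A}$ with $$\|\widehat{A} - A\,\Pi\,\mathrm{diag}(k_i)\|_F \le \epsilon,$$ where $\Pi$ is some permutation matrix and each $k_i\in\{+1,-1\}$, and also recovers $\widehat{\Sigma}$ with $$\|\widehat{\Sigma}-\Sigma\|_F\le \epsilon .$$ Furthermore, the running time and number of samples needed are $\mathrm{poly}\big(n, 1/\epsilon, \|A\|_2, \|\Sigma\|_2, 1/\lambda_{\min}(A)\big)$.
   Context: $\|\cdot\|_2$ applied to a matrix denotes the operator norm, $\|\cdot\|_F$ the Frobenius norm, and $\lambda_{\min}(A)$ the smallest eigenvalue of $A$. $\mathrm{diag}(k_i)$ is the diagonal matrix with diagonal entries $k_1,\dots,k_n$. $\epsilon$ is the target precision. $\mathrm{poly}(\cdot)$ denotes a quantity polynomial in its arguments.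
   Formalization: λ_min(A) is taken to be the smallest singular value of A (equal to the smallest eigenvalue for positive semidefinite A), because a general real A need have no smallest eigenvalue and the bound fails with the smallest modulus of an eigenvalue; the noise η is read as having mean zero. *)

theory Defs
  imports
    "HOL-Probability.Probability"
    "HOL-Combinatorics.Permutations"
    "Jordan_Normal_Form.Char_Poly"
begin

section \<open>Matrices\<close>

definition frobenius_norm :: "real mat \<Rightarrow> real" where
  "frobenius_norm M = sqrt (\<Sum>i<dim_row M. \<Sum>j<dim_col M. (M $$ (i, j))\<^sup>2)"

definition op_norm :: "real mat \<Rightarrow> real" where
  "op_norm M =
    (SUP x \<in> {x \<in> carrier_vec (dim_col M). x \<bullet> x \<le> 1}. sqrt ((M *\<^sub>v x) \<bullet> (M *\<^sub>v x)))"

text \<open>The mixing matrix need not be symmetric; the quantity that governs the sample complexity is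
  its smallest singular value, i.e. the smallest eigenvalue of the factor \<open>|A|\<close> in the polar
  decomposition. For positive semidefinite \<open>A\<close> this is the smallest eigenvalue of \<open>A\<close> itself. The
  smallest modulus of an eigenvalue would not do: it can be \<open>1\<close> for matrices of polynomial norm that
  are singular up to an exponentially small perturbation.\<close>

definition lambda_min :: "real mat \<Rightarrow> real" where
  "lambda_min A = sqrt (Min {k. eigenvalue (transpose_mat A * A) k})"

definition permutation_mat :: "nat \<Rightarrow> real mat \<Rightarrow> bool" where
  "permutation_mat n P \<longleftrightarrow>
    (\<exists>p. p permutes {..<n} \<and> P = mat n n (\<lambda>(i, j). if i = p j then 1 else 0))"

section \<open>The sample distribution\<close>

text \<open>Random vectors of varying dimension \<open>n\<close> are represented by measures on the product
  \<sigma>-algebra \<open>\<Pi>\<^sub>M i\<in>{..<n}. borel\<close>.\<close>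

definition normal_distribution :: "real \<Rightarrow> real \<Rightarrow> real measure" where
  "normal_distribution \<mu> \<sigma> =
    (if \<sigma> = 0 then return borel \<mu> else density lborel (normal_density \<mu> \<sigma>))"

text \<open>All linear functionals are normally distributed, possibly degenerate: the covariance matrix
  may be singular.\<close>

definition gaussian_vector :: "nat \<Rightarrow> (nat \<Rightarrow> real) measure \<Rightarrow> bool" where
  "gaussian_vector n N \<longleftrightarrow>
    prob_space N \<and> sets N = sets (Pi\<^sub>M {..<n} (\<lambda>_. borel)) \<and>
    (\<forall>u :: nat \<Rightarrow> real. \<exists>\<mu> \<sigma>. 0 \<le> \<sigma> \<and>
      distr N borel (\<lambda>z. \<Sum>i<n. u i * z i) = normal_distribution \<mu> \<sigma>)"

definition centered :: "nat \<Rightarrow> (nat \<Rightarrow> real) measure \<Rightarrow> bool" where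
  "centered n N \<longleftrightarrow> (\<forall>i<n. (\<integral>z. z i \<partial>N) = 0)"

definition covariance_mat :: "nat \<Rightarrow> (nat \<Rightarrow> real) measure \<Rightarrow> real mat" where
  "covariance_mat n N = mat n n (\<lambda>(i, j).
    \<integral>z. (z i - (\<integral>w. w i \<partial>N)) * (z j - (\<integral>w. w j \<partial>N)) \<partial>N)"

definition uniform_signs :: "nat \<Rightarrow> (nat \<Rightarrow> real) measure" where
  "uniform_signs n = measure_pmf (pmf_of_set ({..<n} \<rightarrow>\<^sub>E {-1, 1}))"

text \<open>The law of \<open>y = A x + \<eta>\<close>, where \<open>N\<close> is the law of \<open>\<eta>\<close>; independence of \<open>x\<close> and \<open>\<eta>\<close> is
  expressed by the product measure.\<close>

definition ica_sample :: "nat \<Rightarrow> real mat \<Rightarrow> (nat \<Rightarrow> real) measure \<Rightarrow> (nat \<Rightarrow> real) measure" where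
  "ica_sample n A N =
    distr (uniform_signs n \<Otimes>\<^sub>M N) (Pi\<^sub>M {..<n} (\<lambda>_. borel))
      (\<lambda>(x, z). \<lambda>i\<in>{..<n}. vec_index (A *\<^sub>v Matrix.vec n x) i + z i)"

text \<open>An infinite supply of independent samples, together with independent fair coin flips that
  serve as the internal randomness of the algorithm.\<close>

definition ica_space ::
  "nat \<Rightarrow> real mat \<Rightarrow> (nat \<Rightarrow> real) measure \<Rightarrow> ((nat \<Rightarrow> nat \<Rightarrow> real) \<times> (nat \<Rightarrow> bool)) measure" where
  "ica_space n A N =
    Pi\<^sub>M UNIV (\<lambda>_. ica_sample n A N) \<Otimes>\<^sub>M Pi\<^sub>M UNIV (\<lambda>_. measure_pmf (bernoulli_pmf (1/2)))"

section \<open>Model of computation\<close>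

text \<open>Algorithms are programs of a while language for the randomized real RAM (Blum--Shub--Smale
  model): exact field operations and comparisons on reals, all constants rational, no square roots
  and no rounding of reals to integers. Integers, which also serve as addresses, support only
  addition and truncated subtraction. Integer variables, real arrays and array positions are all
  numbered by naturals; a real variable is an array used at position 0. Every assignment, test and
  coin flip takes one unit of time, which is adequate since the expressions of a fixed program have
  constant size; reading a sample of dimension \<open>n\<close> takes \<open>n + 1\<close> units.\<close>

datatype iexp =
    IConst nat
  | IVar nat
  | IAdd iexp iexp
  | ISub iexp iexp

datatype rexp =
    RConst rat
  | ROfInt iexp
  | RGet nat iexp
  | RAdd rexp rexp
  | RSub rexp rexp
  | RMul rexp rexp
  | RDiv rexp rexp

datatype test =
    ILess iexp iexp
  | RLess rexp rexp
  | TNot test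
  | TAnd test test

datatype com =
    Skip
  | IAssign nat iexp
  | RAssign nat iexp rexp
  | Seq com com
  | If test com com
  | While test com
  | Sample nat
  | Coin nat

text \<open>The last two components count the samples and the coin flips consumed so far.\<close>

record state =
  ints :: "nat \<Rightarrow> nat"
  reals :: "nat \<Rightarrow> nat \<Rightarrow> real"
  samples :: nat
  coins :: nat

fun ival :: "iexp \<Rightarrow> state \<Rightarrow> nat" where
  "ival (IConst k) s = k"
| "ival (IVar v) s = ints s v"
| "ival (IAdd e f) s = ival e s + ival f s"
| "ival (ISub e f) s = ival e s - ival f s"

fun rval :: "rexp \<Rightarrow> state \<Rightarrow> real" where
  "rval (RConst q) s = of_rat q"
| "rval (ROfInt e) s = of_nat (ival e s)"
| "rval (RGet a e) s = reals s a (ival e s)"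
| "rval (RAdd e f) s = rval e s + rval f s"
| "rval (RSub e f) s = rval e s - rval f s"
| "rval (RMul e f) s = rval e s * rval f s"
| "rval (RDiv e f) s = rval e s / rval f s"

fun tval :: "test \<Rightarrow> state \<Rightarrow> bool" where
  "tval (ILess e f) s \<longleftrightarrow> ival e s < ival f s"
| "tval (RLess e f) s \<longleftrightarrow> rval e s < rval f s"
| "tval (TNot t) s \<longleftrightarrow> \<not> tval t s"
| "tval (TAnd t u) s \<longleftrightarrow> tval t s \<and> tval u s"

text \<open>\<open>exec n y b c s t s'\<close>: started in state \<open>s\<close>, the command \<open>c\<close> halts in state \<open>s'\<close> after \<open>t\<close>
  units of time, where \<open>y\<close> is the stream of \<open>n\<close>-dimensional samples and \<open>b\<close> the stream of coin
  flips. \<open>Sample a\<close> overwrites positions \<open>0, \<dots>, n - 1\<close> of array \<open>a\<close> by the next sample.\<close>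

inductive exec ::
  "nat \<Rightarrow> (nat \<Rightarrow> nat \<Rightarrow> real) \<Rightarrow> (nat \<Rightarrow> bool) \<Rightarrow> com \<Rightarrow> state \<Rightarrow> nat \<Rightarrow> state \<Rightarrow> bool"
  for n y b where
  Skip: "exec n y b Skip s 1 s"
| IAssign: "exec n y b (IAssign v e) s 1 (s\<lparr>ints := (ints s)(v := ival e s)\<rparr>)"
| RAssign: "exec n y b (RAssign a e f) s 1
    (s\<lparr>reals := (reals s)(a := (reals s a)(ival e s := rval f s))\<rparr>)"
| Seq: "exec n y b c s t s' \<Longrightarrow> exec n y b d s' t' s'' \<Longrightarrow> exec n y b (Seq c d) s (t + t') s''"
| IfTrue: "tval g s \<Longrightarrow> exec n y b c s t s' \<Longrightarrow> exec n y b (If g c d) s (1 + t) s'"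
| IfFalse: "\<not> tval g s \<Longrightarrow> exec n y b d s t s' \<Longrightarrow> exec n y b (If g c d) s (1 + t) s'"
| WhileFalse: "\<not> tval g s \<Longrightarrow> exec n y b (While g c) s 1 s"
| WhileTrue: "tval g s \<Longrightarrow> exec n y b c s t s' \<Longrightarrow> exec n y b (While g c) s' t' s'' \<Longrightarrow>
    exec n y b (While g c) s (1 + t + t') s''"
| Sample: "exec n y b (Sample a) s (n + 1)
    (s\<lparr>reals := (reals s)(a := (\<lambda>i. if i < n then y (samples s) i else reals s a i)),
       samples := samples s + 1\<rparr>)"
| Coin: "exec n y b (Coin v) s 1
    (s\<lparr>ints := (ints s)(v := (if b (coins s) then 1 else 0)), coins := coins s + 1\<rparr>)"

text \<open>The only inputs are the dimension, in integer variable \<open>0\<close>, and the target precision, at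
  position \<open>0\<close> of array \<open>0\<close>.\<close>

definition init_state :: "nat \<Rightarrow> real \<Rightarrow> state" where
  "init_state n \<epsilon> =
    \<lparr>ints = (\<lambda>_. 0)(0 := n), reals = (\<lambda>_ _. 0)(0 := (\<lambda>_. 0)(0 := \<epsilon>)), samples = 0, coins = 0\<rparr>"

text \<open>The matrix stored in an array in row-major order.\<close>

definition matrix_of :: "nat \<Rightarrow> state \<Rightarrow> nat \<Rightarrow> real mat" where
  "matrix_of n s a = mat n n (\<lambda>(i, j). reals s a (i * n + j))"

section \<open>The learning problem\<close>

definition recovers_mixing :: "nat \<Rightarrow> real \<Rightarrow> real mat \<Rightarrow> real mat \<Rightarrow> bool" where
  "recovers_mixing n \<epsilon> A A' \<longleftrightarrow>
    (\<exists>P k. permutation_mat n P \<and> (\<forall>i<n. k i \<in> {1, -1}) \<and>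
      frobenius_norm (A' - A * P * mat_diag n k) \<le> \<epsilon>)"

definition recovers_covariance :: "real \<Rightarrow> real mat \<Rightarrow> real mat \<Rightarrow> bool" where
  "recovers_covariance \<epsilon> S S' \<longleftrightarrow> frobenius_norm (S' - S) \<le> \<epsilon>"

text \<open>On the given samples and coin flips, the program halts within time \<open>T\<close>, having read at most
  \<open>T\<close> samples, with correct estimates of \<open>A\<close> and \<open>S\<close> in arrays \<open>1\<close> and \<open>2\<close>.\<close>

definition succeeds ::
  "com \<Rightarrow> nat \<Rightarrow> real \<Rightarrow> real mat \<Rightarrow> real mat \<Rightarrow> real \<Rightarrow> (nat \<Rightarrow> nat \<Rightarrow> real) \<times> (nat \<Rightarrow> bool) \<Rightarrow> bool" where
  "succeeds prog n \<epsilon> A S T = (\<lambda>(y, b).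
    \<exists>t s. exec n y b prog (init_state n \<epsilon>) t s \<and> real t \<le> T \<and> real (samples s) \<le> T \<and>
      recovers_mixing n \<epsilon> A (matrix_of n s 1) \<and> recovers_covariance \<epsilon> S (matrix_of n s 2))"

end

theory Submission
  imports Defs
begin

text \<open>Write \<open>a\<^sub>j\<close> for the columns of \<open>A\<close>. The fourth cumulant of \<open>\<langle>u, y\<rangle>\<close> is \<open>-2 \<Sum>\<^sub>j \<langle>u, a\<^sub>j\<rangle>\<^sup>4\<close>: the Gaussian noise
  does not contribute. Polarizing, the matrices \<open>H = \<Sum>\<^sub>j \<langle>u, a\<^sub>j\<rangle>\<^sup>2 a\<^sub>j a\<^sub>j\<^sup>T\<close> and \<open>M = \<Sum>\<^sub>j |a\<^sub>j|\<^sup>2 a\<^sub>j a\<^sub>j\<^sup>T\<close> can be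
  estimated from moments up to order four. If the \<open>b\<^sub>j\<close> are dual to the \<open>a\<^sub>j\<close>, then \<open>H - t M\<close> is singular
  exactly for \<open>t = \<langle>u, a\<^sub>j\<rangle>\<^sup>2 / |a\<^sub>j|\<^sup>2\<close>, with kernel vector \<open>b\<^sub>j\<close>, and for a random direction \<open>u\<close> these values
  of \<open>t\<close> are separated by an inverse polynomial. The program scans a fine grid of values of \<open>t\<close>. It detects
  an approximate kernel by applying the polynomial filter \<open>(I - (H - t M)\<^sup>2 / R\<^sup>2)\<^sup>J\<close> to the unit vectors,
  which also yields a vector \<open>g\<close> close to a multiple of \<open>b\<^sub>j\<close>. Then \<open>M g\<close> is close to a multiple of \<open>a\<^sub>j\<close>, and
  it is scaled by an approximate fourth root of \<open>1 / (|M g|\<^sup>2 \<langle>g, M g\<rangle>)\<close>, found by linear search, to become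
  \<open>\<plusminus>a\<^sub>j\<close> up to a small error. The covariance of the noise is what remains of the second moments.

  The norms of \<open>A\<close> and of the noise and the smallest singular value of \<open>A\<close> are unknown to the program. It
  therefore tries scales \<open>L = n + 16, n + 17, \<dots>\<close>, each with a fresh block of samples of size polynomial in
  \<open>L\<close>, until the estimates themselves certify that the trace of the second moments is small, that the
  filter finds no approximate kernel of \<open>M\<close>, and that \<open>\<epsilon>\<close> is large compared with \<open>1 / L\<close>.\<close>

section \<open>Reasoning about programs\<close>

text \<open>The machine has no roots and no eigenvalue routine; this is why an approximate kernel is
  sought by a polynomial filter and the final scaling by a linear search. All quantities are
  compared with powers of one scale W = L^(c+3), at least 16. J filter steps with a matrix of norm
  at most R = W^8 leave a residual R / sqrt J. For the pencil J = W^800 gives W^(-392), far below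
  the separation W^(-40) of the eigenvalues even after the conditioning losses; for M the cruder J =
  W^20 suffices, as that test only has to certify conditioning. Grid step and entry errors W^(-800)
  are then fine enough for every eigenvalue to be noticed. Entry errors of this size follow from
  Chebyshev with W^1700 samples. They are stated relative to the true trace V of the second moments,
  so concentration can be demanded at all scales at once; only a passed trace test shows that W
  dominates V. The exponent c + 3 serves two purposes: the failure probabilities of all rounds sum
  to at most half of (n + 1)^(-c), and W is at least the factor that a random direction of the
  required precision loses. Once a good event for samples and one for coins is fixed, the run is
  deterministic.\<close>

text \<open>\<open>bs\<close> is the big-step semantics without clock in which every execution of a loop makes at most
  \<open>W\<close> iterations. A bound on all iteration counts yields a bound on the running time that is
  polynomial in \<open>W\<close>, so time never has to be tracked explicitly.\<close>

fun bs :: "nat \<Rightarrow> (nat \<Rightarrow> nat \<Rightarrow> real) \<Rightarrow> (nat \<Rightarrow> bool) \<Rightarrow> nat \<Rightarrow> com \<Rightarrow> state \<Rightarrow> state \<Rightarrow> bool" where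
  "bs n y b W Skip s s' \<longleftrightarrow> s' = s"
| "bs n y b W (IAssign v e) s s' \<longleftrightarrow> s' = s\<lparr>ints := (ints s)(v := ival e s)\<rparr>"
| "bs n y b W (RAssign a e f) s s' \<longleftrightarrow>
    s' = s\<lparr>reals := (reals s)(a := (reals s a)(ival e s := rval f s))\<rparr>"
| "bs n y b W (Seq c d) s s' \<longleftrightarrow> (\<exists>r. bs n y b W c s r \<and> bs n y b W d r s')"
| "bs n y b W (If g c d) s s' \<longleftrightarrow> (if tval g s then bs n y b W c s s' else bs n y b W d s s')"
| "bs n y b W (While g c) s s' \<longleftrightarrow> (\<exists>k\<le>W. \<exists>\<sigma>. \<sigma> 0 = s \<and> \<sigma> k = s' \<and> \<not> tval g s' \<and>
    (\<forall>i<k. tval g (\<sigma> i) \<and> bs n y b W c (\<sigma> i) (\<sigma> (Suc i))))"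
| "bs n y b W (Sample a) s s' \<longleftrightarrow>
    s' = s\<lparr>reals := (reals s)(a := (\<lambda>i. if i < n then y (samples s) i else reals s a i)),
       samples := samples s + 1\<rparr>"
| "bs n y b W (Coin v) s s' \<longleftrightarrow>
    s' = s\<lparr>ints := (ints s)(v := (if b (coins s) then 1 else 0)), coins := coins s + 1\<rparr>"

text \<open>Both branches of a conditional are charged and every loop is charged W full iterations;
  only polynomiality in W matters.\<close>

fun time_bound :: "nat \<Rightarrow> nat \<Rightarrow> com \<Rightarrow> nat" where
  "time_bound n W (Seq c d) = time_bound n W c + time_bound n W d"
| "time_bound n W (If g c d) = 1 + time_bound n W c + time_bound n W d"
| "time_bound n W (While g c) = 1 + W * (1 + time_bound n W c)"
| "time_bound n W (Sample a) = n + 1"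
| "time_bound n W _ = 1"

lemmas exec_rules = exec.intros[unfolded One_nat_def]

lemma exec_While_chain:
  assumes "\<And>i. i < k \<Longrightarrow> tval g (\<sigma> i) \<and> (\<exists>t\<le>B. exec n y b c (\<sigma> i) t (\<sigma> (Suc i)))"
    and "\<not> tval g (\<sigma> k)"
  shows "\<exists>t \<le> 1 + k * (1 + B). exec n y b (While g c) (\<sigma> 0) t (\<sigma> k)"
  using assms
proof (induction k arbitrary: \<sigma>)
  case 0
  then show ?case by (intro exI[of _ 1]) (auto intro: exec_rules)
next
  case (Suc k)
  obtain t1 where t1: "t1 \<le> B" "exec n y b c (\<sigma> 0) t1 (\<sigma> 1)" using Suc.prems(1)[of 0] by auto
  have "\<exists>t \<le> 1 + k * (1 + B). exec n y b (While g c) ((\<lambda>i. \<sigma> (Suc i)) 0) t ((\<lambda>i. \<sigma> (Suc i)) k)"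
    by (rule Suc.IH) (use Suc.prems in auto)
  then obtain t2 where t2: "t2 \<le> 1 + k * (1 + B)" "exec n y b (While g c) (\<sigma> 1) t2 (\<sigma> (Suc k))"
    by auto
  have "exec n y b (While g c) (\<sigma> 0) (1 + t1 + t2) (\<sigma> (Suc k))"
    by (rule exec.WhileTrue[OF _ t1(2) t2(2)]) (use Suc.prems(1)[of 0] in auto)
  then show ?case using t1(1) t2(1) by (intro exI[of _ "1 + t1 + t2"]) auto
qed

lemma bs_imp_exec: "bs n y b W c s s' \<Longrightarrow> \<exists>t \<le> time_bound n W c. exec n y b c s t s'"
proof (induction c arbitrary: s s')
  case Skip
  then show ?case by (intro exI[of _ 1]) (auto intro: exec_rules)
next
  case (IAssign v e)
  then show ?case by (intro exI[of _ 1]) (auto intro: exec_rules)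
next
  case (RAssign a e f)
  then show ?case by (intro exI[of _ 1]) (auto intro: exec_rules)
next
  case (Seq c d)
  then obtain r where "bs n y b W c s r" "bs n y b W d r s'" by auto
  with Seq.IH obtain t t' where "t \<le> time_bound n W c" "exec n y b c s t r"
    "t' \<le> time_bound n W d" "exec n y b d r t' s'" by meson
  then show ?case by (intro exI[of _ "t + t'"]) (auto intro: exec.Seq)
next
  case (If g c d)
  show ?case
  proof (cases "tval g s")
    case True
    then obtain t where "t \<le> time_bound n W c" "exec n y b c s t s'"
      using If.IH(1)[of s s'] If.prems by auto
    then show ?thesis using True by (intro exI[of _ "1 + t"]) (auto intro: exec_rules(5)[simplified])
  next
    case False
    then obtain t where "t \<le> time_bound n W d" "exec n y b d s t s'"
      using If.IH(2)[of s s'] If.prems by auto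
    then show ?thesis using False by (intro exI[of _ "1 + t"]) (auto intro: exec_rules(6)[simplified])
  qed
next
  case (While g c)
  then obtain k \<sigma> where k: "k \<le> W" "\<sigma> 0 = s" "\<sigma> k = s'" "\<not> tval g s'"
    "\<forall>i<k. tval g (\<sigma> i) \<and> bs n y b W c (\<sigma> i) (\<sigma> (Suc i))" by auto
  have "\<exists>t \<le> 1 + k * (1 + time_bound n W c). exec n y b (While g c) (\<sigma> 0) t (\<sigma> k)"
    by (rule exec_While_chain) (use k While.IH in auto)
  then obtain t where t: "t \<le> 1 + k * (1 + time_bound n W c)" "exec n y b (While g c) s t s'"
    using k by auto
  have "k * (1 + time_bound n W c) \<le> W * (1 + time_bound n W c)" using k(1) by (rule mult_le_mono1)
  then show ?case using t by (intro exI[of _ t]) simp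
next
  case (Sample a)
  then show ?case using exec.Sample[of n y b a s] by (intro exI[of _ "n + 1"]) auto
next
  case (Coin v)
  then show ?case using exec.Coin[of n y b v s] by (intro exI[of _ 1]) auto
qed

lemma exec_samples_le: "exec n y b c s t s' \<Longrightarrow> samples s' \<le> samples s + t"
  by (induction rule: exec.induct) auto

text \<open>Structural induction: each loop raises the degree by one, and for the two parts of a
  sequence or conditional the degrees are simply added. Coefficient and degree depend on the program
  alone, which makes the final bound uniform in all instances.\<close>

lemma time_bound_poly: "\<exists>K d. \<forall>n W. 1 \<le> W \<longrightarrow> n \<le> W \<longrightarrow> time_bound n W c \<le> K * W ^ d"
proof (induction c)
  case (Seq c d)
  then obtain K e K' e' where *: "\<And>n W. 1 \<le> W \<Longrightarrow> n \<le> W \<Longrightarrow> time_bound n W c \<le> K * W ^ e"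
    "\<And>n W. 1 \<le> W \<Longrightarrow> n \<le> W \<Longrightarrow> time_bound n W d \<le> K' * W ^ e'" by metis
  have "time_bound n W (Seq c d) \<le> (K + K') * W ^ (e + e')" if "1 \<le> W" "n \<le> W" for n W
  proof -
    have "time_bound n W (Seq c d) \<le> K * W ^ e + K' * W ^ e'"
      using *(1)[OF that] *(2)[OF that] by simp
    also have "\<dots> \<le> K * W ^ (e + e') + K' * W ^ (e + e')"
      using that by (intro add_mono mult_le_mono2 power_increasing) auto
    finally show ?thesis by (simp add: algebra_simps)
  qed
  then show ?case by blast
next
  case (If g c d)
  then obtain K e K' e' where *: "\<And>n W. 1 \<le> W \<Longrightarrow> n \<le> W \<Longrightarrow> time_bound n W c \<le> K * W ^ e"
    "\<And>n W. 1 \<le> W \<Longrightarrow> n \<le> W \<Longrightarrow> time_bound n W d \<le> K' * W ^ e'" by metis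
  have "time_bound n W (If g c d) \<le> (1 + K + K') * W ^ (e + e')" if "1 \<le> W" "n \<le> W" for n W
  proof -
    have "time_bound n W (If g c d) \<le> 1 + K * W ^ e + K' * W ^ e'"
      using *(1)[OF that] *(2)[OF that] by simp
    also have "\<dots> \<le> W ^ (e + e') + K * W ^ (e + e') + K' * W ^ (e + e')"
      using that by (intro add_mono mult_le_mono2 power_increasing) auto
    finally show ?thesis by (simp add: algebra_simps)
  qed
  then show ?case by blast
next
  case (While g c)
  then obtain K e where *: "\<And>n W. 1 \<le> W \<Longrightarrow> n \<le> W \<Longrightarrow> time_bound n W c \<le> K * W ^ e" by metis
  have "time_bound n W (While g c) \<le> (2 + K) * W ^ (e + 1)" if "1 \<le> W" "n \<le> W" for n W
  proof -
    have "time_bound n W (While g c) \<le> 1 + W + W * (K * W ^ e)"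
      using mult_le_mono2[OF *[OF that], of W] by (simp add: algebra_simps)
    also have "W * (K * W ^ e) = K * W ^ (e + 1)" by simp
    also have "1 + W + K * W ^ (e + 1) \<le> W ^ (e + 1) + W ^ (e + 1) + K * W ^ (e + 1)"
      using that self_le_power[of W "e + 1"] one_le_power[of W "e + 1"] by (intro add_mono) auto
    finally show ?thesis by (simp add: algebra_simps)
  qed
  then show ?case by blast
next
  case (Sample a)
  have "time_bound n W (Sample a) \<le> 2 * W ^ 1" if "1 \<le> W" "n \<le> W" for n W
    using that by simp
  then show ?case by blast
qed (auto intro: exI[of _ 1] exI[of _ 0])

section \<open>Syntactic footprints of programs, the frame property and preconditions\<close>

fun wints :: "com \<Rightarrow> nat set" where
  "wints (IAssign v e) = {v}"
| "wints (Coin v) = {v}"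
| "wints (Seq c d) = wints c \<union> wints d"
| "wints (If g c d) = wints c \<union> wints d"
| "wints (While g c) = wints c"
| "wints _ = {}"

fun wreals :: "com \<Rightarrow> nat set" where
  "wreals (RAssign a e f) = {a}"
| "wreals (Sample a) = {a}"
| "wreals (Seq c d) = wreals c \<union> wreals d"
| "wreals (If g c d) = wreals c \<union> wreals d"
| "wreals (While g c) = wreals c"
| "wreals _ = {}"

fun draws :: "com \<Rightarrow> bool" where
  "draws (Sample a) = True"
| "draws (Seq c d) \<longleftrightarrow> draws c \<or> draws d"
| "draws (If g c d) \<longleftrightarrow> draws c \<or> draws d"
| "draws (While g c) = draws c"
| "draws _ = False"

definition frame :: "com \<Rightarrow> state \<Rightarrow> state \<Rightarrow> bool" where
  "frame c s s' \<longleftrightarrow> (\<forall>v. v \<notin> wints c \<longrightarrow> ints s' v = ints s v) \<and>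
    (\<forall>a. a \<notin> wreals c \<longrightarrow> reals s' a = reals s a) \<and> (\<not> draws c \<longrightarrow> samples s' = samples s)"

lemma frame_chain:
  assumes "\<And>i. i < k \<Longrightarrow> frame c (\<sigma> i) (\<sigma> (Suc i))"
  shows "frame c (\<sigma> 0) (\<sigma> k)"
  using assms by (induction k) (auto simp: frame_def)

lemma bs_frame: "bs n y b W c s s' \<Longrightarrow> frame c s s'"
proof (induction c arbitrary: s s')
  case (Seq c d)
  then obtain r where "bs n y b W c s r" "bs n y b W d r s'" by auto
  with Seq.IH have "frame c s r" "frame d r s'" by auto
  then show ?case by (auto simp: frame_def)
next
  case (If g c d)
  then have "frame c s s' \<or> frame d s s'" by (auto split: if_splits)
  then show ?case by (auto simp: frame_def)
next
  case (While g c)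
  then obtain k \<sigma> where "\<sigma> 0 = s" "\<sigma> k = s'" "\<forall>i<k. bs n y b W c (\<sigma> i) (\<sigma> (Suc i))" by auto
  then have "frame c s s'" using frame_chain[of k c \<sigma>] While.IH by auto
  then show ?case by (auto simp: frame_def)
qed (auto simp: frame_def)

text \<open>For fixed samples and coins the language is deterministic, so the existence of a bounded
  run that ends in \<open>Q\<close> is a statement of total correctness.\<close>

definition wp :: "nat \<Rightarrow> (nat \<Rightarrow> nat \<Rightarrow> real) \<Rightarrow> (nat \<Rightarrow> bool) \<Rightarrow> nat \<Rightarrow> com \<Rightarrow> (state \<Rightarrow> bool) \<Rightarrow> state \<Rightarrow> bool"
  where "wp n y b W c Q s \<longleftrightarrow> (\<exists>s'. bs n y b W c s s' \<and> Q s')"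

lemma wp_basic:
  "wp n y b W Skip Q s \<longleftrightarrow> Q s"
  "wp n y b W (IAssign v e) Q s \<longleftrightarrow> Q (s\<lparr>ints := (ints s)(v := ival e s)\<rparr>)"
  "wp n y b W (RAssign a e f) Q s \<longleftrightarrow>
    Q (s\<lparr>reals := (reals s)(a := (reals s a)(ival e s := rval f s))\<rparr>)"
  "wp n y b W (If g c d) Q s \<longleftrightarrow> (if tval g s then wp n y b W c Q s else wp n y b W d Q s)"
  "wp n y b W (Sample a) Q s \<longleftrightarrow>
    Q (s\<lparr>reals := (reals s)(a := (\<lambda>i. if i < n then y (samples s) i else reals s a i)),
       samples := samples s + 1\<rparr>)"
  "wp n y b W (Coin v) Q s \<longleftrightarrow>
    Q (s\<lparr>ints := (ints s)(v := (if b (coins s) then 1 else 0)), coins := coins s + 1\<rparr>)"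
  by (auto simp: wp_def)

lemma wp_Seq: "wp n y b W (Seq c d) Q s \<longleftrightarrow> wp n y b W c (wp n y b W d Q) s"
  by (auto simp: wp_def)

text \<open>The frame fact comes for free from the footprint, so specifications only have to mention
  what a command changes.\<close>

lemma wp_mono:
  assumes "wp n y b W c P s" "\<And>s'. frame c s s' \<Longrightarrow> P s' \<Longrightarrow> Q s'"
  shows "wp n y b W c Q s"
  using assms bs_frame by (fastforce simp: wp_def)

lemma wp_frame:
  assumes "wp n y b W c P s"
  shows "wp n y b W c (\<lambda>s'. P s' \<and> frame c s s') s"
  using assms by (rule wp_mono) auto

lemma wp_While:
  assumes "I 0 s" "N \<le> W"
    and step: "\<And>i s. i < N \<Longrightarrow> I i s \<Longrightarrow> tval g s \<and> wp n y b W c (I (Suc i)) s"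
    and "\<And>s. I N s \<Longrightarrow> \<not> tval g s"
  shows "wp n y b W (While g c) (I N) s"
proof -
  have "\<exists>\<sigma>. \<sigma> 0 = s \<and> I k (\<sigma> k) \<and>
      (\<forall>i<k. tval g (\<sigma> i) \<and> bs n y b W c (\<sigma> i) (\<sigma> (Suc i)))" if "k \<le> N" for k
    using that
  proof (induction k)
    case 0
    then show ?case using assms(1) by auto
  next
    case (Suc k)
    then obtain \<sigma> where \<sigma>: "\<sigma> 0 = s" "I k (\<sigma> k)"
      "\<forall>i<k. tval g (\<sigma> i) \<and> bs n y b W c (\<sigma> i) (\<sigma> (Suc i))" by auto
    from step[OF _ \<sigma>(2)] Suc.prems obtain r where r: "tval g (\<sigma> k)" "bs n y b W c (\<sigma> k) r" "I (Suc k) r"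
      by (auto simp: wp_def)
    show ?case
      by (intro exI[of _ "\<sigma>(Suc k := r)"]) (use \<sigma> r in \<open>auto simp: less_Suc_eq\<close>)
  qed
  from this[of N] obtain \<sigma> where "\<sigma> 0 = s" "I N (\<sigma> N)"
      "\<forall>i<N. tval g (\<sigma> i) \<and> bs n y b W c (\<sigma> i) (\<sigma> (Suc i))" by auto
  then show ?thesis using assms(2,4) by (auto simp: wp_def intro!: exI[of _ "\<sigma> N"] exI[of _ N] exI[of _ \<sigma>])
qed

text \<open>For loops whose exit time is known only through an upper bound, namely the linear search
  for the fourth root; \<open>wp_While\<close> covers the loops whose iteration count is determined
  by the analysis.\<close>

lemma wp_While_bounded:
  assumes "I 0 s" "N \<le> W"
    and step: "\<And>i s. I i s \<Longrightarrow> tval g s \<Longrightarrow> i < N \<and> wp n y b W c (I (Suc i)) s"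
  shows "wp n y b W (While g c) (\<lambda>s. (\<exists>i\<le>N. I i s) \<and> \<not> tval g s) s"
proof -
  have "\<exists>k\<le>N. \<exists>\<sigma>. \<sigma> 0 = s' \<and> I (j + k) (\<sigma> k) \<and> \<not> tval g (\<sigma> k) \<and> j + k \<le> N \<and>
      (\<forall>i<k. tval g (\<sigma> i) \<and> bs n y b W c (\<sigma> i) (\<sigma> (Suc i)))" if "I j s'" "j \<le> N" for j s'
    using that
  proof (induction "N - j" arbitrary: j s' rule: less_induct)
    case less
    show ?case
    proof (cases "tval g s'")
      case False
      then show ?thesis using less.prems by (intro exI[of _ 0] conjI) (auto intro: exI[of _ "\<lambda>_. s'"])
    next
      case True
      from step[OF less.prems(1) True] obtain r where r: "j < N" "bs n y b W c s' r" "I (Suc j) r"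
        by (auto simp: wp_def)
      have "N - Suc j < N - j" using r(1) by simp
      with less.hyps[of "Suc j" r] r obtain k \<sigma> where k: "\<sigma> 0 = r" "I (Suc j + k) (\<sigma> k)"
        "\<not> tval g (\<sigma> k)" "Suc j + k \<le> N"
        "\<forall>i<k. tval g (\<sigma> i) \<and> bs n y b W c (\<sigma> i) (\<sigma> (Suc i))"
        by (auto simp: Suc_le_eq)
      have "\<forall>i<Suc k. tval g (case_nat s' \<sigma> i) \<and> bs n y b W c (case_nat s' \<sigma> i) (case_nat s' \<sigma> (Suc i))"
        using k r True by (auto split: nat.split)
      then show ?thesis using k
        by (intro exI[of _ "Suc k"] conjI exI[of _ "case_nat s' \<sigma>"]) auto
    qed
  qed
  from this[of 0 s] assms(1) obtain k \<sigma> where "k \<le> N" "\<sigma> 0 = s" "I k (\<sigma> k)" "\<not> tval g (\<sigma> k)"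
      "\<forall>i<k. tval g (\<sigma> i) \<and> bs n y b W c (\<sigma> i) (\<sigma> (Suc i))" by auto
  then show ?thesis using assms(2)
    by (auto simp: wp_def intro!: exI[of _ "\<sigma> k"] exI[of _ k] exI[of _ \<sigma>])
qed

section \<open>Vectors and matrices as functions\<close>

definition ip :: "nat \<Rightarrow> (nat \<Rightarrow> real) \<Rightarrow> (nat \<Rightarrow> real) \<Rightarrow> real" where
  "ip n x y = (\<Sum>i<n. x i * y i)"

definition nrm :: "nat \<Rightarrow> (nat \<Rightarrow> real) \<Rightarrow> real" where
  "nrm n x = L2_set x {..<n}"

definition mv :: "nat \<Rightarrow> (nat \<Rightarrow> nat \<Rightarrow> real) \<Rightarrow> (nat \<Rightarrow> real) \<Rightarrow> nat \<Rightarrow> real" where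
  "mv n Z x = (\<lambda>i. \<Sum>j<n. Z i j * x j)"

definition tr :: "(nat \<Rightarrow> nat \<Rightarrow> real) \<Rightarrow> nat \<Rightarrow> nat \<Rightarrow> real" where
  "tr Z = (\<lambda>i j. Z j i)"

definition sym :: "nat \<Rightarrow> (nat \<Rightarrow> nat \<Rightarrow> real) \<Rightarrow> bool" where
  "sym n Z \<longleftrightarrow> (\<forall>i<n. \<forall>j<n. Z i j = Z j i)"

definition unitv :: "nat \<Rightarrow> nat \<Rightarrow> real" where
  "unitv k = (\<lambda>i. if i = k then 1 else 0)"

lemma nrm_sq: "(nrm n x)\<^sup>2 = ip n x x"
  by (simp add: nrm_def L2_set_def ip_def sum_nonneg power2_eq_square)

lemma nrm_nonneg [simp]: "0 \<le> nrm n x"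
  by (simp add: nrm_def L2_set_nonneg)

lemma abs_ip_le: "\<bar>ip n x y\<bar> \<le> nrm n x * nrm n y"
proof -
  have "\<bar>ip n x y\<bar> \<le> (\<Sum>i<n. \<bar>x i\<bar> * \<bar>y i\<bar>)" unfolding ip_def
    by (rule order.trans[OF sum_abs]) (simp add: abs_mult)
  also have "\<dots> \<le> nrm n x * nrm n y" unfolding nrm_def by (rule L2_set_mult_ineq)
  finally show ?thesis .
qed

lemma nrm_add_le: "nrm n (\<lambda>i. x i + y i) \<le> nrm n x + nrm n y"
  unfolding nrm_def by (rule L2_set_triangle_ineq)

lemma nrm_scale: "nrm n (\<lambda>i. c * x i) = \<bar>c\<bar> * nrm n x"
proof -
  have "ip n (\<lambda>i. c * x i) (\<lambda>i. c * x i) = c\<^sup>2 * ip n x x"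
    by (simp add: ip_def sum_distrib_left algebra_simps power2_eq_square)
  then have "(nrm n (\<lambda>i. c * x i))\<^sup>2 = (\<bar>c\<bar> * nrm n x)\<^sup>2"
    by (simp add: nrm_sq power_mult_distrib)
  then show ?thesis by (subst (asm) power2_eq_iff_nonneg) auto
qed

lemma nrm_le_add_diff: "nrm n x \<le> nrm n y + nrm n (\<lambda>i. x i - y i)"
  using nrm_add_le[of n y "\<lambda>i. x i - y i"] by simp

lemma nrm_cong: "(\<And>i. i < n \<Longrightarrow> x i = y i) \<Longrightarrow> nrm n x = nrm n y"
  unfolding nrm_def by (rule L2_set_cong) auto

lemma abs_le_nrm: "i < n \<Longrightarrow> \<bar>x i\<bar> \<le> nrm n x"
  unfolding nrm_def using member_le_L2_set[of "{..<n}" i "\<lambda>i. \<bar>x i\<bar>"] by (simp add: L2_set_def)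

lemma nrm_le_bound:
  assumes "\<And>i. i < n \<Longrightarrow> \<bar>x i\<bar> \<le> B" "0 \<le> B"
  shows "nrm n x \<le> sqrt n * B"
proof -
  have "(\<Sum>i<n. (x i)\<^sup>2) \<le> (\<Sum>i<n. B\<^sup>2)"
    using assms by (intro sum_mono) (simp add: power2_le_iff_abs_le)
  then have "nrm n x \<le> sqrt (real n * B\<^sup>2)" unfolding nrm_def L2_set_def by simp
  then show ?thesis using assms(2) by (simp add: real_sqrt_mult)
qed

text \<open>The coordinate of largest modulus. It supplies the unit vector from which the filter is
  started and the dominant index of a vector.\<close>

lemma ex_large_coordinate:
  assumes "0 < n"
  shows "\<exists>i<n. nrm n x \<le> sqrt n * \<bar>x i\<bar>"
proof -
  define B where "B = Max ((\<lambda>i. \<bar>x i\<bar>) ` {..<n})"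
  have "B \<in> (\<lambda>i. \<bar>x i\<bar>) ` {..<n}" unfolding B_def using assms by (intro Max_in) auto
  moreover have "\<bar>x i\<bar> \<le> B" if "i < n" for i unfolding B_def using that by (intro Max_ge) auto
  ultimately obtain i where "i < n" and B: "B = \<bar>x i\<bar>" and le: "\<And>j. j < n \<Longrightarrow> \<bar>x j\<bar> \<le> B" by blast
  moreover have "nrm n x \<le> sqrt n * B" using nrm_le_bound[of n x B, OF le] B by simp
  ultimately show ?thesis using B by blast
qed

lemma nrm_unitv: "k < n \<Longrightarrow> nrm n (unitv k) = 1"
  by (simp add: nrm_def L2_set_def unitv_def if_distrib[of "\<lambda>x. x\<^sup>2"] cong: if_cong)

lemma ip_unitv: "k < n \<Longrightarrow> ip n x (unitv k) = x k"
  by (simp add: ip_def unitv_def if_distrib cong: if_cong)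

lemma ip_mv: "ip n (mv n Z x) y = ip n x (mv n (tr Z) y)"
proof -
  have "ip n (mv n Z x) y = (\<Sum>i<n. \<Sum>j<n. Z i j * x j * y i)"
    by (simp add: ip_def mv_def sum_distrib_right)
  also have "\<dots> = (\<Sum>j<n. \<Sum>i<n. Z i j * x j * y i)" by (rule sum.swap)
  also have "\<dots> = ip n x (mv n (tr Z) y)"
    by (simp add: ip_def mv_def tr_def sum_distrib_left algebra_simps)
  finally show ?thesis .
qed

lemma ip_cong: "(\<And>i. i < n \<Longrightarrow> x i = x' i) \<Longrightarrow> (\<And>i. i < n \<Longrightarrow> y i = y' i) \<Longrightarrow> ip n x y = ip n x' y'"
  by (simp add: ip_def)

lemma ip_mv_sym: "sym n Z \<Longrightarrow> ip n (mv n Z x) y = ip n x (mv n Z y)"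
  by (subst ip_mv) (auto intro!: ip_cong simp: mv_def tr_def sym_def)

text \<open>Cauchy-Schwarz in every row: \<open>r\<close> bounds the row norms, so
  \<open>nrm n r\<close> bounds the Frobenius norm.\<close>

lemma nrm_mv_le_op:
  assumes "\<And>i. i < n \<Longrightarrow> nrm n (Z i) \<le> r i" "\<And>i. i < n \<Longrightarrow> 0 \<le> r i"
  shows "nrm n (mv n Z x) \<le> nrm n r * nrm n x"
proof -
  have "nrm n (mv n Z x) \<le> nrm n (\<lambda>i. nrm n x * r i)"
    unfolding nrm_def[of n "mv n Z x"] nrm_def[of n "\<lambda>i. nrm n x * r i"] L2_set_def
  proof (intro real_sqrt_le_mono sum_mono)
    fix i assume i: "i \<in> {..<n}"
    have "\<bar>mv n Z x i\<bar> \<le> nrm n (Z i) * nrm n x"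
      using abs_ip_le[of n "Z i" x] by (simp add: mv_def ip_def)
    also have "\<dots> \<le> nrm n x * r i" using assms i by (simp add: mult.commute[of _ "nrm n x"] mult_left_mono)
    finally show "(mv n Z x i)\<^sup>2 \<le> (nrm n x * r i)\<^sup>2" by (simp add: abs_le_square_iff[symmetric])
  qed
  also have "\<dots> = \<bar>nrm n x\<bar> * nrm n r" by (rule nrm_scale)
  finally show ?thesis by (simp only: abs_of_nonneg nrm_nonneg mult.commute[of "nrm n r"])
qed

lemma nrm_mv_le:
  assumes "\<And>i j. i < n \<Longrightarrow> j < n \<Longrightarrow> \<bar>Z i j\<bar> \<le> B" "0 \<le> B"
  shows "nrm n (mv n Z x) \<le> real n * B * nrm n x"
proof -
  have "nrm n (mv n Z x) \<le> nrm n (\<lambda>_. sqrt n * B) * nrm n x"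
    by (rule nrm_mv_le_op) (use assms in \<open>auto intro: nrm_le_bound\<close>)
  also have "\<dots> \<le> (sqrt n * (sqrt n * B)) * nrm n x"
    by (intro mult_right_mono nrm_le_bound) (use assms in auto)
  also have "\<dots> = real n * B * nrm n x" by (simp add: mult.assoc[symmetric])
  finally show ?thesis .
qed

lemma mv_diff: "mv n (\<lambda>i j. Z i j - Y i j) x i = mv n Z x i - mv n Y x i"
  by (simp add: mv_def sum_subtractf left_diff_distrib)

lemma nrm_mv_diff_le:
  assumes "\<And>i j. i < n \<Longrightarrow> j < n \<Longrightarrow> \<bar>Z i j - Y i j\<bar> \<le> B" "0 \<le> B"
  shows "nrm n (mv n Z x) \<le> nrm n (mv n Y x) + real n * B * nrm n x"
proof -
  have "nrm n (\<lambda>i. mv n Z x i - mv n Y x i) \<le> real n * B * nrm n x"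
    using nrm_mv_le[of n "\<lambda>i j. Z i j - Y i j" B x] assms by (simp add: mv_diff[abs_def])
  then show ?thesis using nrm_le_add_diff[of n "mv n Z x" "mv n Y x"] by simp
qed

lemma ip_commute: "ip n x y = ip n y x" by (simp add: ip_def mult.commute)

lemma ip_diff_right: "ip n x (\<lambda>i. y i - z i) = ip n x y - ip n x z"
  by (simp add: ip_def sum_subtractf right_diff_distrib)

lemma ip_scale_right: "ip n x (\<lambda>i. c * y i) = c * ip n x y"
  by (simp add: ip_def sum_distrib_left algebra_simps)

lemma ip_diff_scale_self:
  "ip n (\<lambda>i. x i - c * z i) (\<lambda>i. x i - c * z i) = ip n x x - 2 * c * ip n x z + c\<^sup>2 * ip n z z"
proof -
  have "(x i - c * z i) * (x i - c * z i) = x i * x i - 2 * c * (x i * z i) + c\<^sup>2 * (z i * z i)" for i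
    by (simp add: power2_eq_square algebra_simps)
  then show ?thesis
    by (simp only: ip_def sum.distrib sum_subtractf sum_distrib_left[symmetric])
qed

lemma mv_diff_scale: "mv n Z (\<lambda>i. x i - c * y i) = (\<lambda>i. mv n Z x i - c * mv n Z y i)"
proof
  fix i
  have "Z i j * (x j - c * y j) = Z i j * x j - c * (Z i j * y j)" for j by (simp add: algebra_simps)
  then show "mv n Z (\<lambda>i. x i - c * y i) i = mv n Z x i - c * mv n Z y i"
    by (simp only: mv_def sum_subtractf sum_distrib_left[symmetric])
qed

section \<open>Filtering\<close>

text \<open>The polynomial filter \<open>(I - Z\<^sup>2 / R\<^sup>2)\<^sup>J\<close> detects an approximate kernel of the symmetric matrix \<open>Z\<close>
  and, at the same time, produces an approximate kernel vector.\<close>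

definition filt :: "nat \<Rightarrow> (nat \<Rightarrow> nat \<Rightarrow> real) \<Rightarrow> real \<Rightarrow> (nat \<Rightarrow> real) \<Rightarrow> nat \<Rightarrow> real" where
  "filt n Z R x = (\<lambda>i. x i - (1 / R\<^sup>2) * mv n Z (mv n Z x) i)"

definition probe :: "nat \<Rightarrow> (nat \<Rightarrow> nat \<Rightarrow> real) \<Rightarrow> real \<Rightarrow> nat \<Rightarrow> nat \<Rightarrow> nat \<Rightarrow> real" where
  "probe n Z R J k = (filt n Z R ^^ J) (unitv k)"

text \<open>The condition says that the probe has norm at least 1/(2 sqrt n), squared so that the
  program can test it. A unit kernel vector has a coordinate of modulus at least 1/sqrt n, and the
  filter preserves its inner product with the probe; half of this is left for errors.\<close>

definition accepted :: "nat \<Rightarrow> (nat \<Rightarrow> nat \<Rightarrow> real) \<Rightarrow> real \<Rightarrow> nat \<Rightarrow> nat \<Rightarrow> bool" where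
  "accepted n Z R J k \<longleftrightarrow> 1 \<le> 4 * real n * ip n (probe n Z R J k) (probe n Z R J k)"

locale contraction =
  fixes n :: nat and Z :: "nat \<Rightarrow> nat \<Rightarrow> real" and R :: real
  assumes sym: "sym n Z" and R: "0 < R" and bound: "\<And>x. nrm n (mv n Z x) \<le> R * nrm n x"
begin

text \<open>In the expansion of |x - Z^2 x / R^2|^2 the cross term is -2 |Z x|^2 / R^2 by symmetry,
  and the quadratic term is at most |Z x|^2 / R^2 because Z has norm at most R.\<close>

lemma filt_ip: "ip n (filt n Z R x) (filt n Z R x) \<le> ip n x x - (nrm n (mv n Z x) / R)\<^sup>2"
proof -
  let ?y = "mv n Z x" and ?c = "1 / R\<^sup>2"
  let ?z = "mv n Z ?y"
  have eq: "ip n (filt n Z R x) (filt n Z R x) = ip n x x - 2 * ?c * ip n x ?z + ?c\<^sup>2 * ip n ?z ?z"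
    unfolding filt_def by (rule ip_diff_scale_self)
  have xz: "ip n x ?z = (nrm n ?y)\<^sup>2" by (simp add: nrm_sq ip_mv_sym[OF sym])
  have "?c\<^sup>2 * ip n ?z ?z \<le> ?c\<^sup>2 * (R * nrm n ?y)\<^sup>2"
    unfolding nrm_sq[symmetric] using bound[of ?y] by (intro mult_left_mono power_mono) auto
  also have "\<dots> = ?c * (nrm n ?y)\<^sup>2" using R by (simp add: power2_eq_square)
  finally have "ip n (filt n Z R x) (filt n Z R x) \<le> ip n x x - ?c * (nrm n ?y)\<^sup>2"
    unfolding eq xz by linarith
  then show ?thesis by (simp add: power_divide)
qed

lemma filt_nrm_le: "nrm n (filt n Z R x) \<le> nrm n x"
proof (rule power2_le_imp_le)
  show "(nrm n (filt n Z R x))\<^sup>2 \<le> (nrm n x)\<^sup>2"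
    using filt_ip[of x] zero_le_power2[of "nrm n (mv n Z x) / R"] unfolding nrm_sq by linarith
qed simp

lemma mv_filt: "mv n Z (filt n Z R x) = filt n Z R (mv n Z x)"
  unfolding filt_def by (rule mv_diff_scale)

lemma probe_nrm_le: "k < n \<Longrightarrow> nrm n (probe n Z R J k) \<le> 1"
proof (induction J)
  case (Suc J)
  have "nrm n (probe n Z R (Suc J) k) \<le> nrm n (probe n Z R J k)"
    by (simp add: probe_def filt_nrm_le)
  with Suc show ?case by simp
qed (simp add: probe_def nrm_unitv)

text \<open>The squared norm of the iterates starts at 1 and drops in step j by at least (|Z w_j| /
  R)^2. Since Z commutes with the filter these drops are nonincreasing, so J copies of the last one
  fit into 1.\<close>

lemma probe_kernel:
  assumes "k < n"
  shows "real J * (nrm n (mv n Z (probe n Z R J k)))\<^sup>2 \<le> R\<^sup>2"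
proof -
  let ?w = "\<lambda>j. probe n Z R j k"
  have suc: "?w (Suc j) = filt n Z R (?w j)" for j by (simp add: probe_def)
  have dec: "nrm n (mv n Z (?w (Suc j))) \<le> nrm n (mv n Z (?w j))" for j
    by (simp add: suc mv_filt filt_nrm_le)
  have "real J * (nrm n (mv n Z (?w J)) / R)\<^sup>2 + ip n (?w J) (?w J) \<le> 1"
  proof (induction J)
    case 0
    then show ?case using nrm_unitv[OF assms] nrm_sq[of n "unitv k"] by (simp add: probe_def)
  next
    case (Suc J)
    have "real (Suc J) * (nrm n (mv n Z (?w (Suc J))) / R)\<^sup>2 \<le> real (Suc J) * (nrm n (mv n Z (?w J)) / R)\<^sup>2"
      using dec[of J] R by (intro mult_left_mono power_mono divide_right_mono) auto
    moreover have "ip n (?w (Suc J)) (?w (Suc J)) \<le> ip n (?w J) (?w J) - (nrm n (mv n Z (?w J)) / R)\<^sup>2"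
      unfolding suc by (rule filt_ip)
    ultimately show ?case using Suc by (simp add: algebra_simps)
  qed
  moreover have "0 \<le> ip n (?w J) (?w J)" by (simp add: nrm_sq[symmetric])
  ultimately have "real J * (nrm n (mv n Z (?w J)) / R)\<^sup>2 \<le> 1" by simp
  then show ?thesis using R by (simp add: power_divide divide_le_eq_1)
qed

lemma accepted_lower:
  assumes "accepted n Z R J k" "0 < n"
  shows "1 \<le> 2 * sqrt n * nrm n (probe n Z R J k)"
proof -
  have "1\<^sup>2 \<le> (2 * sqrt n * nrm n (probe n Z R J k))\<^sup>2"
    using assms unfolding accepted_def nrm_sq[symmetric] by (simp add: power_mult_distrib)
  then show ?thesis by (rule power2_le_imp_le) auto
qed

text \<open>By symmetry of Z the inner product of v with the iterate changes by at most |Z v| / R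
  per step. Started at a large coordinate of v it is initially at least |v| / sqrt n, and the
  hypothesis keeps the loss over J steps below half of that.\<close>

lemma kernel_accepted:
  assumes "0 < n" "2 * real J * sqrt n * nrm n (mv n Z v) \<le> R * nrm n v" "0 < nrm n v"
  shows "\<exists>k<n. accepted n Z R J k"
proof -
  obtain k where k: "k < n" "nrm n v \<le> sqrt n * \<bar>v k\<bar>" using ex_large_coordinate[OF assms(1)] by blast
  let ?w = "\<lambda>j. probe n Z R j k" and ?e = "nrm n (mv n Z v) / R"
  have suc: "?w (Suc j) = filt n Z R (?w j)" for j by (simp add: probe_def)
  have "\<bar>ip n v (?w j) - v k\<bar> \<le> real j * ?e" for j
  proof (induction j)
    case 0
    then show ?case using k(1) by (simp add: probe_def ip_unitv)
  next
    case (Suc j)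
    let ?y = "mv n Z (?w j)"
    have "ip n v (?w (Suc j)) = ip n v (?w j) - (1 / R\<^sup>2) * ip n v (mv n Z ?y)"
      unfolding suc filt_def by (simp only: ip_diff_right ip_scale_right)
    also have "ip n v (mv n Z ?y) = ip n (mv n Z v) ?y" by (simp add: ip_mv_sym[OF sym])
    finally have eq: "ip n v (?w (Suc j)) = ip n v (?w j) - ip n (mv n Z v) ?y / R\<^sup>2" by simp
    have "\<bar>ip n (mv n Z v) ?y\<bar> \<le> nrm n (mv n Z v) * nrm n ?y" by (rule abs_ip_le)
    also have "\<dots> \<le> nrm n (mv n Z v) * (R * 1)"
      using R probe_nrm_le[OF k(1), of j] mult_left_mono[of "nrm n (?w j)" 1 R]
      by (intro mult_left_mono order.trans[OF bound]) auto
    finally have "\<bar>ip n (mv n Z v) ?y\<bar> / R\<^sup>2 \<le> nrm n (mv n Z v) * R / R\<^sup>2"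
      by (intro divide_right_mono) auto
    also have "\<dots> = ?e" using R by (simp add: power2_eq_square)
    finally have "\<bar>ip n (mv n Z v) ?y / R\<^sup>2\<bar> \<le> ?e" by (simp only: abs_divide abs_power2)
    moreover have "real (Suc j) * ?e = real j * ?e + ?e" by (simp only: of_nat_Suc distrib_right mult_1_left add.commute)
    ultimately show ?case using Suc unfolding eq by linarith
  qed
  from this[of J] have 1: "\<bar>v k\<bar> - real J * ?e \<le> \<bar>ip n v (?w J)\<bar>" by linarith
  have n: "0 < sqrt n" using assms(1) by simp
  have "sqrt n * (real J * ?e) = (2 * real J * sqrt n * nrm n (mv n Z v)) / (2 * R)" by simp
  also have "\<dots> \<le> (R * nrm n v) / (2 * R)" using assms(2) R by (intro divide_right_mono) auto
  also have "\<dots> = nrm n v / 2" using R by simp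
  finally have "sqrt n * (real J * ?e) \<le> nrm n v / 2" .
  then have "nrm n v / 2 \<le> sqrt n * \<bar>v k\<bar> - sqrt n * (real J * ?e)" using k(2) by simp
  also have "\<dots> \<le> sqrt n * \<bar>ip n v (?w J)\<bar>" using mult_left_mono[OF 1, of "sqrt n"] n by (simp add: algebra_simps)
  also have "\<dots> \<le> sqrt n * (nrm n v * nrm n (?w J))" by (intro mult_left_mono abs_ip_le) simp
  finally have "nrm n v * 1 \<le> nrm n v * (2 * sqrt n * nrm n (?w J))" by (simp add: mult_ac)
  then have "1 \<le> 2 * sqrt n * nrm n (?w J)" using assms(3) by (subst (asm) mult_le_cancel_left_pos)
  then have "1\<^sup>2 \<le> (2 * sqrt n * nrm n (?w J))\<^sup>2" by (intro power_mono) auto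
  then have "1 \<le> 4 * real n * ip n (?w J) (?w J)" by (simp add: power_mult_distrib nrm_sq)
  then show ?thesis using k(1) by (auto simp: accepted_def)
qed

end

section \<open>Powers of the scale\<close>

definition pw :: "real \<Rightarrow> int \<Rightarrow> real" where
  "pw W k = W powi k"

text \<open>Numerical factors up to 16 can be paid for with one power of W
  (\<open>P_absorb\<close>), which reduces most estimates below to integer arithmetic on
  exponents.\<close>

locale scale =
  fixes W :: real
  assumes W16: "16 \<le> W"
begin

abbreviation P :: "int \<Rightarrow> real" where "P \<equiv> pw W"

lemma P_pos [simp]: "0 < P k"
  using W16 by (simp add: pw_def)

lemma P_nonneg [simp]: "0 \<le> P k"
  using P_pos[of k] by linarith

lemma P_mult: "P a * P b = P (a + b)"
  using W16 by (simp add: pw_def power_int_add)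

lemma P_power: "P a ^ k = P (int k * a)"
  using W16 by (simp add: pw_def power_int_mult[symmetric] mult.commute flip: power_int_of_nat)

lemma P_0 [simp]: "P 0 = 1" and P_1: "P 1 = W"
  by (simp_all add: pw_def)

lemma P_mono: "a \<le> b \<Longrightarrow> P a \<le> P b"
  using W16 by (simp add: pw_def power_int_increasing)

lemma P_absorb: "c \<le> 16 \<Longrightarrow> c * P a \<le> P (a + 1)"
proof -
  assume "c \<le> 16"
  then have "c * P a \<le> P 1 * P a" using W16 by (intro mult_right_mono) (auto simp: P_1)
  then show ?thesis by (simp add: P_mult add.commute)
qed

lemma P_nat: "P (int k) = W ^ k"
  by (simp add: pw_def)

lemma P_neg_nat: "P (- int k) = 1 / W ^ k"
  by (simp add: pw_def power_int_minus inverse_eq_divide)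

lemma P_le_1: "a \<le> 0 \<Longrightarrow> P a \<le> 1"
  using P_mono[of a 0] by simp

lemma P_sqrt: "sqrt (P (2 * a)) = P a"
  by (rule real_sqrt_unique) (simp_all add: P_power)

lemma P_mult_le: "x \<le> P a \<Longrightarrow> y \<le> P b \<Longrightarrow> 0 \<le> y \<Longrightarrow> a + b \<le> c \<Longrightarrow> x * y \<le> P c"
  using mult_mono[of x "P a" y "P b"] P_mono[of "a + b" c] by (simp add: P_mult)

lemma P_add_le: "x \<le> P a \<Longrightarrow> y \<le> P b \<Longrightarrow> a < c \<Longrightarrow> b < c \<Longrightarrow> x + y \<le> P c"
  using P_absorb[of 2 "c - 1"] P_mono[of a "c - 1"] P_mono[of b "c - 1"] by simp

lemma P_cancel: "x * P a \<le> P b \<Longrightarrow> x \<le> P (b - a)"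
  using mult_right_mono[of "x * P a" "P b" "P (- a)"] by (simp add: mult.assoc P_mult)

end

section \<open>Deterministic analysis\<close>

text \<open>\<open>B k\<close> is the dual basis of the columns, that is, the rows of the inverse of
  A; \<open>colsum\<close> bounds the squared Frobenius norm.\<close>

locale mixing = scale +
  fixes n :: nat and A :: "nat \<Rightarrow> nat \<Rightarrow> real" and B :: "nat \<Rightarrow> nat \<Rightarrow> real"
  assumes n1: "1 \<le> n" and nW: "real n \<le> W"
    and colsum: "(\<Sum>j<n. \<Sum>i<n. (A i j)\<^sup>2) \<le> pw W 2"
    and dual: "\<And>k j. k < n \<Longrightarrow> j < n \<Longrightarrow> mv n (tr A) (B k) j = unitv k j"
begin

definition d :: "nat \<Rightarrow> real" where "d j = (\<Sum>i<n. (A i j)\<^sup>2)"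

text \<open>The matrix A diag(c) A^T. M, H and all members of the pencil are of this form, which
  makes them simultaneously accessible in the coordinates \<open>AT x\<close>.\<close>

definition gen :: "(nat \<Rightarrow> real) \<Rightarrow> nat \<Rightarrow> nat \<Rightarrow> real" where
  "gen c = (\<lambda>k l. \<Sum>j<n. c j * A k j * A l j)"

abbreviation AT :: "(nat \<Rightarrow> real) \<Rightarrow> nat \<Rightarrow> real" where "AT \<equiv> mv n (tr A)"

lemma sqrt_n: "sqrt n \<le> P 1" "1 \<le> sqrt n" "2 * sqrt n \<le> P 1"
proof -
  have "(2 * sqrt n)\<^sup>2 \<le> W\<^sup>2" using nW W16 mult_mono[of 4 W n W] by (simp add: power2_eq_square)
  then show "2 * sqrt n \<le> P 1" unfolding P_1 by (rule power2_le_imp_le) (use W16 in simp)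
  then show "sqrt n \<le> P 1" using real_sqrt_ge_zero[of n] by linarith
  show "1 \<le> sqrt n" using n1 by simp
qed

lemma d_nonneg: "0 \<le> d j"
  by (simp add: d_def sum_nonneg)

lemma sum_d: "(\<Sum>j<n. d j) \<le> P 2"
  using colsum by (simp add: d_def)

lemma d_le: "j < n \<Longrightarrow> d j \<le> P 2"
  using sum_d member_le_sum[of j "{..<n}" d] d_nonneg by force

lemma nrm_col: "nrm n (tr A j) = sqrt (d j)"
  by (simp add: nrm_def L2_set_def d_def tr_def)

lemma nrm_col_le: "j < n \<Longrightarrow> nrm n (tr A j) \<le> P 1"
  using d_le[of j] P_sqrt[of 1] by (metis mult_1_right nrm_col real_sqrt_le_mono)

lemma A_le: "i < n \<Longrightarrow> j < n \<Longrightarrow> \<bar>A i j\<bar> \<le> P 1"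
  using abs_le_nrm[of i n "tr A j"] nrm_col_le[of j] by (simp add: tr_def)

lemma AT_op: "nrm n (AT x) \<le> P 1 * nrm n x"
proof -
  have "nrm n (AT x) \<le> nrm n (\<lambda>j. sqrt (d j)) * nrm n x"
    by (rule nrm_mv_le_op) (auto simp: nrm_col d_nonneg)
  moreover have "nrm n (\<lambda>j. sqrt (d j)) \<le> P 1"
    using real_sqrt_le_mono[OF sum_d] P_sqrt[of 1]
    by (simp add: nrm_def L2_set_def d_nonneg del: real_sqrt_le_iff)
  ultimately show ?thesis using mult_right_mono[of "nrm n (\<lambda>j. sqrt (d j))" "P 1" "nrm n x"] by simp
qed

lemma A_op: "nrm n (mv n A x) \<le> P 1 * nrm n x"
proof (cases "nrm n (mv n A x) = 0")
  case False
  let ?y = "mv n A x"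
  have "nrm n ?y * nrm n ?y = ip n x (AT ?y)" by (simp add: nrm_sq[symmetric, unfolded power2_eq_square] flip: ip_mv)
  also have "\<dots> \<le> nrm n x * nrm n (AT ?y)" using abs_ip_le[of n x "AT ?y"] by linarith
  also have "\<dots> \<le> nrm n x * (P 1 * nrm n ?y)" by (intro mult_left_mono AT_op) simp
  finally have "nrm n ?y * nrm n ?y \<le> (P 1 * nrm n x) * nrm n ?y" by (simp add: mult_ac)
  moreover have "0 < nrm n ?y" using False nrm_nonneg[of n ?y] by linarith
  ultimately show ?thesis by (subst (asm) mult_le_cancel_right_pos)
qed simp

lemma mv_gen: "mv n (gen c) x = mv n A (\<lambda>j. c j * AT x j)"
proof
  fix k
  have "mv n (gen c) x k = (\<Sum>l<n. \<Sum>j<n. c j * A k j * A l j * x l)"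
    by (simp add: mv_def gen_def sum_distrib_right)
  also have "\<dots> = (\<Sum>j<n. \<Sum>l<n. c j * A k j * A l j * x l)" by (rule sum.swap)
  also have "\<dots> = mv n A (\<lambda>j. c j * AT x j) k"
    by (simp add: mv_def tr_def sum_distrib_left mult_ac)
  finally show "mv n (gen c) x k = mv n A (\<lambda>j. c j * AT x j) k" .
qed

lemma gen_le:
  assumes "(\<Sum>j<n. \<bar>c j\<bar>) \<le> P a" "k < n" "l < n"
  shows "\<bar>gen c k l\<bar> \<le> P (a + 2)"
proof -
  have "\<bar>gen c k l\<bar> \<le> (\<Sum>j<n. \<bar>c j\<bar> * P 2)" unfolding gen_def
  proof (rule order.trans[OF sum_abs], rule sum_mono)
    fix j assume "j \<in> {..<n}"
    then have "\<bar>A k j\<bar> * \<bar>A l j\<bar> \<le> P 2" using A_le assms by (intro P_mult_le[of _ 1 _ 1]) auto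
    then show "\<bar>c j * A k j * A l j\<bar> \<le> \<bar>c j\<bar> * P 2"
      by (simp add: abs_mult mult.assoc mult_left_mono)
  qed
  also have "\<dots> \<le> P a * P 2" unfolding sum_distrib_right[symmetric] using assms by (intro mult_right_mono) auto
  finally show ?thesis by (simp add: P_mult)
qed

text \<open>A right inverse of \<open>AT\<close>: expansion in the dual basis.\<close>

definition comb :: "(nat \<Rightarrow> real) \<Rightarrow> nat \<Rightarrow> real" where
  "comb x = (\<lambda>i. \<Sum>k<n. x k * B k i)"

lemma AT_comb: "j < n \<Longrightarrow> AT (comb x) j = x j"
proof -
  assume j: "j < n"
  have "AT (comb x) j = (\<Sum>i<n. \<Sum>k<n. tr A j i * (x k * B k i))"
    by (simp add: mv_def comb_def sum_distrib_left)
  also have "\<dots> = (\<Sum>k<n. \<Sum>i<n. tr A j i * (x k * B k i))" by (rule sum.swap)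
  also have "\<dots> = (\<Sum>k<n. x k * AT (B k) j)" by (simp add: mv_def sum_distrib_left mult_ac)
  also have "\<dots> = (\<Sum>k<n. x k * unitv k j)" by (simp add: dual j)
  also have "\<dots> = x j" using j by (simp add: unitv_def if_distrib cong: if_cong)
  finally show ?thesis .
qed

text \<open>Duality: if w is a preimage of x under \<open>AT\<close>, then |x|^2 = <A x, w> is at
  most |A x| |w|, and l |w| is at most |x|.\<close>

lemma A_lower:
  assumes "\<And>w. l * nrm n w \<le> nrm n (AT w)" "0 < l"
  shows "l * nrm n x \<le> nrm n (mv n A x)"
proof (cases "nrm n x = 0")
  case False
  let ?w = "comb x"
  have x: "nrm n (AT ?w) = nrm n x" by (rule nrm_cong) (simp add: AT_comb)
  have "nrm n x * nrm n x = ip n x x" by (simp add: nrm_sq flip: power2_eq_square)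
  also have "\<dots> = ip n x (AT ?w)" by (rule ip_cong) (simp_all add: AT_comb)
  also have "\<dots> = ip n (mv n A x) ?w" by (simp add: ip_mv)
  also have "\<dots> \<le> nrm n (mv n A x) * nrm n ?w" using abs_ip_le[of n "mv n A x" ?w] by linarith
  finally have "l * (nrm n x * nrm n x) \<le> nrm n (mv n A x) * (l * nrm n ?w)"
    using assms(2) by (simp add: mult_left_mono mult.left_commute)
  also have "\<dots> \<le> nrm n (mv n A x) * nrm n x" using assms(1)[of ?w] x by (intro mult_left_mono) auto
  finally have "(l * nrm n x) * nrm n x \<le> nrm n (mv n A x) * nrm n x" by (simp add: mult_ac)
  moreover have "0 < nrm n x" using False nrm_nonneg[of n x] by linarith
  ultimately show ?thesis by (subst (asm) mult_le_cancel_right_pos)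
qed simp

end

lemma nrm_mult_le:
  assumes "\<And>j. j < n \<Longrightarrow> \<bar>c j\<bar> \<le> K" "0 \<le> K"
  shows "nrm n (\<lambda>j. c j * x j) \<le> K * nrm n x"
proof -
  have "nrm n (\<lambda>j. c j * x j) \<le> nrm n (\<lambda>j. K * x j)"
    unfolding nrm_def L2_set_def
  proof (intro real_sqrt_le_mono sum_mono)
    fix j assume "j \<in> {..<n}"
    then have "\<bar>c j * x j\<bar> \<le> \<bar>K * x j\<bar>" using assms by (simp add: abs_mult mult_right_mono)
    then show "(c j * x j)\<^sup>2 \<le> (K * x j)\<^sup>2" by (simp add: abs_le_square_iff)
  qed
  then show ?thesis using assms(2) by (simp add: nrm_scale)
qed

section \<open>The conditioning test on the estimate of M\<close>

locale estimate = mixing +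
  fixes Wn :: nat and Mh :: "nat \<Rightarrow> nat \<Rightarrow> real"
  assumes Wn: "W = real Wn"
    and errM: "\<And>k l. k < n \<Longrightarrow> l < n \<Longrightarrow> \<bar>Mh k l - gen d k l\<bar> \<le> pw W (-800)"
    and symM: "sym n Mh"
begin

lemma contr_M: "contraction n Mh (P 8)"
proof
  fix x
  have "\<bar>Mh k l\<bar> \<le> P 5" if "k < n" "l < n" for k l
    using gen_le[of d 2 k l] errM[of k l] sum_d that d_nonneg P_add_le[of "\<bar>gen d k l\<bar>" 4 "P (-800)" "-800" 5] by simp
  then have "nrm n (mv n Mh x) \<le> real n * P 5 * nrm n x" by (rule nrm_mv_le) simp_all
  also have "\<dots> \<le> P 8 * nrm n x"
    using nW by (intro mult_right_mono P_mult_le[of _ 1 _ 5]) (auto simp: P_1)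
  finally show "nrm n (mv n Mh x) \<le> P 8 * nrm n x" .
qed (simp_all add: symM)

lemma Mh_err: "nrm n (mv n Mh x) \<le> nrm n (mv n (gen d) x) + P (-799) * nrm n x"
proof -
  have "nrm n (mv n Mh x) \<le> nrm n (mv n (gen d) x) + real n * P (-800) * nrm n x"
    by (rule nrm_mv_diff_le) (simp_all add: errM)
  also have "\<dots> \<le> nrm n (mv n (gen d) x) + P (-799) * nrm n x"
    using nW by (intro add_left_mono mult_right_mono P_mult_le[of _ 1 _ "-800"]) (auto simp: P_1)
  finally show ?thesis .
qed

text \<open>Completeness of the conditioning test. With R = W^8 and W^20 steps the residual of a
  probe is at most W^(-2), while an accepted probe has norm at least W^(-1); acceptance would
  therefore force mu to be at most 2 / W.\<close>

lemma not_accepted: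
  assumes "\<And>x. \<mu> * nrm n x \<le> nrm n (mv n (gen d) x)" and "2 < \<mu> * W" and k: "k < n"
  shows "\<not> accepted n Mh (pw W 8) (Wn ^ 20) k"
proof
  assume acc: "accepted n Mh (pw W 8) (Wn ^ 20) k"
  interpret contraction n Mh "P 8" by (rule contr_M)
  define p where "p = probe n Mh (P 8) (Wn ^ 20) k"
  have "1 \<le> 2 * sqrt n * nrm n p" unfolding p_def using accepted_lower[OF acc] n1 by simp
  also have "\<dots> \<le> P 1 * nrm n p" using sqrt_n by (intro mult_right_mono) auto
  finally have p1: "1 \<le> P 1 * nrm n p" .
  have "real (Wn ^ 20) * (nrm n (mv n Mh p))\<^sup>2 \<le> (P 8)\<^sup>2" unfolding p_def by (rule probe_kernel[OF k])
  then have "P 20 * (nrm n (mv n Mh p))\<^sup>2 \<le> (P 8)\<^sup>2" using P_nat[of 20] Wn by simp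
  then have "P (-20) * (P 20 * (nrm n (mv n Mh p))\<^sup>2) \<le> P (-20) * (P 8)\<^sup>2" by (rule mult_left_mono) simp
  then have "(nrm n (mv n Mh p))\<^sup>2 \<le> (P (-2))\<^sup>2" by (simp add: P_mult P_power flip: mult.assoc)
  then have "nrm n (mv n Mh p) \<le> P (-2)" by (rule power2_le_imp_le) simp
  also have "\<dots> \<le> P (-2) * (P 1 * nrm n p)" using mult_left_mono[OF p1, of "P (-2)"] by simp
  finally have 1: "nrm n (mv n Mh p) \<le> P (-1) * nrm n p" by (simp add: P_mult flip: mult.assoc)
  have "nrm n (mv n (gen d) p) \<le> nrm n (mv n Mh p) + real n * P (-800) * nrm n p"
    by (rule nrm_mv_diff_le) (simp_all add: errM abs_minus_commute)
  also have "real n * P (-800) * nrm n p \<le> P (-1) * nrm n p"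
    using nW by (intro mult_right_mono P_mult_le[of _ 1 _ "-800"]) (auto simp: P_1)
  finally have "\<mu> * nrm n p \<le> 2 * P (-1) * nrm n p" using 1 assms(1)[of p] by linarith
  moreover have "nrm n p \<noteq> 0" using p1 by auto
  then have "0 < nrm n p" using nrm_nonneg[of n p] by linarith
  ultimately have "\<mu> \<le> 2 * P (-1)" by simp
  then have "\<mu> * P 1 \<le> 2 * P (-1) * P 1" by (intro mult_right_mono) auto
  then show False using assms(2) P_mult[of "-1" 1] by (simp add: P_1 mult.assoc)
qed

end

section \<open>The pencil: separated eigenvalues, kernel vectors and extraction of columns\<close>

locale ica = estimate +
  fixes u :: "nat \<Rightarrow> real" and Hh :: "nat \<Rightarrow> nat \<Rightarrow> real"
  assumes u1: "\<And>i. i < n \<Longrightarrow> \<bar>u i\<bar> \<le> 1"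
    and usep: "\<And>i j k s. i < n \<Longrightarrow> j < n \<Longrightarrow> i \<noteq> j \<Longrightarrow> k < n \<Longrightarrow> s = 1 \<or> s = - 1 \<Longrightarrow>
      \<bar>A k i / nrm n (tr A i) - s * (A k j / nrm n (tr A j))\<bar> \<le>
      W * \<bar>ip n u (\<lambda>k. A k i / nrm n (tr A i) - s * (A k j / nrm n (tr A j)))\<bar>"
    and errH: "\<And>k l. k < n \<Longrightarrow> l < n \<Longrightarrow>
      \<bar>Hh k l - gen (\<lambda>j. (ip n (tr A j) u)\<^sup>2) k l\<bar> \<le> pw W (-800)"
    and symH: "sym n Hh"
    and mtest: "\<And>k. k < n \<Longrightarrow> \<not> accepted n Mh (pw W 8) (Wn ^ 20) k"
begin

definition Zh :: "real \<Rightarrow> nat \<Rightarrow> nat \<Rightarrow> real" where "Zh t = (\<lambda>k l. Hh k l - t * Mh k l)"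

definition lam :: "nat \<Rightarrow> real" where "lam j = (ip n (tr A j) u)\<^sup>2 / d j"

lemma ip_u_le: "j < n \<Longrightarrow> (ip n (tr A j) u)\<^sup>2 \<le> P 1 * d j"
proof -
  have u: "nrm n u \<le> sqrt n" using nrm_le_bound[of n u 1] u1 by simp
  have "\<bar>ip n (tr A j) u\<bar> \<le> sqrt (d j) * sqrt n"
    by (rule order.trans[OF abs_ip_le]) (use u in \<open>auto simp: nrm_col d_nonneg intro: mult_mono\<close>)
  then have "\<bar>ip n (tr A j) u\<bar>\<^sup>2 \<le> (sqrt (d j) * sqrt n)\<^sup>2" by (intro power_mono) auto
  then have "(ip n (tr A j) u)\<^sup>2 \<le> d j * n" by (simp add: power_mult_distrib d_nonneg)
  also have "\<dots> \<le> d j * W" using nW d_nonneg by (intro mult_left_mono) auto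
  finally show ?thesis by (simp add: P_1 mult.commute)
qed

text \<open>For t up to W^2 the entries stay below W^7, and a factor n turns this into the norm
  bound W^8. This fixes the radius R used in every run of the filter.\<close>

lemma contr_Z:
  assumes "0 \<le> t" "t \<le> P 2"
  shows "contraction n (Zh t) (P 8)"
proof
  fix x
  have "\<bar>Zh t k l\<bar> \<le> P 7" if kl: "k < n" "l < n" for k l
  proof -
    have "(\<Sum>j<n. \<bar>(ip n (tr A j) u)\<^sup>2\<bar>) \<le> (\<Sum>j<n. P 1 * d j)" by (intro sum_mono) (simp add: ip_u_le)
    also have "\<dots> \<le> P 1 * P 2" unfolding sum_distrib_left[symmetric] by (intro mult_left_mono sum_d) simp
    finally have "\<bar>gen (\<lambda>j. (ip n (tr A j) u)\<^sup>2) k l\<bar> \<le> P (3 + 2)" by (intro gen_le kl) (simp add: P_mult)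
    then have "\<bar>Hh k l\<bar> \<le> P 5 + P (-800)" using errH[OF kl] by simp
    then have H: "\<bar>Hh k l\<bar> \<le> P 6" using P_add_le[of "P 5" 5 "P (-800)" "-800" 6] by simp
    have M: "\<bar>Mh k l\<bar> \<le> P 4 + P (-800)" using gen_le[of d 2 k l] errM[OF kl] sum_d kl d_nonneg by simp
    have "\<bar>Mh k l\<bar> \<le> 2 * P 4" using M P_mono[of "-800" 4] by simp
    then have "\<bar>t\<bar> * \<bar>Mh k l\<bar> \<le> P 2 * (2 * P 4)" using assms by (intro mult_mono) auto
    also have "\<dots> = 2 * P 6" using P_mult[of 2 4] by simp
    finally have "\<bar>t * Mh k l\<bar> \<le> 2 * P 6" by (simp add: abs_mult)
    then show ?thesis using H P_absorb[of 3 6] by (simp add: Zh_def)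
  qed
  then have "nrm n (mv n (Zh t) x) \<le> real n * P 7 * nrm n x" by (rule nrm_mv_le) simp_all
  also have "\<dots> \<le> P 8 * nrm n x"
    using nW by (intro mult_right_mono P_mult_le[of _ 1 _ 7]) (auto simp: P_1)
  finally show "nrm n (mv n (Zh t) x) \<le> P 8 * nrm n x" .
  show "sym n (Zh t)" using symM symH by (simp add: sym_def Zh_def)
qed simp

text \<open>Soundness of the conditioning test: as no start vector is accepted, the contrapositive
  of \<open>kernel_accepted\<close> with J = W^20 bounds the estimate of M from below by W^(-13),
  and the entry errors are negligible against this. Conditioning is thus certified by the data
  alone.\<close>

lemma M_lower: "P (-14) * nrm n w \<le> nrm n (mv n (gen d) w)"
proof (cases "nrm n w = 0")
  case False
  then have pos: "0 < nrm n w" using nrm_nonneg[of n w] by linarith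
  interpret contraction n Mh "P 8" by (rule contr_M)
  have "\<not> 2 * real (Wn ^ 20) * sqrt n * nrm n (mv n Mh w) \<le> P 8 * nrm n w"
    using kernel_accepted[of "Wn ^ 20" w] mtest n1 pos by auto
  then have "P 8 * nrm n w \<le> (P 20 * (2 * sqrt n)) * nrm n (mv n Mh w)"
    using P_nat[of 20] Wn by (simp add: mult_ac)
  also have "\<dots> \<le> P 21 * nrm n (mv n Mh w)"
    using sqrt_n P_mult_le[of "P 20" 20 "2 * sqrt n" 1 21] by (intro mult_right_mono) auto
  finally have "P (-21) * (P 8 * nrm n w) \<le> P (-21) * (P 21 * nrm n (mv n Mh w))"
    by (rule mult_left_mono) simp
  then have "P (-13) * nrm n w \<le> nrm n (mv n Mh w)" by (simp add: P_mult flip: mult.assoc)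
  also note Mh_err
  finally have "(P (-13) - P (-799)) * nrm n w \<le> nrm n (mv n (gen d) w)" by (simp add: algebra_simps)
  moreover have "P (-14) \<le> P (-13) - P (-799)" using P_absorb[of 2 "-14"] P_mono[of "-799" "-14"] by simp
  then have "P (-14) * nrm n w \<le> (P (-13) - P (-799)) * nrm n w" by (rule mult_right_mono) simp
  ultimately show ?thesis by linarith
qed simp

text \<open>M = A diag(d) A^T, and the factors A and diag(d) have norm at most W and W^2.\<close>

lemma AT_lower: "P (-17) * nrm n w \<le> nrm n (AT w)"
proof -
  have "P (-14) * nrm n w \<le> nrm n (mv n A (\<lambda>j. d j * AT w j))" using M_lower[of w] by (simp add: mv_gen)
  also have "\<dots> \<le> P 1 * nrm n (\<lambda>j. d j * AT w j)" by (rule A_op)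
  also have "\<dots> \<le> P 1 * (P 2 * nrm n (AT w))"
    by (intro mult_left_mono nrm_mult_le) (auto simp: d_nonneg d_le)
  finally have "P (-3) * (P (-14) * nrm n w) \<le> P (-3) * (P 1 * (P 2 * nrm n (AT w)))" by (rule mult_left_mono) simp
  then show ?thesis by (simp add: P_mult flip: mult.assoc)
qed

lemmas A_lower' = A_lower[OF AT_lower P_pos]

lemma mv_unitv: "j < n \<Longrightarrow> mv n Z (unitv j) = (\<lambda>k. Z k j)"
  by (simp add: mv_def unitv_def if_distrib cong: if_cong)

lemma d_lower: "j < n \<Longrightarrow> P (-34) \<le> d j"
proof -
  assume j: "j < n"
  have "P (-17) \<le> sqrt (d j)"
    using A_lower'[of "unitv j"] nrm_col[of j] j by (simp add: nrm_unitv mv_unitv tr_def)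
  then have "P (-17) ^ 2 \<le> (sqrt (d j))\<^sup>2" by (intro power_mono) auto
  then show ?thesis by (simp add: P_power d_nonneg)
qed

lemma d_pos: "j < n \<Longrightarrow> 0 < d j"
  using d_lower[of j] P_pos[of "-34"] by linarith

lemma ip_u: "j < n \<Longrightarrow> (ip n (tr A j) u)\<^sup>2 = d j * lam j"
  using d_pos[of j] by (simp add: lam_def)

lemma lam_bounds: "j < n \<Longrightarrow> 0 \<le> lam j" "j < n \<Longrightarrow> lam j \<le> P 1"
  using ip_u_le[of j] d_pos[of j] by (simp_all add: lam_def pos_divide_le_eq)

text \<open>With x_j = <u, a_j> / |a_j| the difference of the eigenvalues is (x_i - x_j)(x_i + x_j).
  Hence u must separate both the difference and the sum of two normalized columns, which is why
  \<open>usep\<close> carries a sign.\<close>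

lemma separation:
  assumes "i < n" "j < n" "i \<noteq> j"
  shows "P (-40) \<le> \<bar>lam i - lam j\<bar>"
proof -
  let ?x = "\<lambda>j. ip n (tr A j) u / sqrt (d j)"
  have key: "P (-20) \<le> \<bar>?x i - s * ?x j\<bar>" if s: "s = 1 \<or> s = - 1" for s
  proof -
    \<comment> \<open>The coefficients of the combination w of the two columns:
      \<open>A_lower'\<close> bounds |w| from below by the norm of z, which is at least 1 /
      |a_i|.\<close>
    define z where "z = (\<lambda>k. if k = i then 1 / sqrt (d i) else if k = j then - s / sqrt (d j) else 0)"
    define w where "w = (\<lambda>k. A k i / sqrt (d i) - s * (A k j / sqrt (d j)))"
    have Az: "mv n A z k = w k" for k
    proof -
      have "mv n A z k = (\<Sum>m\<in>{i, j}. A k m * z m)" unfolding mv_def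
        by (rule sum.mono_neutral_right) (use assms in \<open>auto simp: z_def\<close>)
      then show ?thesis using assms by (simp add: z_def w_def)
    qed
    have "sqrt (d i) \<le> P 1" using nrm_col_le[OF assms(1)] nrm_col by simp
    then have "P (-1) * sqrt (d i) \<le> P (-1) * P 1" by (intro mult_left_mono) auto
    then have "P (-1) \<le> 1 / sqrt (d i)" using d_pos[OF assms(1)] by (simp add: P_mult pos_le_divide_eq)
    also have "\<dots> \<le> nrm n z" using abs_le_nrm[OF assms(1), of z] by (simp add: z_def d_nonneg)
    finally have "P (-17) * P (-1) \<le> P (-17) * nrm n z" by (intro mult_left_mono) auto
    also have "\<dots> \<le> nrm n (mv n A z)" by (rule A_lower')
    also have "\<dots> = nrm n w" by (rule nrm_cong) (rule Az)
    finally have 1: "P (-18) \<le> nrm n w" by (simp add: P_mult)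
    obtain k where k: "k < n" "nrm n w \<le> sqrt n * \<bar>w k\<bar>" using ex_large_coordinate[of n w] n1 by auto
    have "P (-18) \<le> P 1 * \<bar>w k\<bar>"
      using 1 k(2) mult_right_mono[OF sqrt_n(1), of "\<bar>w k\<bar>"] by linarith
    also have "\<dots> \<le> P 1 * (P 1 * \<bar>ip n u w\<bar>)"
      using usep[OF assms k(1) s] by (intro mult_left_mono) (use W16 in \<open>simp_all add: nrm_col w_def P_1\<close>)
    finally have "P (-2) * P (-18) \<le> P (-2) * (P 1 * (P 1 * \<bar>ip n u w\<bar>))" by (rule mult_left_mono) simp
    then have "P (-20) \<le> \<bar>ip n u w\<bar>" by (simp add: P_mult flip: mult.assoc)
    moreover have "ip n u w = ?x i - s * ?x j"
    proof -
      have "u k * w k = (tr A i k * u k) / sqrt (d i) - s * ((tr A j k * u k) / sqrt (d j))" for k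
        by (simp add: w_def tr_def algebra_simps)
      then show ?thesis
        by (simp only: ip_def sum_subtractf sum_divide_distrib[symmetric] sum_distrib_left[symmetric])
    qed
    ultimately show ?thesis by simp
  qed
  have sq: "lam m = ?x m * ?x m" for m
    using d_nonneg[of m] by (simp add: lam_def power2_eq_square)
  have "lam i - lam j = (?x i - 1 * ?x j) * (?x i - (-1) * ?x j)"
    unfolding sq by (rule square_diff_square_factored[THEN trans]) simp
  then have "\<bar>lam i - lam j\<bar> = \<bar>?x i - 1 * ?x j\<bar> * \<bar>?x i - (-1) * ?x j\<bar>" by (simp only: abs_mult)
  also have "P (-20) * P (-20) \<le> \<dots>" using key[of 1] key[of "-1"] by (intro mult_mono) auto
  finally show ?thesis by (simp add: P_mult)
qed

lemma mv_pencil: "nrm n (mv n (gen (\<lambda>j. d j * (lam j - t))) x) = nrm n (mv n A (\<lambda>j. (d j * (lam j - t)) * AT x j))"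
  by (simp add: mv_gen)

lemma Zh_err:
  assumes "0 \<le> t" "t \<le> P 2" "k < n" "l < n"
  shows "\<bar>Zh t k l - gen (\<lambda>j. d j * (lam j - t)) k l\<bar> \<le> P (-797)"
proof -
  have "gen (\<lambda>j. d j * (lam j - t)) k l = gen (\<lambda>j. (ip n (tr A j) u)\<^sup>2) k l - t * gen d k l"
    unfolding gen_def sum_distrib_left sum_subtractf[symmetric]
    by (rule sum.cong) (auto simp: ip_u algebra_simps)
  then have eq: "Zh t k l - gen (\<lambda>j. d j * (lam j - t)) k l =
      (Hh k l - gen (\<lambda>j. (ip n (tr A j) u)\<^sup>2) k l) - t * (Mh k l - gen d k l)"
    by (simp add: Zh_def algebra_simps)
  have "\<bar>t * (Mh k l - gen d k l)\<bar> \<le> P (-798)"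
    using assms errM[of k l] P_mult_le[of t 2 "\<bar>Mh k l - gen d k l\<bar>" "-800" "-798"] by (simp add: abs_mult)
  moreover have "P (-800) + P (-798) \<le> P (-797)" by (rule P_add_le) auto
  ultimately show ?thesis using errH[of k l] assms unfolding eq by linarith
qed

lemma Zh_close:
  assumes "0 \<le> t" "t \<le> P 2"
  shows "nrm n (mv n (Zh t) x) \<le> nrm n (mv n (gen (\<lambda>j. d j * (lam j - t))) x) + P (-796) * nrm n x"
    and "nrm n (mv n (gen (\<lambda>j. d j * (lam j - t))) x) \<le> nrm n (mv n (Zh t) x) + P (-796) * nrm n x"
proof -
  have 1: "real n * P (-797) * nrm n x \<le> P (-796) * nrm n x"
    using nW by (intro mult_right_mono P_mult_le[of _ 1 _ "-797"]) (auto simp: P_1)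
  have "nrm n (mv n (Zh t) x) \<le> nrm n (mv n (gen (\<lambda>j. d j * (lam j - t))) x) + real n * P (-797) * nrm n x"
    by (rule nrm_mv_diff_le) (use Zh_err assms in auto)
  then show "nrm n (mv n (Zh t) x) \<le> nrm n (mv n (gen (\<lambda>j. d j * (lam j - t))) x) + P (-796) * nrm n x"
    using 1 by linarith
  have "nrm n (mv n (gen (\<lambda>j. d j * (lam j - t))) x) \<le> nrm n (mv n (Zh t) x) + real n * P (-797) * nrm n x"
    by (rule nrm_mv_diff_le) (use Zh_err assms in \<open>auto simp: abs_minus_commute\<close>)
  then show "nrm n (mv n (gen (\<lambda>j. d j * (lam j - t))) x) \<le> nrm n (mv n (Zh t) x) + P (-796) * nrm n x"
    using 1 by linarith
qed

text \<open>The numbers \<open>AT p j\<close> are the coordinates of p in the dual basis, so p is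
  nearly a multiple of b_i with a coefficient that is not too small.\<close>

definition near_kernel :: "real \<Rightarrow> nat \<Rightarrow> (nat \<Rightarrow> real) \<Rightarrow> bool" where
  "near_kernel t i p \<longleftrightarrow> i < n \<and> \<bar>lam i - t\<bar> \<le> P (-300) \<and> nrm n p \<le> 1 \<and>
    P (-19) \<le> \<bar>AT p i\<bar> \<and> (\<forall>j<n. j \<noteq> i \<longrightarrow> \<bar>AT p j\<bar> \<le> P (-299))"

text \<open>Soundness of the scan. The residual of the probe is W^(-392); stripping off A and the
  weights d_j costs W^17 and W^34, so |lam_j - t| |<a_j, p>| is at most W^(-340) for every j. The
  largest coordinate i forces lam_i close to t, and then the separation W^(-40) makes the other
  coordinates tiny.\<close>

lemma accepted_near_kernel:
  assumes t: "0 \<le> t" "t \<le> P 2" and k: "k < n" and acc: "accepted n (Zh t) (P 8) (Wn ^ 800) k"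
  shows "\<exists>i. near_kernel t i (probe n (Zh t) (P 8) (Wn ^ 800) k)"
proof -
  interpret contraction n "Zh t" "P 8" by (rule contr_Z[OF t])
  define p where "p = probe n (Zh t) (P 8) (Wn ^ 800) k"
  define x where "x = AT p"
  have p1: "nrm n p \<le> 1" unfolding p_def by (rule probe_nrm_le[OF k])
  have "1 \<le> 2 * sqrt n * nrm n p" unfolding p_def using accepted_lower[OF acc] n1 by simp
  also have "\<dots> \<le> P 1 * nrm n p" using sqrt_n by (intro mult_right_mono) auto
  finally have "P (-1) * 1 \<le> P (-1) * (P 1 * nrm n p)" by (intro mult_left_mono) auto
  then have p2: "P (-1) \<le> nrm n p" by (simp add: P_mult flip: mult.assoc)
  have "real (Wn ^ 800) * (nrm n (mv n (Zh t) p))\<^sup>2 \<le> (P 8)\<^sup>2" unfolding p_def by (rule probe_kernel[OF k])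
  then have "P 800 * (nrm n (mv n (Zh t) p))\<^sup>2 \<le> (P 8)\<^sup>2"
    using P_nat[of 800] Wn by simp
  then have "P (-800) * (P 800 * (nrm n (mv n (Zh t) p))\<^sup>2) \<le> P (-800) * (P 8)\<^sup>2"
    by (rule mult_left_mono) simp
  then have "(nrm n (mv n (Zh t) p))\<^sup>2 \<le> (P (-392))\<^sup>2" by (simp add: P_mult P_power flip: mult.assoc)
  then have "nrm n (mv n (Zh t) p) \<le> P (-392)" by (rule power2_le_imp_le) simp
  moreover have "P (-796) * nrm n p \<le> P (-796) * 1" using p1 by (intro mult_left_mono) auto
  moreover have "P (-392) + P (-796) \<le> P (-391)" by (rule P_add_le) auto
  ultimately have Zp: "nrm n (mv n A (\<lambda>j. (d j * (lam j - t)) * x j)) \<le> P (-391)"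
    using Zh_close(2)[OF t, of p] unfolding mv_pencil x_def by linarith
  have cx: "\<bar>lam j - t\<bar> * \<bar>x j\<bar> \<le> P (-340)" if j: "j < n" for j
  proof -
    have "\<bar>(d j * (lam j - t)) * x j\<bar> \<le> nrm n (\<lambda>j. (d j * (lam j - t)) * x j)"
      using abs_le_nrm[OF j, of "\<lambda>j. (d j * (lam j - t)) * x j"] .
    then have "P (-17) * \<bar>(d j * (lam j - t)) * x j\<bar> \<le> P (-17) * nrm n (\<lambda>j. (d j * (lam j - t)) * x j)"
      by (intro mult_left_mono) auto
    also have "\<dots> \<le> P (-391)" using A_lower' Zp by (rule order.trans)
    finally have "\<bar>(d j * (lam j - t)) * x j\<bar> * P (-17) \<le> P (-391)" by (simp add: mult.commute)
    from P_cancel[OF this] have "d j * (\<bar>lam j - t\<bar> * \<bar>x j\<bar>) \<le> P (-374)"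
      using d_nonneg[of j] by (simp add: abs_mult mult.assoc)
    moreover have "P (-34) * (\<bar>lam j - t\<bar> * \<bar>x j\<bar>) \<le> d j * (\<bar>lam j - t\<bar> * \<bar>x j\<bar>)"
      by (intro mult_right_mono d_lower j) simp
    ultimately have "(\<bar>lam j - t\<bar> * \<bar>x j\<bar>) * P (-34) \<le> P (-374)" by (simp add: mult.commute)
    from P_cancel[OF this] show ?thesis by simp
  qed
  obtain i where i: "i < n" "nrm n x \<le> sqrt n * \<bar>x i\<bar>" using ex_large_coordinate[of n x] n1 by auto
  have "P (-17) * P (-1) \<le> P (-17) * nrm n p" using p2 by (intro mult_left_mono) auto
  also have "\<dots> \<le> nrm n x" unfolding x_def by (rule AT_lower)
  also have "\<dots> \<le> sqrt n * \<bar>x i\<bar>" by (rule i(2))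
  also have "\<dots> \<le> P 1 * \<bar>x i\<bar>" by (intro mult_right_mono sqrt_n(1)) simp
  finally have "P (-1) * (P (-17) * P (-1)) \<le> P (-1) * (P 1 * \<bar>x i\<bar>)" by (rule mult_left_mono) simp
  then have xi: "P (-19) \<le> \<bar>x i\<bar>" by (simp add: P_mult flip: mult.assoc)
  have "\<bar>lam i - t\<bar> * P (-19) \<le> \<bar>lam i - t\<bar> * \<bar>x i\<bar>" using xi by (intro mult_left_mono) auto
  with cx[OF i(1)] have "\<bar>lam i - t\<bar> * P (-19) \<le> P (-340)" by linarith
  from P_cancel[OF this] have li: "\<bar>lam i - t\<bar> \<le> P (-321)" by simp
  have "\<bar>x j\<bar> \<le> P (-299)" if j: "j < n" "j \<noteq> i" for j
  proof -
    have "P (-40) - P (-321) \<le> \<bar>lam j - t\<bar>" using separation[OF j(1) i(1) j(2)] li by linarith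
    moreover have "P (-41) \<le> P (-40) - P (-321)" using P_absorb[of 2 "-41"] P_mono[of "-321" "-41"] by simp
    ultimately have "P (-41) \<le> \<bar>lam j - t\<bar>" by linarith
    then have "P (-41) * \<bar>x j\<bar> \<le> \<bar>lam j - t\<bar> * \<bar>x j\<bar>" by (rule mult_right_mono) simp
    with cx[OF j(1)] have "\<bar>x j\<bar> * P (-41) \<le> P (-340)" by (simp add: mult.commute)
    from P_cancel[OF this] show ?thesis by simp
  qed
  moreover have "\<bar>lam i - t\<bar> \<le> P (-300)" using li P_mono[of "-321" "-300"] by simp
  ultimately have "near_kernel t i p" using i(1) xi p1 by (auto simp: near_kernel_def x_def)
  then show ?thesis unfolding p_def by blast
qed

text \<open>Completeness of the scan. Near lam_i the dual vector b_i is an approximate kernel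
  vector: the exact pencil maps it to d_i (lam_i - t) a_i, and entry errors add W^(-796) relative to
  its norm. This stays small even against W^800 filter steps.\<close>

lemma eigenvalue_accepted:
  assumes t: "0 \<le> t" "t \<le> P 2" and i: "i < n" and close: "\<bar>lam i - t\<bar> \<le> P (-800)"
  shows "\<exists>k<n. accepted n (Zh t) (P 8) (Wn ^ 800) k"
proof -
  interpret contraction n "Zh t" "P 8" by (rule contr_Z[OF t])
  let ?c = "\<lambda>j. d j * (lam j - t)"
  have "1 = ip n (tr A i) (B i)" using dual[OF i i] by (simp add: mv_def ip_def unitv_def)
  also have "\<dots> \<le> nrm n (tr A i) * nrm n (B i)" using abs_ip_le[of n "tr A i" "B i"] by linarith
  also have "\<dots> \<le> P 1 * nrm n (B i)" using nrm_col_le[OF i] by (intro mult_right_mono) auto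
  finally have B1: "1 \<le> P 1 * nrm n (B i)" .
  have "nrm n (\<lambda>j. ?c j * AT (B i) j) = nrm n (\<lambda>j. ?c i * unitv i j)"
    by (rule nrm_cong) (simp add: dual[OF i], simp add: unitv_def)
  also have "\<dots> = d i * \<bar>lam i - t\<bar>" by (simp add: nrm_scale nrm_unitv[OF i] abs_mult d_nonneg)
  also have "\<dots> \<le> P (-798)" by (rule P_mult_le[of _ 2 _ "-800"]) (use close d_le[OF i] in auto)
  finally have "P 1 * nrm n (\<lambda>j. ?c j * AT (B i) j) \<le> P 1 * P (-798)" by (rule mult_left_mono) simp
  then have "nrm n (mv n (gen ?c) (B i)) \<le> P (-797)"
    unfolding mv_pencil using A_op[of "\<lambda>j. ?c j * AT (B i) j"] by (simp add: P_mult)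
  also have "\<dots> \<le> P (-797) * (P 1 * nrm n (B i))" using B1 by simp
  also have "\<dots> = P (-796) * nrm n (B i)" by (simp add: P_mult flip: mult.assoc)
  finally have "nrm n (mv n (Zh t) (B i)) \<le> 2 * P (-796) * nrm n (B i)"
    using Zh_close(1)[OF t, of "B i"] by simp
  also have "\<dots> \<le> P (-795) * nrm n (B i)" using P_absorb[of 2 "-796"] by (intro mult_right_mono) auto
  finally have 1: "nrm n (mv n (Zh t) (B i)) \<le> P (-795) * nrm n (B i)" .
  have "real (Wn ^ 800) = P 800" using P_nat[of 800] Wn by simp
  then have "2 * real (Wn ^ 800) * sqrt n \<le> P 801"
    using sqrt_n P_mult_le[of "P 800" 800 "2 * sqrt n" 1 801] by (simp add: mult_ac)
  with 1 have "2 * real (Wn ^ 800) * sqrt n * nrm n (mv n (Zh t) (B i)) \<le> P 801 * (P (-795) * nrm n (B i))"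
    by (intro mult_mono) simp_all
  also have "\<dots> \<le> P 8 * nrm n (B i)"
    unfolding mult.assoc[symmetric] by (intro mult_right_mono) (simp_all add: P_mult P_mono)
  finally have "2 * real (Wn ^ 800) * sqrt n * nrm n (mv n (Zh t) (B i)) \<le> P 8 * nrm n (B i)" .
  moreover have "0 < nrm n (B i)" using B1 by (cases "nrm n (B i) = 0") (auto simp: less_le)
  ultimately show ?thesis using kernel_accepted n1 by auto
qed

text \<open>M p is the sum of d_j <a_j, p> a_j, dominated by the term j = i, which is c a_i. The
  unknown factor is read off from <v, v>, about c^2 d_i, and <v, p>, about d_i <a_i, p>^2: their
  product is c^4. This is the origin of the fourth root and of the undetermined sign.\<close>

lemma extraction:
  assumes "near_kernel t i p"
  defines "v \<equiv> mv n Mh p" and "c \<equiv> d i * AT p i"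
  shows "\<And>r. r < n \<Longrightarrow> \<bar>v r - c * A r i\<bar> \<le> P (-295)"
    and "\<bar>ip n v v * ip n v p - c ^ 4\<bar> \<le> P (-68) * c ^ 4"
    and "P (-53) \<le> \<bar>c\<bar>" and "\<bar>c\<bar> \<le> P 3"
proof -
  from assms(1) have i: "i < n" and p1: "nrm n p \<le> 1" and xi: "P (-19) \<le> \<bar>AT p i\<bar>"
    and xj: "\<And>j. j < n \<Longrightarrow> j \<noteq> i \<Longrightarrow> \<bar>AT p j\<bar> \<le> P (-299)"
    by (auto simp: near_kernel_def)
  have split: "(\<Sum>j<n. f j) = f i + (\<Sum>j\<in>{..<n} - {i}. f j)" for f :: "nat \<Rightarrow> real"
    using i by (subst sum.remove[of _ i]) auto
  have xi_le: "\<bar>AT p i\<bar> \<le> P 1"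
    using abs_le_nrm[OF i, of "AT p"] AT_op[of p] mult_left_mono[OF p1, of "P 1"] P_nonneg[of 1] by linarith
  have ac: "\<bar>c\<bar> = d i * \<bar>AT p i\<bar>" by (simp add: c_def abs_mult d_nonneg)
  have "P (-34) * P (-19) \<le> d i * \<bar>AT p i\<bar>" by (rule mult_mono) (use d_lower[OF i] xi d_nonneg in auto)
  then show c_low: "P (-53) \<le> \<bar>c\<bar>" unfolding ac by (simp add: P_mult)
  show c_up: "\<bar>c\<bar> \<le> P 3" unfolding ac by (rule P_mult_le[of _ 2 _ 1]) (use d_le[OF i] xi_le in auto)
  have diff: "nrm n (\<lambda>r. v r - mv n (gen d) p r) \<le> P (-799)"
  proof -
    have "nrm n (\<lambda>r. v r - mv n (gen d) p r) \<le> real n * P (-800) * nrm n p"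
      using nrm_mv_le[of n "\<lambda>i j. Mh i j - gen d i j" "P (-800)" p] errM by (simp add: v_def mv_diff[abs_def])
    also have "\<dots> \<le> real n * P (-800) * 1" using p1 by (intro mult_left_mono) auto
    also have "\<dots> \<le> P (-799)" using nW P_mult_le[of "real n" 1 "P (-800)" "-800" "-799"] by (simp add: P_1)
    finally show ?thesis .
  qed
  show vr: "\<bar>v r - c * A r i\<bar> \<le> P (-295)" if r: "r < n" for r
  proof -
    have "mv n (gen d) p r - c * A r i = (\<Sum>j\<in>{..<n} - {i}. A r j * (d j * AT p j))"
      unfolding mv_gen by (subst mv_def, subst split) (simp add: c_def mult_ac)
    also have "\<bar>\<dots>\<bar> \<le> (\<Sum>j\<in>{..<n} - {i}. d j * P (-298))"
    proof (rule order.trans[OF sum_abs], rule sum_mono)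
      fix j assume j: "j \<in> {..<n} - {i}"
      have "\<bar>A r j\<bar> * \<bar>AT p j\<bar> \<le> P (-298)"
        by (rule P_mult_le[of _ 1 _ "-299"]) (use A_le[OF r] xj j in auto)
      then show "\<bar>A r j * (d j * AT p j)\<bar> \<le> d j * P (-298)"
        using mult_left_mono[of "\<bar>A r j\<bar> * \<bar>AT p j\<bar>" "P (-298)" "d j"] d_nonneg[of j]
        by (simp add: abs_mult mult_ac)
    qed
    also have "\<dots> \<le> (\<Sum>j<n. d j * P (-298))" by (rule sum_mono2) (auto simp: d_nonneg)
    also have "\<dots> \<le> P 2 * P (-298)" unfolding sum_distrib_right[symmetric] by (intro mult_right_mono sum_d) simp
    finally have "\<bar>mv n (gen d) p r - c * A r i\<bar> \<le> P (-296)" by (simp add: P_mult)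
    moreover have "\<bar>v r - mv n (gen d) p r\<bar> \<le> P (-799)"
      using abs_le_nrm[OF r, of "\<lambda>r. v r - mv n (gen d) p r"] diff by linarith
    moreover have "P (-296) + P (-799) \<le> P (-295)" by (rule P_add_le) auto
    ultimately show ?thesis by linarith
  qed
  have vv: "\<bar>ip n v v - c\<^sup>2 * d i\<bar> \<le> P (-289)"
  proof -
    have "\<bar>v r * v r - c\<^sup>2 * (A r i)\<^sup>2\<bar> \<le> P (-290)" if r: "r < n" for r
    proof -
      have cA: "\<bar>c * A r i\<bar> \<le> P 4"
        unfolding abs_mult by (rule P_mult_le[of _ 3 _ 1]) (use c_up A_le[OF r i] in auto)
      have "\<bar>v r + c * A r i\<bar> \<le> P (-295) + 2 * P 4" using vr[OF r] cA by linarith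
      also have "\<dots> \<le> P 5" using P_mono[of "-295" 4] P_absorb[of 3 4] by simp
      finally have "\<bar>v r - c * A r i\<bar> * \<bar>v r + c * A r i\<bar> \<le> P (-290)"
        by (intro P_mult_le[of _ "-295" _ 5] vr r) auto
      moreover have "v r * v r - c\<^sup>2 * (A r i)\<^sup>2 = (v r - c * A r i) * (v r + c * A r i)"
        by (simp add: power2_eq_square algebra_simps)
      ultimately show ?thesis by (simp only: abs_mult)
    qed
    then have "(\<Sum>r<n. \<bar>v r * v r - c\<^sup>2 * (A r i)\<^sup>2\<bar>) \<le> (\<Sum>r<n. P (-290))" by (intro sum_mono) auto
    also have "\<dots> \<le> P (-289)" using nW P_mult_le[of "real n" 1 "P (-290)" "-290" "-289"] by (simp add: P_1)
    finally have "\<bar>\<Sum>r<n. v r * v r - c\<^sup>2 * (A r i)\<^sup>2\<bar> \<le> P (-289)" by (rule order.trans[OF sum_abs])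
    then show ?thesis by (simp add: ip_def d_def sum_subtractf sum_distrib_left)
  qed
  define e where "e = d i * (AT p i)\<^sup>2"
  have e0: "0 \<le> e" by (simp add: e_def d_nonneg)
  have e_le: "e \<le> P 4"
  proof -
    have "(AT p i)\<^sup>2 \<le> P 2" using P_mult_le[OF xi_le xi_le, of 2] by (simp add: power2_eq_square)
    then show ?thesis unfolding e_def using d_le[OF i] by (intro P_mult_le[of _ 2 _ 2]) auto
  qed
  have vp: "\<bar>ip n v p - e\<bar> \<le> P (-289)"
  proof -
    have sum: "ip n (mv n (gen d) p) p = (\<Sum>j<n. d j * AT p j * AT p j)"
      unfolding mv_gen ip_mv by (simp add: ip_def)
    have eq: "ip n (mv n (gen d) p) p - e = (\<Sum>j\<in>{..<n} - {i}. d j * AT p j * AT p j)"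
      unfolding sum by (subst split) (simp add: e_def power2_eq_square)
    have "\<bar>\<Sum>j\<in>{..<n} - {i}. d j * AT p j * AT p j\<bar> \<le> (\<Sum>j\<in>{..<n} - {i}. d j * P (-598))"
    proof (rule order.trans[OF sum_abs], rule sum_mono)
      fix j assume j: "j \<in> {..<n} - {i}"
      have "\<bar>AT p j\<bar> * \<bar>AT p j\<bar> \<le> P (-598)"
        by (rule P_mult_le[of _ "-299" _ "-299"]) (use xj j in auto)
      then show "\<bar>d j * AT p j * AT p j\<bar> \<le> d j * P (-598)"
        using mult_left_mono[of "\<bar>AT p j\<bar> * \<bar>AT p j\<bar>" "P (-598)" "d j"] d_nonneg[of j]
        by (simp add: abs_mult mult_ac)
    qed
    also have "\<dots> \<le> (\<Sum>j<n. d j * P (-598))" by (rule sum_mono2) (auto simp: d_nonneg)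
    also have "\<dots> \<le> P 2 * P (-598)" unfolding sum_distrib_right[symmetric] by (intro mult_right_mono sum_d) simp
    finally have 1: "\<bar>ip n (mv n (gen d) p) p - e\<bar> \<le> P (-596)" unfolding eq by (simp add: P_mult)
    have "ip n v p - ip n (mv n (gen d) p) p = ip n p (\<lambda>r. v r - mv n (gen d) p r)"
      by (simp add: ip_diff_right ip_commute)
    also have "\<bar>\<dots>\<bar> \<le> nrm n p * nrm n (\<lambda>r. v r - mv n (gen d) p r)" by (rule abs_ip_le)
    also have "\<dots> \<le> 1 * P (-799)" using p1 diff by (intro mult_mono) auto
    finally have "\<bar>ip n v p - ip n (mv n (gen d) p) p\<bar> \<le> P (-799)" by simp
    moreover have "P (-596) + P (-799) \<le> P (-289)" by (rule P_add_le) auto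
    ultimately show ?thesis using 1 by linarith
  qed
  have c4: "c ^ 4 = (c\<^sup>2 * d i) * e" by (simp add: e_def c_def power2_eq_square power4_eq_xxxx)
  have cd: "0 \<le> c\<^sup>2 * d i" "c\<^sup>2 * d i \<le> P 8"
  proof -
    have "c\<^sup>2 \<le> P 6" using P_mult_le[OF c_up c_up, of 6] by (simp add: power2_eq_square)
    then show "c\<^sup>2 * d i \<le> P 8" using d_le[OF i] d_nonneg by (intro P_mult_le[of _ 6 _ 2]) auto
  qed (simp add: d_nonneg)
  have "\<bar>ip n v p\<bar> \<le> P 4 + P (-289)" using vp e_le e0 by linarith
  also have "\<dots> \<le> P 5" by (rule P_add_le) auto
  finally have "\<bar>ip n v v - c\<^sup>2 * d i\<bar> * \<bar>ip n v p\<bar> \<le> P (-284)"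
    by (intro P_mult_le[of _ "-289" _ 5] vv) auto
  moreover have "\<bar>c\<^sup>2 * d i\<bar> * \<bar>ip n v p - e\<bar> \<le> P (-281)"
    by (intro P_mult_le[of _ 8 _ "-289"] vp) (use cd in auto)
  moreover have "ip n v v * ip n v p - c ^ 4 = (ip n v v - c\<^sup>2 * d i) * ip n v p + (c\<^sup>2 * d i) * (ip n v p - e)"
    unfolding c4 by (simp add: algebra_simps)
  moreover have "P (-284) + P (-281) \<le> P (-280)" by (rule P_add_le) auto
  ultimately have "\<bar>ip n v v * ip n v p - c ^ 4\<bar> \<le> P (-280)" unfolding abs_mult[symmetric] by linarith
  \<comment> \<open>The lower bound W^(-53) for |c| turns the absolute error into a relative one:
    -280 = -68 - 4 times 53.\<close>
  also have "\<dots> = P (-68) * P (-53) ^ 4" by (simp add: P_power P_mult)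
  also have "\<dots> \<le> P (-68) * \<bar>c\<bar> ^ 4" using c_low by (intro mult_left_mono power_mono) auto
  finally show "\<bar>ip n v v * ip n v p - c ^ 4\<bar> \<le> P (-68) * c ^ 4" by simp
qed

lemma le_fourth_power: "1 \<le> x \<Longrightarrow> x \<le> x ^ 4" for x :: real
  by (rule self_le_power) auto

text \<open>As |c| is at least W^(-53), the search has succeeded by g = W^54, which bounds its
  length. If g passes and the preceding value g - W^(-20) does not, then g |c| is within W^(-16) of
  1, and g v agrees with plus or minus a_i up to W^(-14).\<close>

lemma scale_search:
  assumes "near_kernel t i p"
  defines "v \<equiv> mv n Mh p"
  shows "P 54 \<le> g \<Longrightarrow> 1 \<le> g ^ 4 * (ip n v v * ip n v p)"
    and "\<lbrakk>1 \<le> g ^ 4 * (ip n v v * ip n v p); P (-20) \<le> g; (g - P (-20)) ^ 4 * (ip n v v * ip n v p) < 1\<rbrakk> \<Longrightarrow>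
      \<exists>\<sigma>. (\<sigma> = 1 \<or> \<sigma> = - 1) \<and> (\<forall>r<n. \<bar>g * v r - \<sigma> * A r i\<bar> \<le> P (-14))"
proof -
  define c where "c = d i * AT p i"
  note ex = extraction[OF assms(1), folded v_def c_def]
  have i: "i < n" using assms(1) by (simp add: near_kernel_def)
  define Q where "Q = ip n v v * ip n v p"
  define D where "D = \<bar>c\<bar>"
  define r where "r = P (-68)"
  have D4: "c ^ 4 = D ^ 4" by (simp add: D_def)
  have D: "P (-53) \<le> D" "D \<le> P 3" "0 < D"
    using ex(3,4) P_pos[of "-53"] by (auto simp: D_def simp del: P_pos)
  have r: "0 < r" "r \<le> 1 / 16" unfolding r_def
    using P_absorb[of 16 "-68"] P_le_1[of "-67"] by simp_all
  have Q: "(1 - r) * D ^ 4 \<le> Q" "Q \<le> (1 + r) * D ^ 4"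
    using ex(2) unfolding Q_def[symmetric] D4 r_def[symmetric] by (simp_all add: algebra_simps abs_le_iff)
  have gQ: "(1 - r) * (h * D) ^ 4 \<le> h ^ 4 * Q" "h ^ 4 * Q \<le> (1 + r) * (h * D) ^ 4" for h
    using mult_left_mono[OF Q(1), of "h ^ 4"] mult_left_mono[OF Q(2), of "h ^ 4"]
    by (simp_all add: power_mult_distrib mult_ac)
  show "1 \<le> g ^ 4 * (ip n v v * ip n v p)" if g: "P 54 \<le> g"
  proof -
    have "P 54 * P (-53) \<le> g * D" using g D order.trans[OF P_nonneg g] by (intro mult_mono) auto
    then have gD: "16 \<le> g * D" using W16 by (simp add: P_mult P_1)
    then have "16 \<le> (g * D) ^ 4" using le_fourth_power[of "g * D"] by linarith
    then have "(1 - r) * 16 \<le> (1 - r) * (g * D) ^ 4" using r by (intro mult_left_mono) auto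
    also have "\<dots> \<le> g ^ 4 * Q" by (rule gQ(1))
    finally have "(1 - r) * 16 \<le> g ^ 4 * Q" .
    moreover have "1 \<le> (1 - r) * 16" using r by simp
    ultimately show ?thesis unfolding Q_def by linarith
  qed
  assume g: "1 \<le> g ^ 4 * (ip n v v * ip n v p)" "P (-20) \<le> g"
    "(g - P (-20)) ^ 4 * (ip n v v * ip n v p) < 1"
  define x where "x = g * D"
  define y where "y = (g - P (-20)) * D"
  have x0: "0 \<le> x" using g(2) P_nonneg[of "-20"] D(3) unfolding x_def by (intro mult_nonneg_nonneg) linarith+
  have x1: "1 - r \<le> x"
  \<comment> \<open>No root has to be estimated: x^4 <= x below 1 and x <= x^4 above 1 suffice to
    compare x and y with 1.\<close>
  proof (cases "1 \<le> x")
    case False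
    then have "x ^ 4 \<le> x" using x0 power_decreasing[of 1 4 x] by simp
    then have "(1 + r) * x ^ 4 \<le> (1 + r) * x" using r by (intro mult_left_mono) auto
    moreover have "1 \<le> (1 + r) * x ^ 4" using g(1) gQ(2)[of g] unfolding Q_def x_def by linarith
    ultimately have "1 \<le> x + r * x" by (simp add: algebra_simps)
    moreover have "r * x \<le> r * 1" using False r by (intro mult_left_mono) auto
    ultimately show ?thesis by simp
  qed (use r in simp)
  have y1: "y \<le> 1 + 2 * r"
  proof (cases "1 \<le> y")
    case True
    then have "(1 - r) * y \<le> (1 - r) * y ^ 4" using r le_fourth_power[OF True] by (intro mult_left_mono) auto
    also have "\<dots> < 1" using g(3) gQ(1)[of "g - P (-20)"] unfolding Q_def y_def by linarith
    finally have lt: "(1 - r) * y < 1" .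
    have "0 \<le> r * (1 - 2 * r)" using r by (intro mult_nonneg_nonneg) auto
    then have "1 \<le> (1 - r) * (1 + 2 * r)" by (simp add: algebra_simps)
    with lt have "(1 - r) * y < (1 - r) * (1 + 2 * r)" by linarith
    then show ?thesis using r by (subst (asm) mult_less_cancel_left_pos) auto
  qed (use r in simp)
  have "P (-20) * D \<le> P (-17)" by (rule P_mult_le[of _ "-20" _ 3]) (use D in auto)
  then have "x \<le> 1 + 2 * r + P (-17)" using y1 by (simp add: x_def y_def algebra_simps)
  moreover have "2 * r \<le> P (-17)" unfolding r_def using P_absorb[of 2 "-68"] P_mono[of "-67" "-17"] by simp
  ultimately have xg: "\<bar>x - 1\<bar> \<le> P (-16)" using x1 r P_absorb[of 2 "-17"] by simp
  have "x \<le> 2" using xg P_le_1[of "-16"] by linarith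
  then have "g * P (-53) \<le> 2" using D mult_left_mono[OF D(1), of g] order.trans[OF P_nonneg g(2)] by (simp add: x_def)
  then have "g * P (-53) \<le> P 1" using W16 by (simp add: P_1)
  from P_cancel[OF this] have g_le: "g \<le> P 54" by simp
  define \<sigma> where "\<sigma> = sgn c"
  have \<sigma>: "\<sigma> = 1 \<or> \<sigma> = - 1" using D(3) by (auto simp: \<sigma>_def D_def sgn_if)
  have "\<bar>g * v k - \<sigma> * A k i\<bar> \<le> P (-14)" if k: "k < n" for k
  proof -
    have "c = \<sigma> * D" unfolding \<sigma>_def D_def by (simp add: sgn_mult_abs)
    then have eq: "g * v k - \<sigma> * A k i = (x - 1) * (\<sigma> * A k i) + g * (v k - c * A k i)"
      by (simp add: x_def algebra_simps)
    have "\<bar>x - 1\<bar> * \<bar>\<sigma> * A k i\<bar> \<le> P (-15)"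
      by (rule P_mult_le[of _ "-16" _ 1]) (use xg A_le[OF k i] \<sigma> in \<open>auto simp: abs_mult\<close>)
    moreover have "\<bar>g\<bar> * \<bar>v k - c * A k i\<bar> \<le> P (-15)"
      by (rule P_mult_le[of _ 54 _ "-295"]) (use ex(1)[OF k] g_le order.trans[OF P_nonneg g(2)] in auto)
    ultimately show ?thesis unfolding eq
      using abs_triangle_ineq[of "(x - 1) * (\<sigma> * A k i)" "g * (v k - c * A k i)"] P_absorb[of 2 "-15"]
      by (simp add: abs_mult)
  qed
  with \<sigma> show "\<exists>\<sigma>. (\<sigma> = 1 \<or> \<sigma> = - 1) \<and> (\<forall>r<n. \<bar>g * v r - \<sigma> * A r i\<bar> \<le> P (-14))" by blast
qed

end

section \<open>Program building blocks\<close>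

text \<open>Unrolled while the program is being built, so a power with a fixed exponent is one
  expression of fixed size.\<close>

fun rpow :: "rexp \<Rightarrow> nat \<Rightarrow> rexp" where
  "rpow e 0 = RConst 1"
| "rpow e (Suc k) = RMul e (rpow e k)"

lemma rval_rpow [simp]: "rval (rpow e k) s = rval e s ^ k"
  by (induction k) auto

definition for_n :: "nat \<Rightarrow> com \<Rightarrow> com" where
  "for_n v c = Seq (IAssign v (IConst 0))
    (While (ILess (IVar v) (IVar 0)) (Seq c (IAssign v (IAdd (IVar v) (IConst 1)))))"

text \<open>Bounds such as W^800 exist only as reals, since integers cannot be multiplied; the
  integer counter is converted for the comparison.\<close>

definition for_r :: "nat \<Rightarrow> rexp \<Rightarrow> com \<Rightarrow> com" where
  "for_r v e c = Seq (IAssign v (IConst 0))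
    (While (RLess (ROfInt (IVar v)) e) (Seq c (IAssign v (IAdd (IVar v) (IConst 1)))))"

text \<open>Runs through all pairs of indices, kept in variables 3 and 5; the row offsets of both indices
  are maintained in variables 4 and 6, because products of integers are not available.\<close>

definition for_2 :: "com \<Rightarrow> com" where
  "for_2 c = Seq (IAssign 4 (IConst 0)) (for_n 3
    (Seq (Seq (IAssign 6 (IConst 0)) (for_n 5 (Seq c (IAssign 6 (IAdd (IVar 6) (IVar 0))))))
      (IAssign 4 (IAdd (IVar 4) (IVar 0)))))"

abbreviation scalar :: "nat \<Rightarrow> rexp" where "scalar a \<equiv> RGet a (IConst 0)"

abbreviation set_scalar :: "nat \<Rightarrow> rexp \<Rightarrow> com" where "set_scalar a e \<equiv> RAssign a (IConst 0) e"

lemma writes_for [simp]: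
  "wints (for_n v c) = insert v (wints c)" "wreals (for_n v c) = wreals c" "draws (for_n v c) = draws c"
  "wints (for_r v e c) = insert v (wints c)" "wreals (for_r v e c) = wreals c" "draws (for_r v e c) = draws c"
  "wints (for_2 c) = {3, 4, 5, 6} \<union> wints c" "wreals (for_2 c) = wreals c" "draws (for_2 c) = draws c"
  by (auto simp: for_n_def for_r_def for_2_def)

lemma frame_ints: "frame c s s' \<Longrightarrow> v \<notin> wints c \<Longrightarrow> ints s' v = ints s v"
  by (simp add: frame_def)

lemma frame_reals: "frame c s s' \<Longrightarrow> a \<notin> wreals c \<Longrightarrow> reals s' a = reals s a"
  by (simp add: frame_def)

lemma frame_trans: "frame c s s' \<Longrightarrow> frame c s' s'' \<Longrightarrow> frame c s s''"
  by (auto simp: frame_def)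

lemma frame_refl: "frame c s s"
  by (simp add: frame_def)

locale machine =
  fixes n :: nat and y :: "nat \<Rightarrow> nat \<Rightarrow> real" and b :: "nat \<Rightarrow> bool" and W :: nat
  assumes nW: "n \<le> W"
begin

abbreviation Wp where "Wp \<equiv> wp n y b W"

lemma wp_SeqI:
  assumes "Wp c P s" "\<And>s'. frame c s s' \<Longrightarrow> P s' \<Longrightarrow> Wp d Q s'"
  shows "Wp (Seq c d) Q s"
  unfolding wp_Seq using assms by (rule wp_mono)

text \<open>The common part of \<open>wp_for_n\<close> and \<open>wp_for_r\<close>. By
  \<open>indep\<close> the counter can be reset and advanced without touching the invariant, and the
  frame relative to the initial state tells the step what the loop has left alone so far.\<close>

lemma wp_counting:
  assumes v: "v \<notin> wints c" and N: "N \<le> W" and base: "I 0 s0"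
    and indep: "\<And>i s x. I i s \<Longrightarrow> I i (s\<lparr>ints := (ints s)(v := x)\<rparr>)"
    and step: "\<And>i s. i < N \<Longrightarrow> I i s \<Longrightarrow> ints s v = i \<Longrightarrow> frame (Seq c (IAssign v e)) s0 s \<Longrightarrow> Wp c (I (Suc i)) s"
    and guard: "\<And>i s. I i s \<Longrightarrow> ints s v = i \<Longrightarrow> frame (Seq c (IAssign v e)) s0 s \<Longrightarrow> tval g s \<longleftrightarrow> i < N"
    and e: "e = IAdd (IVar v) (IConst 1)"
  shows "Wp (Seq (IAssign v (IConst 0)) (While g (Seq c (IAssign v e))))
    (\<lambda>s. I N s \<and> frame (Seq c (IAssign v e)) s0 s) s0"
proof -
  let ?F = "frame (Seq c (IAssign v e)) s0"
  define s1 where "s1 = s0\<lparr>ints := (ints s0)(v := 0)\<rparr>"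
  have "Wp (While g (Seq c (IAssign v e))) (\<lambda>s. I N s \<and> ints s v = N \<and> ?F s) s1"
  proof (rule wp_While[where I = "\<lambda>i s. I i s \<and> ints s v = i \<and> ?F s"])
    show "I 0 s1 \<and> ints s1 v = 0 \<and> ?F s1" using base indep by (auto simp: s1_def frame_def)
    show "N \<le> W" by (rule N)
    fix i s assume i: "i < N" and s: "I i s \<and> ints s v = i \<and> ?F s"
    then have "Wp c (I (Suc i)) s" using step by blast
    then have "Wp c (\<lambda>s'. I (Suc i) s' \<and> frame c s s') s" by (rule wp_frame)
    then have "Wp (Seq c (IAssign v e)) (\<lambda>s. I (Suc i) s \<and> ints s v = Suc i \<and> ?F s) s"
      unfolding wp_Seq by (rule wp_mono) (use s v indep in \<open>auto simp: wp_basic e frame_def\<close>)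
    then show "tval g s \<and> Wp (Seq c (IAssign v e)) (\<lambda>s. I (Suc i) s \<and> ints s v = Suc i \<and> ?F s) s"
      using guard i s by blast
  qed (use guard in blast)
  then show ?thesis unfolding wp_Seq wp_basic by (auto simp: s1_def elim!: wp_mono)
qed

lemma wp_for_n:
  assumes "v \<noteq> 0" "v \<notin> wints c" "0 \<notin> wints c" "ints s0 0 = n" "I 0 s0"
    and "\<And>i s x. I i s \<Longrightarrow> I i (s\<lparr>ints := (ints s)(v := x)\<rparr>)"
    and "\<And>i s. i < n \<Longrightarrow> I i s \<Longrightarrow> ints s v = i \<Longrightarrow> frame (for_n v c) s0 s \<Longrightarrow> Wp c (I (Suc i)) s"
  shows "Wp (for_n v c) (\<lambda>s. I n s \<and> frame (for_n v c) s0 s) s0"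
proof -
  have F: "frame (Seq c (IAssign v e)) s0 = frame (for_n v c) s0" for e
    by (auto simp: frame_def fun_eq_iff)
  show ?thesis unfolding F[symmetric, of "IAdd (IVar v) (IConst 1)"]
    by (subst for_n_def, rule wp_counting) (use assms nW in \<open>auto simp: F frame_def\<close>)
qed

lemma wp_for_r:
  assumes "v \<notin> wints c" "N \<le> W" "I 0 s0"
    and "\<And>i s x. I i s \<Longrightarrow> I i (s\<lparr>ints := (ints s)(v := x)\<rparr>)"
    and "\<And>s. frame (for_r v e c) s0 s \<Longrightarrow> rval e s = real N"
    and "\<And>i s. i < N \<Longrightarrow> I i s \<Longrightarrow> ints s v = i \<Longrightarrow> frame (for_r v e c) s0 s \<Longrightarrow> Wp c (I (Suc i)) s"
  shows "Wp (for_r v e c) (\<lambda>s. I N s \<and> frame (for_r v e c) s0 s) s0"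
proof -
  have F: "frame (Seq c (IAssign v e')) s0 = frame (for_r v e c) s0" for e'
    by (auto simp: frame_def fun_eq_iff)
  show ?thesis unfolding F[symmetric, of "IAdd (IVar v) (IConst 1)"]
    by (subst for_r_def, rule wp_counting) (use assms in \<open>auto simp: F\<close>)
qed

lemma pair_index_less: "i < n \<Longrightarrow> j < n \<Longrightarrow> i * n + j < n * n"
proof -
  assume "i < n" "j < n"
  then have "i * n + j < Suc i * n" "Suc i * n \<le> n * n" using mult_le_mono1[of "Suc i" n n] by simp_all
  then show ?thesis by (rule less_le_trans)
qed

lemma pair_index_inj: "j < n \<Longrightarrow> j' < n \<Longrightarrow> i * n + j = i' * n + j' \<Longrightarrow> i = i' \<and> j = j'"
  by (metis add.commute div_mult_self3 div_less add_0 mod_mult_self3 mod_less mod_mult_self1 not_less_zero div_mult_self1)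

text \<open>A single invariant, indexed by the row-major position i n + j, serves both nested loops;
  finishing a row at i n + n is the same as starting the next one.\<close>

lemma wp_for_2:
  assumes c: "0 \<notin> wints c" "3 \<notin> wints c" "4 \<notin> wints c" "5 \<notin> wints c" "6 \<notin> wints c"
    and n: "ints s0 0 = n" and base: "I 0 s0"
    and indep: "\<And>i s v x. v \<in> {3, 4, 5, 6} \<Longrightarrow> I i s \<Longrightarrow> I i (s\<lparr>ints := (ints s)(v := x)\<rparr>)"
    and step: "\<And>i j s. i < n \<Longrightarrow> j < n \<Longrightarrow> I (i * n + j) s \<Longrightarrow> ints s 3 = i \<Longrightarrow> ints s 5 = j \<Longrightarrow>
      ints s 4 = i * n \<Longrightarrow> ints s 6 = j * n \<Longrightarrow> frame (for_2 c) s0 s \<Longrightarrow> Wp c (I (Suc (i * n + j))) s"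
  shows "Wp (for_2 c) (\<lambda>s. I (n * n) s \<and> frame (for_2 c) s0 s) s0"
proof -
  let ?inner = "Seq c (IAssign 6 (IAdd (IVar 6) (IVar 0)))"
  let ?outer = "Seq (Seq (IAssign 6 (IConst 0)) (for_n 5 ?inner)) (IAssign 4 (IAdd (IVar 4) (IVar 0)))"
  define s1 where "s1 = s0\<lparr>ints := (ints s0)(4 := 0)\<rparr>"
  have F: "frame (for_2 c) s0 s" if "frame (for_n 3 ?outer) s1 s" for s
    using that by (auto simp: frame_def s1_def)
  have "Wp (for_n 3 ?outer) (\<lambda>s. (I (n * n) s \<and> ints s 4 = n * n) \<and> frame (for_n 3 ?outer) s1 s) s1"
  proof (rule wp_for_n[where I = "\<lambda>i s. I (i * n) s \<and> ints s 4 = i * n"])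
    show "I (0 * n) s1 \<and> ints s1 4 = 0 * n" using base indep by (simp add: s1_def)
    fix i s assume i: "i < n" and s: "I (i * n) s \<and> ints s 4 = i * n" "ints s 3 = i"
      and fr: "frame (for_n 3 ?outer) s1 s"
    have n_s: "ints s 0 = n" using frame_ints[OF F[OF fr], of 0] c n by simp
    define s2 where "s2 = s\<lparr>ints := (ints s)(6 := 0)\<rparr>"
    have "Wp (for_n 5 ?inner) (\<lambda>s. (I (i * n + n) s \<and> ints s 6 = n * n) \<and> frame (for_n 5 ?inner) s2 s) s2"
    proof (rule wp_for_n[where I = "\<lambda>j s. I (i * n + j) s \<and> ints s 6 = j * n"])
      show "I (i * n + 0) s2 \<and> ints s2 6 = 0 * n" using s indep by (simp add: s2_def)
      show "ints s2 0 = n" using n_s by (simp add: s2_def)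
      fix j r assume j: "j < n" and r: "I (i * n + j) r \<and> ints r 6 = j * n" "ints r 5 = j"
        and fr2: "frame (for_n 5 ?inner) s2 r"
      have r': "ints r 3 = i" "ints r 4 = i * n" "ints r 0 = n"
        using frame_ints[OF fr2] c s n_s by (auto simp: s2_def)
      have "frame (for_2 c) s0 r" using F[OF fr] fr2 by (auto simp: frame_def s2_def)
      then have "Wp c (I (Suc (i * n + j))) r" using step[OF i j] r r' by blast
      then have "Wp c (\<lambda>r'. I (Suc (i * n + j)) r' \<and> frame c r r') r" by (rule wp_frame)
      then show "Wp ?inner (\<lambda>s. I (i * n + Suc j) s \<and> ints s 6 = Suc j * n) r"
        unfolding wp_Seq by (rule wp_mono) (use r r' c indep in \<open>auto simp: wp_basic frame_def\<close>)
    next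
      fix j r x assume "I (i * n + j) r \<and> ints r 6 = j * n"
      then show "I (i * n + j) (r\<lparr>ints := (ints r)(5 := x)\<rparr>) \<and>
          ints (r\<lparr>ints := (ints r)(5 := x)\<rparr>) 6 = j * n" using indep by auto
    qed (use c in auto)
    then show "Wp ?outer (\<lambda>s. I (Suc i * n) s \<and> ints s 4 = Suc i * n) s"
      unfolding wp_Seq wp_basic ival.simps s2_def[symmetric]
    proof (rule wp_mono, goal_cases)
      case (1 r)
      then have "ints r 4 = i * n" "ints r 0 = n" using c s n_s by (auto simp: frame_def s2_def)
      then show ?case using 1 indep by (auto simp: wp_basic add.commute)
    qed
  next
    fix i s x assume "I (i * n) s \<and> ints s 4 = i * n"
    then show "I (i * n) (s\<lparr>ints := (ints s)(3 := x)\<rparr>) \<and>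
        ints (s\<lparr>ints := (ints s)(3 := x)\<rparr>) 4 = i * n" using indep by auto
  qed (use c n in \<open>auto simp: s1_def\<close>)
  then show ?thesis unfolding for_2_def wp_Seq wp_basic ival.simps s1_def[symmetric]
    by (rule wp_mono) (auto dest!: F simp: for_2_def[symmetric])
qed

text \<open>For loops that fill or update the arrays in \<open>X\<close> entry by entry. Positions
  not yet reached still hold the initial contents, so the step may read the old entry; accumulation
  relies on this.\<close>

lemma wp_for_2_entries:
  assumes c: "0 \<notin> wints c" "3 \<notin> wints c" "4 \<notin> wints c" "5 \<notin> wints c" "6 \<notin> wints c"
    and n: "ints s0 0 = n"
    and step: "\<And>i j s. i < n \<Longrightarrow> j < n \<Longrightarrow> ints s 3 = i \<Longrightarrow> ints s 5 = j \<Longrightarrow> ints s 4 = i * n \<Longrightarrow>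
      ints s 6 = j * n \<Longrightarrow> frame (for_2 c) s0 s \<Longrightarrow>
      (\<And>a. a \<in> X \<Longrightarrow> reals s a (i * n + j) = reals s0 a (i * n + j)) \<Longrightarrow>
      Wp c (\<lambda>s'. \<forall>a\<in>X. reals s' a = (reals s a)(i * n + j := F a i j)) s"
  shows "Wp (for_2 c) (\<lambda>s. (\<forall>a\<in>X. \<forall>i<n. \<forall>j<n. reals s a (i * n + j) = F a i j) \<and> frame (for_2 c) s0 s) s0"
proof -
  define I where "I p s \<longleftrightarrow> (\<forall>a\<in>X. (\<forall>i<n. \<forall>j<n. i * n + j < p \<longrightarrow> reals s a (i * n + j) = F a i j) \<and>
    (\<forall>q\<ge>p. reals s a q = reals s0 a q))" for p :: nat and s :: state
  have "Wp (for_2 c) (\<lambda>s. I (n * n) s \<and> frame (for_2 c) s0 s) s0"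
  proof (rule wp_for_2[OF c n])
    fix i j s
    assume i: "i < n" and j: "j < n" and I: "I (i * n + j) s" and s: "ints s 3 = i" "ints s 5 = j"
      "ints s 4 = i * n" "ints s 6 = j * n" "frame (for_2 c) s0 s"
    have "Wp c (\<lambda>s'. \<forall>a\<in>X. reals s' a = (reals s a)(i * n + j := F a i j)) s"
      by (rule step[OF i j s]) (use I in \<open>auto simp: I_def\<close>)
    then show "Wp c (I (Suc (i * n + j))) s"
    proof (rule wp_mono)
      fix s' :: state assume s': "\<forall>a\<in>X. reals s' a = (reals s a)(i * n + j := F a i j)"
      show "I (Suc (i * n + j)) s'"
        unfolding I_def
      proof (intro ballI conjI allI impI)
        fix a i' j' assume a: "a \<in> X" and ij: "i' < n" "j' < n" "i' * n + j' < Suc (i * n + j)"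
        show "reals s' a (i' * n + j') = F a i' j'"
        proof (cases "i' * n + j' = i * n + j")
          case True
          then show ?thesis using pair_index_inj[OF ij(2) j True] s' a by simp
        next
          case False
          then show ?thesis using I s' a ij by (auto simp: I_def)
        qed
      next
        fix a q assume "a \<in> X" "Suc (i * n + j) \<le> q"
        then show "reals s' a q = reals s0 a q" using I s' by (auto simp: I_def)
      qed
    qed
  qed (auto simp: I_def)
  then show ?thesis by (rule wp_mono) (use pair_index_less in \<open>auto simp: I_def\<close>)
qed

lemma wp_for_n_entries:
  assumes "v \<noteq> 0" "v \<notin> wints c" "0 \<notin> wints c" "ints s0 0 = n"
    and step: "\<And>i s. i < n \<Longrightarrow> ints s v = i \<Longrightarrow> frame (for_n v c) s0 s \<Longrightarrow> reals s a i = reals s0 a i \<Longrightarrow>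
      Wp c (\<lambda>s'. reals s' a = (reals s a)(i := F i)) s"
  shows "Wp (for_n v c) (\<lambda>s. (\<forall>i<n. reals s a i = F i) \<and> frame (for_n v c) s0 s) s0"
proof -
  define I where "I p s \<longleftrightarrow> (\<forall>i<p. reals s a i = F i) \<and> (\<forall>q\<ge>p. reals s a q = reals s0 a q)" for p :: nat and s :: state
  have "Wp (for_n v c) (\<lambda>s. I n s \<and> frame (for_n v c) s0 s) s0"
  proof (rule wp_for_n[OF assms(1-4)])
    fix i s assume i: "i < n" and I: "I i s" and s: "ints s v = i" "frame (for_n v c) s0 s"
    have "Wp c (\<lambda>s'. reals s' a = (reals s a)(i := F i)) s" by (rule step[OF i s]) (use I in \<open>auto simp: I_def\<close>)
    then show "Wp c (I (Suc i)) s" by (rule wp_mono) (use I in \<open>auto simp: I_def less_Suc_eq\<close>)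
  qed (auto simp: I_def)
  then show ?thesis by (rule wp_mono) (auto simp: I_def)
qed

lemma wp_sum:
  assumes "v \<noteq> 0" "ints s0 0 = n" and c: "c = RAssign a e (RAdd (RGet a e) f)"
    and e: "\<And>s. frame (for_n v c) s0 s \<Longrightarrow> ival e s = k"
    and f: "\<And>i s. i < n \<Longrightarrow> ints s v = i \<Longrightarrow> frame (for_n v c) s0 s \<Longrightarrow> rval f s = F i"
  shows "Wp (for_n v c) (\<lambda>s. reals s a = (reals s0 a)(k := reals s0 a k + (\<Sum>i<n. F i)) \<and> frame (for_n v c) s0 s) s0"
proof -
  have "Wp (for_n v c) (\<lambda>s. (reals s a = (reals s0 a)(k := reals s0 a k + (\<Sum>i<n. F i))) \<and> frame (for_n v c) s0 s) s0"
    by (rule wp_for_n[where I = "\<lambda>i s. reals s a = (reals s0 a)(k := reals s0 a k + (\<Sum>j<i. F j))"])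
      (use assms in \<open>auto simp: wp_basic\<close>)
  then show ?thesis by (rule wp_mono) auto
qed

end

section \<open>The algorithm\<close>

text \<open>Integer variables: 1 is the current scale \<open>L\<close>, 2 a flag that asks for another round, 3 to 6 and
  12 are used for indices, 7 is the starting vector of the filter, 8 and 9 are counters, 10 is the number of
  columns found. Arrays: 3 is the random direction \<open>u\<close>, 4 the current sample, 5 to 9 are moment estimates,
  10 is a member of the pencil, 11 to 13 are work vectors, from 14 on there are scalars.\<close>

definition base :: "nat \<Rightarrow> rexp" where "base q = rpow (ROfInt (IVar 1)) q"

abbreviation entry :: "nat \<Rightarrow> rexp" where "entry a \<equiv> RGet a (IAdd (IVar 4) (IVar 5))"

abbreviation set_entry :: "nat \<Rightarrow> rexp \<Rightarrow> com" where "set_entry a e \<equiv> RAssign a (IAdd (IVar 4) (IVar 5)) e"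

definition dot :: "nat \<Rightarrow> nat \<Rightarrow> nat \<Rightarrow> com" where
  "dot a x z = Seq (set_scalar a (RConst 0))
    (for_n 3 (set_scalar a (RAdd (scalar a) (RMul (RGet x (IVar 3)) (RGet z (IVar 3))))))"

text \<open>An update z := e z + f Z x in place. With e = 0, f = 1 it is the plain product, with e =
  1, f = -1/R^2 the second half of a filter step.\<close>

definition mat_vec :: "nat \<Rightarrow> nat \<Rightarrow> nat \<Rightarrow> rexp \<Rightarrow> rexp \<Rightarrow> com" where
  "mat_vec Z x z e f = Seq (IAssign 4 (IConst 0)) (for_n 3
    (Seq (RAssign z (IVar 3) (RMul e (RGet z (IVar 3))))
    (Seq (for_n 5 (RAssign z (IVar 3) (RAdd (RGet z (IVar 3)) (RMul f (RMul (entry Z) (RGet x (IVar 5)))))))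
      (IAssign 4 (IAdd (IVar 4) (IVar 0))))))"

definition run_filter :: "nat \<Rightarrow> nat \<Rightarrow> nat \<Rightarrow> com" where
  "run_filter q Z J = Seq (for_n 3 (RAssign 11 (IVar 3) (RConst 0))) (Seq (RAssign 11 (IVar 7) (RConst 1))
    (Seq (for_r 8 (rpow (base q) J) (Seq (mat_vec Z 11 12 (RConst 0) (RConst 1))
        (mat_vec Z 12 11 (RConst 1) (RSub (RConst 0) (RDiv (RConst 1) (rpow (rpow (base q) 8) 2))))))
      (dot 14 11 11)))"

text \<open>Entry (i, j) of the product of a matrix with its transpose. It runs inside
  \<open>for_2\<close>, which keeps the row offsets i n and j n in variables 4 and 6.\<close>

definition rows_product :: "nat \<Rightarrow> com" where
  "rows_product a = Seq (set_scalar 18 (RConst 0)) (for_n 12 (set_scalar 18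
    (RAdd (scalar 18) (RMul (RGet a (IAdd (IVar 4) (IVar 12))) (RGet a (IAdd (IVar 6) (IVar 12)))))))"

definition arr :: "nat \<Rightarrow> state \<Rightarrow> nat \<Rightarrow> nat \<Rightarrow> nat \<Rightarrow> real" where
  "arr n s a = (\<lambda>i j. reals s a (i * n + j))"

lemma wp_IAssign_fun:
  "wp n y b W (IAssign v e) Q = (\<lambda>s. Q (s\<lparr>ints := (ints s)(v := ival e s)\<rparr>))"
  by (rule ext) (rule wp_basic)

lemma mv_cong:
  "(\<And>j. j < n \<Longrightarrow> Z i j = Z' i j) \<Longrightarrow> (\<And>j. j < n \<Longrightarrow> x j = x' j) \<Longrightarrow> mv n Z x i = mv n Z' x' i"
  by (simp add: mv_def)

lemma filt_cong:
  assumes "\<And>i j. i < n \<Longrightarrow> j < n \<Longrightarrow> Z i j = Z' i j" "\<And>j. j < n \<Longrightarrow> x j = x' j" "i < n"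
  shows "filt n Z R x i = filt n Z' R x' i"
proof -
  have "mv n Z x j = mv n Z' x' j" if "j < n" for j using assms that by (intro mv_cong) auto
  then have "mv n Z (mv n Z x) i = mv n Z' (mv n Z' x') i" using assms by (intro mv_cong) auto
  then show ?thesis using assms by (simp add: filt_def)
qed

lemma probe_cong:
  assumes "\<And>i j. i < n \<Longrightarrow> j < n \<Longrightarrow> Z i j = Z' i j" "i < n"
  shows "probe n Z R J k i = probe n Z' R J k i"
  using assms(2)
proof (induction J arbitrary: i)
  case (Suc J)
  then show ?case unfolding probe_def funpow.simps comp_def
    by (intro filt_cong assms(1)) (simp_all add: probe_def)
qed (simp add: probe_def)

lemma accepted_cong:
  assumes "\<And>i j. i < n \<Longrightarrow> j < n \<Longrightarrow> Z i j = Z' i j"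
  shows "accepted n Z R J k \<longleftrightarrow> accepted n Z' R J k"
proof -
  have "ip n (probe n Z R J k) (probe n Z R J k) = ip n (probe n Z' R J k) (probe n Z' R J k)"
    by (intro ip_cong probe_cong assms)
  then show ?thesis by (simp add: accepted_def)
qed

lemma writes_blocks [simp]:
  "wints (dot a x z) = {3}" "wreals (dot a x z) = {a}" "draws (dot a x z) = False"
  "wints (mat_vec Z x z e f) = {3, 4, 5}" "wreals (mat_vec Z x z e f) = {z}" "draws (mat_vec Z x z e f) = False"
  "wints (run_filter q Z J) = {3, 4, 5, 8}" "wreals (run_filter q Z J) = {11, 12, 14}"
  "draws (run_filter q Z J) = False"
  "wints (rows_product a) = {12}" "wreals (rows_product a) = {18}" "draws (rows_product a) = False"
  by (auto simp: dot_def mat_vec_def run_filter_def rows_product_def)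

lemma rval_base [simp]: "rval (base q) s = real (ints s 1 ^ q)"
  by (simp add: base_def)

context machine
begin

lemma wp_dot:
  assumes "ints s 0 = n" "a \<noteq> x" "a \<noteq> z"
  shows "Wp (dot a x z) (\<lambda>s'. reals s' a 0 = ip n (reals s x) (reals s z)) s"
  unfolding dot_def wp_Seq wp_basic
  by (rule wp_mono, rule wp_sum[where k = 0 and F = "\<lambda>i. reals s x i * reals s z i"])
    (use assms in \<open>auto simp: frame_reals ip_def\<close>)

lemma wp_mat_vec:
  assumes "ints s0 0 = n" "z \<noteq> Z" "z \<noteq> x"
    and e: "\<And>s. frame (mat_vec Z x z e f) s0 s \<Longrightarrow> rval e s = \<alpha>"
    and f: "\<And>s. frame (mat_vec Z x z e f) s0 s \<Longrightarrow> rval f s = \<beta>"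
  shows "Wp (mat_vec Z x z e f)
    (\<lambda>s. \<forall>i<n. reals s z i = \<alpha> * reals s0 z i + \<beta> * mv n (arr n s0 Z) (reals s0 x) i) s0"
proof -
  let ?in = "RAssign z (IVar 3) (RAdd (RGet z (IVar 3)) (RMul f (RMul (entry Z) (RGet x (IVar 5)))))"
  let ?c = "Seq (RAssign z (IVar 3) (RMul e (RGet z (IVar 3)))) (Seq (for_n 5 ?in) (IAssign 4 (IAdd (IVar 4) (IVar 0))))"
  let ?F = "\<lambda>i. \<alpha> * reals s0 z i + \<beta> * mv n (arr n s0 Z) (reals s0 x) i"
  define s1 where "s1 = s0\<lparr>ints := (ints s0)(4 := 0)\<rparr>"
  define I where "I p s \<longleftrightarrow> (\<forall>i<p. reals s z i = ?F i) \<and> (\<forall>q\<ge>p. reals s z q = reals s0 z q) \<and> ints s 4 = p * n"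
    for p :: nat and s :: state
  have F: "frame (mat_vec Z x z e f) s0 s" if "frame (for_n 3 ?c) s1 s" for s
    using that by (auto simp: frame_def s1_def)
  have "Wp (for_n 3 ?c) (\<lambda>s. I n s \<and> frame (for_n 3 ?c) s1 s) s1"
  proof (rule wp_for_n)
    show "I 0 s1" by (simp add: I_def s1_def)
    fix i s assume i: "i < n" and I: "I i s" and s: "ints s 3 = i" and fr: "frame (for_n 3 ?c) s1 s"
    have s': "ints s 0 = n" "reals s Z = reals s0 Z" "reals s x = reals s0 x" "ints s 4 = i * n"
      using fr assms I by (auto simp: frame_def s1_def I_def)
    define s2 where "s2 = s\<lparr>reals := (reals s)(z := (reals s z)(i := \<alpha> * reals s0 z i))\<rparr>"
    have "Wp (for_n 5 ?in) (\<lambda>r. reals r z = (reals s2 z)(i := reals s2 z i +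
        (\<Sum>j<n. \<beta> * (arr n s0 Z i j * reals s0 x j))) \<and> frame (for_n 5 ?in) s2 r) s2"
    proof (rule wp_sum)
      fix r j assume r: "frame (for_n 5 ?in) s2 r"
      show "ival (IVar 3) r = i" using r s by (auto simp: frame_def s2_def)
      assume "j < n" "ints r 5 = j"
      moreover have "frame (mat_vec Z x z e f) s0 r"
        by (rule frame_trans[OF F[OF fr]]) (use r in \<open>auto simp: frame_def s2_def\<close>)
      ultimately show "rval (RMul f (RMul (entry Z) (RGet x (IVar 5)))) r = \<beta> * (arr n s0 Z i j * reals s0 x j)"
        using r s' f assms by (auto simp: frame_def s2_def arr_def)
    qed (use s' in \<open>auto simp: s2_def\<close>)
    then have "Wp (for_n 5 ?in) (\<lambda>r. I (Suc i) (r\<lparr>ints := (ints r)(4 := ints r 4 + ints r 0)\<rparr>)) s2"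
      by (rule wp_mono) (use I s' in \<open>auto simp: I_def s2_def frame_def less_Suc_eq mv_def sum_distrib_left\<close>)
    moreover have "s\<lparr>reals := (reals s)(z := (reals s z)(ival (IVar 3) s := rval (RMul e (RGet z (IVar 3))) s))\<rparr> = s2"
      using e[OF F[OF fr]] s I by (simp add: s2_def I_def)
    ultimately show "Wp ?c (I (Suc i)) s"
      unfolding wp_Seq wp_basic(3) by (simp add: wp_IAssign_fun)
  qed (use assms in \<open>auto simp: I_def s1_def\<close>)
  then show ?thesis unfolding mat_vec_def wp_Seq wp_basic ival.simps s1_def[symmetric]
    by (rule wp_mono) (auto simp: I_def)
qed

lemma wp_run_filter:
  assumes "ints s0 0 = n" "ints s0 7 < n" "Z \<notin> {11, 12, 14}" "(ints s0 1 ^ q) ^ J \<le> W"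
  defines "k \<equiv> ints s0 7" and "Wn \<equiv> ints s0 1 ^ q"
  defines "w \<equiv> probe n (arr n s0 Z) (real Wn ^ 8) (Wn ^ J) k"
  shows "Wp (run_filter q Z J) (\<lambda>s. (\<forall>i<n. reals s 11 i = w i) \<and> reals s 14 0 = ip n w w) s0"
proof -
  let ?e = "RSub (RConst 0) (RDiv (RConst 1) (rpow (rpow (base q) 8) 2))"
  let ?body = "Seq (mat_vec Z 11 12 (RConst 0) (RConst 1)) (mat_vec Z 12 11 (RConst 1) ?e)"
  let ?w = "\<lambda>J. probe n (arr n s0 Z) (real Wn ^ 8) J k"
  have Wn: "Wn ^ J \<le> W" using assms(4) by (simp add: Wn_def)
  have z: "Wp (for_n 3 (RAssign 11 (IVar 3) (RConst 0)))
      (\<lambda>s. (\<forall>i<n. reals s 11 i = 0) \<and> frame (for_n 3 (RAssign 11 (IVar 3) (RConst 0))) s0 s) s0"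
    by (rule wp_for_n_entries) (use assms(1) in \<open>auto simp: wp_basic\<close>)
  have loop: "Wp (for_r 8 (rpow (base q) J) ?body)
      (\<lambda>s. (\<forall>i<n. reals s 11 i = w i) \<and> frame (for_r 8 (rpow (base q) J) ?body) s1 s) s1"
    if s1: "\<forall>i<n. reals s1 11 i = unitv k i" "frame (run_filter q Z J) s0 s1" for s1
    unfolding w_def
  proof (rule wp_for_r[where I = "\<lambda>p s. \<forall>i<n. reals s 11 i = ?w p i"])
    show "Wn ^ J \<le> W" by (rule Wn)
    show "\<forall>i<n. reals s1 11 i = ?w 0 i" using s1 by (simp add: probe_def)
    fix s assume fr: "frame (for_r 8 (rpow (base q) J) ?body) s1 s"
    have fr0: "frame (run_filter q Z J) s0 s" using s1(2) fr by (auto simp: frame_def)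
    show "rval (rpow (base q) J) s = real (Wn ^ J)"
      using fr0 by (simp add: Wn_def frame_def)
    fix p assume p: "p < Wn ^ J" and I: "\<forall>i<n. reals s 11 i = ?w p i"
    have s: "ints s 0 = n" "arr n s Z = arr n s0 Z" "ints s 1 ^ q = Wn"
      using fr0 assms(1,3) by (auto simp: frame_def arr_def Wn_def)
    show "Wp ?body (\<lambda>s. \<forall>i<n. reals s 11 i = ?w (Suc p) i) s"
    proof (rule wp_SeqI, rule wp_mat_vec[where \<alpha> = 0 and \<beta> = 1])
      fix r assume r: "frame (mat_vec Z 11 12 (RConst 0) (RConst 1)) s r"
        "\<forall>i<n. reals r 12 i = 0 * reals s 12 i + 1 * mv n (arr n s Z) (reals s 11) i"
      have r': "ints r 0 = n" "arr n r Z = arr n s0 Z" "ints r 1 ^ q = Wn" "reals r 11 = reals s 11"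
        using r(1) s assms(3) by (auto simp: frame_def arr_def)
      have r12: "\<And>i. i < n \<Longrightarrow> reals r 12 i = mv n (arr n s0 Z) (?w p) i"
        using r(2) s(2) I by (auto intro!: mv_cong)
      have "Wp (mat_vec Z 12 11 (RConst 1) ?e)
          (\<lambda>t. \<forall>i<n. reals t 11 i = 1 * reals r 11 i + (- (1 / (real Wn ^ 8)\<^sup>2)) * mv n (arr n r Z) (reals r 12) i) r"
        by (rule wp_mat_vec) (use r' assms(3) in \<open>auto simp: frame_def\<close>)
      then show "Wp (mat_vec Z 12 11 (RConst 1) ?e) (\<lambda>s. \<forall>i<n. reals s 11 i = ?w (Suc p) i) r"
      proof (rule wp_mono, intro allI impI)
        fix t i assume t: "\<forall>i<n. reals t 11 i = 1 * reals r 11 i +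
          (- (1 / (real Wn ^ 8)\<^sup>2)) * mv n (arr n r Z) (reals r 12) i" and i: "i < n"
        have "mv n (arr n r Z) (reals r 12) i = mv n (arr n s0 Z) (mv n (arr n s0 Z) (?w p)) i"
          using r12 r'(2) i by (intro mv_cong) auto
        then have "reals t 11 i = filt n (arr n s0 Z) (real Wn ^ 8) (?w p) i"
          using t i I r'(4) by (simp add: filt_def)
        then show "reals t 11 i = ?w (Suc p) i" by (simp add: probe_def)
      qed
    qed (use s assms(3) in auto)
  qed auto
  show ?thesis unfolding run_filter_def
  proof (rule wp_SeqI[OF z], goal_cases)
    case (1 s1)
    define s2 where "s2 = s1\<lparr>reals := (reals s1)(11 := (reals s1 11)(k := 1))\<rparr>"
    have s2: "\<forall>i<n. reals s2 11 i = unitv k i" "frame (run_filter q Z J) s0 s2"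
      using 1 by (auto simp: s2_def unitv_def frame_def)
    have eq: "s1\<lparr>reals := (reals s1)(11 := (reals s1 11)(ival (IVar 7) s1 := rval (RConst 1) s1))\<rparr> = s2"
      using 1 by (simp add: s2_def k_def frame_def)
    have "Wp (Seq (for_r 8 (rpow (base q) J) ?body) (dot 14 11 11))
      (\<lambda>s. (\<forall>i<n. reals s 11 i = w i) \<and> reals s 14 0 = ip n w w) s2"
    proof (rule wp_SeqI[OF loop[OF s2]], goal_cases)
      case (1 s3)
      then have "ints s3 0 = n" using s2(2) assms(1) by (auto simp: frame_def)
      then have "Wp (dot 14 11 11) (\<lambda>s'. reals s' 14 0 = ip n (reals s3 11) (reals s3 11)) s3"
        by (rule wp_dot) auto
      then show ?case by (rule wp_mono) (use 1 in \<open>auto simp: frame_def intro!: ip_cong\<close>)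
    qed
    then show ?case unfolding wp_Seq[of _ _ _ _ "RAssign 11 (IVar 7) (RConst 1)"] wp_basic eq .
  qed
qed

lemma wp_rows_product:
  assumes "ints s 0 = n" "ints s 4 = i * n" "ints s 6 = j * n" "a \<noteq> 18"
  shows "Wp (rows_product a) (\<lambda>s'. reals s' 18 0 = (\<Sum>l<n. arr n s a i l * arr n s a j l)) s"
  unfolding rows_product_def wp_Seq wp_basic
  by (rule wp_mono, rule wp_sum[where k = 0 and F = "\<lambda>l. arr n s a i l * arr n s a j l"])
    (use assms in \<open>auto simp: frame_def arr_def\<close>)

end

section \<open>Moment estimators, cumulants and the stopping test\<close>

definition weighted :: "nat \<Rightarrow> (nat \<Rightarrow> nat \<Rightarrow> real) \<Rightarrow> (nat \<Rightarrow> real) \<Rightarrow> nat \<Rightarrow> nat \<Rightarrow> real" where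
  "weighted m Y x = (\<lambda>i j. \<Sum>t<m. x t * (Y t i * Y t j) / real m)"

definition est_cov :: "nat \<Rightarrow> (nat \<Rightarrow> nat \<Rightarrow> real) \<Rightarrow> nat \<Rightarrow> nat \<Rightarrow> real" where
  "est_cov m Y = weighted m Y (\<lambda>_. 1)"

definition est_trace :: "nat \<Rightarrow> nat \<Rightarrow> (nat \<Rightarrow> nat \<Rightarrow> real) \<Rightarrow> real" where
  "est_trace n m Y = (\<Sum>t<m. ip n (Y t) (Y t) / real m)"

text \<open>Solved for M from the moment identity E[|y|^2 y y^T] = tr(C) C + 2 C^2 - 2 M, where C
  denotes the second moments of y; the first two terms are what a Gaussian vector would
  give.\<close>

definition est_M :: "nat \<Rightarrow> nat \<Rightarrow> (nat \<Rightarrow> nat \<Rightarrow> real) \<Rightarrow> nat \<Rightarrow> nat \<Rightarrow> real" where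
  "est_M n m Y = (\<lambda>i j. (weighted m Y (\<lambda>t. ip n (Y t) (Y t)) i j - est_trace n m Y * est_cov m Y i j
    - 2 * (\<Sum>l<n. est_cov m Y i l * est_cov m Y j l)) / (-2))"

text \<open>Solved for H from E[<u, y>^2 y y^T] = <u, C u> C + 2 (C u)(C u)^T - 2 H.\<close>

definition est_H :: "nat \<Rightarrow> nat \<Rightarrow> (nat \<Rightarrow> nat \<Rightarrow> real) \<Rightarrow> (nat \<Rightarrow> real) \<Rightarrow> nat \<Rightarrow> nat \<Rightarrow> real" where
  "est_H n m Y u = (\<lambda>i j. (weighted m Y (\<lambda>t. (ip n u (Y t))\<^sup>2) i j
    - ip n u (mv n (est_cov m Y) u) * est_cov m Y i j
    - 2 * (mv n (est_cov m Y) u i * mv n (est_cov m Y) u j)) / (-2))"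

definition block_size :: "nat \<Rightarrow> rexp" where "block_size q = rpow (base q) 1700"

abbreviation accumulate :: "nat \<Rightarrow> nat \<Rightarrow> rexp \<Rightarrow> com" where
  "accumulate q a e \<equiv> set_entry a (RAdd (entry a)
    (RDiv (RMul e (RMul (RGet 4 (IVar 3)) (RGet 4 (IVar 5)))) (block_size q)))"

definition moments :: "nat \<Rightarrow> com" where
  "moments q = Seq (for_2 (Seq (set_entry 5 (RConst 0)) (Seq (set_entry 6 (RConst 0)) (set_entry 7 (RConst 0)))))
    (Seq (set_scalar 16 (RConst 0))
    (for_r 9 (block_size q) (Seq (Sample 4) (Seq (dot 14 4 4) (Seq (dot 15 3 4)
      (Seq (for_2 (Seq (accumulate q 5 (RConst 1)) (Seq (accumulate q 6 (scalar 14))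
        (accumulate q 7 (RMul (scalar 15) (scalar 15))))))
      (set_scalar 16 (RAdd (scalar 16) (RDiv (scalar 14) (block_size q))))))))))"

definition cumulants :: com where
  "cumulants = Seq (mat_vec 5 3 13 (RConst 0) (RConst 1)) (Seq (dot 17 3 13)
    (for_2 (Seq (rows_product 5)
      (Seq (set_entry 8 (RDiv (RSub (RSub (entry 6) (RMul (scalar 16) (entry 5)))
          (RMul (RConst 2) (scalar 18))) (RConst (-2))))
        (set_entry 9 (RDiv (RSub (RSub (entry 7) (RMul (scalar 17) (entry 5)))
          (RMul (RConst 2) (RMul (RGet 13 (IVar 3)) (RGet 13 (IVar 5))))) (RConst (-2))))))))"

definition small :: test where
  "small = RLess (RMul (RMul (RConst 4) (ROfInt (IVar 0))) (scalar 14)) (RConst 1)"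

definition check :: "nat \<Rightarrow> com" where
  "check q = Seq (IAssign 2 (IConst 0))
    (Seq (If (TAnd (RLess (scalar 16) (base q)) (TNot (RLess (RMul (scalar 0) (base q)) (RConst 1))))
      Skip (IAssign 2 (IConst 1)))
    (for_n 7 (Seq (run_filter q 8 20) (If small Skip (IAssign 2 (IConst 1))))))"

lemma writes_round [simp]:
  "wints (moments q) = {3, 4, 5, 6, 9}" "wreals (moments q) = {4, 5, 6, 7, 14, 15, 16}"
  "wints cumulants = {3, 4, 5, 6, 12}" "wreals cumulants = {8, 9, 13, 17, 18}" "draws cumulants = False"
  "wints (check q) = {2, 3, 4, 5, 7, 8}" "wreals (check q) = {11, 12, 14}" "draws (check q) = False"
  by (auto simp: moments_def cumulants_def check_def)

context machine
begin

lemma wp_moments: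
  assumes n: "ints s0 0 = n" and m: "m = (ints s0 1 ^ q) ^ 1700" "m \<le> W"
  defines "u \<equiv> reals s0 3" and "Y \<equiv> \<lambda>t. y (samples s0 + t)"
  shows "Wp (moments q) (\<lambda>s. (\<forall>i<n. \<forall>j<n. arr n s 5 i j = est_cov m Y i j \<and>
      arr n s 6 i j = weighted m Y (\<lambda>t. ip n (Y t) (Y t)) i j \<and>
      arr n s 7 i j = weighted m Y (\<lambda>t. (ip n u (Y t))\<^sup>2) i j) \<and>
    reals s 16 0 = est_trace n m Y \<and> samples s = samples s0 + m) s0"
proof -
  let ?zero = "Seq (set_entry 5 (RConst 0)) (Seq (set_entry 6 (RConst 0)) (set_entry 7 (RConst 0)))"
  let ?acc = "Seq (accumulate q 5 (RConst 1)) (Seq (accumulate q 6 (scalar 14))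
        (accumulate q 7 (RMul (scalar 15) (scalar 15))))"
  let ?tail = "Seq (for_2 ?acc) (set_scalar 16 (RAdd (scalar 16) (RDiv (scalar 14) (block_size q))))"
  let ?body = "Seq (Sample 4) (Seq (dot 14 4 4) (Seq (dot 15 3 4) ?tail))"
  \<comment> \<open>The three moment matrices are accumulated in the same loop and differ only in
    the weight of a sample.\<close>
  define x :: "nat \<Rightarrow> nat \<Rightarrow> real" where
    "x a t = (if a = 5 then 1 else if a = 6 then ip n (Y t) (Y t) else (ip n u (Y t))\<^sup>2)" for a t
  define I where "I p s \<longleftrightarrow> (\<forall>a\<in>{5, 6, 7}. \<forall>i<n. \<forall>j<n. reals s a (i * n + j) = (\<Sum>t<p. x a t * (Y t i * Y t j) / real m)) \<and>
    reals s 16 0 = (\<Sum>t<p. ip n (Y t) (Y t) / real m) \<and> samples s = samples s0 + p" for p :: nat and s :: state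
  have z: "Wp (for_2 ?zero) (\<lambda>s. (\<forall>a\<in>{5, 6, 7}. \<forall>i<n. \<forall>j<n. reals s a (i * n + j) = 0) \<and> frame (for_2 ?zero) s0 s) s0"
    by (rule wp_for_2_entries) (use n in \<open>auto simp: wp_basic wp_Seq\<close>)
  have loop: "Wp (for_r 9 (block_size q) ?body) (\<lambda>s. I m s \<and> frame (for_r 9 (block_size q) ?body) s1 s) s1"
    if s1: "I 0 s1" "frame (moments q) s0 s1" for s1
  proof (rule wp_for_r)
    show "I 0 s1" "m \<le> W" by (rule s1 m)+
    fix s assume fr: "frame (for_r 9 (block_size q) ?body) s1 s"
    have fr0: "frame (moments q) s0 s" using s1(2) fr by (auto simp: frame_def moments_def)
    then have s: "ints s 0 = n" "reals s 3 = u" "ints s 1 = ints s0 1" using n by (auto simp: frame_def u_def)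
    show "rval (block_size q) s = real m" using s by (simp add: block_size_def m)
    fix p assume p: "p < m" and I: "I p s"
    define r1 where "r1 = s\<lparr>reals := (reals s)(4 := (\<lambda>i. if i < n then y (samples s) i else reals s 4 i)),
       samples := samples s + 1\<rparr>"
    have r1: "\<And>i. i < n \<Longrightarrow> reals r1 4 i = Y p i" using I by (simp add: r1_def I_def Y_def)
    have tail: "Wp ?tail (I (Suc p)) r"
      if r: "frame (Seq (dot 14 4 4) (dot 15 3 4)) r1 r" "reals r 14 0 = ip n (Y p) (Y p)"
        "reals r 15 0 = ip n u (Y p)" for r
    proof -
      have r': "ints r 0 = n" "ints r 1 = ints s0 1" "\<And>i. i < n \<Longrightarrow> reals r 4 i = Y p i"
        "reals r 5 = reals s 5" "reals r 6 = reals s 6" "reals r 7 = reals s 7" "reals r 16 = reals s 16"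
        "samples r = samples s + 1"
        using r(1) s r1 by (auto simp: frame_def) (auto simp: r1_def)
      have "Wp (for_2 ?acc) (\<lambda>t. (\<forall>a\<in>{5, 6, 7}. \<forall>i<n. \<forall>j<n. reals t a (i * n + j) =
          reals r a (i * n + j) + x a p * (Y p i * Y p j) / real m) \<and> frame (for_2 ?acc) r t) r"
      proof (rule wp_for_2_entries)
        fix i j t
        assume *: "i < n" "j < n" "ints t 3 = i" "ints t 5 = j" "ints t 4 = i * n" "ints t 6 = j * n"
          "frame (for_2 ?acc) r t" "\<And>a. a \<in> {5, 6, 7} \<Longrightarrow> reals t a (i * n + j) = reals r a (i * n + j)"
        have "ints t 1 = ints s0 1" "reals t 4 i = Y p i" "reals t 4 j = Y p j" "reals t 14 0 = ip n (Y p) (Y p)"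
          "reals t 15 0 = ip n u (Y p)" using *(1,2,7) r' r(2,3) by (auto simp: frame_def)
        then show "Wp ?acc (\<lambda>s'. \<forall>a\<in>{5, 6, 7}. reals s' a = (reals t a)(i * n + j :=
            reals r a (i * n + j) + x a p * (Y p i * Y p j) / real m)) t"
          using * by (auto simp: wp_basic wp_Seq x_def block_size_def m power2_eq_square)
      qed (use r' in auto)
      then show ?thesis
      proof (rule wp_SeqI, goal_cases)
        case (1 t)
        have eq: "reals t 14 0 = ip n (Y p) (Y p)" "reals t 16 0 = reals s 16 0" "ints t 1 = ints s0 1"
          "samples t = samples s + 1"
          using 1(1) r' r(2) by (auto simp: frame_def)
        have "rval (block_size q) t = real m" using eq by (simp add: block_size_def m)
        then show ?case using 1(2) eq I r' by (auto simp: wp_basic I_def)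
      qed
    qed
    have "Wp (Seq (dot 14 4 4) (Seq (dot 15 3 4) ?tail)) (I (Suc p)) r1"
    proof (rule wp_SeqI[OF wp_dot], goal_cases)
      case (4 r2)
      have r2: "ints r2 0 = n" "reals r2 3 = u" "\<And>i. i < n \<Longrightarrow> reals r2 4 i = Y p i"
        using 4(1) s r1 by (auto simp: frame_def) (auto simp: r1_def)
      show ?case
      proof (rule wp_SeqI[OF wp_dot], goal_cases)
        case (4 r3)
        show ?case
        proof (rule tail)
          show "frame (Seq (dot 14 4 4) (dot 15 3 4)) r1 r3"
            using \<open>frame (dot 14 4 4) r1 r2\<close> 4(1) by (auto simp: frame_def)
          have "reals r3 14 0 = reals r2 14 0" using 4(1) by (simp add: frame_def)
          also have "\<dots> = ip n (Y p) (Y p)" using \<open>reals r2 14 0 = _\<close> r1 by (simp cong: ip_cong)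
          finally show "reals r3 14 0 = ip n (Y p) (Y p)" .
          show "reals r3 15 0 = ip n u (Y p)" using 4(2) r2 by (simp cong: ip_cong)
        qed
      qed (use r2 in auto)
    qed (use s in \<open>auto simp: r1_def\<close>)
    then show "Wp ?body (I (Suc p)) s" unfolding wp_Seq[of _ _ _ _ "Sample 4"] wp_basic r1_def[symmetric] .
  qed (auto simp: I_def)
  show ?thesis unfolding moments_def
  proof (rule wp_SeqI[OF z], goal_cases)
    case (1 s1)
    define s2 where "s2 = s1\<lparr>reals := (reals s1)(16 := (reals s1 16)(0 := 0))\<rparr>"
    have fr: "frame (moments q) s0 s2" using 1 by (auto simp: s2_def frame_def)
    have "samples s2 = samples s0" using 1 by (simp add: s2_def frame_def)
    then have "I 0 s2" using 1 by (auto simp: I_def s2_def)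
    from loop[OF this fr] have "Wp (for_r 9 (block_size q) ?body) (\<lambda>s. (\<forall>i<n. \<forall>j<n. arr n s 5 i j = est_cov m Y i j \<and>
      arr n s 6 i j = weighted m Y (\<lambda>t. ip n (Y t) (Y t)) i j \<and>
      arr n s 7 i j = weighted m Y (\<lambda>t. (ip n u (Y t))\<^sup>2) i j) \<and>
      reals s 16 0 = est_trace n m Y \<and> samples s = samples s0 + m) s2"
      by (rule wp_mono) (auto simp: I_def arr_def est_cov_def weighted_def est_trace_def x_def)
    then show ?case unfolding wp_Seq wp_basic s2_def by simp
  qed
qed

lemma wp_cumulants:
  assumes n: "ints s0 0 = n" and "\<And>i j. i < n \<Longrightarrow> j < n \<Longrightarrow> arr n s0 5 i j = C i j"
    and "\<And>i j. i < n \<Longrightarrow> j < n \<Longrightarrow> arr n s0 6 i j = X i j"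
    and "\<And>i j. i < n \<Longrightarrow> j < n \<Longrightarrow> arr n s0 7 i j = X' i j"
    and "reals s0 16 0 = v" "reals s0 3 = u"
  shows "Wp cumulants (\<lambda>s. \<forall>i<n. \<forall>j<n.
      arr n s 8 i j = (X i j - v * C i j - 2 * (\<Sum>l<n. C i l * C j l)) / (-2) \<and>
      arr n s 9 i j = (X' i j - ip n u (mv n C u) * C i j - 2 * (mv n C u i * mv n C u j)) / (-2)) s0"
proof -
  let ?c = "Seq (rows_product 5)
      (Seq (set_entry 8 (RDiv (RSub (RSub (entry 6) (RMul (scalar 16) (entry 5)))
          (RMul (RConst 2) (scalar 18))) (RConst (-2))))
        (set_entry 9 (RDiv (RSub (RSub (entry 7) (RMul (scalar 17) (entry 5)))
          (RMul (RConst 2) (RMul (RGet 13 (IVar 3)) (RGet 13 (IVar 5))))) (RConst (-2)))))"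
  let ?F = "\<lambda>a i j. if a = (8 :: nat) then (X i j - v * C i j - 2 * (\<Sum>l<n. C i l * C j l)) / (-2)
      else (X' i j - ip n u (mv n C u) * C i j - 2 * (mv n C u i * mv n C u j)) / (-2)"
  have loop: "Wp (for_2 ?c) (\<lambda>s. (\<forall>a\<in>{8, 9}. \<forall>i<n. \<forall>j<n. reals s a (i * n + j) = ?F a i j) \<and> frame (for_2 ?c) s1 s) s1"
    if fr: "frame cumulants s0 s1" and s1: "\<And>i. i < n \<Longrightarrow> reals s1 13 i = mv n C u i"
      "reals s1 17 0 = ip n u (mv n C u)" for s1
  proof (rule wp_for_2_entries)
    fix i j s
    assume *: "i < n" "j < n" "ints s 3 = i" "ints s 5 = j" "ints s 4 = i * n" "ints s 6 = j * n" "frame (for_2 ?c) s1 s"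
      "\<And>a. a \<in> {8, 9} \<Longrightarrow> reals s a (i * n + j) = reals s1 a (i * n + j)"
    have s0: "ints s 0 = n" "reals s 5 = reals s0 5" "reals s 6 = reals s0 6" "reals s 7 = reals s0 7"
      "reals s 16 = reals s0 16" "reals s 13 = reals s1 13" "reals s 17 = reals s1 17"
      using *(7) fr n by (auto simp: frame_def)
    have "Wp (rows_product 5) (\<lambda>s'. reals s' 18 0 = (\<Sum>l<n. arr n s 5 i l * arr n s 5 j l)) s"
      by (rule wp_rows_product) (use * s0 in auto)
    then show "Wp ?c (\<lambda>s'. \<forall>a\<in>{8, 9}. reals s' a = (reals s a)(i * n + j := ?F a i j)) s"
    proof (rule wp_SeqI, goal_cases)
      case (1 r)
      have sm: "(\<Sum>l<n. arr n s 5 i l * arr n s 5 j l) = (\<Sum>l<n. C i l * C j l)"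
        using assms(2) * s0 by (intro sum.cong) (auto simp: arr_def)
      have e: "reals r 5 (i * n + j) = C i j" "reals r 6 (i * n + j) = X i j" "reals r 7 (i * n + j) = X' i j"
        "reals r 16 0 = v" "reals r 13 i = mv n C u i" "reals r 13 j = mv n C u j"
        "reals r 17 0 = ip n u (mv n C u)" "ints r 4 = i * n" "ints r 5 = j" "ints r 3 = i"
        "reals r 8 = reals s 8" "reals r 9 = reals s 9"
        using 1(1) s0 assms * s1 by (auto simp: frame_def arr_def)
      show ?case using 1(2) e unfolding sm by (auto simp: wp_basic wp_Seq)
    qed
  qed (use fr n in \<open>auto simp: frame_def\<close>)
  show ?thesis unfolding cumulants_def
  proof (rule wp_SeqI[OF wp_mat_vec[where \<alpha> = 0 and \<beta> = 1]], goal_cases)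
    case (6 s1)
    have s1: "ints s1 0 = n" "reals s1 3 = u" using 6(1) n assms(6) by (auto simp: frame_def)
    have m: "reals s1 13 i = mv n C u i" if "i < n" for i
      using 6(2) that assms(2,6) by (auto intro!: mv_cong)
    show ?case
    proof (rule wp_SeqI[OF wp_dot], goal_cases)
      case (4 s2)
      show ?case
      proof (rule wp_mono[OF loop], goal_cases)
        case 1
        then show ?case using 4(1) \<open>frame (mat_vec _ _ _ _ _) _ _\<close> by (auto simp: frame_def)
      next
        case (2 i)
        then show ?case using 4(1) m by (simp add: frame_def)
      next
        case 3
        then show ?case using 4(2) s1 m by (simp cong: ip_cong)
      next
        case (4 s3)
        then show ?case by (auto simp: arr_def)
      qed
    qed (use s1 in auto)
  qed (use n in auto)
qed

lemma wp_check:
  assumes n: "ints s0 0 = n" "1 \<le> n" and "Wn = ints s0 1 ^ q" "Wn ^ 20 \<le> W"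
    and M: "\<And>i j. i < n \<Longrightarrow> j < n \<Longrightarrow> arr n s0 8 i j = M i j"
  shows "Wp (check q) (\<lambda>s. ints s 2 = 0 \<longleftrightarrow> reals s0 16 0 < real Wn \<and> 1 \<le> reals s0 0 0 * real Wn \<and>
      (\<forall>k<n. \<not> accepted n M (real Wn ^ 8) (Wn ^ 20) k)) s0"
proof -
  let ?body = "Seq (run_filter q 8 20) (If small Skip (IAssign 2 (IConst 1)))"
  let ?ok = "reals s0 16 0 < real Wn \<and> 1 \<le> reals s0 0 0 * real Wn"
  have loop: "Wp (for_n 7 ?body) (\<lambda>s. (ints s 2 = 0 \<longleftrightarrow> ?ok \<and> (\<forall>k<n. \<not> accepted n M (real Wn ^ 8) (Wn ^ 20) k)) \<and>
      frame (for_n 7 ?body) s1 s) s1"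
    if s1: "ints s1 2 = 0 \<longleftrightarrow> ?ok" "frame (check q) s0 s1" for s1
  proof (rule wp_for_n[where I = "\<lambda>p s. ints s 2 = 0 \<longleftrightarrow> ?ok \<and> (\<forall>k<p. \<not> accepted n M (real Wn ^ 8) (Wn ^ 20) k)"])
    show "ints s1 2 = 0 \<longleftrightarrow> ?ok \<and> (\<forall>k<0. \<not> accepted n M (real Wn ^ 8) (Wn ^ 20) k)" using s1 by simp
    fix p s
    assume p: "p < n" and I: "ints s 2 = 0 \<longleftrightarrow> ?ok \<and> (\<forall>k<p. \<not> accepted n M (real Wn ^ 8) (Wn ^ 20) k)"
      and s: "ints s 7 = p" "frame (for_n 7 ?body) s1 s"
    have s': "ints s 0 = n" "ints s 1 ^ q = Wn" "arr n s 8 = arr n s0 8"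
      using s(2) s1(2) assms by (auto simp: frame_def arr_def)
    let ?w = "probe n (arr n s 8) (real (ints s 1 ^ q) ^ 8) ((ints s 1 ^ q) ^ 20) (ints s 7)"
    have "Wp (run_filter q 8 20) (\<lambda>r. (\<forall>i<n. reals r 11 i = ?w i) \<and> reals r 14 0 = ip n ?w ?w) s"
      by (rule wp_run_filter) (use s s' p assms in auto)
    then show "Wp ?body (\<lambda>s. ints s 2 = 0 \<longleftrightarrow> ?ok \<and> (\<forall>k<Suc p. \<not> accepted n M (real Wn ^ 8) (Wn ^ 20) k)) s"
    proof (rule wp_SeqI, goal_cases)
      case (1 r)
      have r: "ints r 0 = n" "ints r 2 = ints s 2" using 1(1) s' by (auto simp: frame_def)
      have "accepted n M (real Wn ^ 8) (Wn ^ 20) p \<longleftrightarrow> accepted n (arr n s 8) (real Wn ^ 8) (Wn ^ 20) p"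
        by (rule accepted_cong) (simp add: s' M)
      also have "\<dots> \<longleftrightarrow> \<not> tval small r"
      proof -
        have "?w = probe n (arr n s 8) (real Wn ^ 8) (Wn ^ 20) p" by (simp only: s(1) s'(2))
        then show ?thesis using 1(2) r by (simp only: accepted_def small_def) (simp add: not_less)
      qed
      finally show ?case using I r by (auto simp: wp_basic less_Suc_eq)
    qed
  qed (use s1 n in \<open>auto simp: frame_def\<close>)
  define s1 where "s1 = s0\<lparr>ints := (ints s0)(2 := if ?ok then 0 else 1)\<rparr>"
  have "ints s1 2 = 0 \<longleftrightarrow> ?ok" "frame (check q) s0 s1" by (auto simp: s1_def frame_def)
  from loop[OF this] have 1: "Wp (for_n 7 ?body) (\<lambda>s. (ints s 2 = 0 \<longleftrightarrow> ?ok \<and>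
      (\<forall>k<n. \<not> accepted n M (real Wn ^ 8) (Wn ^ 20) k))) s1"
    by (rule wp_mono) auto
  show ?thesis
    unfolding check_def wp_Seq wp_basic
    using 1 assms(3) by (auto simp: s1_def not_less cong: if_cong)
qed

end

section \<open>Extraction of a column, scan of the grid and covariance of the noise\<close>

definition extract_column :: "nat \<Rightarrow> com" where
  "extract_column q = Seq (set_scalar 19 (scalar 24)) (Seq (mat_vec 8 11 12 (RConst 0) (RConst 1))
    (Seq (dot 14 12 12) (Seq (dot 15 12 11) (Seq (set_scalar 21 (RMul (scalar 14) (scalar 15)))
    (Seq (set_scalar 20 (RConst 0))
    (Seq (While (RLess (RMul (rpow (scalar 20) 4) (scalar 21)) (RConst 1))
        (set_scalar 20 (RAdd (scalar 20) (RDiv (RConst 1) (rpow (base q) 20)))))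
    (Seq (IAssign 4 (IConst 0))
    (Seq (for_n 3 (Seq (RAssign 1 (IAdd (IVar 4) (IVar 10)) (RMul (scalar 20) (RGet 12 (IVar 3))))
        (IAssign 4 (IAdd (IVar 4) (IVar 0)))))
      (IAssign 10 (IAdd (IVar 10) (IConst 1)))))))))))"

text \<open>Grid points within W^(-41) of the last success are skipped. This distance exceeds by far
  the window W^(-300) around an eigenvalue in which acceptance can occur, and it is below the
  separation W^(-40); so no eigenvalue is used twice and none is lost.\<close>

definition visit :: "nat \<Rightarrow> com" where
  "visit q = If (RLess (RAdd (scalar 19) (RDiv (RConst 1) (rpow (base q) 41))) (scalar 24))
    (Seq (run_filter q 10 800) (If small Skip (extract_column q))) Skip"

text \<open>W^802 steps of width W^(-800) cover the parameters below W^2, while the eigenvalues are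
  at most W. The initial value -1 of the last success keeps the grid point 0 from being
  skipped.\<close>

definition scan :: "nat \<Rightarrow> com" where
  "scan q = Seq (IAssign 10 (IConst 0)) (Seq (set_scalar 19 (RConst (-1)))
    (for_r 9 (rpow (base q) 802)
      (Seq (set_scalar 24 (RDiv (ROfInt (IVar 9)) (rpow (base q) 800)))
      (Seq (for_2 (set_entry 10 (RSub (entry 9) (RMul (scalar 24) (entry 8)))))
        (for_n 7 (visit q))))))"

text \<open>The second moments are A A^T plus the covariance of the noise, and A A^T does not notice
  a permutation or sign change of the columns.\<close>

definition finish :: com where
  "finish = for_2 (Seq (rows_product 1) (set_entry 2 (RSub (entry 5) (scalar 18))))"

lemma writes_scan [simp]:
  "wints (extract_column q) = {3, 4, 5, 10}" "wreals (extract_column q) = {1, 12, 14, 15, 19, 20, 21}" "draws (extract_column q) = False"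
  "wints (visit q) = {3, 4, 5, 8, 10}" "wreals (visit q) = {1, 11, 12, 14, 15, 19, 20, 21}" "draws (visit q) = False"
  "wints (scan q) = {3, 4, 5, 6, 7, 8, 9, 10}" "wreals (scan q) = {1, 10, 11, 12, 14, 15, 19, 20, 21, 24}"
  "draws (scan q) = False"
  by (auto simp: extract_column_def visit_def scan_def)

context machine
begin

text \<open>Reaching W^54 in steps of W^(-20) takes W^74 iterations. The invariant remembers that
  the preceding value failed, because this is the upper bound on the result.\<close>

lemma wp_fourth_root:
  assumes Wn: "ints s0 1 ^ q = Wn" "1 \<le> Wn" "Wn ^ 74 \<le> W" and Q: "reals s0 21 0 = Q" and g: "reals s0 20 0 = 0"
    and big: "\<And>g. real Wn ^ 54 \<le> g \<Longrightarrow> 1 \<le> g ^ 4 * Q"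
  defines "h \<equiv> 1 / real Wn ^ 20"
  shows "Wp (While (RLess (RMul (rpow (scalar 20) 4) (scalar 21)) (RConst 1))
        (set_scalar 20 (RAdd (scalar 20) (RDiv (RConst 1) (rpow (base q) 20)))))
    (\<lambda>s. 1 \<le> reals s 20 0 ^ 4 * Q \<and> h \<le> reals s 20 0 \<and> (reals s 20 0 - h) ^ 4 * Q < 1) s0"
proof -
  let ?g = "RLess (RMul (rpow (scalar 20) 4) (scalar 21)) (RConst 1)"
  let ?c = "set_scalar 20 (RAdd (scalar 20) (RDiv (RConst 1) (rpow (base q) 20)))"
  define I where "I i s \<longleftrightarrow> reals s 20 0 = real i * h \<and> (0 < i \<longrightarrow> (real i * h - h) ^ 4 * Q < 1) \<and> frame ?c s0 s"
    for i :: nat and s :: state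
  have h: "0 < h" using Wn(2) by (simp add: h_def)
  have "Wp (While ?g ?c) (\<lambda>s. (\<exists>i\<le>Wn ^ 74. I i s) \<and> \<not> tval ?g s) s0"
  proof (rule wp_While_bounded)
    show "I 0 s0" using g by (simp add: I_def frame_refl)
    fix i s assume I: "I i s" and t: "tval ?g s"
    have s: "reals s 21 0 = Q" "ints s 1 ^ q = Wn" using I Q Wn by (auto simp: I_def frame_def)
    have lt: "(real i * h) ^ 4 * Q < 1" using t I s by (simp add: I_def)
    then have "real i * h < real Wn ^ 54" using big[of "real i * h"] by linarith
    then have "real i < real Wn ^ 54 * real Wn ^ 20" using Wn(2) by (simp add: h_def pos_divide_less_eq)
    then have "real i < real (Wn ^ 74)" by (simp flip: power_add)
    then have "i < Wn ^ 74" by (simp only: of_nat_less_iff)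
    moreover have "reals s 20 0 + 1 / real Wn ^ 20 = real (Suc i) * h" using I by (simp add: I_def h_def algebra_simps add_divide_distrib)
    moreover have "frame ?c s0 (s\<lparr>reals := (reals s)(20 := (reals s 20)(0 := x))\<rparr>)" for x
      using I by (auto simp: I_def frame_def)
    moreover have "rval (RDiv (RConst 1) (rpow (base q) 20)) s = 1 / real Wn ^ 20" using s by (simp flip: of_nat_power)
    ultimately show "i < Wn ^ 74 \<and> Wp ?c (I (Suc i)) s"
      using lt by (simp add: wp_basic I_def algebra_simps)
  qed (use Wn in auto)
  then show ?thesis
  proof (rule wp_mono, elim conjE exE)
    fix s i assume I: "I i s" and t: "\<not> tval ?g s"
    have s: "reals s 21 0 = Q" using I Q by (auto simp: I_def frame_def)
    have ge: "1 \<le> reals s 20 0 ^ 4 * Q" using t s by (simp add: not_less)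
    \<comment> \<open>The start value 0 fails the test, so a preceding value exists.\<close>
    then have "i \<noteq> 0" using I by (cases "i = 0") (auto simp: I_def)
    then have "1 * h \<le> real i * h" using h by (intro mult_right_mono) auto
    then show "1 \<le> reals s 20 0 ^ 4 * Q \<and> h \<le> reals s 20 0 \<and> (reals s 20 0 - h) ^ 4 * Q < 1"
      using ge I \<open>i \<noteq> 0\<close> by (simp add: I_def)
  qed
qed

lemma wp_write_column:
  assumes n: "ints s0 0 = n" "1 \<le> n" "ints s0 4 = 0"
  shows "Wp (for_n 3 (Seq (RAssign 1 (IAdd (IVar 4) (IVar 10)) (RMul (scalar 20) (RGet 12 (IVar 3))))
        (IAssign 4 (IAdd (IVar 4) (IVar 0)))))
    (\<lambda>s. (\<forall>r<n. reals s 1 (r * n + ints s0 10) = reals s0 20 0 * reals s0 12 r) \<and>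
      (\<forall>j. (\<forall>r<n. j \<noteq> r * n + ints s0 10) \<longrightarrow> reals s 1 j = reals s0 1 j)) s0"
proof -
  let ?c = "Seq (RAssign 1 (IAdd (IVar 4) (IVar 10)) (RMul (scalar 20) (RGet 12 (IVar 3)))) (IAssign 4 (IAdd (IVar 4) (IVar 0)))"
  define I where "I p s \<longleftrightarrow> (\<forall>r<p. reals s 1 (r * n + ints s0 10) = reals s0 20 0 * reals s0 12 r) \<and>
      (\<forall>j. (\<forall>r<p. j \<noteq> r * n + ints s0 10) \<longrightarrow> reals s 1 j = reals s0 1 j) \<and> ints s 4 = p * n"
    for p :: nat and s :: state
  have "Wp (for_n 3 ?c) (\<lambda>s. I n s \<and> frame (for_n 3 ?c) s0 s) s0"
  proof (rule wp_for_n)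
    fix i s assume *: "i < n" "I i s" "ints s 3 = i" "frame (for_n 3 ?c) s0 s"
    have s: "ints s 0 = n" "ints s 10 = ints s0 10" "reals s 20 = reals s0 20" "reals s 12 = reals s0 12"
      using *(4) n by (auto simp: frame_def)
    have "r * n + c \<noteq> i * n + c" if "r < i" for r c using that n(2) by auto
    then show "Wp ?c (I (Suc i)) s"
      using * s by (auto simp: wp_Seq wp_basic I_def less_Suc_eq)
  qed (use n in \<open>auto simp: I_def\<close>)
  then show ?thesis by (rule wp_mono) (auto simp: I_def)
qed

lemma wp_extract_column:
  assumes n: "ints s0 0 = n" "1 \<le> n" and Wn: "ints s0 1 ^ q = Wn" "1 \<le> Wn" "Wn ^ 74 \<le> W"
    and M: "\<And>i j. i < n \<Longrightarrow> j < n \<Longrightarrow> arr n s0 8 i j = M i j" and p: "\<And>i. i < n \<Longrightarrow> reals s0 11 i = p i"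
    and big: "\<And>g. real Wn ^ 54 \<le> g \<Longrightarrow> 1 \<le> g ^ 4 * (ip n v v * ip n v p)" and v: "v = mv n M p"
  defines "Q \<equiv> ip n v v * ip n v p" and "h \<equiv> 1 / real Wn ^ 20"
  shows "Wp (extract_column q) (\<lambda>s. (\<exists>g. 1 \<le> g ^ 4 * Q \<and> h \<le> g \<and> (g - h) ^ 4 * Q < 1 \<and>
      (\<forall>r<n. reals s 1 (r * n + ints s0 10) = g * v r)) \<and>
      (\<forall>j. (\<forall>r<n. j \<noteq> r * n + ints s0 10) \<longrightarrow> reals s 1 j = reals s0 1 j) \<and>
      ints s 10 = Suc (ints s0 10) \<and> reals s 19 0 = reals s0 24 0) s0"
    (is "Wp _ ?Post s0")
proof -
  let ?loop = "While (RLess (RMul (rpow (scalar 20) 4) (scalar 21)) (RConst 1))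
        (set_scalar 20 (RAdd (scalar 20) (RDiv (RConst 1) (rpow (base q) 20))))"
  let ?col = "for_n 3 (Seq (RAssign 1 (IAdd (IVar 4) (IVar 10)) (RMul (scalar 20) (RGet 12 (IVar 3))))
        (IAssign 4 (IAdd (IVar 4) (IVar 0))))"
  let ?end = "Seq (IAssign 4 (IConst 0)) (Seq ?col (IAssign 10 (IAdd (IVar 10) (IConst 1))))"
  define s1 where "s1 = s0\<lparr>reals := (reals s0)(19 := (reals s0 19)(0 := reals s0 24 0))\<rparr>"
  have fin: "Wp ?end ?Post t"
    if t: "ints t 0 = n" "ints t 10 = ints s0 10" "reals t 1 = reals s0 1" "reals t 19 0 = reals s0 24 0"
      "\<And>r. r < n \<Longrightarrow> reals t 12 r = v r"
      "1 \<le> reals t 20 0 ^ 4 * Q \<and> h \<le> reals t 20 0 \<and> (reals t 20 0 - h) ^ 4 * Q < 1" for t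
  proof -
    define t' where "t' = t\<lparr>ints := (ints t)(4 := 0)\<rparr>"
    have "Wp (Seq ?col (IAssign 10 (IAdd (IVar 10) (IConst 1)))) ?Post t'"
    proof (rule wp_SeqI[OF wp_write_column], goal_cases)
      case (4 r)
      have r: "ints r 10 = ints s0 10" "reals r 19 = reals t 19" "reals t' 20 0 = reals t 20 0"
        "reals t' 12 = reals t 12" "ints t' 10 = ints s0 10" "reals t' 1 = reals s0 1"
        using 4(1) t by (auto simp: frame_def t'_def)
      show ?case using 4(2) t r by (auto simp: wp_basic intro!: exI[of _ "reals t 20 0"])
    qed (use t n in \<open>auto simp: t'_def\<close>)
    then show ?thesis unfolding wp_Seq[of _ _ _ _ "IAssign 4 (IConst 0)"] wp_basic t'_def by simp
  qed
  have "Wp (Seq (mat_vec 8 11 12 (RConst 0) (RConst 1))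
    (Seq (dot 14 12 12) (Seq (dot 15 12 11) (Seq (set_scalar 21 (RMul (scalar 14) (scalar 15)))
    (Seq (set_scalar 20 (RConst 0)) (Seq ?loop ?end)))))) ?Post s1"
  proof (rule wp_SeqI[OF wp_mat_vec[where \<alpha> = 0 and \<beta> = 1]], goal_cases)
    case (6 s2)
    have s2: "ints s2 0 = n" "ints s2 1 = ints s0 1" "ints s2 10 = ints s0 10" "reals s2 1 = reals s0 1"
      "reals s2 19 0 = reals s0 24 0" "reals s2 11 = reals s0 11"
      using 6(1) n by (auto simp: frame_def s1_def)
    have v2: "reals s2 12 i = v i" if "i < n" for i
      using 6(2) that M p v by (auto simp: s1_def arr_def intro!: mv_cong)
    show ?case
    proof (rule wp_SeqI[OF wp_dot], goal_cases)
      case (4 s3)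
      have s3: "ints s3 0 = n" "ints s3 1 = ints s0 1" "ints s3 10 = ints s0 10" "reals s3 1 = reals s0 1"
        "reals s3 19 0 = reals s0 24 0" "reals s3 11 = reals s0 11" "reals s3 12 = reals s2 12"
        using 4(1) s2 by (auto simp: frame_def)
      have d3: "reals s3 14 0 = ip n v v" using 4(2) v2 by (simp cong: ip_cong)
      show ?case
      proof (rule wp_SeqI[OF wp_dot], goal_cases)
        case (4 s4)
        have s4: "ints s4 0 = n" "ints s4 1 = ints s0 1" "ints s4 10 = ints s0 10" "reals s4 1 = reals s0 1"
          "reals s4 19 0 = reals s0 24 0" "reals s4 12 = reals s2 12" "reals s4 14 0 = ip n v v"
          using 4(1) s3 d3 by (auto simp: frame_def)
        have d4: "reals s4 15 0 = ip n v p" using 4(2) v2 s3 p by (simp cong: ip_cong)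
        define s5 where "s5 = s4\<lparr>reals := (reals s4)(21 := (reals s4 21)(0 := Q), 20 := (reals s4 20)(0 := 0))\<rparr>"
        have "Wp (Seq ?loop ?end) ?Post s5"
        proof (rule wp_SeqI[OF wp_fourth_root[where Q = Q and Wn = Wn]], goal_cases)
          case (7 s6)
          show ?case by (rule fin) (use 7 s4 v2 in \<open>auto simp: frame_def s5_def h_def\<close>)
        qed (use s4 Wn big in \<open>auto simp: s5_def Q_def\<close>)
        then show ?case unfolding wp_Seq[of _ _ _ _ "set_scalar _ _"] wp_basic
          using s4 d4 by (simp add: s5_def Q_def)
      qed (use s3 in auto)
    qed (use s2 in auto)
  qed (use n in \<open>auto simp: s1_def\<close>)
  then show ?thesis unfolding extract_column_def wp_Seq[of _ _ _ _ "set_scalar 19 _"] wp_basic s1_def by simp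
qed

lemma wp_finish:
  assumes n: "ints s0 0 = n"
  shows "Wp finish (\<lambda>s. \<forall>i<n. \<forall>j<n. arr n s 2 i j = arr n s0 5 i j - (\<Sum>l<n. arr n s0 1 i l * arr n s0 1 j l)) s0"
proof -
  let ?c = "Seq (rows_product 1) (set_entry 2 (RSub (entry 5) (scalar 18)))"
  have "Wp (for_2 ?c) (\<lambda>s. (\<forall>a\<in>{2}. \<forall>i<n. \<forall>j<n. reals s a (i * n + j) =
      arr n s0 5 i j - (\<Sum>l<n. arr n s0 1 i l * arr n s0 1 j l)) \<and> frame (for_2 ?c) s0 s) s0"
  proof (rule wp_for_2_entries)
    fix i j s
    assume *: "i < n" "j < n" "ints s 3 = i" "ints s 5 = j" "ints s 4 = i * n" "ints s 6 = j * n" "frame (for_2 ?c) s0 s"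
    have s: "ints s 0 = n" "reals s 5 = reals s0 5" "reals s 1 = reals s0 1" using *(7) n by (auto simp: frame_def)
    have "Wp (rows_product 1) (\<lambda>s'. reals s' 18 0 = (\<Sum>l<n. arr n s 1 i l * arr n s 1 j l)) s"
      by (rule wp_rows_product) (use * s in auto)
    then show "Wp ?c (\<lambda>s'. \<forall>a\<in>{2}. reals s' a = (reals s a)(i * n + j :=
        arr n s0 5 i j - (\<Sum>l<n. arr n s0 1 i l * arr n s0 1 j l))) s"
    proof (rule wp_SeqI, goal_cases)
      case (1 r)
      then show ?case using s * by (auto simp: wp_basic frame_def arr_def)
    qed
  qed (use n in auto)
  then show ?thesis unfolding finish_def by (rule wp_mono) (auto simp: arr_def)
qed

end

section \<open>Invariants of the scan\<close>

locale ica_run = ica W n A B Wn Mh u Hh + machine n y b Wb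
  for W n A B Wn Mh u Hh y b Wb +
  fixes q L :: nat
  assumes WL: "Wn = L ^ q" and big: "Wn ^ 1700 \<le> Wb"
begin

lemma Wn16: "16 \<le> Wn" "1 \<le> Wn"
  using W16 Wn by simp_all

lemma Wn_power_le: "k \<le> 1700 \<Longrightarrow> Wn ^ k \<le> Wb"
  using power_increasing[of k 1700 Wn] Wn16 big by linarith

lemma P_Wn: "real Wn ^ k = P (int k)" "1 / real Wn ^ k = P (- int k)"
  using P_nat[of k] P_neg_nat[of k] Wn by simp_all

definition good :: "state \<Rightarrow> nat \<Rightarrow> nat \<Rightarrow> bool" where
  "good s c i \<longleftrightarrow> (\<exists>\<sigma>. (\<sigma> = 1 \<or> \<sigma> = - 1) \<and> (\<forall>r<n. \<bar>arr n s 1 r c - \<sigma> * A r i\<bar> \<le> P (-14)))"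

text \<open>The columns found so far belong to distinct eigenvalues \<open>lam (\<phi> c)\<close>, because the values \<open>l c\<close> of the
  parameter at which they were found are increasing with gaps larger than \<open>P (-41)\<close>.\<close>

definition found :: "(nat \<Rightarrow> nat) \<Rightarrow> (nat \<Rightarrow> real) \<Rightarrow> state \<Rightarrow> bool" where
  "found \<phi> l s \<longleftrightarrow> (\<forall>c<ints s 10. \<phi> c < n \<and> \<bar>lam (\<phi> c) - l c\<bar> \<le> P (-300) \<and> good s c (\<phi> c)) \<and>
    (\<forall>c c'. c < c' \<longrightarrow> c' < ints s 10 \<longrightarrow> l c + P (-41) < l c') \<and>
    reals s 19 0 = (if ints s 10 = 0 then -1 else l (ints s 10 - 1))"

lemma found_cong:
  "ints s 10 = ints s' 10 \<Longrightarrow> reals s 1 = reals s' 1 \<Longrightarrow> reals s 19 = reals s' 19 \<Longrightarrow> found \<phi> l s \<longleftrightarrow> found \<phi> l s'"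
  by (simp add: found_def good_def arr_def)

text \<open>One eigenvalue can only account for parameters within 2 W^(-300) of each other, but
  successes are more than W^(-41) apart.\<close>

lemma found_inj:
  assumes "found \<phi> l s"
  shows "inj_on \<phi> {..<ints s 10}"
proof -
  have "\<phi> c \<noteq> \<phi> c'" if "c < c'" "c' < ints s 10" for c c'
  proof
    assume "\<phi> c = \<phi> c'"
    moreover have "\<bar>lam (\<phi> c) - l c\<bar> \<le> P (-300)" "\<bar>lam (\<phi> c') - l c'\<bar> \<le> P (-300)" "l c + P (-41) < l c'"
      using assms that by (auto simp: found_def)
    moreover have "2 * P (-300) \<le> P (-41)" using P_absorb[of 2 "-300"] P_mono[of "-299" "-41"] by simp
    ultimately show False by simp
  qed
  then show ?thesis by (auto simp: inj_on_def) (metis linorder_neqE_nat)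
qed

lemma found_le:
  assumes "found \<phi> l s"
  shows "ints s 10 \<le> n"
proof -
  have "\<phi> ` {..<ints s 10} \<subseteq> {..<n}" using assms by (auto simp: found_def)
  then have "card {..<ints s 10} \<le> card {..<n}" using found_inj[OF assms] by (metis card_inj_on_le finite_lessThan)
  then show ?thesis by simp
qed

text \<open>Skipping loses nothing: an eigenvalue near a skipped parameter is closer than W^(-40) to
  the eigenvalue of the last column, hence it is the same one.\<close>

lemma found_near:
  assumes "found \<phi> l s" and last: "reals s 19 0 \<le> t" "t \<le> reals s 19 0 + P (-41)" "0 \<le> t"
    and i: "i < n" and t: "\<bar>lam i - t\<bar> \<le> P (-300)"
  shows "i \<in> \<phi> ` {..<ints s 10}"
proof -
  \<comment> \<open>Before the first success the reference value is -1, and no nonnegative parameter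
    is within W^(-41) of it.\<close>
  have "ints s 10 \<noteq> 0"
  proof
    assume "ints s 10 = 0"
    then have "t \<le> -1 + P (-41)" using assms(1) last by (simp add: found_def)
    moreover have "P (-41) \<le> 1 / 16" using P_absorb[of 16 "-41"] P_le_1[of "-40"] by simp
    ultimately show False using last by linarith
  qed
  define c where "c = ints s 10 - 1"
  then have c: "c < ints s 10" "reals s 19 0 = l c" "\<phi> c < n" "\<bar>lam (\<phi> c) - l c\<bar> \<le> P (-300)"
    using assms(1) \<open>ints s 10 \<noteq> 0\<close> by (auto simp: found_def)
  have "\<bar>lam i - lam (\<phi> c)\<bar> \<le> P (-300) + P (-41) + P (-300)" using t c last by linarith
  also have "\<dots> < 4 * P (-41)" using P_mono[of "-300" "-41"] P_pos[of "-41"] by linarith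
  also have "\<dots> \<le> P (-40)" using P_absorb[of 4 "-41"] by simp
  finally have "i = \<phi> c" using separation[OF i c(3)] by (cases "i = \<phi> c") auto
  then show ?thesis using c(1) by auto
qed

lemma found_extend:
  assumes fd: "found \<phi> l s" and lt: "reals s 19 0 + P (-41) < t"
    and t: "\<bar>lam i - t\<bar> \<le> P (-300)" and i: "i < n"
    and s': "ints s' 10 = Suc (ints s 10)" "reals s' 19 0 = t"
      "\<And>j. (\<forall>r<n. j \<noteq> r * n + ints s 10) \<Longrightarrow> reals s' 1 j = reals s 1 j"
      "good s' (ints s 10) i"
  shows "found (\<phi>(ints s 10 := i)) (l(ints s 10 := t)) s'"
proof -
  let ?m = "ints s 10"
  have step: "l c + P (-41) < t" if "c < ?m" for c
  proof (cases "c = ?m - 1")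
    case True
    then show ?thesis using fd lt that by (simp add: found_def)
  next
    case False
    then have "l c + P (-41) < l (?m - 1)" using fd that by (auto simp: found_def)
    moreover have "l (?m - 1) + P (-41) < t" using fd lt that by (simp add: found_def)
    ultimately show ?thesis using P_pos[of "-41"] by linarith
  qed
  have "fd1": "\<phi> c < n \<and> \<bar>lam (\<phi> c) - l c\<bar> \<le> P (-300) \<and> good s c (\<phi> c)" if "c < ?m" for c
    using fd that by (simp add: found_def)
  have "good s' c (\<phi> c)" if c: "c < ?m" for c
  proof -
    \<comment> \<open>If n columns were present already, their eigenvalues would exhaust all indices
      including i, against the gap between successes. So the new column index is below n, and
      writing it leaves the earlier columns of the row-major array intact.\<close>
    have "?m < n"
    proof (rule ccontr)
      assume "\<not> ?m < n"
      then have "?m = n" using found_le[OF fd] by simp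
      then have "\<phi> ` {..<?m} = {..<n}"
        using found_inj[OF fd] fd1 by (intro card_subset_eq) (auto simp: card_image)
      then obtain c' where c': "c' < ?m" "\<phi> c' = i" using i by (metis imageE lessThan_iff)
      then have "\<bar>lam i - l c'\<bar> \<le> P (-300)" using fd1 by blast
      moreover have "2 * P (-300) \<le> P (-41)" using P_absorb[of 2 "-300"] P_mono[of "-299" "-41"] by simp
      ultimately show False using t step[OF c'(1)] by linarith
    qed
    then have "r * n + c \<noteq> r' * n + ?m" for r r' using c pair_index_inj[of c ?m r r'] by auto
    then have "arr n s' 1 r c = arr n s 1 r c" for r using s'(3) by (simp add: arr_def)
    then show ?thesis using fd1[OF c] by (simp add: good_def)
  qed
  then show ?thesis unfolding found_def s'(1,2)
    using fd1 i t step s'(4) fd by (auto simp: less_Suc_eq found_def)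
qed

text \<open>The last clause covers both reasons for being done with t: either t was skipped as close
  to the last success, or its acceptance has just made it the last success.\<close>

lemma wp_visit:
  assumes s0: "ints s0 0 = n" "ints s0 1 = L" "ints s0 7 = k" "k < n" "reals s0 24 0 = t" and t: "0 \<le> t" "t \<le> P 2"
    and Z: "\<And>i j. i < n \<Longrightarrow> j < n \<Longrightarrow> arr n s0 10 i j = Zh t i j"
    and M: "\<And>i j. i < n \<Longrightarrow> j < n \<Longrightarrow> arr n s0 8 i j = Mh i j"
    and fd: "found \<phi> l s0" and last: "reals s0 19 0 \<le> t"
  shows "Wp (visit q) (\<lambda>s. (\<exists>\<phi>' l'. found \<phi>' l' s \<and> \<phi> ` {..<ints s0 10} \<subseteq> \<phi>' ` {..<ints s 10}) \<and>
    reals s0 19 0 \<le> reals s 19 0 \<and> reals s 19 0 \<le> t \<and>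
    (accepted n (Zh t) (P 8) (Wn ^ 800) k \<longrightarrow> t \<le> reals s 19 0 + P (-41))) s0" (is "Wp _ ?Post s0")
proof (cases "reals s0 19 0 + P (-41) < t")
  case False
  then have "\<not> tval (RLess (RAdd (scalar 19) (RDiv (RConst 1) (rpow (base q) 41))) (scalar 24)) s0"
    using s0 WL P_Wn(2)[of 41] by (simp flip: of_nat_power)
  moreover have "?Post s0" using fd last False by auto
  ultimately show ?thesis unfolding visit_def wp_basic by simp
next
  case True
  let ?w = "probe n (Zh t) (P 8) (Wn ^ 800) k"
  have P8: "real Wn ^ 8 = P 8" using P_Wn(1)[of 8] by simp
  let ?wz = "probe n (arr n s0 10) (real (ints s0 1 ^ q) ^ 8) ((ints s0 1 ^ q) ^ 800) (ints s0 7)"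
  have pz: "?wz i = ?w i" if "i < n" for i
    unfolding s0 WL[symmetric] P8 using that Z by (intro probe_cong) auto
  have ipz: "ip n ?wz ?wz = ip n ?w ?w" by (intro ip_cong pz)
  have le: "(ints s0 1 ^ q) ^ 800 \<le> Wb" unfolding s0 WL[symmetric] by (rule Wn_power_le) simp
  have w0: "Wp (run_filter q 10 800) (\<lambda>s. (\<forall>i<n. reals s 11 i = ?wz i) \<and> reals s 14 0 = ip n ?wz ?wz) s0"
    by (rule wp_run_filter[OF s0(1) _ _ le]) (simp_all add: s0(3,4))
  have flt: "Wp (run_filter q 10 800) (\<lambda>s. (\<forall>i<n. reals s 11 i = ?w i) \<and> reals s 14 0 = ip n ?w ?w) s0"
  proof (rule wp_mono[OF w0], elim conjE, intro conjI allI impI)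
    fix s' :: state and i assume "\<forall>i<n. reals s' 11 i = ?wz i" "i < n"
    then show "reals s' 11 i = ?w i" using pz[of i] by (simp only:)
  next
    fix s' :: state assume "reals s' 14 0 = ip n ?wz ?wz"
    then show "reals s' 14 0 = ip n ?w ?w" using ipz by (rule trans)
  qed
  have "Wp (Seq (run_filter q 10 800) (If small Skip (extract_column q))) ?Post s0"
  proof (rule wp_SeqI[OF flt], goal_cases)
    case (1 r)
    have r: "ints r 0 = n" "ints r 1 = L" "ints r 10 = ints s0 10" "reals r 19 = reals s0 19" "reals r 24 0 = t"
      "reals r 1 = reals s0 1" "reals r 8 = reals s0 8"
      using 1(1) s0 by (auto simp: frame_def)
    have good_r: "good r = good s0" using r by (simp add: good_def arr_def fun_eq_iff)
    have fd_r: "found \<phi> l r" using fd r good_r by (simp add: found_def)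
    have acc: "accepted n (Zh t) (P 8) (Wn ^ 800) k \<longleftrightarrow> \<not> tval small r"
      using 1(2) r by (simp add: accepted_def small_def not_less)
    show ?case
    proof (cases "tval small r")
      case small: True
      then show ?thesis using acc fd_r last r unfolding wp_basic by auto
    next
      case False
      with acc obtain i where nk: "near_kernel t i ?w" using accepted_near_kernel[OF t s0(4)] by blast
      have i: "i < n" "\<bar>lam i - t\<bar> \<le> P (-300)" using nk by (auto simp: near_kernel_def)
      let ?v = "mv n Mh ?w"
      let ?Q = "ip n ?v ?v * ip n ?v ?w" and ?h = "1 / real Wn ^ 20"
      have "Wp (extract_column q) (\<lambda>s. (\<exists>g. 1 \<le> g ^ 4 * ?Q \<and> ?h \<le> g \<and> (g - ?h) ^ 4 * ?Q < 1 \<and>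
          (\<forall>j<n. reals s 1 (j * n + ints r 10) = g * ?v j)) \<and>
          (\<forall>j. (\<forall>i<n. j \<noteq> i * n + ints r 10) \<longrightarrow> reals s 1 j = reals r 1 j) \<and>
          ints s 10 = Suc (ints r 10) \<and> reals s 19 0 = reals r 24 0) r"
      proof (rule wp_extract_column)
        show "1 \<le> g ^ 4 * ?Q" if "real Wn ^ 54 \<le> g" for g
          using scale_search(1)[OF nk, of g] that P_Wn(1)[of 54] by simp
      qed (use r 1 n1 WL Wn16 Wn_power_le[of 74] M in \<open>auto simp: arr_def\<close>)
      then have "Wp (extract_column q) ?Post r"
      proof (rule wp_mono, elim conjE exE)
        fix s' :: state and g assume g: "1 \<le> g ^ 4 * ?Q" "?h \<le> g" "(g - ?h) ^ 4 * ?Q < 1"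
          and c: "\<forall>j<n. reals s' 1 (j * n + ints r 10) = g * ?v j"
          and o: "\<forall>j. (\<forall>i<n. j \<noteq> i * n + ints r 10) \<longrightarrow> reals s' 1 j = reals r 1 j"
          and e: "ints s' 10 = Suc (ints r 10)" "reals s' 19 0 = reals r 24 0"
        have h: "?h = P (-20)" using P_Wn(2)[of 20] by simp
        have "good s' (ints r 10) i"
          using scale_search(2)[OF nk, of g] g c unfolding h good_def arr_def by simp
        then have "found (\<phi>(ints r 10 := i)) (l(ints r 10 := t)) s'"
          by (intro found_extend[OF fd_r]) (use True r i e o in auto)
        moreover have "\<phi> ` {..<ints s0 10} \<subseteq> (\<phi>(ints r 10 := i)) ` {..<ints s' 10}"
          using e r by (auto simp: image_iff)
        ultimately show "?Post s'" using e r last by auto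
      qed
      then show ?thesis using False unfolding wp_basic by simp
    qed
  qed
  moreover have "tval (RLess (RAdd (scalar 19) (RDiv (RConst 1) (rpow (base q) 41))) (scalar 24)) s0"
    using True s0 WL P_Wn(2)[of 41] by (simp flip: of_nat_power)
  ultimately show ?thesis unfolding visit_def wp_basic by simp
qed

lemma wp_scan:
  assumes n: "ints s0 0 = n" "ints s0 1 = L"
    and MH: "\<And>i j. i < n \<Longrightarrow> j < n \<Longrightarrow> arr n s0 8 i j = Mh i j \<and> arr n s0 9 i j = Hh i j"
  shows "Wp (scan q) (\<lambda>s. \<exists>\<phi>. bij_betw \<phi> {..<n} {..<n} \<and> (\<forall>c<n. good s c (\<phi> c))) s0"
proof -
  let ?pencil = "for_2 (set_entry 10 (RSub (entry 9) (RMul (scalar 24) (entry 8))))"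
  let ?body = "Seq (set_scalar 24 (RDiv (ROfInt (IVar 9)) (rpow (base q) 800))) (Seq ?pencil (for_n 7 (visit q)))"
  define h where "h = P (-800)"
  \<comment> \<open>The shift by one: the grid point p h is responsible for the eigenvalues between
    (p - 1) h and p h, so before it is visited those up to (p - 1) h are done. At p = 0 this bound
    is negative and the claim is vacuous.\<close>
  define I where "I p s \<longleftrightarrow> (\<exists>\<phi> l. found \<phi> l s \<and> reals s 19 0 \<le> real p * h \<and>
    (\<forall>i<n. lam i \<le> (real p - 1) * h \<longrightarrow> i \<in> \<phi> ` {..<ints s 10}))" for p :: nat and s :: state
  have h0: "0 < h" by (simp add: h_def)
  define s1 where "s1 = s0\<lparr>ints := (ints s0)(10 := 0), reals := (reals s0)(19 := (reals s0 19)(0 := -1))\<rparr>"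
  have "Wp (for_r 9 (rpow (base q) 802) ?body) (\<lambda>s. I (Wn ^ 802) s \<and> frame (for_r 9 (rpow (base q) 802) ?body) s1 s) s1"
  proof (rule wp_for_r)
    have "lam i \<le> (0 - 1) * h \<Longrightarrow> i < n \<Longrightarrow> False" for i using lam_bounds(1)[of i] h0 by simp
    then show "I 0 s1" unfolding I_def by (intro exI[of _ "\<lambda>_. 0"]) (auto simp: found_def s1_def)
    show "Wn ^ 802 \<le> Wb" by (rule Wn_power_le) simp
    fix s assume fr: "frame (for_r 9 (rpow (base q) 802) ?body) s1 s"
    then have s: "ints s 0 = n" "ints s 1 = L" "reals s 8 = reals s0 8" "reals s 9 = reals s0 9"
      using n by (auto simp: frame_def s1_def)
    show "rval (rpow (base q) 802) s = real (Wn ^ 802)" using s WL by simp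
    fix p assume p: "p < Wn ^ 802" and I: "I p s" and s9: "ints s 9 = p"
    define t where "t = real p * h"
    have t0: "0 \<le> t" using h0 by (simp add: t_def)
    have "real p \<le> real (Wn ^ 802)" using p by (simp only: of_nat_le_iff)
    then have "t \<le> P 802 * P (-800)" unfolding t_def h_def using P_Wn(1)[of 802] by (intro mult_right_mono) auto
    then have t2: "t \<le> P 2" by (simp add: P_mult)
    have tv: "rval (RDiv (ROfInt (IVar 9)) (rpow (base q) 800)) s = t"
    proof -
      have hW: "h = 1 / real Wn ^ 800" using P_Wn(2)[of 800] by (simp add: h_def)
      show ?thesis using s s9 WL by (simp add: t_def hW)
    qed
    define s2 where "s2 = s\<lparr>reals := (reals s)(24 := (reals s 24)(0 := t))\<rparr>"
    have pencil: "Wp ?pencil (\<lambda>r. (\<forall>a\<in>{10}. \<forall>i<n. \<forall>j<n. reals r a (i * n + j) = Zh t i j) \<and> frame ?pencil s2 r) s2"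
    proof (rule wp_for_2_entries)
      fix i j r assume *: "i < n" "j < n" "ints r 3 = i" "ints r 5 = j" "ints r 4 = i * n" "frame ?pencil s2 r"
      have "reals r 8 = reals s0 8" "reals r 9 = reals s0 9" "reals r 24 0 = t"
        using *(6) s by (auto simp: frame_def s2_def)
      then show "Wp (set_entry 10 (RSub (entry 9) (RMul (scalar 24) (entry 8))))
          (\<lambda>s'. \<forall>a\<in>{10}. reals s' a = (reals r a)(i * n + j := Zh t i j)) r"
        using * MH[of i j] by (simp add: wp_basic arr_def Zh_def)
    qed (use s in \<open>auto simp: s2_def\<close>)
    have "Wp (Seq ?pencil (for_n 7 (visit q))) (I (Suc p)) s2"
    proof (rule wp_SeqI[OF pencil], goal_cases)
      case (1 s3)
      have s3: "ints s3 0 = n" "ints s3 1 = L" "reals s3 8 = reals s0 8" "reals s3 24 0 = t"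
        "reals s3 10 (i * n + j) = Zh t i j" if "i < n" "j < n" for i j
        using 1 s that by (auto simp: frame_def s2_def)
      have s3': "ints s3 10 = ints s 10" "reals s3 19 = reals s 19" "reals s3 1 = reals s 1"
        using 1 by (auto simp: frame_def s2_def)
      have s3n: "ints s3 0 = n" using s3(1)[of 0 0] n1 by simp
      from I obtain \<phi> l where fd: "found \<phi> l s" and last: "reals s 19 0 \<le> t"
        and cov: "\<forall>i<n. lam i \<le> (real p - 1) * h \<longrightarrow> i \<in> \<phi> ` {..<ints s 10}"
        by (auto simp: I_def t_def)
      define K where "K k r \<longleftrightarrow> (\<exists>\<phi>' l'. found \<phi>' l' r \<and> \<phi> ` {..<ints s 10} \<subseteq> \<phi>' ` {..<ints r 10}) \<and>
        reals r 19 0 \<le> t \<and> (\<forall>k'<k. accepted n (Zh t) (P 8) (Wn ^ 800) k' \<longrightarrow> t \<le> reals r 19 0 + P (-41))"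
        for k :: nat and r :: state
      have "good s3 = good s" using s3' by (simp add: good_def arr_def fun_eq_iff)
      then have fd3: "found \<phi> l s3" using fd s3' by (simp add: found_def)
      have "Wp (for_n 7 (visit q)) (\<lambda>r. K n r \<and> frame (for_n 7 (visit q)) s3 r) s3"
      proof (rule wp_for_n)
        show "K 0 s3" using fd3 last s3' by (auto simp: K_def)
        fix k r assume k: "k < n" and K: "K k r" and r7: "ints r 7 = k" and fr3: "frame (for_n 7 (visit q)) s3 r"
        from K obtain \<phi>' l' where r': "found \<phi>' l' r" "\<phi> ` {..<ints s 10} \<subseteq> \<phi>' ` {..<ints r 10}" "reals r 19 0 \<le> t"
          "\<forall>k'<k. accepted n (Zh t) (P 8) (Wn ^ 800) k' \<longrightarrow> t \<le> reals r 19 0 + P (-41)"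
          by (auto simp: K_def)
        have rr: "ints r 0 = n" "ints r 1 = L" "reals r 24 0 = t" "reals r 8 = reals s0 8" "reals r 10 = reals s3 10"
          using fr3 s3[of 0 0] n1 by (auto simp: frame_def)
        have "Wp (visit q) (\<lambda>s'. (\<exists>\<phi>'' l''. found \<phi>'' l'' s' \<and> \<phi>' ` {..<ints r 10} \<subseteq> \<phi>'' ` {..<ints s' 10}) \<and>
          reals r 19 0 \<le> reals s' 19 0 \<and> reals s' 19 0 \<le> t \<and>
          (accepted n (Zh t) (P 8) (Wn ^ 800) k \<longrightarrow> t \<le> reals s' 19 0 + P (-41))) r"
          by (rule wp_visit) (use rr r7 k t0 t2 r' s3 MH in \<open>auto simp: arr_def\<close>)
        then show "Wp (visit q) (K (Suc k)) r"
        proof (rule wp_mono)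
          fix s' assume "(\<exists>\<phi>'' l''. found \<phi>'' l'' s' \<and> \<phi>' ` {..<ints r 10} \<subseteq> \<phi>'' ` {..<ints s' 10}) \<and>
            reals r 19 0 \<le> reals s' 19 0 \<and> reals s' 19 0 \<le> t \<and>
            (accepted n (Zh t) (P 8) (Wn ^ 800) k \<longrightarrow> t \<le> reals s' 19 0 + P (-41))"
          then show "K (Suc k) s'" using r' unfolding K_def
            by (fastforce simp: less_Suc_eq)
        qed
      next
        fix k r x assume "K k r"
        moreover have "found \<phi>' l' (r\<lparr>ints := (ints r)(7 := x)\<rparr>) = found \<phi>' l' r" for \<phi>' l'
          by (rule found_cong) auto
        ultimately show "K k (r\<lparr>ints := (ints r)(7 := x)\<rparr>)" by (simp add: K_def)
      qed (use s3n in auto)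
      then show ?case
      proof (rule wp_mono, elim conjE)
        fix r assume "K n r"
        then obtain \<phi>' l' where r: "found \<phi>' l' r" "\<phi> ` {..<ints s 10} \<subseteq> \<phi>' ` {..<ints r 10}" "reals r 19 0 \<le> t"
          "\<forall>k<n. accepted n (Zh t) (P 8) (Wn ^ 800) k \<longrightarrow> t \<le> reals r 19 0 + P (-41)"
          by (auto simp: K_def)
        have "i \<in> \<phi>' ` {..<ints r 10}" if i: "i < n" "lam i \<le> (real (Suc p) - 1) * h" for i
        proof (cases "lam i \<le> (real p - 1) * h")
          case True
          then show ?thesis using cov i r by blast
        next
          case False
          then have cl: "\<bar>lam i - t\<bar> \<le> P (-800)" using i by (simp add: t_def h_def algebra_simps)
          then obtain k where "k < n" "accepted n (Zh t) (P 8) (Wn ^ 800) k"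
            using eigenvalue_accepted[OF t0 t2 i(1)] by blast
          then have "t \<le> reals r 19 0 + P (-41)" using r by blast
          moreover have "\<bar>lam i - t\<bar> \<le> P (-300)" using cl P_mono[of "-800" "-300"] by simp
          ultimately show ?thesis using found_near[OF r(1,3) _ t0 i(1)] by blast
        qed
        moreover have "t \<le> real (Suc p) * h" using h0 by (simp add: t_def)
        ultimately show "I (Suc p) r" unfolding I_def using r by (intro exI[of _ \<phi>'] exI[of _ l']) auto
      qed
    qed
    then show "Wp ?body (I (Suc p)) s" unfolding wp_Seq[of _ _ _ _ "set_scalar _ _"] wp_basic tv s2_def by simp
  next
    fix p s x assume "I p s"
    moreover have "found \<phi>' l' (s\<lparr>ints := (ints s)(9 := x)\<rparr>) = found \<phi>' l' s" for \<phi>' l'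
      by (rule found_cong) auto
    ultimately show "I p (s\<lparr>ints := (ints s)(9 := x)\<rparr>)" by (simp add: I_def)
  qed auto
  then have "Wp (for_r 9 (rpow (base q) 802) ?body) (\<lambda>s. \<exists>\<phi>. bij_betw \<phi> {..<n} {..<n} \<and> (\<forall>c<n. good s c (\<phi> c))) s1"
  proof (rule wp_mono, elim conjE)
    fix s assume "I (Wn ^ 802) s"
    then obtain \<phi> l where fd: "found \<phi> l s" and cov: "\<forall>i<n. lam i \<le> (real (Wn ^ 802) - 1) * h \<longrightarrow> i \<in> \<phi> ` {..<ints s 10}"
      by (auto simp: I_def)
    have "(real (Wn ^ 802) - 1) * h = P 2 - P (-800)"
      using P_Wn(1)[of 802] by (simp add: h_def left_diff_distrib P_mult)
    moreover have "P 1 \<le> P 2 - P (-800)" using P_absorb[of 2 1] P_mono[of "-800" 1] by simp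
    ultimately have "{..<n} \<subseteq> \<phi> ` {..<ints s 10}" using cov lam_bounds(2) by fastforce
    moreover have "\<phi> ` {..<ints s 10} \<subseteq> {..<n}" using fd by (auto simp: found_def)
    ultimately have im: "\<phi> ` {..<ints s 10} = {..<n}" by blast
    then have "ints s 10 = n" using card_image[OF found_inj[OF fd]] by simp
    then show "\<exists>\<phi>. bij_betw \<phi> {..<n} {..<n} \<and> (\<forall>c<n. good s c (\<phi> c))"
      using im found_inj[OF fd] fd by (auto simp: bij_betw_def found_def intro!: exI[of _ \<phi>])
  qed
  then show ?thesis unfolding scan_def wp_Seq[of _ _ _ _ "IAssign _ _"] wp_Seq[of _ _ _ _ "set_scalar 19 _"] wp_basic
    by (simp add: s1_def)
qed

end

section \<open>Random direction, search over scales and the whole program\<close>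

definition bits_bound :: "nat \<Rightarrow> rexp" where
  "bits_bound c = RMul (RConst 4) (rpow (ROfInt (IAdd (IVar 0) (IConst 1))) (c + 2))"

text \<open>Coins are read until the power of two in scalar 23 reaches 4 (n + 1)^(c + 2). With that
  many bits per coordinate the union bound 2 n^2 / 2^depth over signed pairs of columns is at most
  half of (n + 1)^(-c).\<close>

definition random_bits :: "nat \<Rightarrow> com" where
  "random_bits c = While (RLess (scalar 23) (bits_bound c)) (Seq (Coin 11)
    (Seq (set_scalar 22 (RAdd (RAdd (scalar 22) (scalar 22)) (ROfInt (IVar 11))))
      (set_scalar 23 (RAdd (scalar 23) (scalar 23)))))"

definition direction :: "nat \<Rightarrow> com" where
  "direction c = for_n 3 (Seq (set_scalar 22 (RConst 0)) (Seq (set_scalar 23 (RConst 1))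
    (Seq (random_bits c) (RAssign 3 (IVar 3) (RDiv (scalar 22) (scalar 23))))))"

definition one_round :: "nat \<Rightarrow> com" where
  "one_round q = Seq (IAssign 1 (IAdd (IVar 1) (IConst 1))) (Seq (moments q) (Seq cumulants (check q)))"

text \<open>\<open>one_round\<close> advances the scale before using it, so the start value n + 15
  makes n + 16 the first scale; the flag is preset to enter the loop.\<close>

definition program :: "nat \<Rightarrow> nat \<Rightarrow> com" where
  "program c q = Seq (direction c) (Seq (IAssign 1 (IAdd (IVar 0) (IConst 15))) (Seq (IAssign 2 (IConst 1))
    (Seq (While (ILess (IConst 0) (IVar 2)) (one_round q)) (Seq (scan q) finish))))"

fun bits_value :: "(nat \<Rightarrow> bool) \<Rightarrow> nat \<Rightarrow> nat \<Rightarrow> nat" where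
  "bits_value b o1 0 = 0"
| "bits_value b o1 (Suc t) = 2 * bits_value b o1 t + (if b (o1 + t) then 1 else 0)"

text \<open>The number of samples consumed before round L, so that \<open>block\<close> consists of
  the fresh samples of that round.\<close>

definition offset :: "nat \<Rightarrow> nat \<Rightarrow> nat \<Rightarrow> nat" where
  "offset q n L = (\<Sum>l\<in>{n + 16..<L}. (l ^ q) ^ 1700)"

definition block :: "nat \<Rightarrow> nat \<Rightarrow> (nat \<Rightarrow> nat \<Rightarrow> real) \<Rightarrow> nat \<Rightarrow> nat \<Rightarrow> nat \<Rightarrow> real" where
  "block q n y L t = y (offset q n L + t)"

text \<open>Only the samples enter: at which scale the program stops does not depend on the random
  direction.\<close>

definition passes :: "nat \<Rightarrow> nat \<Rightarrow> real \<Rightarrow> (nat \<Rightarrow> nat \<Rightarrow> real) \<Rightarrow> nat \<Rightarrow> bool" where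
  "passes q n \<epsilon> y L \<longleftrightarrow> est_trace n ((L ^ q) ^ 1700) (block q n y L) < real (L ^ q) \<and> 1 \<le> \<epsilon> * real (L ^ q) \<and>
    (\<forall>k<n. \<not> accepted n (est_M n ((L ^ q) ^ 1700) (block q n y L)) (real (L ^ q) ^ 8) ((L ^ q) ^ 20) k)"

lemma writes_program [simp]:
  "wints (random_bits c) = {11}" "wreals (random_bits c) = {22, 23}" "draws (random_bits c) = False"
  "wints (direction c) = {3, 11}" "wreals (direction c) = {3, 22, 23}" "draws (direction c) = False"
  by (auto simp: direction_def random_bits_def)

context machine
begin

lemma wp_random_bits:
  assumes n: "ints s0 0 = n" and s0: "reals s0 22 0 = 0" "reals s0 23 0 = 1"
    and \<beta>: "4 * (n + 1) ^ (c + 2) \<le> 2 ^ \<beta>" "\<And>t. t < \<beta> \<Longrightarrow> 2 ^ t < 4 * (n + 1) ^ (c + 2)" "\<beta> \<le> W"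
  shows "Wp (random_bits c) (\<lambda>s. reals s 22 0 = real (bits_value b (coins s0) \<beta>) \<and> reals s 23 0 = 2 ^ \<beta> \<and>
    coins s = coins s0 + \<beta>) s0"
proof -
  let ?body = "Seq (Coin 11) (Seq (set_scalar 22 (RAdd (RAdd (scalar 22) (scalar 22)) (ROfInt (IVar 11))))
      (set_scalar 23 (RAdd (scalar 23) (scalar 23))))"
  define I where "I t s \<longleftrightarrow> reals s 22 0 = real (bits_value b (coins s0) t) \<and> reals s 23 0 = 2 ^ t \<and>
    coins s = coins s0 + t \<and> ints s 0 = n" for t :: nat and s :: state
  have g: "tval (RLess (scalar 23) (bits_bound c)) s \<longleftrightarrow> 2 ^ t < 4 * (n + 1) ^ (c + 2)" if "I t s" for t s
  proof -
    have eq: "real (4 * (n + 1) ^ (c + 2)) = 4 * (real n + 1) ^ (c + 2)"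
      by (simp only: of_nat_mult of_nat_power of_nat_add of_nat_numeral of_nat_1)
    have "tval (RLess (scalar 23) (bits_bound c)) s \<longleftrightarrow> real (2 ^ t) < real (4 * (n + 1) ^ (c + 2))"
      unfolding eq using that by (simp add: I_def bits_bound_def add.commute)
    then show ?thesis by (simp only: of_nat_less_iff)
  qed
  have "Wp (random_bits c) (I \<beta>) s0"
    unfolding random_bits_def
  proof (rule wp_While)
    show "I 0 s0" using s0 n by (simp add: I_def)
    fix t s assume "t < \<beta>" "I t s"
    then show "tval (RLess (scalar 23) (bits_bound c)) s \<and> Wp ?body (I (Suc t)) s"
      using g \<beta>(2) by (auto simp: wp_Seq wp_basic I_def)
  next
    fix s assume "I \<beta> s"
    then show "\<not> tval (RLess (scalar 23) (bits_bound c)) s" using g \<beta>(1) by (simp add: not_less)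
  qed (rule \<beta>)
  then show ?thesis by (rule wp_mono) (auto simp: I_def)
qed

lemma wp_direction:
  assumes n: "ints s0 0 = n" and "coins s0 = 0"
    and \<beta>: "4 * (n + 1) ^ (c + 2) \<le> 2 ^ \<beta>" "\<And>t. t < \<beta> \<Longrightarrow> 2 ^ t < 4 * (n + 1) ^ (c + 2)" "\<beta> \<le> W"
  shows "Wp (direction c) (\<lambda>s. \<forall>i<n. reals s 3 i = real (bits_value b (i * \<beta>) \<beta>) / 2 ^ \<beta>) s0"
proof -
  let ?body = "Seq (set_scalar 22 (RConst 0)) (Seq (set_scalar 23 (RConst 1))
    (Seq (random_bits c) (RAssign 3 (IVar 3) (RDiv (scalar 22) (scalar 23)))))"
  define I where "I i s \<longleftrightarrow> (\<forall>j<i. reals s 3 j = real (bits_value b (j * \<beta>) \<beta>) / 2 ^ \<beta>) \<and> coins s = i * \<beta>"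
    for i :: nat and s :: state
  have "Wp (for_n 3 ?body) (\<lambda>s. I n s \<and> frame (for_n 3 ?body) s0 s) s0"
  proof (rule wp_for_n)
    fix i s assume i: "i < n" "I i s" "ints s 3 = i" and fr: "frame (for_n 3 ?body) s0 s"
    define s1 where "s1 = s\<lparr>reals := (reals s)(22 := (reals s 22)(0 := 0), 23 := (reals s 23)(0 := 1))\<rparr>"
    have "ints s 0 = n" using fr n by (simp add: frame_def)
    then have "Wp (random_bits c) (\<lambda>s. reals s 22 0 = real (bits_value b (coins s1) \<beta>) \<and> reals s 23 0 = 2 ^ \<beta> \<and>
      coins s = coins s1 + \<beta>) s1"
      by (intro wp_random_bits \<beta>) (auto simp: s1_def)
    then have "Wp (Seq (random_bits c) (RAssign 3 (IVar 3) (RDiv (scalar 22) (scalar 23)))) (I (Suc i)) s1"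
      unfolding wp_Seq
    proof (rule wp_mono)
      fix r assume r: "frame (random_bits c) s1 r" "reals r 22 0 = real (bits_value b (coins s1) \<beta>) \<and> reals r 23 0 = 2 ^ \<beta> \<and>
        coins r = coins s1 + \<beta>"
      have "reals r 3 = reals s 3" "ints r 3 = i" using r(1) i by (auto simp: frame_def s1_def)
      then show "Wp (RAssign 3 (IVar 3) (RDiv (scalar 22) (scalar 23))) (I (Suc i)) r"
        using r(2) i by (auto simp: wp_basic I_def s1_def less_Suc_eq)
    qed
    then show "Wp ?body (I (Suc i)) s" unfolding wp_Seq[of _ _ _ _ "set_scalar _ _"] wp_basic by (simp add: s1_def)
  qed (use n assms(2) in \<open>auto simp: I_def\<close>)
  then show ?thesis unfolding direction_def by (rule wp_mono) (auto simp: I_def)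
qed

definition estimates :: "nat \<Rightarrow> (nat \<Rightarrow> real) \<Rightarrow> nat \<Rightarrow> state \<Rightarrow> bool" where
  "estimates q u L s \<longleftrightarrow> (\<forall>i<n. \<forall>j<n. arr n s 5 i j = est_cov ((L ^ q) ^ 1700) (block q n y L) i j \<and>
    arr n s 8 i j = est_M n ((L ^ q) ^ 1700) (block q n y L) i j \<and>
    arr n s 9 i j = est_H n ((L ^ q) ^ 1700) (block q n y L) u i j)"

lemma wp_one_round:
  assumes n: "ints s0 0 = n" "1 \<le> n" and L: "Suc (ints s0 1) = L" "(L ^ q) ^ 1700 \<le> W" "16 \<le> L"
    and s0: "samples s0 = offset q n L" "reals s0 3 = u" "reals s0 0 0 = \<epsilon>"
  shows "Wp (one_round q) (\<lambda>s. estimates q u L s \<and> (ints s 2 = 0 \<longleftrightarrow> passes q n \<epsilon> y L) \<and>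
    samples s = samples s0 + (L ^ q) ^ 1700 \<and> ints s 1 = L) s0"
proof -
  let ?m = "(L ^ q) ^ 1700" and ?Y = "block q n y L"
  define s1 where "s1 = s0\<lparr>ints := (ints s0)(1 := L)\<rparr>"
  have s1: "ints s1 0 = n" "ints s1 1 = L" "reals s1 3 = u" "samples s1 = offset q n L" "reals s1 0 0 = \<epsilon>"
    using n s0 by (auto simp: s1_def)
  have Y: "(\<lambda>t. y (samples s1 + t)) = ?Y" using s1 by (simp add: block_def fun_eq_iff)
  have Yt: "y (offset q n L + t) = ?Y t" for t by (simp add: block_def)
  have "Wp (moments q) (\<lambda>s. (\<forall>i<n. \<forall>j<n. arr n s 5 i j = est_cov ?m ?Y i j \<and>
      arr n s 6 i j = weighted ?m ?Y (\<lambda>t. ip n (?Y t) (?Y t)) i j \<and>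
      arr n s 7 i j = weighted ?m ?Y (\<lambda>t. (ip n u (?Y t))\<^sup>2) i j) \<and>
    reals s 16 0 = est_trace n ?m ?Y \<and> samples s = samples s1 + ?m) s1"
    using wp_moments[of s1 ?m q] s1 L unfolding Y by (simp add: Yt)
  then have "Wp (Seq (moments q) (Seq cumulants (check q))) (\<lambda>s. estimates q u L s \<and>
    (ints s 2 = 0 \<longleftrightarrow> passes q n \<epsilon> y L) \<and> samples s = samples s0 + ?m \<and> ints s 1 = L) s1"
  proof (rule wp_SeqI, goal_cases)
    case (1 s2)
    have s2: "ints s2 0 = n" "ints s2 1 = L" "reals s2 3 = u" "reals s2 0 0 = \<epsilon>" "samples s2 = samples s0 + ?m"
      using 1 s1 s0 by (auto simp: frame_def)
    have "Wp cumulants (\<lambda>s. \<forall>i<n. \<forall>j<n.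
      arr n s 8 i j = (weighted ?m ?Y (\<lambda>t. ip n (?Y t) (?Y t)) i j - est_trace n ?m ?Y * est_cov ?m ?Y i j
        - 2 * (\<Sum>l<n. est_cov ?m ?Y i l * est_cov ?m ?Y j l)) / (-2) \<and>
      arr n s 9 i j = (weighted ?m ?Y (\<lambda>t. (ip n u (?Y t))\<^sup>2) i j - ip n u (mv n (est_cov ?m ?Y) u) * est_cov ?m ?Y i j
        - 2 * (mv n (est_cov ?m ?Y) u i * mv n (est_cov ?m ?Y) u j)) / (-2)) s2"
      by (rule wp_cumulants) (use 1(2) s2 in auto)
    then show ?case
    proof (rule wp_SeqI, goal_cases)
      case (1 s3)
      have s3: "ints s3 0 = n" "ints s3 1 = L" "reals s3 16 = reals s2 16" "reals s3 0 0 = \<epsilon>" "reals s3 5 = reals s2 5"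
        "samples s3 = samples s0 + ?m"
        using 1(1) s2 by (auto simp: frame_def)
      have est: "estimates q u L s3"
        using 1(2) \<open>(\<forall>i<n. \<forall>j<n. arr n s2 5 i j = _ \<and> _) \<and> _\<close> s3(5)
        by (auto simp: estimates_def est_M_def est_H_def arr_def)
      have "(L ^ q) ^ 20 \<le> W" using power_increasing[of 20 1700 "L ^ q"] L by (auto intro: order.trans)
      then have "Wp (check q) (\<lambda>s. ints s 2 = 0 \<longleftrightarrow> reals s3 16 0 < real (L ^ q) \<and> 1 \<le> reals s3 0 0 * real (L ^ q) \<and>
        (\<forall>k<n. \<not> accepted n (est_M n ?m ?Y) (real (L ^ q) ^ 8) ((L ^ q) ^ 20) k)) s3"
        by (intro wp_check) (use s3 n est in \<open>auto simp: estimates_def\<close>)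
      then show ?case
      proof (rule wp_mono, goal_cases)
        case (1 s4)
        have "reals s2 16 0 = est_trace n ?m ?Y" using \<open>(\<forall>i<n. \<forall>j<n. arr n s2 5 i j = _ \<and> _) \<and> _\<close> by simp
        moreover have "estimates q u L s4" using 1(1) est by (auto simp: estimates_def frame_def arr_def)
        ultimately show ?case using 1 s3 by (simp add: passes_def frame_def)
      qed
    qed
  qed
  then show ?thesis unfolding one_round_def wp_Seq[of _ _ _ _ "IAssign _ _"] wp_basic using L by (simp add: s1_def)
qed

text \<open>The specification of the scan is a hypothesis, required only at the first scale that
  passes, since the deterministic analysis applies only there. The auxiliary state r is the one
  after the scan; \<open>finish\<close> leaves array 1 unchanged.\<close>

lemma wp_program:
  assumes n: "1 \<le> n" and q: "1 \<le> q"
    and \<beta>: "4 * (n + 1) ^ (c + 2) \<le> 2 ^ \<beta>" "\<And>t. t < \<beta> \<Longrightarrow> 2 ^ t < 4 * (n + 1) ^ (c + 2)" "\<beta> \<le> W"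
    and L: "n + 16 \<le> L" "passes q n \<epsilon> y L" "\<And>l. n + 16 \<le> l \<Longrightarrow> l < L \<Longrightarrow> \<not> passes q n \<epsilon> y l" "(L ^ q) ^ 1700 \<le> W"
    and scan: "\<And>s u. ints s 0 = n \<Longrightarrow> ints s 1 = L \<Longrightarrow> estimates q u L s \<Longrightarrow>
      (\<And>i. i < n \<Longrightarrow> u i = real (bits_value b (i * \<beta>) \<beta>) / 2 ^ \<beta>) \<Longrightarrow> Wp (scan q) G s"
  shows "Wp (program c q) (\<lambda>s. \<exists>r. G r \<and> reals s 1 = reals r 1 \<and> (\<forall>i<n. \<forall>j<n. arr n s 2 i j =
    est_cov ((L ^ q) ^ 1700) (block q n y L) i j - (\<Sum>l<n. arr n s 1 i l * arr n s 1 j l))) (init_state n \<epsilon>)"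
    (is "Wp _ ?Post _")
proof -
  define N where "N = L - (n + 15)"
  have Lp: "l \<le> (l ^ q) ^ 1700" if "1 \<le> l" for l :: nat
    using self_le_power[of l "q * 1700"] that q by (simp add: power_mult)
  have N: "1 \<le> N" "N \<le> W" "n + 15 + N = L" using L Lp[of L] by (auto simp: N_def)
  have "Wp (direction c) (\<lambda>s. \<forall>i<n. reals s 3 i = real (bits_value b (i * \<beta>) \<beta>) / 2 ^ \<beta>) (init_state n \<epsilon>)"
    by (rule wp_direction) (use \<beta> in \<open>auto simp: init_state_def\<close>)
  then show ?thesis unfolding program_def
  proof (rule wp_SeqI, goal_cases)
    case (1 s1)
    define u where "u = reals s1 3"
    have s1: "ints s1 0 = n" "samples s1 = 0" "reals s1 0 0 = \<epsilon>"
      using 1(1) by (auto simp: frame_def init_state_def)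
    define s2 where "s2 = s1\<lparr>ints := (ints s1)(1 := n + 15, 2 := 1)\<rparr>"
    define I where "I i s \<longleftrightarrow> ints s 1 = n + 15 + i \<and> ints s 0 = n \<and> reals s 3 = u \<and> reals s 0 0 = \<epsilon> \<and>
      samples s = offset q n (n + 16 + i) \<and> (if i = 0 then ints s 2 = 1 else estimates q u (n + 15 + i) s \<and>
        (ints s 2 = 0 \<longleftrightarrow> passes q n \<epsilon> y (n + 15 + i)))" for i :: nat and s :: state
    have "Wp (While (ILess (IConst 0) (IVar 2)) (one_round q)) (I N) s2"
    proof (rule wp_While)
      show "I 0 s2" using s1 by (simp add: I_def s2_def u_def offset_def)
      show "N \<le> W" by (rule N)
      fix i s assume i: "i < N" and I: "I i s"
      have "ints s 2 \<noteq> 0" using I L(3)[of "n + 15 + i"] i N by (cases "i = 0") (auto simp: I_def)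
      moreover have "Wp (one_round q) (\<lambda>s'. estimates q u (n + 16 + i) s' \<and> (ints s' 2 = 0 \<longleftrightarrow> passes q n \<epsilon> y (n + 16 + i)) \<and>
        samples s' = samples s + ((n + 16 + i) ^ q) ^ 1700 \<and> ints s' 1 = n + 16 + i) s"
      proof (rule wp_one_round)
        have "((n + 16 + i) ^ q) ^ 1700 \<le> (L ^ q) ^ 1700" using i N by (intro power_mono) auto
        then show "((n + 16 + i) ^ q) ^ 1700 \<le> W" using L(4) by linarith
      qed (use I n in \<open>auto simp: I_def\<close>)
      then have "Wp (one_round q) (I (Suc i)) s"
      proof (rule wp_mono, goal_cases)
        case (1 s')
        have "ints s' 0 = ints s 0" "reals s' 3 = reals s 3" "reals s' 0 = reals s 0"
          using 1(1) by (auto simp: frame_def one_round_def)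
        moreover have "offset q n (n + 16 + Suc i) = offset q n (n + 16 + i) + ((n + 16 + i) ^ q) ^ 1700"
          unfolding offset_def add_Suc_right by (subst sum.atLeastLessThan_Suc) auto
        moreover have e: "n + 15 + Suc i = n + 16 + i" by simp
        ultimately show ?case unfolding I_def e using 1(2) I by (simp add: I_def)
      qed
      ultimately show "tval (ILess (IConst 0) (IVar 2)) s \<and> Wp (one_round q) (I (Suc i)) s" by simp
    next
      fix s assume "I N s"
      then show "\<not> tval (ILess (IConst 0) (IVar 2)) s" using N L(2) by (auto simp: I_def)
    qed
    then have "Wp (Seq (While (ILess (IConst 0) (IVar 2)) (one_round q)) (Seq (scan q) finish)) ?Post s2"
    proof (rule wp_SeqI, goal_cases)
      case (1 s3)
      have s3: "ints s3 0 = n" "ints s3 1 = L" "estimates q u L s3" using 1(2) N by (auto simp: I_def)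
      have "Wp (scan q) G s3"
        by (rule scan[OF s3]) (use \<open>\<forall>i<n. reals s1 3 i = _\<close> in \<open>simp add: u_def\<close>)
      then show ?case
      proof (rule wp_SeqI, goal_cases)
        case (1 s4)
        have "ints s4 0 = n" "reals s4 5 = reals s3 5" using 1(1) s3 by (auto simp: frame_def)
        then have "Wp finish (\<lambda>s. \<forall>i<n. \<forall>j<n. arr n s 2 i j = arr n s3 5 i j - (\<Sum>l<n. arr n s4 1 i l * arr n s4 1 j l)) s4"
          using wp_finish[of s4] by (simp add: arr_def)
        then show ?case
        proof (rule wp_mono, goal_cases)
          case (1 s5)
          have "reals s5 1 = reals s4 1" using 1(1) by (auto simp: frame_def finish_def rows_product_def)
          then show ?case using 1(2) s3(3) \<open>G s4\<close> by (auto simp: estimates_def arr_def)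
        qed
      qed
    qed
    then show ?case unfolding wp_Seq[of _ _ _ _ "IAssign _ _"] wp_basic by (simp add: s2_def s1)
  qed
qed

end

section \<open>Measurability of the success event\<close>

text \<open>A functional evaluator that aborts, signalled by the flag, if a loop is not left within \<open>k\<close> iterations.\<close>

type_synonym conf = "bool \<times> nat \<times> state"

definition loop_step :: "test \<Rightarrow> (conf \<Rightarrow> conf) \<Rightarrow> conf \<Rightarrow> conf" where
  "loop_step g f x = (if tval g (snd (snd x)) then f (fst x, fst (snd x) + 1, snd (snd x)) else x)"

fun runs :: "nat \<Rightarrow> nat \<Rightarrow> (nat \<Rightarrow> nat \<Rightarrow> real) \<Rightarrow> (nat \<Rightarrow> bool) \<Rightarrow> com \<Rightarrow> conf \<Rightarrow> conf" where
  "runs k n y b Skip x = (fst x, fst (snd x) + 1, snd (snd x))"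
| "runs k n y b (IAssign v e) x = (let s = snd (snd x) in
    (fst x, fst (snd x) + 1, s\<lparr>ints := (ints s)(v := ival e s)\<rparr>))"
| "runs k n y b (RAssign a e f) x = (let s = snd (snd x) in
    (fst x, fst (snd x) + 1, s\<lparr>reals := (reals s)(a := (reals s a)(ival e s := rval f s))\<rparr>))"
| "runs k n y b (Seq c d) x = runs k n y b d (runs k n y b c x)"
| "runs k n y b (If g c d) x = (if tval g (snd (snd x))
    then runs k n y b c (fst x, fst (snd x) + 1, snd (snd x)) else runs k n y b d (fst x, fst (snd x) + 1, snd (snd x)))"
| "runs k n y b (While g c) x = (let z = (loop_step g (runs k n y b c) ^^ k) x in
    (fst z \<and> \<not> tval g (snd (snd z)), fst (snd z) + 1, snd (snd z)))"
| "runs k n y b (Sample a) x = (let s = snd (snd x) in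
    (fst x, fst (snd x) + (n + 1), s\<lparr>reals := (reals s)(a := (\<lambda>i. if i < n then y (samples s) i else reals s a i)),
       samples := samples s + 1\<rparr>))"
| "runs k n y b (Coin v) x = (let s = snd (snd x) in
    (fst x, fst (snd x) + 1, s\<lparr>ints := (ints s)(v := (if b (coins s) then 1 else 0)), coins := coins s + 1\<rparr>))"

lemma funpow_fixed: "f x = x \<Longrightarrow> (f ^^ j) x = x"
  by (induction j) auto

lemma exec_pos: "exec n y b c s t s' \<Longrightarrow> 1 \<le> t"
  by (induction rule: exec.induct) auto

text \<open>The second conjunct strengthens the induction for loops: \<open>loop_step\<close> is
  stationary once the guard fails, so any number of iterations beyond the running time leads to the
  same result. The -1 is the tick of the final test, which \<open>runs\<close> adds after the
  iteration.\<close>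

lemma exec_imp_runs:
  assumes "exec n y b c s t s'"
  shows "(\<forall>k\<ge>t. \<forall>f t0. runs k n y b c (f, t0, s) = (f, t0 + t, s')) \<and>
    (\<forall>g d. c = While g d \<longrightarrow> \<not> tval g s' \<and> (\<forall>k\<ge>t. \<forall>j\<ge>t. \<forall>f t0.
      (loop_step g (runs k n y b d) ^^ j) (f, t0, s) = (f, t0 + t - 1, s')))"
  using assms
proof (induction rule: exec.induct)
  case (WhileFalse g s c)
  have "(loop_step g (runs k n y b c) ^^ j) (f, t0, s) = (f, t0, s)" for k j f t0
    by (rule funpow_fixed) (use WhileFalse in \<open>simp add: loop_step_def\<close>)
  then show ?case using WhileFalse by simp
next
  case (WhileTrue g s c t s' t' s'')
  have pos: "1 \<le> t" "1 \<le> t'" using exec_pos[OF WhileTrue.hyps(2)] exec_pos[OF WhileTrue.hyps(3)] .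
  have "(loop_step g (runs k n y b c) ^^ j) (f, t0, s) = (f, t0 + (1 + t + t') - 1, s'')"
    if k: "1 + t + t' \<le> k" "1 + t + t' \<le> j" for k j f t0
  proof -
    obtain i where i: "j = Suc i" using k by (cases j) auto
    have "loop_step g (runs k n y b c) (f, t0, s) = (f, t0 + 1 + t, s')"
      using WhileTrue.hyps(1) WhileTrue.IH(1) k by (simp add: loop_step_def)
    then have "(loop_step g (runs k n y b c) ^^ j) (f, t0, s) = (loop_step g (runs k n y b c) ^^ i) (f, t0 + 1 + t, s')"
      unfolding i funpow_Suc_right comp_def by simp
    also have "\<dots> = (f, t0 + 1 + t + t' - 1, s'')" using WhileTrue.IH(2) k i by simp
    finally show ?thesis by simp
  qed
  moreover have "\<not> tval g s''" using WhileTrue.IH(2) by simp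
  ultimately show ?case by simp
qed (auto simp: Let_def)

lemma runs_imp_exec:
  "runs k n y b c (f, t0, s) = (True, t1, s1) \<Longrightarrow> f \<and> t0 \<le> t1 \<and> exec n y b c s (t1 - t0) s1"
proof (induction c arbitrary: f t0 s t1 s1)
  case (Seq c d)
  obtain f' t' s' where 1: "runs k n y b c (f, t0, s) = (f', t', s')" by (metis prod.exhaust)
  with Seq.prems have 2: "runs k n y b d (f', t', s') = (True, t1, s1)" by simp
  from Seq.IH(2)[OF 2] have d: "f'" "t' \<le> t1" "exec n y b d s' (t1 - t') s1" by auto
  have "runs k n y b c (f, t0, s) = (True, t', s')" using 1 d by simp
  from Seq.IH(1)[OF this] have c: "f" "t0 \<le> t'" "exec n y b c s (t' - t0) s'" by auto
  have "t' - t0 + (t1 - t') = t1 - t0" using c d by simp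
  then show ?case using exec.Seq[OF c(3) d(3)] c d by simp
next
  case (If g c d)
  show ?case
  proof (cases "tval g s")
    case True
    then have *: "f" "t0 + 1 \<le> t1" "exec n y b c s (t1 - (t0 + 1)) s1" using If.IH(1)[of f "t0 + 1"] If.prems by auto
    then have "1 + (t1 - (t0 + 1)) = t1 - t0" by simp
    then show ?thesis using exec.IfTrue[OF True *(3), of d] * by simp
  next
    case False
    then have *: "f" "t0 + 1 \<le> t1" "exec n y b d s (t1 - (t0 + 1)) s1" using If.IH(2)[of f "t0 + 1"] If.prems by auto
    then have "1 + (t1 - (t0 + 1)) = t1 - t0" by simp
    then show ?thesis using exec.IfFalse[OF False *(3), of c] * by simp
  qed
next
  case (While g c)
  have "f \<and> t0 \<le> t' \<and> exec n y b (While g c) s (t' + 1 - t0) s'"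
    if "(loop_step g (runs k n y b c) ^^ j) (f, t0, s) = (True, t', s')" "\<not> tval g s'" for j f t0 s t' s'
    using that
  proof (induction j arbitrary: f t0 s)
    case 0
    then show ?case using exec.WhileFalse[of g s n y b c] by simp
  next
    case (Suc j)
    show ?case
    proof (cases "tval g s")
      case False
      then have "(loop_step g (runs k n y b c) ^^ Suc j) (f, t0, s) = (f, t0, s)"
        by (intro funpow_fixed) (simp add: loop_step_def)
      then show ?thesis using Suc.prems exec.WhileFalse[of g s n y b c] False by simp
    next
      case True
      obtain f' t'' s'' where 1: "runs k n y b c (f, t0 + 1, s) = (f', t'', s'')" by (metis prod.exhaust)
      have "loop_step g (runs k n y b c) (f, t0, s) = (f', t'', s'')" using True 1 by (simp add: loop_step_def)
      then have "(loop_step g (runs k n y b c) ^^ j) (f', t'', s'') = (True, t', s')"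
        using Suc.prems(1) unfolding funpow_Suc_right comp_def by simp
      from Suc.IH[OF this Suc.prems(2)] have *: "f'" "t'' \<le> t'" "exec n y b (While g c) s'' (t' + 1 - t'') s'" by auto
      have "runs k n y b c (f, t0 + 1, s) = (True, t'', s'')" using 1 * by simp
      from While.IH[OF this] have c: "f" "t0 + 1 \<le> t''" "exec n y b c s (t'' - (t0 + 1)) s''" by auto
      have "1 + (t'' - (t0 + 1)) + (t' + 1 - t'') = t' + 1 - t0" using * c by simp
      then show ?thesis using exec.WhileTrue[OF True c(3) *(3)] * c by simp
    qed
  qed
  note key = this
  obtain z where z: "(loop_step g (runs k n y b c) ^^ k) (f, t0, s) = z" by simp
  then have "fst z" "\<not> tval g s1" "fst (snd z) + 1 = t1" "snd (snd z) = s1"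
    using While.prems by (auto simp: Let_def)
  then have t1: "1 \<le> t1" "\<not> tval g s1" "z = (True, t1 - 1, s1)" by (auto simp: prod_eq_iff)
  from key[OF z[unfolded t1(3)] t1(2)] show ?case using t1(1) by auto
next
  case (Coin v)
  then show ?case using exec.Coin[of n y b v s] by (auto simp: Let_def)
qed (auto simp: Let_def intro: exec.intros exec.intros[unfolded One_nat_def] exec.Sample[simplified])

text \<open>This writes halting runs as a countable union over the fuel k of total functions, whose
  measurability can be shown by induction on the program.\<close>

lemma exec_iff_runs: "exec n y b c s t s' \<longleftrightarrow> (\<exists>k. runs k n y b c (True, 0, s) = (True, t, s'))"
proof
  assume "exec n y b c s t s'"
  from exec_imp_runs[OF this] have "\<forall>k\<ge>t. \<forall>f t0. runs k n y b c (f, t0, s) = (f, t0 + t, s')" by blast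
  then show "\<exists>k. runs k n y b c (True, 0, s) = (True, t, s')" by (intro exI[of _ t]) simp
next
  assume "\<exists>k. runs k n y b c (True, 0, s) = (True, t, s')"
  then show "exec n y b c s t s'" using runs_imp_exec by fastforce
qed

text \<open>Componentwise measurability avoids a sigma-algebra on states. It suffices because
  expressions read single components whose addresses range over a countable set.\<close>

definition measurable_conf :: "'w measure \<Rightarrow> ('w \<Rightarrow> conf) \<Rightarrow> bool" where
  "measurable_conf M X \<longleftrightarrow> (\<lambda>w. fst (X w)) \<in> M \<rightarrow>\<^sub>M count_space UNIV \<and>
    (\<lambda>w. fst (snd (X w))) \<in> M \<rightarrow>\<^sub>M count_space UNIV \<and>
    (\<forall>v. (\<lambda>w. ints (snd (snd (X w))) v) \<in> M \<rightarrow>\<^sub>M count_space UNIV) \<and>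
    (\<forall>a i. (\<lambda>w. reals (snd (snd (X w))) a i) \<in> borel_measurable M) \<and>
    (\<lambda>w. samples (snd (snd (X w)))) \<in> M \<rightarrow>\<^sub>M count_space UNIV \<and>
    (\<lambda>w. coins (snd (snd (X w)))) \<in> M \<rightarrow>\<^sub>M count_space UNIV"

lemma measurable_confD:
  assumes "measurable_conf M X"
  shows "(\<lambda>w. fst (X w)) \<in> M \<rightarrow>\<^sub>M count_space UNIV" "(\<lambda>w. fst (snd (X w))) \<in> M \<rightarrow>\<^sub>M count_space UNIV"
    "(\<lambda>w. ints (snd (snd (X w))) v) \<in> M \<rightarrow>\<^sub>M count_space UNIV"
    "(\<lambda>w. reals (snd (snd (X w))) a i) \<in> borel_measurable M"
    "(\<lambda>w. samples (snd (snd (X w)))) \<in> M \<rightarrow>\<^sub>M count_space UNIV"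
    "(\<lambda>w. coins (snd (snd (X w)))) \<in> M \<rightarrow>\<^sub>M count_space UNIV"
  using assms by (auto simp: measurable_conf_def)

lemma measurable_ival:
  assumes X: "measurable_conf M X"
  shows "(\<lambda>w. ival e (snd (snd (X w)))) \<in> M \<rightarrow>\<^sub>M count_space UNIV"
proof (induction e)
  case (IAdd e f)
  note [measurable] = IAdd
  show ?case by simp
next
  case (ISub e f)
  note [measurable] = ISub
  show ?case by simp
qed (auto intro: measurable_confD[OF X])

lemma measurable_index:
  fixes f :: "nat \<Rightarrow> 'w \<Rightarrow> 'b"
  assumes "\<And>i. f i \<in> M \<rightarrow>\<^sub>M N" "g \<in> M \<rightarrow>\<^sub>M count_space UNIV"
  shows "(\<lambda>w. f (g w) w) \<in> M \<rightarrow>\<^sub>M N"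
  using assms by (rule measurable_compose_countable)

lemma measurable_rval:
  assumes X: "measurable_conf M X"
  shows "(\<lambda>w. rval e (snd (snd (X w)))) \<in> borel_measurable M"
proof (induction e)
  case (ROfInt e)
  note [measurable] = measurable_ival[OF X]
  show ?case by simp
next
  case (RGet a e)
  show ?case unfolding rval.simps
    by (rule measurable_index[where f = "\<lambda>i w. reals (snd (snd (X w))) a i"])
      (auto intro: measurable_confD[OF X] measurable_ival[OF X])
next
  case (RAdd e f)
  note [measurable] = RAdd
  show ?case by simp
next
  case (RSub e f)
  note [measurable] = RSub
  show ?case by simp
next
  case (RMul e f)
  note [measurable] = RMul
  show ?case by simp
next
  case (RDiv e f)
  note [measurable] = RDiv
  show ?case by simp
qed auto

lemma measurable_tval:
  assumes X: "measurable_conf M X"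
  shows "Measurable.pred M (\<lambda>w. tval g (snd (snd (X w))))"
proof (induction g)
  case (ILess e f)
  have "(\<lambda>w. i < ival f (snd (snd (X w)))) \<in> M \<rightarrow>\<^sub>M count_space UNIV" for i
    using measurable_compose[OF measurable_ival[OF X], of "\<lambda>j. i < j"] by simp
  then show ?case unfolding tval.simps
    by (rule measurable_index[where f = "\<lambda>i w. i < ival f (snd (snd (X w)))"]) (rule measurable_ival[OF X])
next
  case (RLess e f)
  note [measurable] = measurable_rval[OF X]
  show ?case unfolding tval.simps by measurable
next
  case (TNot g)
  note [measurable] = TNot
  show ?case unfolding tval.simps by measurable
next
  case (TAnd g h)
  note [measurable] = TAnd
  show ?case unfolding tval.simps by measurable
qed

lemma measurable_conf_If:
  assumes "Measurable.pred M P" "measurable_conf M X" "measurable_conf M Y"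
  shows "measurable_conf M (\<lambda>w. if P w then X w else Y w)"
proof -
  have "(\<lambda>w. h (if P w then X w else Y w)) \<in> M \<rightarrow>\<^sub>M N" if "(\<lambda>w. h (X w)) \<in> M \<rightarrow>\<^sub>M N" "(\<lambda>w. h (Y w)) \<in> M \<rightarrow>\<^sub>M N"
    for h :: "conf \<Rightarrow> 'c" and N
    unfolding if_distrib[of h] using that assms(1) by (intro measurable_If) auto
  note aux = this
  note mX = measurable_confD[OF assms(2)] and mY = measurable_confD[OF assms(3)]
  show ?thesis unfolding measurable_conf_def
  proof (intro conjI allI)
    show "(\<lambda>w. fst (if P w then X w else Y w)) \<in> M \<rightarrow>\<^sub>M count_space UNIV"
      using mX(1) mY(1) by (rule aux)
    show "(\<lambda>w. fst (snd (if P w then X w else Y w))) \<in> M \<rightarrow>\<^sub>M count_space UNIV"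
      using mX(2) mY(2) by (rule aux[of "\<lambda>x. fst (snd x)"])
    show "(\<lambda>w. ints (snd (snd (if P w then X w else Y w))) v) \<in> M \<rightarrow>\<^sub>M count_space UNIV" for v
      using mX(3) mY(3) by (rule aux[of "\<lambda>x. ints (snd (snd x)) v"])
    show "(\<lambda>w. reals (snd (snd (if P w then X w else Y w))) a i) \<in> borel_measurable M" for a i
      using mX(4) mY(4) by (rule aux[of "\<lambda>x. reals (snd (snd x)) a i"])
    show "(\<lambda>w. samples (snd (snd (if P w then X w else Y w)))) \<in> M \<rightarrow>\<^sub>M count_space UNIV"
      using mX(5) mY(5) by (rule aux[of "\<lambda>x. samples (snd (snd x))"])
    show "(\<lambda>w. coins (snd (snd (if P w then X w else Y w)))) \<in> M \<rightarrow>\<^sub>M count_space UNIV"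
      using mX(6) mY(6) by (rule aux[of "\<lambda>x. coins (snd (snd x))"])
  qed
qed

lemma measurable_conf_tick: "measurable_conf M X \<Longrightarrow> measurable_conf M (\<lambda>w. (fst (X w), fst (snd (X w)) + k, snd (snd (X w))))"
  unfolding measurable_conf_def by (auto intro: measurable_compose[where g = "\<lambda>x. x + k"])

lemma measurable_runs:
  assumes y: "\<And>t i. i < n \<Longrightarrow> (\<lambda>w. y w t i) \<in> borel_measurable M"
    and b: "\<And>t. (\<lambda>w. b w t) \<in> M \<rightarrow>\<^sub>M count_space UNIV"
  shows "measurable_conf M X \<Longrightarrow> measurable_conf M (\<lambda>w. runs k n (y w) (b w) c (X w))"
proof (induction c arbitrary: X)
  case Skip
  then show ?case using measurable_conf_tick[of M X 1] by simp
next
  case (IAssign v e)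
  note [measurable] = measurable_confD[OF IAssign] measurable_ival[OF IAssign]
  have "(\<lambda>w. ((ints (snd (snd (X w))))(v := ival e (snd (snd (X w))))) u) \<in> M \<rightarrow>\<^sub>M count_space UNIV" for u
    by (cases "u = v") auto
  then show ?case unfolding measurable_conf_def by (simp add: Let_def)
next
  case (RAssign a e f)
  note [measurable] = measurable_confD[OF RAssign] measurable_ival[OF RAssign] measurable_rval[OF RAssign]
  have "(\<lambda>w. ((reals (snd (snd (X w))))(a := (reals (snd (snd (X w))) a)
      (ival e (snd (snd (X w))) := rval f (snd (snd (X w)))))) a' i) \<in> borel_measurable M" for a' i
  proof (cases "a' = a")
    case True
    have "(\<lambda>w. if i = ival e (snd (snd (X w))) then rval f (snd (snd (X w))) else reals (snd (snd (X w))) a i) \<in> borel_measurable M"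
      by measurable
    then show ?thesis using True by (simp add: fun_upd_def)
  qed auto
  then show ?case unfolding measurable_conf_def by (simp add: Let_def)
next
  case (Seq c d)
  then show ?case by simp
next
  case (If g c d)
  show ?case unfolding runs.simps
    by (intro measurable_conf_If measurable_tval If measurable_conf_tick)
next
  case (While g c)
  have step: "measurable_conf M (\<lambda>w. loop_step g (runs k n (y w) (b w) c) (X w))" if "measurable_conf M X" for X
    unfolding loop_step_def by (intro measurable_conf_If measurable_tval While.IH measurable_conf_tick that)
  have it: "measurable_conf M (\<lambda>w. (loop_step g (runs k n (y w) (b w) c) ^^ j) (X w))" for j
    by (induction j) (use While.prems step in auto)
  note [measurable] = measurable_confD[OF it[of k]] measurable_tval[OF it[of k]]
  show ?case unfolding measurable_conf_def by (simp add: Let_def)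
next
  case (Sample a)
  note [measurable] = measurable_confD[OF Sample]
  have "(\<lambda>w. y w (samples (snd (snd (X w)))) i) \<in> borel_measurable M" if "i < n" for i
    by (rule measurable_index[where f = "\<lambda>t w. y w t i"]) (use y that in auto)
  then have "(\<lambda>w. ((reals (snd (snd (X w))))(a := (\<lambda>i. if i < n then y w (samples (snd (snd (X w)))) i
      else reals (snd (snd (X w))) a i))) a' i) \<in> borel_measurable M" for a' i
    by (cases "a' = a"; cases "i < n") auto
  then show ?case unfolding measurable_conf_def by (simp add: Let_def)
next
  case (Coin v)
  note [measurable] = measurable_confD[OF Coin]
  have [measurable]: "(\<lambda>w. b w (coins (snd (snd (X w))))) \<in> M \<rightarrow>\<^sub>M count_space UNIV"
    by (rule measurable_index[where f = "\<lambda>t w. b w t"]) (use b in auto)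
  have "(\<lambda>w. ((ints (snd (snd (X w))))(v := if b w (coins (snd (snd (X w)))) then 1 else 0)) u) \<in> M \<rightarrow>\<^sub>M count_space UNIV" for u
    by (cases "u = v") auto
  then show ?case unfolding measurable_conf_def by (simp add: Let_def)
qed

lemma finite_signs: "finite ({..<n :: nat} \<rightarrow>\<^sub>E {1, - 1 :: real})"
  by (intro finite_PiE) auto

lemma mixing_entry:
  assumes A: "A \<in> carrier_mat n n" and p: "p permutes {..<n}" and ij: "i < n" "j < n"
  shows "(A * mat n n (\<lambda>(i, j). if i = p j then 1 else 0) * mat_diag n k) $$ (i, j) = A $$ (i, p j) * (k j :: real)"
proof -
  let ?P = "mat n n (\<lambda>(i, j). if i = p j then 1 else 0 :: real)"
  have dim: "dim_row (mat_diag n k) = n" "dim_col (mat_diag n k) = n" by (simp_all add: mat_diag_def)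
  have pj: "p j < n" using permutes_in_image[OF p] ij by simp
  have "(A * ?P * mat_diag n k) $$ (i, j) = (\<Sum>l<n. (A * ?P) $$ (i, l) * mat_diag n k $$ (l, j))"
    using A ij by (simp add: scalar_prod_def atLeast0LessThan dim)
  also have "\<dots> = (A * ?P) $$ (i, j) * k j"
    using ij by (simp add: mat_diag_def if_distrib cong: if_cong) 
  also have "(A * ?P) $$ (i, j) = (\<Sum>l<n. A $$ (i, l) * (if l = p j then 1 else 0))"
    using A ij by (simp add: scalar_prod_def atLeast0LessThan)
  also have "\<dots> = A $$ (i, p j)" using pj by (simp add: if_distrib cong: if_cong)
  finally show ?thesis .
qed

text \<open>Restricting the signs to extensional functions leaves finitely many pairs of permutation
  and signs, so success becomes a finite disjunction of conditions on array entries.\<close>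

lemma recovers_mixing_iff:
  assumes A: "A \<in> carrier_mat n n"
  shows "recovers_mixing n \<epsilon> A (mat n n (\<lambda>(i, j). X i j)) \<longleftrightarrow>
    (\<exists>p\<in>{p. p permutes {..<n}}. \<exists>k\<in>{..<n} \<rightarrow>\<^sub>E {1, - 1}.
      sqrt (\<Sum>i<n. \<Sum>j<n. (X i j - A $$ (i, p j) * k j)\<^sup>2) \<le> \<epsilon>)"
proof -
  have eq: "frobenius_norm (mat n n (\<lambda>(i, j). X i j) - A * mat n n (\<lambda>(i, j). if i = p j then 1 else 0) * mat_diag n k) =
      sqrt (\<Sum>i<n. \<Sum>j<n. (X i j - A $$ (i, p j) * k j)\<^sup>2)" if p: "p permutes {..<n}" for p k
  proof -
    let ?B = "A * mat n n (\<lambda>(i, j). if i = p j then 1 else 0) * mat_diag n k"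
    have d: "dim_row ?B = n" "dim_col ?B = n" using A by (auto simp: mat_diag_def)
    have "(mat n n (\<lambda>(i, j). X i j) - ?B) $$ (i, j) = X i j - A $$ (i, p j) * k j" if "i < n" "j < n" for i j
      using that d mixing_entry[OF A p that, of k] by simp
    then show ?thesis using d by (simp add: frobenius_norm_def)
  qed
  show ?thesis
  proof
    assume "recovers_mixing n \<epsilon> A (mat n n (\<lambda>(i, j). X i j))"
    then obtain p k where p: "p permutes {..<n}" and k: "\<forall>i<n. k i \<in> {1, - 1}"
      and le: "frobenius_norm (mat n n (\<lambda>(i, j). X i j) - A * mat n n (\<lambda>(i, j). if i = p j then 1 else 0) * mat_diag n k) \<le> \<epsilon>"
      by (auto simp: recovers_mixing_def permutation_mat_def)
    have "sqrt (\<Sum>i<n. \<Sum>j<n. (X i j - A $$ (i, p j) * restrict k {..<n} j)\<^sup>2) \<le> \<epsilon>"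
      using le unfolding eq[OF p] by simp
    moreover have "restrict k {..<n} \<in> {..<n} \<rightarrow>\<^sub>E {1, - 1}" using k by auto
    ultimately show "\<exists>p\<in>{p. p permutes {..<n}}. \<exists>k\<in>{..<n} \<rightarrow>\<^sub>E {1, - 1}.
      sqrt (\<Sum>i<n. \<Sum>j<n. (X i j - A $$ (i, p j) * k j)\<^sup>2) \<le> \<epsilon>" using p by blast
  next
    assume "\<exists>p\<in>{p. p permutes {..<n}}. \<exists>k\<in>{..<n} \<rightarrow>\<^sub>E {1, - 1}.
      sqrt (\<Sum>i<n. \<Sum>j<n. (X i j - A $$ (i, p j) * k j)\<^sup>2) \<le> \<epsilon>"
    then obtain p k where p: "p permutes {..<n}" and k: "k \<in> {..<n} \<rightarrow>\<^sub>E {1, - 1}"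
      and le: "sqrt (\<Sum>i<n. \<Sum>j<n. (X i j - A $$ (i, p j) * k j)\<^sup>2) \<le> \<epsilon>" by auto
    show "recovers_mixing n \<epsilon> A (mat n n (\<lambda>(i, j). X i j))" unfolding recovers_mixing_def permutation_mat_def
      using p k le by (intro exI[of _ "mat n n (\<lambda>(i, j). if i = p j then 1 else 0)"] exI[of _ k] conjI)
        (auto simp: eq[OF p])
  qed
qed

lemma recovers_covariance_iff:
  assumes "S \<in> carrier_mat n n"
  shows "recovers_covariance \<epsilon> S (mat n n (\<lambda>(i, j). X i j)) \<longleftrightarrow> sqrt (\<Sum>i<n. \<Sum>j<n. (X i j - S $$ (i, j))\<^sup>2) \<le> \<epsilon>"
  using assms by (simp add: recovers_covariance_def frobenius_norm_def)

text \<open>Indispensable for the lower bound on the probability: \<open>measure\<close> is 0 by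
  convention on sets that are not measurable, so monotonicity needs this.\<close>

lemma sets_succeeds:
  assumes A: "A \<in> carrier_mat n n" and S: "S \<in> carrier_mat n n"
    and y: "\<And>t i. i < n \<Longrightarrow> (\<lambda>w. fst w t i) \<in> borel_measurable M"
    and b: "\<And>t. (\<lambda>w. snd w t) \<in> M \<rightarrow>\<^sub>M count_space UNIV"
  shows "{w \<in> space M. succeeds prog n \<epsilon> A S T w} \<in> sets M"
proof -
  define X where "X k w = runs k n (fst w) (snd w) prog (True, 0, init_state n \<epsilon>)" for k and w :: "(nat \<Rightarrow> nat \<Rightarrow> real) \<times> (nat \<Rightarrow> bool)"
  have "measurable_conf M (\<lambda>w. (True, 0, init_state n \<epsilon>))" by (simp add: measurable_conf_def)
  then have X: "measurable_conf M (X k)" for k unfolding X_def by (intro measurable_runs y b)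
  note [measurable] = measurable_confD[OF X]
  have fin: "finite {p. p permutes {..<n}}" by (rule finite_permutations) simp
  have iff: "succeeds prog n \<epsilon> A S T w \<longleftrightarrow> (\<exists>k. fst (X k w) \<and> real (fst (snd (X k w))) \<le> T \<and>
    real (samples (snd (snd (X k w)))) \<le> T \<and> recovers_mixing n \<epsilon> A (matrix_of n (snd (snd (X k w))) 1) \<and>
    recovers_covariance \<epsilon> S (matrix_of n (snd (snd (X k w))) 2))" for w
  proof
    assume "succeeds prog n \<epsilon> A S T w"
    then obtain t s where ts: "exec n (fst w) (snd w) prog (init_state n \<epsilon>) t s" "real t \<le> T" "real (samples s) \<le> T"
      "recovers_mixing n \<epsilon> A (matrix_of n s 1)" "recovers_covariance \<epsilon> S (matrix_of n s 2)"
      unfolding succeeds_def by (cases w) auto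
    from ts(1) obtain k where "X k w = (True, t, s)" unfolding exec_iff_runs X_def by blast
    with ts show "\<exists>k. fst (X k w) \<and> real (fst (snd (X k w))) \<le> T \<and>
    real (samples (snd (snd (X k w)))) \<le> T \<and> recovers_mixing n \<epsilon> A (matrix_of n (snd (snd (X k w))) 1) \<and>
    recovers_covariance \<epsilon> S (matrix_of n (snd (snd (X k w))) 2)" by (intro exI[of _ k]) simp
  next
    assume "\<exists>k. fst (X k w) \<and> real (fst (snd (X k w))) \<le> T \<and>
    real (samples (snd (snd (X k w)))) \<le> T \<and> recovers_mixing n \<epsilon> A (matrix_of n (snd (snd (X k w))) 1) \<and>
    recovers_covariance \<epsilon> S (matrix_of n (snd (snd (X k w))) 2)"
    then obtain k where k: "fst (X k w)" "real (fst (snd (X k w))) \<le> T"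
      "real (samples (snd (snd (X k w)))) \<le> T" "recovers_mixing n \<epsilon> A (matrix_of n (snd (snd (X k w))) 1)"
      "recovers_covariance \<epsilon> S (matrix_of n (snd (snd (X k w))) 2)" by blast
    obtain f t s where X: "X k w = (f, t, s)" by (rule prod_cases3)
    then have "exec n (fst w) (snd w) prog (init_state n \<epsilon>) t s"
      unfolding exec_iff_runs using k(1) by (auto simp: X_def)
    then show "succeeds prog n \<epsilon> A S T w" unfolding succeeds_def using k X by (cases w) auto
  qed
  have mA: "recovers_mixing n \<epsilon> A (matrix_of n s 1) \<longleftrightarrow> (\<exists>p\<in>{p. p permutes {..<n}}. \<exists>k\<in>{..<n} \<rightarrow>\<^sub>E {1, - 1}.
      sqrt (\<Sum>i<n. \<Sum>j<n. (reals s 1 (i * n + j) - A $$ (i, p j) * k j)\<^sup>2) \<le> \<epsilon>)" for s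
    unfolding matrix_of_def by (rule recovers_mixing_iff[OF A])
  have mS: "recovers_covariance \<epsilon> S (matrix_of n s 2) \<longleftrightarrow>
      sqrt (\<Sum>i<n. \<Sum>j<n. (reals s 2 (i * n + j) - S $$ (i, j))\<^sup>2) \<le> \<epsilon>" for s
    unfolding matrix_of_def by (rule recovers_covariance_iff[OF S])
  have [measurable]: "Measurable.pred M (\<lambda>w. \<exists>p\<in>{p. p permutes {..<n}}. \<exists>k'\<in>{..<n} \<rightarrow>\<^sub>E {1, - 1}.
      sqrt (\<Sum>i<n. \<Sum>j<n. (reals (snd (snd (X k w))) 1 (i * n + j) - A $$ (i, p j) * k' j)\<^sup>2) \<le> \<epsilon>)" for k
    by (intro pred_intros_finite fin finite_signs) measurable
  show ?thesis unfolding iff mA mS by measurable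
qed

section \<open>Concentration\<close>

lemma indep_coordinates:
  assumes D: "prob_space D"
  shows "prob_space.indep_vars (Pi\<^sub>M UNIV (\<lambda>_::nat. D)) (\<lambda>_. D) (\<lambda>t y. y t) UNIV"
proof -
  interpret product_prob_space "\<lambda>_::nat. D" UNIV
    using D by (simp add: product_prob_space_def product_sigma_finite_def product_prob_space_axioms_def
        prob_space_imp_sigma_finite)
  have eq: "distr (Pi\<^sub>M UNIV (\<lambda>_::nat. D)) (Pi\<^sub>M UNIV (\<lambda>_. D)) (\<lambda>x. \<lambda>i\<in>UNIV. x i) = Pi\<^sub>M UNIV (\<lambda>_. D)"
    unfolding restrict_def by (simp add: distr_id)
  show ?thesis
    by (subst P.indep_vars_iff_distr_eq_PiM) (simp_all add: eq PiM_component)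
qed

text \<open>After centering, which only lowers the second moment, the cross terms vanish by
  independence and the average has variance at most B / m. The shift \<open>off\<close> places the
  block anywhere in the stream.\<close>

lemma block_chebyshev:
  fixes g :: "'a \<Rightarrow> real"
  assumes D: "prob_space D" and g [measurable]: "g \<in> borel_measurable D" and g2: "integrable D (\<lambda>x. (g x)\<^sup>2)"
    and B: "(\<integral>x. (g x)\<^sup>2 \<partial>D) \<le> B" and m: "0 < m" and a: "0 < a"
  shows "measure (Pi\<^sub>M UNIV (\<lambda>_::nat. D)) {y \<in> space (Pi\<^sub>M UNIV (\<lambda>_::nat. D)).
    a \<le> \<bar>(\<Sum>t<m. g (y (off + t)) / real m) - (\<integral>x. g x \<partial>D)\<bar>} \<le> B / (real m * a\<^sup>2)"
proof -
  interpret D: prob_space D by fact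
  let ?M = "Pi\<^sub>M UNIV (\<lambda>_::nat. D)"
  interpret product_prob_space "\<lambda>_::nat. D" UNIV
    using D by (simp add: product_prob_space_def product_sigma_finite_def product_prob_space_axioms_def
        prob_space_imp_sigma_finite)
  define \<mu> where "\<mu> = (\<integral>x. g x \<partial>D)"
  define h where "h x = g x - \<mu>" for x
  define X where "X t y = h (y (off + t))" for t :: nat and y :: "nat \<Rightarrow> 'a"
  have [measurable]: "h \<in> borel_measurable D" unfolding h_def by measurable
  have gi: "integrable D g" using g2 g by (rule D.square_integrable_imp_integrable[rotated])
  have comp: "distr ?M D (\<lambda>y. y t) = D" for t by (rule PiM_component) simp
  have trans: "integrable D f \<Longrightarrow> integrable ?M (\<lambda>y. f (y t))" "(\<integral>y. f (y t) \<partial>?M) = (\<integral>x. f x \<partial>D)"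
    if [measurable]: "f \<in> borel_measurable D" for f :: "'a \<Rightarrow> real" and t
    using integrable_distr_eq[of "\<lambda>y. y t" ?M D f] integral_distr[of "\<lambda>y. y t" ?M D f] by (simp_all add: comp)
  have h2: "integrable D (\<lambda>x. (h x)\<^sup>2)" unfolding h_def power2_diff using gi g2 by simp
  have h1: "integrable D h" "(\<integral>x. h x \<partial>D) = 0" unfolding h_def using gi by (simp_all add: \<mu>_def D.prob_space)
  have hB: "(\<integral>x. (h x)\<^sup>2 \<partial>D) \<le> B"
  proof -
    have "(\<integral>x. (h x)\<^sup>2 \<partial>D) = (\<integral>x. (g x)\<^sup>2 \<partial>D) - \<mu>\<^sup>2"
      using D.variance_eq[OF gi g2] by (simp add: h_def \<mu>_def)
    then show ?thesis using B by (smt (verit) zero_le_power2)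
  qed
  have ind: "P.indep_vars (\<lambda>_. borel) (\<lambda>t y. h (y t)) UNIV"
    using P.indep_vars_compose2[OF indep_coordinates[OF D], of "\<lambda>_. h" "\<lambda>_. borel"] by simp
  have Xint: "integrable ?M (X t)" "P.expectation (X t) = 0" "integrable ?M (\<lambda>y. (X t y)\<^sup>2)"
    "P.expectation (\<lambda>y. (X t y)\<^sup>2) \<le> B" for t
    using trans[of h "off + t"] trans[of "\<lambda>x. (h x)\<^sup>2" "off + t"] h1 h2 hB
    by (simp_all add: X_def[abs_def])
  have hi: "integrable ?M (\<lambda>y. h (y t))" for t using trans(1)[of h t] h1 by simp
  have XX: "integrable ?M (\<lambda>y. X s y * X t y)" "s \<noteq> t \<Longrightarrow> P.expectation (\<lambda>y. X s y * X t y) = 0" for s t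
  proof -
    have *: "integrable ?M (\<lambda>y. X s y * X t y) \<and> P.expectation (\<lambda>y. X s y * X t y) = 0" if "s \<noteq> t"
    proof -
      have "P.indep_vars (\<lambda>_. borel) (\<lambda>t y. h (y t)) {off + s, off + t}"
        using ind by (rule P.indep_vars_subset) simp
      from P.indep_vars_lebesgue_integral[OF _ this] P.indep_vars_integrable[OF _ this]
      show ?thesis using that hi Xint(2)[of s] by (auto simp: X_def[abs_def])
    qed
    show "integrable ?M (\<lambda>y. X s y * X t y)" using * Xint(3)[of s] by (cases "s = t") (auto simp: power2_eq_square)
    show "P.expectation (\<lambda>y. X s y * X t y) = 0" if "s \<noteq> t" using * that by blast
  qed
  define f where "f y = (\<Sum>t<m. X t y / real m)" for y
  have [measurable]: "f \<in> borel_measurable ?M" unfolding f_def X_def by measurable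
  have f2: "(f y)\<^sup>2 = (\<Sum>s<m. \<Sum>t<m. X s y * X t y) / (real m)\<^sup>2" for y
    by (simp add: f_def sum_divide_distrib[symmetric] power_divide power2_eq_square sum_product)
  have int2: "integrable ?M (\<lambda>y. (f y)\<^sup>2)" unfolding f2 using XX by simp
  have ex: "P.expectation f = 0" unfolding f_def using Xint by simp
  have "P.expectation (\<lambda>y. (f y)\<^sup>2) = (\<Sum>s<m. \<Sum>t<m. P.expectation (\<lambda>y. X s y * X t y)) / (real m)\<^sup>2"
    unfolding f2 using XX by simp
  also have "(\<Sum>s<m. \<Sum>t<m. P.expectation (\<lambda>y. X s y * X t y)) = (\<Sum>s<m. P.expectation (\<lambda>y. (X s y)\<^sup>2))"
  proof (rule sum.cong)
    fix s assume s: "s \<in> {..<m}"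
    have "(\<Sum>t<m. P.expectation (\<lambda>y. X s y * X t y)) = (\<Sum>t\<in>{s}. P.expectation (\<lambda>y. X s y * X t y))"
      by (rule sum.mono_neutral_right) (use s XX in auto)
    then show "(\<Sum>t<m. P.expectation (\<lambda>y. X s y * X t y)) = P.expectation (\<lambda>y. (X s y)\<^sup>2)"
      by (simp add: power2_eq_square)
  qed simp
  also have "\<dots> / (real m)\<^sup>2 \<le> (\<Sum>s<m. B) / (real m)\<^sup>2" using Xint by (intro divide_right_mono sum_mono) auto
  also have "\<dots> = B / real m" using m by (simp add: power2_eq_square)
  finally have var: "P.variance f \<le> B / real m" by (simp add: ex)
  have "measure ?M {y \<in> space ?M. a \<le> \<bar>f y - P.expectation f\<bar>} \<le> P.variance f / a\<^sup>2"
    by (rule P.Chebyshev_inequality) (use int2 a in auto)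
  also have "\<dots> \<le> B / real m / a\<^sup>2" using var by (intro divide_right_mono) auto
  finally have "measure ?M {y \<in> space ?M. a \<le> \<bar>f y\<bar>} \<le> B / (real m * a\<^sup>2)" by (simp add: ex)
  moreover have "f y = (\<Sum>t<m. g (y (off + t)) / real m) - \<mu>" for y
    using m by (simp add: f_def X_def h_def diff_divide_distrib sum_subtractf)
  ultimately show ?thesis by (simp add: \<mu>_def)
qed

section \<open>Random directions\<close>

abbreviation coin_space :: "(nat \<Rightarrow> bool) measure" where
  "coin_space \<equiv> Pi\<^sub>M UNIV (\<lambda>_. measure_pmf (bernoulli_pmf (1/2)))"

lemma prob_space_coin_space: "prob_space coin_space"
  by (rule prob_space_PiM) (rule measure_pmf.prob_space_axioms)

lemma measure_cylinder:
  assumes "finite J"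
  shows "measure coin_space {b. \<forall>j\<in>J. b j = f j} = (1 / 2) ^ card J"
proof -
  interpret product_prob_space "\<lambda>_::nat. measure_pmf (bernoulli_pmf (1/2))" UNIV
    by (simp add: product_prob_space_def product_sigma_finite_def product_prob_space_axioms_def
        prob_space_imp_sigma_finite measure_pmf.prob_space_axioms)
  have "emeasure coin_space {b \<in> space coin_space. \<forall>j\<in>J. b j \<in> {f j}} =
      (\<Prod>j\<in>J. emeasure (measure_pmf (bernoulli_pmf (1/2))) {f j})"
    by (rule emeasure_PiM_Collect) (use assms in auto)
  also have "\<dots> = (\<Prod>j\<in>J. ennreal (1 / 2))"
    by (intro prod.cong) (auto simp: emeasure_pmf_single pmf_bernoulli_True pmf_bernoulli_False split: bool.split)
  also have "\<dots> = ennreal ((1 / 2) ^ card J)" unfolding prod_constant by (rule ennreal_power) simp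
  finally show ?thesis by (simp add: measure_def space_PiM)
qed

lemma sets_cylinder: "finite J \<Longrightarrow> {b. \<forall>j\<in>J. b j = f j} \<in> sets coin_space"
proof -
  assume J: "finite J"
  have "{b \<in> space coin_space. \<forall>j\<in>J. b j = f j} \<in> sets coin_space" using J by measurable
  then show ?thesis by (simp add: space_PiM)
qed

text \<open>A counting argument: the coins in J - K leave at most one choice on K, so the event is a
  union of at most 2^|J - K| cylinders of measure 2^(-|J|).\<close>

lemma measure_determined_le:
  assumes J: "finite J" and K: "K \<subseteq> J"
    and B: "\<And>b b'. (\<And>j. j \<in> J \<Longrightarrow> b j = b' j) \<Longrightarrow> b \<in> B \<Longrightarrow> b' \<in> B"
    and det: "\<And>b b' j. b \<in> B \<Longrightarrow> b' \<in> B \<Longrightarrow> (\<And>j. j \<in> J - K \<Longrightarrow> b j = b' j) \<Longrightarrow> j \<in> K \<Longrightarrow> b j = b' j"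
  shows "B \<in> sets coin_space" "measure coin_space B \<le> (1 / 2) ^ card K"
proof -
  interpret prob_space coin_space by (rule prob_space_coin_space)
  define F where "F = (\<lambda>b. restrict b J) ` B"
  have "F \<subseteq> J \<rightarrow>\<^sub>E UNIV" by (auto simp: F_def)
  moreover have "finite (J \<rightarrow>\<^sub>E (UNIV :: bool set))" using J by (intro finite_PiE) auto
  ultimately have F: "finite F" by (rule finite_subset)
  have un: "B = (\<Union>f\<in>F. {b. \<forall>j\<in>J. b j = f j})"
  proof (rule equalityI; rule subsetI)
    fix b assume "b \<in> B"
    then show "b \<in> (\<Union>f\<in>F. {b. \<forall>j\<in>J. b j = f j})" by (auto simp: F_def intro!: bexI[of _ b])
  next
    fix b assume "b \<in> (\<Union>f\<in>F. {b. \<forall>j\<in>J. b j = f j})"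
    then obtain b' where "b' \<in> B" "\<forall>j\<in>J. b j = b' j" by (auto simp: F_def)
    then show "b \<in> B" using B[of b' b] by auto
  qed
  show "B \<in> sets coin_space" unfolding un by (intro sets.finite_UN F sets_cylinder J)
  have "inj_on (\<lambda>f. restrict f (J - K)) F"
  proof (rule inj_onI)
    fix f f' assume "f \<in> F" "f' \<in> F" and eq: "restrict f (J - K) = restrict f' (J - K)"
    then obtain b b' where b: "b \<in> B" "f = restrict b J" "b' \<in> B" "f' = restrict b' J" by (auto simp: F_def)
    have "b j = b' j" if "j \<in> J - K" for j using eq that b by (metis Diff_iff restrict_apply')
    then have "b j = b' j" if "j \<in> J" for j using det[OF b(1,3)] that by blast
    then show "f = f'" using b by (auto simp: restrict_def)
  qed
  then have "card F \<le> card ((J - K) \<rightarrow>\<^sub>E (UNIV :: bool set))"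
    by (rule card_inj_on_le) (use J in \<open>auto intro!: finite_PiE\<close>)
  also have "\<dots> = 2 ^ card (J - K)" using J by (simp add: card_PiE)
  finally have cF: "real (card F) \<le> 2 ^ card (J - K)" by (metis of_nat_le_iff of_nat_numeral of_nat_power)
  have "measure coin_space B \<le> (\<Sum>f\<in>F. measure coin_space {b. \<forall>j\<in>J. b j = f j})"
    unfolding un by (rule finite_measure_subadditive_finite) (use F sets_cylinder J in auto)
  also have "\<dots> = real (card F) * (1 / 2) ^ card J" using measure_cylinder[OF J] by simp
  also have "\<dots> \<le> 2 ^ card (J - K) * (1 / 2) ^ card J" using cF by (intro mult_right_mono) auto
  also have "card J = card (J - K) + card K" using J K by (simp add: card_Diff_subset finite_subset card_mono)
  then have "2 ^ card (J - K) * (1 / 2) ^ card J = (1 / 2 :: real) ^ card K"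
    by (simp add: power_add power_one_over)
  finally show "measure coin_space B \<le> (1 / 2) ^ card K" .
qed

section \<open>Moments of the sample distribution\<close>

lemma integrable_return_real:
  fixes f :: "real \<Rightarrow> real"
  assumes "f \<in> borel_measurable borel"
  shows "integrable (return borel c) f"
proof -
  interpret prob_space "return borel c" by (rule prob_space_return) simp
  show ?thesis by (rule integrable_const_bound[of _ "norm (f c)"]) (use assms in \<open>auto simp: AE_return\<close>)
qed

lemma abs_mult_le_squares: "\<bar>x * y\<bar> \<le> x\<^sup>2 + y\<^sup>2" for x y :: real
proof -
  have "0 \<le> \<bar>x\<bar> * \<bar>y\<bar>" by simp
  moreover have "2 * (\<bar>x\<bar> * \<bar>y\<bar>) \<le> x\<^sup>2 + y\<^sup>2"
    using sum_squares_bound[of "\<bar>x\<bar>" "\<bar>y\<bar>"] by (simp add: mult.assoc)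
  ultimately show ?thesis unfolding abs_mult by linarith
qed

text \<open>The constants 3 and 105 are the double factorials 3!! and 7!!. The degenerate case is a
  point mass and is treated separately.\<close>

lemma normal_distribution_moments:
  assumes "0 \<le> \<sigma>"
  shows "integrable (normal_distribution 0 \<sigma>) (\<lambda>x. x ^ k)"
    and "(\<integral>x. x ^ 2 \<partial>normal_distribution 0 \<sigma>) = \<sigma>\<^sup>2"
    and "(\<integral>x. x ^ 4 \<partial>normal_distribution 0 \<sigma>) = 3 * \<sigma> ^ 4"
    and "(\<integral>x. x ^ 8 \<partial>normal_distribution 0 \<sigma>) = 105 * \<sigma> ^ 8"
    and "odd k \<Longrightarrow> (\<integral>x. x ^ k \<partial>normal_distribution 0 \<sigma>) = 0"
proof -
  have int: "integrable (density lborel (normal_density 0 \<sigma>)) (\<lambda>x. x ^ k)" if "0 < \<sigma>" for k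
    using integrable_normal_moment[OF that, of 0 k] by (subst integrable_density) auto
  have ev: "(\<integral>x. x ^ k \<partial>density lborel (normal_density 0 \<sigma>)) = (\<integral>x. normal_density 0 \<sigma> x * (x - 0) ^ k \<partial>lborel)" for k
    by (subst integral_density) auto
  show "integrable (normal_distribution 0 \<sigma>) (\<lambda>x. x ^ k)"
    using assms int[of k] by (auto simp: normal_distribution_def integrable_return_real)
  have pos: "0 < \<sigma> \<or> \<sigma> = 0" using assms by auto
  have even: "(\<integral>x. x ^ (2 * k) \<partial>normal_distribution 0 \<sigma>) = fact (2 * k) / (2 ^ k * fact k) * \<sigma> ^ (2 * k)"
    if "0 < k" for k
  proof (cases "\<sigma> = 0")
    case True
    have "(\<integral>x. x ^ (2 * k) \<partial>return borel (0 :: real)) = 0 ^ (2 * k)" by (rule integral_return) auto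
    then show ?thesis using that True by (simp add: normal_distribution_def power_0_left)
  next
    case False
    then have p: "0 < \<sigma>" using assms by simp
    have "(\<integral>x. x ^ (2 * k) \<partial>normal_distribution 0 \<sigma>) = fact (2 * k) / ((2 / \<sigma>\<^sup>2) ^ k * fact k)"
      using ev[of "2 * k"] integral_normal_moment_even[OF p, of 0 k] False by (simp add: normal_distribution_def)
    also have "\<dots> = fact (2 * k) / (2 ^ k * fact k) * \<sigma> ^ (2 * k)" by (simp add: power_divide power_mult)
    finally show ?thesis .
  qed
  show "(\<integral>x. x ^ 2 \<partial>normal_distribution 0 \<sigma>) = \<sigma>\<^sup>2" using even[of 1] by simp
  show "(\<integral>x. x ^ 4 \<partial>normal_distribution 0 \<sigma>) = 3 * \<sigma> ^ 4" using even[of 2] by (simp add: fact_numeral)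
  show "(\<integral>x. x ^ 8 \<partial>normal_distribution 0 \<sigma>) = 105 * \<sigma> ^ 8" using even[of 4] by (simp add: fact_numeral)
  show "(\<integral>x. x ^ k \<partial>normal_distribution 0 \<sigma>) = 0" if odd: "odd k"
  proof -
    obtain j where j: "k = 2 * j + 1" using odd by (rule oddE)
    show ?thesis unfolding j
    proof (cases "\<sigma> = 0")
      case True
      have "(\<integral>x. x ^ (2 * j + 1) \<partial>return borel (0 :: real)) = 0 ^ (2 * j + 1)" by (rule integral_return) auto
      then show "(\<integral>x. x ^ (2 * j + 1) \<partial>normal_distribution 0 \<sigma>) = 0" using True by (simp add: normal_distribution_def)
    next
      case False
      then show "(\<integral>x. x ^ (2 * j + 1) \<partial>normal_distribution 0 \<sigma>) = 0"
        using assms integral_normal_moment_odd[of \<sigma> 0 j] ev[of "2 * j + 1"] by (simp add: normal_distribution_def)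
    qed
  qed
qed

section \<open>Linear forms in the Gaussian noise\<close>

locale gaussian_noise =
  fixes n :: nat and N :: "(nat \<Rightarrow> real) measure"
  assumes gauss: "gaussian_vector n N" and cent: "centered n N"
begin

sublocale N: prob_space N
  using gauss by (simp add: gaussian_vector_def)

lemma sets_N: "sets N = sets (Pi\<^sub>M {..<n} (\<lambda>_. borel))"
  using gauss by (simp add: gaussian_vector_def)

lemma component_measurable [measurable]: "i < n \<Longrightarrow> (\<lambda>z. z i) \<in> borel_measurable N"
  unfolding measurable_cong_sets[OF sets_N refl] by (rule measurable_component_singleton) simp

lemma form_measurable [measurable]: "(\<lambda>z. ip n u z) \<in> borel_measurable N"
  unfolding ip_def by measurable

lemma form_integrable1: "integrable N (\<lambda>z. z i)" if i: "i < n"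
proof -
  obtain \<mu> \<sigma> where s: "0 \<le> \<sigma>" and d: "distr N borel (\<lambda>z. \<Sum>j<n. unitv i j * z j) = normal_distribution \<mu> \<sigma>"
    using gauss unfolding gaussian_vector_def by blast
  have "integrable (normal_distribution \<mu> \<sigma>) (\<lambda>x. x)"
    using s integrable_normal_moment_nz_1[of \<sigma> \<mu>]
    by (auto simp: normal_distribution_def integrable_return_real less_le integrable_density)
  then have "integrable N (\<lambda>z. \<Sum>j<n. unitv i j * z j)"
    unfolding d[symmetric] by (subst (asm) integrable_distr_eq) (auto simp flip: ip_def)
  moreover have "(\<Sum>j<n. unitv i j * z j) = z i" for z :: "nat \<Rightarrow> real"
    using i ip_unitv[of i n z] by (simp add: ip_def mult.commute)
  ultimately show ?thesis by simp
qed

lemma form_normal: "\<exists>\<sigma>\<ge>0. distr N borel (\<lambda>z. ip n u z) = normal_distribution 0 \<sigma>"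
proof -
  obtain \<mu> \<sigma> where s: "0 \<le> \<sigma>" and d: "distr N borel (\<lambda>z. \<Sum>j<n. u j * z j) = normal_distribution \<mu> \<sigma>"
    using gauss unfolding gaussian_vector_def by blast
  have d': "distr N borel (\<lambda>z. ip n u z) = normal_distribution \<mu> \<sigma>" using d by (simp add: ip_def)
  have "(\<integral>x. x \<partial>normal_distribution \<mu> \<sigma>) = \<mu>"
  proof (cases "\<sigma> = 0")
    case False
    then have "0 < \<sigma>" using s by simp
    then show ?thesis using integral_normal_moment_nz_1[of \<sigma> \<mu>] False
      by (simp add: normal_distribution_def integral_density)
  next
    case True
    have "(\<integral>x. x \<partial>return borel \<mu>) = \<mu>" by (rule integral_return) auto
    then show ?thesis using True by (simp add: normal_distribution_def)
  qed
  moreover have "(\<integral>x. x \<partial>normal_distribution \<mu> \<sigma>) = (\<integral>z. ip n u z \<partial>N)"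
    unfolding d'[symmetric] by (rule integral_distr) measurable
  moreover have "(\<integral>z. ip n u z \<partial>N) = (\<Sum>i<n. u i * (\<integral>z. z i \<partial>N))"
    unfolding ip_def using form_integrable1 by (subst Bochner_Integration.integral_sum) auto
  then have "(\<integral>z. ip n u z \<partial>N) = 0" using cent by (simp add: centered_def)
  ultimately show ?thesis using d' s by auto
qed

definition cov :: "nat \<Rightarrow> nat \<Rightarrow> real" where "cov i j = (\<integral>z. z i * z j \<partial>N)"

lemma form_moments:
  shows form_integrable: "integrable N (\<lambda>z. ip n u z ^ k)"
    and form_odd: "odd k \<Longrightarrow> (\<integral>z. ip n u z ^ k \<partial>N) = 0"
    and form_4: "(\<integral>z. ip n u z ^ 4 \<partial>N) = 3 * (\<integral>z. ip n u z ^ 2 \<partial>N)\<^sup>2"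
    and form_8: "(\<integral>z. ip n u z ^ 8 \<partial>N) = 105 * (\<integral>z. ip n u z ^ 2 \<partial>N) ^ 4"
proof -
  obtain \<sigma> where s: "0 \<le> \<sigma>" and d: "distr N borel (\<lambda>z. ip n u z) = normal_distribution 0 \<sigma>"
    using form_normal by blast
  have tr: "(\<integral>z. ip n u z ^ k \<partial>N) = (\<integral>x. x ^ k \<partial>normal_distribution 0 \<sigma>)" for k
    unfolding d[symmetric] by (rule integral_distr[symmetric]) measurable
  show "integrable N (\<lambda>z. ip n u z ^ k)"
    using normal_distribution_moments(1)[OF s, of k] unfolding d[symmetric] by (subst (asm) integrable_distr_eq) auto
  show "(\<integral>z. ip n u z ^ k \<partial>N) = 0" if "odd k" using normal_distribution_moments(5)[OF s that] tr by simp
  show "(\<integral>z. ip n u z ^ 4 \<partial>N) = 3 * (\<integral>z. ip n u z ^ 2 \<partial>N)\<^sup>2"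
    using normal_distribution_moments(2,3)[OF s] by (simp only: tr) simp
  show "(\<integral>z. ip n u z ^ 8 \<partial>N) = 105 * (\<integral>z. ip n u z ^ 2 \<partial>N) ^ 4"
    using normal_distribution_moments(2,4)[OF s] by (simp only: tr) (simp flip: power_mult)
qed

lemma component_form: "i < n \<Longrightarrow> ip n (unitv i) z = z i"
  using ip_unitv[of i n z] by (simp add: ip_commute)

lemma prod2_integrable: "i < n \<Longrightarrow> j < n \<Longrightarrow> integrable N (\<lambda>z. z i * z j)"
proof -
  assume i: "i < n" and j: "j < n"
  have "integrable N (\<lambda>z. (z i)\<^sup>2)" "integrable N (\<lambda>z. (z j)\<^sup>2)"
    using form_integrable[of "unitv i" 2] form_integrable[of "unitv j" 2] i j by (simp_all add: component_form)
  then have "integrable N (\<lambda>z. (z i)\<^sup>2 + (z j)\<^sup>2)" by (rule Bochner_Integration.integrable_add)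
  then show ?thesis
  proof (rule Bochner_Integration.integrable_bound)
    show "AE z in N. norm (z i * z j) \<le> norm ((z i)\<^sup>2 + (z j)\<^sup>2)"
      using abs_mult_le_squares by (intro AE_I2) (simp add: real_norm_def)
  qed (use i j in measurable)
qed

lemma form_2: "(\<integral>z. ip n u z ^ 2 \<partial>N) = ip n u (mv n cov u)"
proof -
  have "ip n u z ^ 2 = (\<Sum>i<n. \<Sum>j<n. u i * u j * (z i * z j))" for z
    by (simp add: ip_def power2_eq_square sum_product mult_ac)
  then have "(\<integral>z. ip n u z ^ 2 \<partial>N) = (\<integral>z. (\<Sum>i<n. \<Sum>j<n. u i * u j * (z i * z j)) \<partial>N)" by simp
  also have "\<dots> = (\<Sum>i<n. \<integral>z. (\<Sum>j<n. u i * u j * (z i * z j)) \<partial>N)"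
    by (rule Bochner_Integration.integral_sum) (auto intro!: Bochner_Integration.integrable_sum prod2_integrable)
  also have "\<dots> = (\<Sum>i<n. \<Sum>j<n. \<integral>z. u i * u j * (z i * z j) \<partial>N)"
    by (intro sum.cong refl Bochner_Integration.integral_sum) (auto intro!: prod2_integrable)
  finally have "(\<integral>z. ip n u z ^ 2 \<partial>N) = (\<Sum>i<n. \<Sum>j<n. u i * u j * cov i j)" by (simp add: cov_def)
  then show ?thesis by (simp add: ip_def mv_def sum_distrib_left mult_ac)
qed

lemma covariance_mat_cov: "i < n \<Longrightarrow> j < n \<Longrightarrow> covariance_mat n N $$ (i, j) = cov i j"
  using cent by (simp add: covariance_mat_def cov_def centered_def)

end

section \<open>Linear forms in random signs\<close>

abbreviation signs :: "nat \<Rightarrow> (nat \<Rightarrow> real) set" where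
  "signs n \<equiv> {..<n} \<rightarrow>\<^sub>E {-1, 1}"

lemma finite_signs': "finite (signs n)"
  by (intro finite_PiE) auto

lemma card_signs: "card (signs n) = 2 ^ n"
  by (simp add: card_PiE numeral_2_eq_2)

lemma sum_signs_Suc: "(\<Sum>x\<in>signs (Suc n). f x) = (\<Sum>x\<in>signs n. f (x(n := -1)) + f (x(n := 1)))"
proof -
  have eq: "signs (Suc n) = (\<lambda>(c, g). g(n := c)) ` ({-1, 1} \<times> signs n)"
    by (simp add: lessThan_Suc PiE_insert_eq)
  have inj: "inj_on (\<lambda>(c, g). g(n := c)) ({-1, 1} \<times> signs n)"
    using inj_combinator[of n "{..<n}" "\<lambda>_. {-1, 1 :: real}"] by simp
  have "(\<Sum>x\<in>signs (Suc n). f x) = (\<Sum>(c, g)\<in>{-1, 1} \<times> signs n. f (g(n := c)))"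
    unfolding eq by (subst sum.reindex[OF inj]) (simp add: case_prod_unfold)
  also have "\<dots> = (\<Sum>c\<in>{-1, 1}. \<Sum>g\<in>signs n. f (g(n := c)))" by (rule sum.cartesian_product[symmetric])
  finally show ?thesis by (simp add: sum.distrib)
qed

lemma ip_fun_upd: "ip (Suc n) v (x(n := c)) = ip n v x + v n * c"
  by (simp add: ip_def)

lemma sum_signs_2: "(\<Sum>x\<in>signs n. (ip n v x)\<^sup>2) = 2 ^ n * ip n v v"
proof (induction n)
  case (Suc n)
  have "(ip (Suc n) v (x(n := -1)))\<^sup>2 + (ip (Suc n) v (x(n := 1)))\<^sup>2 = 2 * (ip n v x)\<^sup>2 + 2 * (v n)\<^sup>2" for x
    unfolding ip_fun_upd by (simp add: power2_eq_square algebra_simps)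
  then have "(\<Sum>x\<in>signs (Suc n). (ip (Suc n) v x)\<^sup>2) = 2 * (2 ^ n * ip n v v) + 2 ^ n * (2 * (v n)\<^sup>2)"
    unfolding sum_signs_Suc by (simp add: sum.distrib sum_distrib_left[symmetric] Suc card_signs)
  then show ?case by (simp add: ip_def power2_eq_square algebra_simps)
qed (simp add: ip_def)

text \<open>Splitting off the last sign cancels the odd powers. The deviation -2 sum v_i^4 from the
  Gaussian value is the fourth cumulant, the only source of information about the columns.\<close>

lemma sum_signs_4: "(\<Sum>x\<in>signs n. (ip n v x) ^ 4) = 2 ^ n * (3 * (ip n v v)\<^sup>2 - 2 * (\<Sum>i<n. v i ^ 4))"
proof (induction n)
  case (Suc n)
  have "(ip (Suc n) v (x(n := -1))) ^ 4 + (ip (Suc n) v (x(n := 1))) ^ 4 =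
      2 * (ip n v x) ^ 4 + (12 * (v n)\<^sup>2) * (ip n v x)\<^sup>2 + 2 * (v n) ^ 4" for x
    unfolding ip_fun_upd by (simp add: power2_eq_square power4_eq_xxxx algebra_simps)
  then have "(\<Sum>x\<in>signs (Suc n). (ip (Suc n) v x) ^ 4) =
      2 * (2 ^ n * (3 * (ip n v v)\<^sup>2 - 2 * (\<Sum>i<n. v i ^ 4))) + (12 * (v n)\<^sup>2) * (2 ^ n * ip n v v) + 2 ^ n * (2 * (v n) ^ 4)"
    unfolding sum_signs_Suc by (simp add: sum.distrib sum_distrib_left[symmetric] Suc card_signs sum_signs_2)
  also have "\<dots> = 2 ^ Suc n * (3 * (ip n v v + v n * v n)\<^sup>2 - 2 * ((\<Sum>i<n. v i ^ 4) + v n ^ 4))"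
    by (simp add: power2_eq_square power4_eq_xxxx algebra_simps)
  also have "\<dots> = 2 ^ Suc n * (3 * (ip (Suc n) v v)\<^sup>2 - 2 * (\<Sum>i<Suc n. v i ^ 4))" by (simp add: ip_def)
  finally show ?case .
qed (simp add: ip_def)

section \<open>Moments and cumulants of the samples\<close>

locale ica_model = gaussian_noise +
  fixes A :: "real mat"
  assumes A: "A \<in> carrier_mat n n"
begin

definition Af :: "nat \<Rightarrow> nat \<Rightarrow> real" where "Af i j = A $$ (i, j)"

definition C :: "nat \<Rightarrow> nat \<Rightarrow> real" where "C i j = (\<Sum>k<n. Af i k * Af j k) + cov i j"

abbreviation D :: "(nat \<Rightarrow> real) measure" where "D \<equiv> ica_sample n A N"

abbreviation mix :: "(nat \<Rightarrow> real) \<Rightarrow> (nat \<Rightarrow> real) \<Rightarrow> nat \<Rightarrow> real" where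
  "mix x z \<equiv> (\<lambda>i\<in>{..<n}. mv n Af x i + z i)"

lemma D_eq: "D = distr (uniform_signs n \<Otimes>\<^sub>M N) (Pi\<^sub>M {..<n} (\<lambda>_. borel)) (\<lambda>(x, z). mix x z)"
  unfolding ica_sample_def
proof (rule distr_cong, goal_cases)
  case (3 w)
  have "vec_index (A *\<^sub>v Matrix.vec n x) i = mv n Af x i" if "i < n" for x i
    using A that by (simp add: mv_def Af_def scalar_prod_def atLeast0LessThan)
  then show ?case by (auto simp: case_prod_unfold restrict_def)
qed auto

lemma mix_measurable [measurable]:
  "(\<lambda>(x, z). mix x z) \<in> uniform_signs n \<Otimes>\<^sub>M N \<rightarrow>\<^sub>M Pi\<^sub>M {..<n} (\<lambda>_. borel)"
proof -
  have "(\<lambda>w. mv n Af (fst w) i + snd w i) \<in> borel_measurable (uniform_signs n \<Otimes>\<^sub>M N)" if i: "i < n" for i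
  proof (rule borel_measurable_add)
    have "(\<lambda>x. mv n Af x i) \<in> borel_measurable (uniform_signs n)" by (simp add: uniform_signs_def)
    then show "(\<lambda>w. mv n Af (fst w) i) \<in> borel_measurable (uniform_signs n \<Otimes>\<^sub>M N)"
      by (rule measurable_compose[OF measurable_fst])
    show "(\<lambda>w. snd w i) \<in> borel_measurable (uniform_signs n \<Otimes>\<^sub>M N)"
      using i by (intro measurable_compose[OF measurable_snd component_measurable])
  qed
  then show ?thesis unfolding case_prod_unfold by (intro measurable_restrict) auto
qed

lemma uniform_signs_prob: "prob_space (uniform_signs n)"
  unfolding uniform_signs_def by (rule measure_pmf.prob_space_axioms)

lemma prob_space_D: "prob_space D"
proof -
  interpret U: prob_space "uniform_signs n" by (rule uniform_signs_prob)
  interpret UN: pair_prob_space "uniform_signs n" N ..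
  show ?thesis unfolding D_eq by (rule UN.prob_space_distr) measurable
qed

lemma sets_D [measurable_cong]: "sets D = sets (Pi\<^sub>M {..<n} (\<lambda>_. borel))"
  unfolding D_eq by simp

lemma set_pmf_signs: "set_pmf (pmf_of_set (signs n)) = signs n"
  using finite_signs'[of n] card_signs[of n] by (intro set_pmf_of_set) (auto simp flip: card_gt_0_iff)

lemma integral_signs: "(\<integral>x. f x \<partial>uniform_signs n) = (\<Sum>x\<in>signs n. f x) / 2 ^ n" for f :: "(nat \<Rightarrow> real) \<Rightarrow> real"
  unfolding uniform_signs_def using finite_signs'[of n] card_signs[of n]
  by (subst integral_pmf_of_set) (auto simp flip: card_gt_0_iff)

text \<open>Fubini, with the outer integral a finite average over sign patterns; hence integrability
  over the noise for each fixed pattern suffices.\<close>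

lemma integral_D:
  fixes f :: "(nat \<Rightarrow> real) \<Rightarrow> real"
  assumes f [measurable]: "f \<in> borel_measurable (Pi\<^sub>M {..<n} (\<lambda>_. borel))"
    and int: "\<And>x. x \<in> signs n \<Longrightarrow> integrable N (\<lambda>z. f (mix x z))"
  shows "integrable D f" "(\<integral>y. f y \<partial>D) = (\<Sum>x\<in>signs n. \<integral>z. f (mix x z) \<partial>N) / 2 ^ n"
proof -
  interpret U: prob_space "uniform_signs n" by (rule uniform_signs_prob)
  interpret UN: pair_prob_space "uniform_signs n" N ..
  have [measurable]: "(\<lambda>(x, z). f (mix x z)) \<in> borel_measurable (uniform_signs n \<Otimes>\<^sub>M N)"
    using measurable_compose[OF mix_measurable f] by (simp add: case_prod_unfold)
  have i: "integrable (uniform_signs n \<Otimes>\<^sub>M N) (\<lambda>(x, z). f (mix x z))"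
  proof (rule UN.Fubini_integrable)
    show "integrable (uniform_signs n) (\<lambda>x. \<integral>z. norm (case (x, z) of (x, z) \<Rightarrow> f (mix x z)) \<partial>N)"
      unfolding uniform_signs_def by (rule integrable_measure_pmf_finite) (simp add: set_pmf_signs finite_signs')
    show "AE x in uniform_signs n. integrable N (\<lambda>z. case (x, z) of (x, z) \<Rightarrow> f (mix x z))"
      unfolding uniform_signs_def AE_measure_pmf_iff set_pmf_signs using int by auto
  qed measurable
  show "integrable D f" unfolding D_eq
    by (subst integrable_distr_eq) (use i in \<open>auto simp: case_prod_unfold\<close>)
  have "(\<integral>y. f y \<partial>D) = (\<integral>w. (case w of (x, z) \<Rightarrow> f (mix x z)) \<partial>(uniform_signs n \<Otimes>\<^sub>M N))"
    unfolding D_eq by (subst integral_distr) (auto simp: case_prod_unfold)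
  also have "\<dots> = (\<integral>x. (\<integral>z. f (mix x z) \<partial>N) \<partial>uniform_signs n)"
    using UN.integral_fst'[OF i] by simp
  also have "\<dots> = (\<Sum>x\<in>signs n. \<integral>z. f (mix x z) \<partial>N) / 2 ^ n" by (rule integral_signs)
  finally show "(\<integral>y. f y \<partial>D) = (\<Sum>x\<in>signs n. \<integral>z. f (mix x z) \<partial>N) / 2 ^ n" .
qed

lemma ip_mix: "ip n w (mix x z) = ip n (mv n (tr Af) w) x + ip n w z"
proof -
  have "ip n w (mix x z) = ip n w (\<lambda>i. mv n Af x i + z i)" by (rule ip_cong) auto
  also have "\<dots> = ip n w (mv n Af x) + ip n w z" by (simp add: ip_def distrib_left sum.distrib)
  also have "ip n w (mv n Af x) = ip n (mv n (tr Af) w) x" by (metis ip_mv ip_commute)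
  finally show ?thesis .
qed

lemma ip_measurable [measurable]: "ip n w \<in> borel_measurable (Pi\<^sub>M {..<n} (\<lambda>_. borel))"
  unfolding ip_def by measurable

text \<open>The second moment of <w, y> by \<open>moment_2\<close>; \<open>q_eq\<close> splits it
  into the signal part |A^T w|^2 and the noise part \<open>\<sigma>2 w\<close>.\<close>

definition q :: "(nat \<Rightarrow> real) \<Rightarrow> real" where "q w = ip n w (mv n C w)"

definition v :: "(nat \<Rightarrow> real) \<Rightarrow> nat \<Rightarrow> real" where "v w = mv n (tr Af) w"

definition \<sigma>2 :: "(nat \<Rightarrow> real) \<Rightarrow> real" where "\<sigma>2 w = (\<integral>z. ip n w z ^ 2 \<partial>N)"

lemma q_eq: "q w = ip n (v w) (v w) + \<sigma>2 w"
proof -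
  have "mv n C w i = mv n Af (mv n (tr Af) w) i + mv n cov w i" for i
  proof -
    have "mv n Af (mv n (tr Af) w) i = (\<Sum>k<n. \<Sum>j<n. Af i k * (Af j k * w j))"
      by (simp add: mv_def tr_def sum_distrib_left)
    also have "\<dots> = (\<Sum>j<n. \<Sum>k<n. Af i k * (Af j k * w j))" by (rule sum.swap)
    also have "\<dots> = (\<Sum>j<n. (\<Sum>k<n. Af i k * Af j k) * w j)" unfolding sum_distrib_right by (simp add: mult_ac)
    finally show ?thesis by (simp add: mv_def C_def distrib_right sum.distrib)
  qed
  then have "q w = ip n w (mv n Af (mv n (tr Af) w)) + ip n w (mv n cov w)"
    by (simp add: q_def ip_def distrib_left sum.distrib)
  also have "ip n w (mv n Af (mv n (tr Af) w)) = ip n (v w) (v w)" unfolding v_def by (metis ip_mv ip_commute)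
  finally show ?thesis by (simp add: \<sigma>2_def form_2)
qed

lemma \<sigma>2_nonneg: "0 \<le> \<sigma>2 w"
  by (simp add: \<sigma>2_def)

lemma power_mix_integrable: "integrable N (\<lambda>z. ip n w (mix x z) ^ k)"
proof -
  have "ip n w (mix x z) ^ k = (\<Sum>j\<le>k. of_nat (k choose j) * ip n (v w) x ^ j * ip n w z ^ (k - j))" for z
    unfolding ip_mix v_def by (rule binomial_ring)
  then show ?thesis using form_integrable by simp
qed

lemma power_integrable: "integrable D (\<lambda>y. ip n w y ^ k)"
  by (rule integral_D) (auto intro: power_mix_integrable)

lemma moment_2: "(\<integral>y. ip n w y ^ 2 \<partial>D) = q w"
proof -
  have "(\<integral>z. ip n w (mix x z) ^ 2 \<partial>N) = (ip n (v w) x)\<^sup>2 + \<sigma>2 w" for x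
  proof -
    have "ip n w (mix x z) ^ 2 = (ip n (v w) x)\<^sup>2 + 2 * ip n (v w) x * ip n w z ^ 1 + ip n w z ^ 2" for z
      unfolding ip_mix v_def by (simp add: power2_eq_square algebra_simps)
    then show ?thesis using form_integrable[of w 1] form_integrable[of w 2] form_odd[of 1 w]
      by (simp add: \<sigma>2_def N.prob_space)
  qed
  then have "(\<integral>y. ip n w y ^ 2 \<partial>D) = (\<Sum>x\<in>signs n. (ip n (v w) x)\<^sup>2 + \<sigma>2 w) / 2 ^ n"
    by (subst integral_D) (auto intro: power_mix_integrable)
  also have "\<dots> = q w" by (simp add: sum.distrib sum_signs_2 card_signs q_eq add_divide_distrib)
  finally show ?thesis .
qed

lemma moment_4: "(\<integral>y. ip n w y ^ 4 \<partial>D) = 3 * (q w)\<^sup>2 - 2 * (\<Sum>a<n. v w a ^ 4)"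
proof -
  have "(\<integral>z. ip n w (mix x z) ^ 4 \<partial>N) = (ip n (v w) x) ^ 4 + 6 * \<sigma>2 w * (ip n (v w) x)\<^sup>2 + 3 * (\<sigma>2 w)\<^sup>2" for x
  proof -
    have "ip n w (mix x z) ^ 4 = (ip n (v w) x) ^ 4 + 4 * (ip n (v w) x) ^ 3 * ip n w z ^ 1
        + 6 * (ip n (v w) x)\<^sup>2 * ip n w z ^ 2 + 4 * ip n (v w) x * ip n w z ^ 3 + ip n w z ^ 4" for z
      unfolding ip_mix v_def by (simp add: power2_eq_square power3_eq_cube power4_eq_xxxx algebra_simps)
    then show ?thesis using form_integrable[of w 1] form_integrable[of w 2] form_integrable[of w 3]
      form_integrable[of w 4] form_odd[of 1 w] form_odd[of 3 w] form_4[of w]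
      by (simp add: \<sigma>2_def N.prob_space)
  qed
  then have "(\<integral>y. ip n w y ^ 4 \<partial>D) =
      (\<Sum>x\<in>signs n. (ip n (v w) x) ^ 4 + 6 * \<sigma>2 w * (ip n (v w) x)\<^sup>2 + 3 * (\<sigma>2 w)\<^sup>2) / 2 ^ n"
    by (subst integral_D) (auto intro: power_mix_integrable)
  also have "\<dots> = 3 * (ip n (v w) (v w))\<^sup>2 - 2 * (\<Sum>a<n. v w a ^ 4) + 6 * \<sigma>2 w * ip n (v w) (v w) + 3 * (\<sigma>2 w)\<^sup>2"
    by (simp add: sum.distrib sum_distrib_left[symmetric] sum_signs_2 sum_signs_4 card_signs add_divide_distrib)
  finally show ?thesis by (simp add: q_eq power2_eq_square algebra_simps)
qed

lemma power8_add_le: "(x + y) ^ 8 \<le> 128 * (x ^ 8 + y ^ 8)" for x y :: real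
proof -
  have sq: "(a + b)\<^sup>2 \<le> 2 * (a\<^sup>2 + b\<^sup>2)" for a b :: real
    using sum_squares_bound[of a b] by (simp add: power2_sum)
  have "((x + y)\<^sup>2)\<^sup>2 \<le> (2 * (x\<^sup>2 + y\<^sup>2))\<^sup>2" by (intro power_mono sq) simp
  also have "\<dots> = 4 * (x\<^sup>2 + y\<^sup>2)\<^sup>2" by (simp only: power_mult_distrib) simp
  also have "\<dots> \<le> 4 * (2 * ((x\<^sup>2)\<^sup>2 + (y\<^sup>2)\<^sup>2))" by (intro mult_left_mono sq) simp
  finally have "(((x + y)\<^sup>2)\<^sup>2)\<^sup>2 \<le> (8 * ((x\<^sup>2)\<^sup>2 + (y\<^sup>2)\<^sup>2))\<^sup>2" by (intro power_mono) simp_all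
  also have "\<dots> = 64 * ((x\<^sup>2)\<^sup>2 + (y\<^sup>2)\<^sup>2)\<^sup>2" by (simp only: power_mult_distrib) simp
  also have "\<dots> \<le> 64 * (2 * (((x\<^sup>2)\<^sup>2)\<^sup>2 + ((y\<^sup>2)\<^sup>2)\<^sup>2))" by (intro mult_left_mono sq) simp
  finally show ?thesis by (simp flip: power_mult)
qed

text \<open>Eighth moments control the variance of the fourth moment estimates. For a fixed sign
  pattern the signal is at most n |v w|^2 in square, and the Gaussian part contributes 105 times the
  fourth power of its variance.\<close>

lemma moment_8: "(\<integral>y. ip n w y ^ 8 \<partial>D) \<le> 128 * (real n ^ 4 + 105) * q w ^ 4"
proof -
  have b: "(\<integral>z. ip n w (mix x z) ^ 8 \<partial>N) \<le> 128 * (real n ^ 4 + 105) * q w ^ 4" if x: "x \<in> signs n" for x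
  proof -
    have "x i * x i = 1" if "i < n" for i using PiE_mem[OF x, of i] that by auto
    then have "ip n x x = (\<Sum>i<n. 1)" unfolding ip_def by (intro sum.cong) auto
    then have nx: "(nrm n x)\<^sup>2 = real n" by (simp add: nrm_sq)
    have "(ip n (v w) x)\<^sup>2 \<le> (nrm n (v w) * nrm n x)\<^sup>2"
      using abs_ip_le[of n "v w" x] by (simp add: abs_le_square_iff[symmetric])
    also have "\<dots> = ip n (v w) (v w) * real n" by (simp only: power_mult_distrib nx) (simp add: nrm_sq)
    also have "\<dots> \<le> q w * real n" using \<sigma>2_nonneg by (intro mult_right_mono) (auto simp: q_eq)
    finally have s2: "((ip n (v w) x)\<^sup>2) ^ 4 \<le> (q w * real n) ^ 4" by (intro power_mono) auto
    have "0 \<le> ip n (v w) (v w)" by (simp add: nrm_sq[symmetric])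
    then have "\<sigma>2 w \<le> q w" by (simp add: q_eq)
    then have z8: "(\<sigma>2 w) ^ 4 \<le> q w ^ 4" using \<sigma>2_nonneg by (intro power_mono) auto
    have "(\<integral>z. ip n w (mix x z) ^ 8 \<partial>N) \<le> (\<integral>z. 128 * ((ip n (v w) x) ^ 8 + ip n w z ^ 8) \<partial>N)"
    proof (rule integral_mono)
      show "integrable N (\<lambda>z. ip n w (mix x z) ^ 8)" by (rule power_mix_integrable)
      show "integrable N (\<lambda>z. 128 * ((ip n (v w) x) ^ 8 + ip n w z ^ 8))" using form_integrable by simp
    qed (unfold ip_mix v_def, rule power8_add_le)
    also have "\<dots> = 128 * ((ip n (v w) x) ^ 8 + 105 * \<sigma>2 w ^ 4)"
      using form_integrable[of w 8] form_8[of w] by (simp add: N.prob_space \<sigma>2_def)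
    also have "\<dots> \<le> 128 * ((q w * real n) ^ 4 + 105 * q w ^ 4)"
      using s2 z8 by (simp flip: power_mult)
    also have "\<dots> = 128 * (real n ^ 4 + 105) * q w ^ 4" by (simp add: power_mult_distrib algebra_simps)
    finally show ?thesis .
  qed
  have "(\<integral>y. ip n w y ^ 8 \<partial>D) = (\<Sum>x\<in>signs n. \<integral>z. ip n w (mix x z) ^ 8 \<partial>N) / 2 ^ n"
    by (subst integral_D) (auto intro: power_mix_integrable)
  also have "\<dots> \<le> (\<Sum>x\<in>signs n. 128 * (real n ^ 4 + 105) * q w ^ 4) / 2 ^ n"
    by (intro divide_right_mono sum_mono b) auto
  also have "\<dots> = 128 * (real n ^ 4 + 105) * q w ^ 4" by (simp add: card_signs)
  finally show ?thesis .
qed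

lemma C_sym: "C i j = C j i"
  by (simp add: C_def cov_def mult.commute)

definition \<beta> :: "(nat \<Rightarrow> real) \<Rightarrow> (nat \<Rightarrow> real) \<Rightarrow> real" where "\<beta> u w = ip n u (mv n C w)"

lemma mv_lin: "mv n Z (\<lambda>i. a * u i + b * w i) i = a * mv n Z u i + b * mv n Z w i"
  by (simp add: mv_def sum.distrib sum_distrib_left distrib_left mult_ac)

lemma ip_lin: "ip n (\<lambda>i. a * u i + b * w i) y = a * ip n u y + b * ip n w y"
proof -
  have "(a * u i + b * w i) * y i = a * (u i * y i) + b * (w i * y i)" for i by (simp add: algebra_simps)
  then show ?thesis by (simp only: ip_def sum.distrib sum_distrib_left[symmetric])
qed

lemma \<beta>_sym: "\<beta> u w = \<beta> w u"
proof -
  have "ip n (mv n C u) w = ip n u (mv n C w)" by (rule ip_mv_sym) (auto simp: sym_def C_sym)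
  then show ?thesis by (simp add: \<beta>_def ip_commute)
qed

lemma q_lin: "q (\<lambda>i. a * u i + b * w i) = a\<^sup>2 * q u + 2 * a * b * \<beta> u w + b\<^sup>2 * q w"
proof -
  have "ip n y (mv n C (\<lambda>i. a * u i + b * w i)) = a * ip n y (mv n C u) + b * ip n y (mv n C w)" for y
  proof -
    have "mv n C (\<lambda>i. a * u i + b * w i) = (\<lambda>i. a * mv n C u i + b * mv n C w i)" by (rule ext) (rule mv_lin)
    then show ?thesis using ip_lin[of a "mv n C u" b "mv n C w" y] by (simp add: ip_commute)
  qed
  then have "q (\<lambda>i. a * u i + b * w i) = a * (a * q u + b * \<beta> w u) + b * (a * \<beta> u w + b * q w)"
    unfolding q_def \<beta>_def ip_lin by (simp add: algebra_simps)
  then show ?thesis using \<beta>_sym[of u w] by (simp add: power2_eq_square algebra_simps)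
qed

lemma v_lin: "v (\<lambda>i. a * u i + b * w i) k = a * v u k + b * v w k"
  by (simp add: v_def mv_lin)

lemma polarize_22:
  "(x + z) ^ 4 + (x - z) ^ 4 - 2 * x ^ 4 - 2 * z ^ 4 = 12 * (x\<^sup>2 * z\<^sup>2)" for x z :: real
  by (simp add: power2_eq_square power4_eq_xxxx algebra_simps)

text \<open>Polarization of \<open>moment_4\<close> along u + w and u - w; the coefficients 1 and -1
  are written out so that the linearity lemmas apply.\<close>

lemma moment_22:
  shows "integrable D (\<lambda>y. (ip n u y)\<^sup>2 * (ip n w y)\<^sup>2)"
    and "(\<integral>y. (ip n u y)\<^sup>2 * (ip n w y)\<^sup>2 \<partial>D) = q u * q w + 2 * (\<beta> u w)\<^sup>2 - 2 * (\<Sum>a<n. (v u a)\<^sup>2 * (v w a)\<^sup>2)"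
proof -
  let ?p = "\<lambda>i. 1 * u i + 1 * w i" and ?m = "\<lambda>i. 1 * u i + (-1) * w i"
  have eq: "(ip n u y)\<^sup>2 * (ip n w y)\<^sup>2 = (ip n ?p y ^ 4 + ip n ?m y ^ 4 - 2 * ip n u y ^ 4 - 2 * ip n w y ^ 4) / 12" for y
    using polarize_22[of "ip n u y" "ip n w y"] unfolding ip_lin by simp
  show "integrable D (\<lambda>y. (ip n u y)\<^sup>2 * (ip n w y)\<^sup>2)" unfolding eq
    by (intro Bochner_Integration.integrable_divide Bochner_Integration.integrable_diff
        Bochner_Integration.integrable_add integrable_mult_right power_integrable)
  have s: "(\<Sum>a<n. v ?p a ^ 4) + (\<Sum>a<n. v ?m a ^ 4) - 2 * (\<Sum>a<n. v u a ^ 4) - 2 * (\<Sum>a<n. v w a ^ 4) =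
      12 * (\<Sum>a<n. (v u a)\<^sup>2 * (v w a)\<^sup>2)"
  proof -
    have "(\<Sum>a<n. (v u a + v w a) ^ 4 + (v u a - v w a) ^ 4 - 2 * v u a ^ 4 - 2 * v w a ^ 4) =
      (\<Sum>a<n. 12 * ((v u a)\<^sup>2 * (v w a)\<^sup>2))" by (simp only: polarize_22)
    then show ?thesis unfolding v_lin
      by (simp only: sum.distrib sum_subtractf sum_distrib_left[symmetric] mult_1_left mult_minus1 add_uminus_conv_diff)
  qed
  have "(\<integral>y. (ip n u y)\<^sup>2 * (ip n w y)\<^sup>2 \<partial>D) = ((\<integral>y. ip n ?p y ^ 4 \<partial>D) + (\<integral>y. ip n ?m y ^ 4 \<partial>D)
      - 2 * (\<integral>y. ip n u y ^ 4 \<partial>D) - 2 * (\<integral>y. ip n w y ^ 4 \<partial>D)) / 12"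
    unfolding eq using power_integrable[of ?p 4] power_integrable[of ?m 4] power_integrable[of u 4] power_integrable[of w 4]
    by (simp only: Bochner_Integration.integral_divide_zero Bochner_Integration.integral_diff Bochner_Integration.integral_add
        Bochner_Integration.integrable_diff Bochner_Integration.integrable_add integrable_mult_right integral_mult_right_zero)
  also have "\<dots> = (3 * ((q ?p)\<^sup>2 + (q ?m)\<^sup>2 - 2 * (q u)\<^sup>2 - 2 * (q w)\<^sup>2) -
      2 * ((\<Sum>a<n. v ?p a ^ 4) + (\<Sum>a<n. v ?m a ^ 4) - 2 * (\<Sum>a<n. v u a ^ 4) - 2 * (\<Sum>a<n. v w a ^ 4))) / 12"
    unfolding moment_4 by (simp only: right_diff_distrib distrib_left mult.left_commute) (simp add: algebra_simps)
  also have "\<dots> = (3 * ((q ?p)\<^sup>2 + (q ?m)\<^sup>2 - 2 * (q u)\<^sup>2 - 2 * (q w)\<^sup>2) - 2 * (12 * (\<Sum>a<n. (v u a)\<^sup>2 * (v w a)\<^sup>2))) / 12"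
    unfolding s ..
  also have "(q ?p)\<^sup>2 + (q ?m)\<^sup>2 - 2 * (q u)\<^sup>2 - 2 * (q w)\<^sup>2 = 4 * (q u * q w) + 8 * (\<beta> u w)\<^sup>2"
    unfolding q_lin by (simp add: power2_eq_square algebra_simps)
  finally show "(\<integral>y. (ip n u y)\<^sup>2 * (ip n w y)\<^sup>2 \<partial>D) = q u * q w + 2 * (\<beta> u w)\<^sup>2 - 2 * (\<Sum>a<n. (v u a)\<^sup>2 * (v w a)\<^sup>2)"
    by simp
qed

lemma v_unitv: "k < n \<Longrightarrow> v (unitv k) a = Af k a"
  by (simp add: v_def mv_def tr_def unitv_def if_distrib cong: if_cong)

lemma \<beta>_unitv: "k < n \<Longrightarrow> \<beta> u (unitv k) = mv n C u k"
  using \<beta>_sym[of u "unitv k"] by (simp add: \<beta>_def ip_commute[of n "unitv k"] ip_unitv)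

lemma C_unitv: "k < n \<Longrightarrow> l < n \<Longrightarrow> \<beta> (unitv k) (unitv l) = C k l"
  using \<beta>_unitv[of l "unitv k"] by (simp add: mv_def unitv_def if_distrib C_sym[of l] cong: if_cong)

text \<open>The fourth cumulant of the sample is that of its non-Gaussian part.\<close>

lemma moment_211:
  assumes k: "k < n" and l: "l < n"
  shows "integrable D (\<lambda>y. (ip n u y)\<^sup>2 * (y k * y l))"
    and "(\<integral>y. (ip n u y)\<^sup>2 * (y k * y l) \<partial>D) =
      q u * C k l + 2 * (mv n C u k * mv n C u l) - 2 * (\<Sum>a<n. (v u a)\<^sup>2 * (Af k a * Af l a))"
proof -
  let ?p = "\<lambda>i. 1 * unitv k i + 1 * unitv l i" and ?m = "\<lambda>i. 1 * unitv k i + (-1) * unitv l i"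
  have yk: "y k = ip n (unitv k) y" "y l = ip n (unitv l) y" for y using k l by (simp_all add: component_form)
  have eq: "(ip n u y)\<^sup>2 * (y k * y l) = ((ip n u y)\<^sup>2 * (ip n ?p y)\<^sup>2 - (ip n u y)\<^sup>2 * (ip n ?m y)\<^sup>2) / 4" for y
    unfolding ip_lin yk by (simp add: power2_eq_square algebra_simps)
  show "integrable D (\<lambda>y. (ip n u y)\<^sup>2 * (y k * y l))" unfolding eq
    by (intro Bochner_Integration.integrable_divide Bochner_Integration.integrable_diff moment_22)
  have \<beta>: "\<beta> u (\<lambda>i. a * unitv k i + b * unitv l i) = a * mv n C u k + b * mv n C u l" for a b
  proof -
    have "\<beta> u (\<lambda>i. a * unitv k i + b * unitv l i) = a * \<beta> (unitv k) u + b * \<beta> (unitv l) u"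
      by (subst \<beta>_sym) (simp add: \<beta>_def ip_lin)
    then show ?thesis using \<beta>_sym \<beta>_unitv k l by simp
  qed
  have "(\<integral>y. (ip n u y)\<^sup>2 * (y k * y l) \<partial>D) =
      ((\<integral>y. (ip n u y)\<^sup>2 * (ip n ?p y)\<^sup>2 \<partial>D) - (\<integral>y. (ip n u y)\<^sup>2 * (ip n ?m y)\<^sup>2 \<partial>D)) / 4"
    unfolding eq using moment_22(1)[of u ?p] moment_22(1)[of u ?m]
    by (simp only: Bochner_Integration.integral_divide_zero Bochner_Integration.integral_diff)
  also have "\<dots> = (q u * (q ?p - q ?m) + 2 * ((\<beta> u ?p)\<^sup>2 - (\<beta> u ?m)\<^sup>2)
      - 2 * (\<Sum>a<n. (v u a)\<^sup>2 * (v ?p a)\<^sup>2 - (v u a)\<^sup>2 * (v ?m a)\<^sup>2)) / 4"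
    unfolding moment_22(2) sum_subtractf by (simp only: right_diff_distrib) (simp add: algebra_simps)
  also have "q ?p - q ?m = 4 * C k l" unfolding q_lin using C_unitv[OF k l] by simp
  also have "(\<beta> u ?p)\<^sup>2 - (\<beta> u ?m)\<^sup>2 = 4 * (mv n C u k * mv n C u l)"
    unfolding \<beta> by (simp add: power2_eq_square algebra_simps)
  also have "(\<Sum>a<n. (v u a)\<^sup>2 * (v ?p a)\<^sup>2 - (v u a)\<^sup>2 * (v ?m a)\<^sup>2) = (\<Sum>a<n. 4 * ((v u a)\<^sup>2 * (Af k a * Af l a)))"
    unfolding v_lin using k l by (intro sum.cong) (simp_all add: v_unitv power2_eq_square algebra_simps)
  finally show "(\<integral>y. (ip n u y)\<^sup>2 * (y k * y l) \<partial>D) =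
      q u * C k l + 2 * (mv n C u k * mv n C u l) - 2 * (\<Sum>a<n. (v u a)\<^sup>2 * (Af k a * Af l a))"
    unfolding sum_distrib_left[symmetric] by simp
qed

lemma component_power: "i < n \<Longrightarrow> integrable D (\<lambda>y. y i ^ k)"
  using power_integrable[of "unitv i" k] by (simp add: component_form)

lemma D_component [measurable]: "i < n \<Longrightarrow> (\<lambda>y. y i) \<in> borel_measurable D"
  unfolding measurable_cong_sets[OF sets_D refl] by (rule measurable_component_singleton) simp

lemma q_unitv: "i < n \<Longrightarrow> q (unitv i) = C i i"
  using C_unitv[of i i] by (simp add: q_def \<beta>_def)

lemma C_diag_nonneg: "i < n \<Longrightarrow> 0 \<le> C i i"
proof -
  assume "i < n"
  have "0 \<le> ip n (v (unitv i)) (v (unitv i))" by (simp add: nrm_sq[symmetric])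
  then show ?thesis using q_eq[of "unitv i"] \<sigma>2_nonneg[of "unitv i"] q_unitv[OF \<open>i < n\<close>] by linarith
qed

text \<open>The expectation of |y|^2. This one number dominates the columns of A, the noise and all
  moments in use, and it is what the trace test estimates.\<close>

definition V :: real where "V = (\<Sum>i<n. C i i)"

lemma C_diag_le: "i < n \<Longrightarrow> C i i \<le> V"
  unfolding V_def using C_diag_nonneg by (intro member_le_sum) auto

lemma moment_11:
  assumes "i < n" "j < n"
  shows "integrable D (\<lambda>y. y i * y j)" "(\<integral>y. y i * y j \<partial>D) = C i j"
    "integrable D (\<lambda>y. (y i * y j)\<^sup>2)" "(\<integral>y. (y i * y j)\<^sup>2 \<partial>D) \<le> 6 * V\<^sup>2"
proof -
  let ?p = "\<lambda>a. 1 * unitv i a + 1 * unitv j a" and ?m = "\<lambda>a. 1 * unitv i a + (-1) * unitv j a"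
  have yk: "y i = ip n (unitv i) y" "y j = ip n (unitv j) y" for y using assms by (simp_all add: component_form)
  have eq: "y i * y j = ((ip n ?p y)\<^sup>2 - (ip n ?m y)\<^sup>2) / 4" for y
    unfolding ip_lin yk by (simp add: power2_eq_square algebra_simps)
  show "integrable D (\<lambda>y. y i * y j)" unfolding eq
    by (intro Bochner_Integration.integrable_divide Bochner_Integration.integrable_diff power_integrable)
  have "(\<integral>y. y i * y j \<partial>D) = ((\<integral>y. (ip n ?p y)\<^sup>2 \<partial>D) - (\<integral>y. (ip n ?m y)\<^sup>2 \<partial>D)) / 4"
    unfolding eq using power_integrable[of ?p 2] power_integrable[of ?m 2]
    by (simp only: Bochner_Integration.integral_divide_zero Bochner_Integration.integral_diff)
  also have "\<dots> = C i j" unfolding moment_2 q_lin using C_unitv[OF assms] by simp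
  finally show "(\<integral>y. y i * y j \<partial>D) = C i j" .
  have le: "(y i * y j)\<^sup>2 \<le> y i ^ 4 + y j ^ 4" for y :: "nat \<Rightarrow> real"
    using abs_mult_le_squares[of "(y i)\<^sup>2" "(y j)\<^sup>2"] by (simp add: power_mult_distrib flip: power_mult)
  have i4: "integrable D (\<lambda>y. y i ^ 4 + y j ^ 4)" using component_power assms by simp
  show i2: "integrable D (\<lambda>y. (y i * y j)\<^sup>2)"
    using i4 by (rule Bochner_Integration.integrable_bound) (use assms le in \<open>auto intro!: AE_I2 order.trans[OF le]\<close>)
  have m4: "(\<integral>y. y a ^ 4 \<partial>D) \<le> 3 * V\<^sup>2" if a: "a < n" for a
  proof -
    have "(\<integral>y. y a ^ 4 \<partial>D) \<le> 3 * (C a a)\<^sup>2"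
      using moment_4[of "unitv a"] a by (simp add: component_form q_unitv sum_nonneg)
    also have "\<dots> \<le> 3 * V\<^sup>2" using C_diag_nonneg[OF a] C_diag_le[OF a] by (intro mult_left_mono power_mono) auto
    finally show ?thesis .
  qed
  have "(\<integral>y. (y i * y j)\<^sup>2 \<partial>D) \<le> (\<integral>y. y i ^ 4 + y j ^ 4 \<partial>D)" using i2 i4 le by (rule integral_mono)
  also have "\<dots> = (\<integral>y. y i ^ 4 \<partial>D) + (\<integral>y. y j ^ 4 \<partial>D)" using component_power assms by simp
  finally show "(\<integral>y. (y i * y j)\<^sup>2 \<partial>D) \<le> 6 * V\<^sup>2" using m4[OF assms(1)] m4[OF assms(2)] by linarith
qed

lemma moment_1111:
  assumes "i < n" "j < n" "k < n" "l < n"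
  shows "integrable D (\<lambda>y. (y i * y j) * (y k * y l))" "integrable D (\<lambda>y. ((y i * y j) * (y k * y l))\<^sup>2)"
    "(\<integral>y. ((y i * y j) * (y k * y l))\<^sup>2 \<partial>D) \<le> 512 * (real n ^ 4 + 105) * V ^ 4"
proof -
  have le: "((y i * y j) * (y k * y l))\<^sup>2 \<le> y i ^ 8 + y j ^ 8 + y k ^ 8 + y l ^ 8" for y :: "nat \<Rightarrow> real"
  proof -
    have "((y i * y j) * (y k * y l))\<^sup>2 \<le> ((y i * y j)\<^sup>2)\<^sup>2 + ((y k * y l)\<^sup>2)\<^sup>2"
      using abs_mult_le_squares[of "(y i * y j)\<^sup>2" "(y k * y l)\<^sup>2"] by (simp add: power_mult_distrib)
    moreover have "((a * b)\<^sup>2)\<^sup>2 \<le> a ^ 8 + b ^ 8" for a b :: real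
      using abs_mult_le_squares[of "a ^ 4" "b ^ 4"] by (simp add: power_mult_distrib flip: power_mult)
    ultimately show ?thesis by (smt (verit))
  qed
  have i8: "integrable D (\<lambda>y. y i ^ 8 + y j ^ 8 + y k ^ 8 + y l ^ 8)" using component_power assms by simp
  show i2: "integrable D (\<lambda>y. ((y i * y j) * (y k * y l))\<^sup>2)"
    using i8 by (rule Bochner_Integration.integrable_bound) (use assms le in \<open>auto intro!: AE_I2 order.trans[OF le]\<close>)
  interpret D: prob_space D by (rule prob_space_D)
  show "integrable D (\<lambda>y. (y i * y j) * (y k * y l))"
    using i2 by (rule D.square_integrable_imp_integrable[rotated]) (use assms in measurable)
  have m8: "(\<integral>y. y a ^ 8 \<partial>D) \<le> 128 * (real n ^ 4 + 105) * V ^ 4" if a: "a < n" for a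
  proof -
    have "(\<integral>y. y a ^ 8 \<partial>D) \<le> 128 * (real n ^ 4 + 105) * (C a a) ^ 4"
      using moment_8[of "unitv a"] a by (simp add: component_form q_unitv)
    also have "\<dots> \<le> 128 * (real n ^ 4 + 105) * V ^ 4" using C_diag_nonneg[OF a] C_diag_le[OF a]
      by (intro mult_left_mono power_mono) auto
    finally show ?thesis .
  qed
  have "(\<integral>y. ((y i * y j) * (y k * y l))\<^sup>2 \<partial>D) \<le> (\<integral>y. y i ^ 8 + y j ^ 8 + y k ^ 8 + y l ^ 8 \<partial>D)"
    using i2 i8 le by (rule integral_mono)
  also have "\<dots> = (\<integral>y. y i ^ 8 \<partial>D) + (\<integral>y. y j ^ 8 \<partial>D) + (\<integral>y. y k ^ 8 \<partial>D) + (\<integral>y. y l ^ 8 \<partial>D)"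
    using component_power assms by simp
  finally show "(\<integral>y. ((y i * y j) * (y k * y l))\<^sup>2 \<partial>D) \<le> 512 * (real n ^ 4 + 105) * V ^ 4"
    using m8[OF assms(1)] m8[OF assms(2)] m8[OF assms(3)] m8[OF assms(4)] by linarith
qed

end

section \<open>Accuracy of the moment estimates\<close>

text \<open>M is the sum of the matrices H for u = e_i, and the estimators inherit this identity
  exactly, so the accuracy of M follows from that of H.\<close>

lemma est_M_eq:
  assumes "k < n" "l < n"
  shows "est_M n m Y k l = (\<Sum>i<n. est_H n m Y (unitv i) k l)"
proof -
  let ?C = "est_cov m Y"
  have u: "ip n (unitv i) x = x i" if "i < n" for i x using ip_unitv[OF that, of x] by (simp add: ip_commute)
  have mu: "mv n ?C (unitv i) = (\<lambda>j. ?C j i)" if "i < n" for i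
    using that by (simp add: mv_def unitv_def if_distrib cong: if_cong)
  have w: "weighted m Y (\<lambda>t. ip n (Y t) (Y t)) k l = (\<Sum>i<n. weighted m Y (\<lambda>t. (ip n (unitv i) (Y t))\<^sup>2) k l)"
  proof -
    have "(\<Sum>i<n. weighted m Y (\<lambda>t. (ip n (unitv i) (Y t))\<^sup>2) k l) = (\<Sum>i<n. \<Sum>t<m. (Y t i)\<^sup>2 * (Y t k * Y t l) / real m)"
      by (intro sum.cong refl) (simp add: weighted_def u)
    also have "\<dots> = (\<Sum>t<m. \<Sum>i<n. (Y t i)\<^sup>2 * (Y t k * Y t l) / real m)" by (rule sum.swap)
    finally show ?thesis by (simp add: weighted_def ip_def power2_eq_square sum_distrib_right sum_divide_distrib)
  qed
  have t: "est_trace n m Y = (\<Sum>i<n. ?C i i)"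
  proof -
    have "(\<Sum>i<n. ?C i i) = (\<Sum>t<m. \<Sum>i<n. Y t i * Y t i / real m)"
      unfolding est_cov_def weighted_def by (subst sum.swap) simp
    then show ?thesis by (simp add: est_trace_def ip_def sum_divide_distrib)
  qed
  have "(\<Sum>i<n. est_H n m Y (unitv i) k l) = (\<Sum>i<n. (weighted m Y (\<lambda>t. (ip n (unitv i) (Y t))\<^sup>2) k l
      - ?C i i * ?C k l - 2 * (?C k i * ?C l i)) / (-2))"
    by (intro sum.cong refl) (simp add: est_H_def u mu)
  also have "\<dots> = ((\<Sum>i<n. weighted m Y (\<lambda>t. (ip n (unitv i) (Y t))\<^sup>2) k l)
      - (\<Sum>i<n. ?C i i) * ?C k l - 2 * (\<Sum>i<n. ?C k i * ?C l i)) / (-2)"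
    by (simp add: sum_subtractf sum_divide_distrib[symmetric] sum_distrib_left sum_distrib_right sum_negf)
  finally show ?thesis by (simp add: est_M_def w t)
qed

lemma weighted_sym: "weighted m Y x k l = weighted m Y x l k"
  by (simp add: weighted_def mult_ac)

lemma est_sym: "sym n (est_M n m Y)" "sym n (est_H n m Y u)"
  by (simp_all add: sym_def est_M_def est_H_def est_cov_def weighted_sym[of m Y _ _ j for j] mult_ac)

text \<open>\<open>X\<close> and \<open>C\<close> are the exact moments, \<open>Y\<close> is a sample on which they are well approximated.\<close>

locale good_block = scale +
  fixes n m :: nat and Y :: "nat \<Rightarrow> nat \<Rightarrow> real" and C :: "nat \<Rightarrow> nat \<Rightarrow> real" and X :: "nat \<Rightarrow> nat \<Rightarrow> nat \<Rightarrow> nat \<Rightarrow> real"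
  assumes nW: "real n \<le> W"
    and C_le: "\<And>i j. i < n \<Longrightarrow> j < n \<Longrightarrow> \<bar>C i j\<bar> \<le> pw W 3"
    and errC: "\<And>i j. i < n \<Longrightarrow> j < n \<Longrightarrow> \<bar>(\<Sum>t<m. (Y t i * Y t j) / real m) - C i j\<bar> \<le> pw W (-828)"
    and errX: "\<And>i j k l. i < n \<Longrightarrow> j < n \<Longrightarrow> k < n \<Longrightarrow> l < n \<Longrightarrow>
      \<bar>(\<Sum>t<m. ((Y t i * Y t j) * (Y t k * Y t l)) / real m) - X i j k l\<bar> \<le> pw W (-826)"
begin

abbreviation Ch where "Ch \<equiv> est_cov m Y"

lemma n_mult: "x \<le> P a \<Longrightarrow> 0 \<le> x \<Longrightarrow> real n * x \<le> P (a + 1)"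
  using nW by (intro P_mult_le[of _ 1 _ a]) (auto simp: P_1)

lemma sum_le: "(\<And>i. i < n \<Longrightarrow> \<bar>f i\<bar> \<le> P a) \<Longrightarrow> \<bar>\<Sum>i<n. f i\<bar> \<le> P (a + 1)"
proof -
  assume "\<And>i. i < n \<Longrightarrow> \<bar>f i\<bar> \<le> P a"
  then have "(\<Sum>i<n. \<bar>f i\<bar>) \<le> (\<Sum>i<n. P a)" by (intro sum_mono) auto
  also have "\<dots> \<le> P (a + 1)" using n_mult[of "P a" a] by simp
  finally show ?thesis by (rule order.trans[OF sum_abs])
qed

lemma mult_bounded: "\<bar>x\<bar> \<le> 1 \<Longrightarrow> \<bar>y\<bar> \<le> a \<Longrightarrow> \<bar>x * y\<bar> \<le> a" for x y a :: real
  using mult_mono[of "\<bar>x\<bar>" 1 "\<bar>y\<bar>" a] by (simp add: abs_mult)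

lemma Ch_err: "i < n \<Longrightarrow> j < n \<Longrightarrow> \<bar>Ch i j - C i j\<bar> \<le> P (-828)"
  using errC[of i j] by (simp add: est_cov_def weighted_def)

lemma Ch_le: "i < n \<Longrightarrow> j < n \<Longrightarrow> \<bar>Ch i j\<bar> \<le> P 4"
  using Ch_err[of i j] C_le[of i j] P_absorb[of 2 3] P_mono[of "-828" 3] by simp

lemma prod_err:
  assumes "\<bar>a' - a\<bar> \<le> P i" "\<bar>b' - b\<bar> \<le> P j" "\<bar>b'\<bar> \<le> P k" "\<bar>a\<bar> \<le> P l" "i + k < r" "l + j < r"
  shows "\<bar>a' * b' - a * b\<bar> \<le> P r"
proof -
  have "\<bar>a' - a\<bar> * \<bar>b'\<bar> \<le> P (i + k)" "\<bar>a\<bar> * \<bar>b' - b\<bar> \<le> P (l + j)"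
    using assms by (auto intro!: P_mult_le)
  moreover have "a' * b' - a * b = (a' - a) * b' + a * (b' - b)" by (simp add: algebra_simps)
  ultimately show ?thesis
    using abs_triangle_ineq[of "(a' - a) * b'" "a * (b' - b)"] P_add_le[of "\<bar>a' - a\<bar> * \<bar>b'\<bar>" "i + k" "\<bar>a\<bar> * \<bar>b' - b\<bar>" "l + j" r] assms
    by (simp add: abs_mult)
qed

text \<open>The target G enters only as the solution of the moment identity, which keeps the error
  analysis independent of the probabilistic model. The dominant loss is a product of a moment of
  size W^5 with an error of about W^(-826).\<close>

lemma est_H_err:
  assumes u: "\<And>i. i < n \<Longrightarrow> \<bar>u i\<bar> \<le> 1" and k: "k < n" and l: "l < n"
    and G: "(\<Sum>i<n. \<Sum>j<n. u i * (u j * X i j k l)) = ip n u (mv n C u) * C k l + 2 * (mv n C u k * mv n C u l) - 2 * G"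
  shows "\<bar>est_H n m Y u k l - G\<bar> \<le> P (-810)"
proof -
  let ?Xh = "\<lambda>i j. \<Sum>t<m. ((Y t i * Y t j) * (Y t k * Y t l)) / real m"
  have w: "weighted m Y (\<lambda>t. (ip n u (Y t))\<^sup>2) k l = (\<Sum>i<n. \<Sum>j<n. u i * (u j * ?Xh i j))"
  proof -
    have "(ip n u (Y t))\<^sup>2 * (Y t k * Y t l) / real m = (\<Sum>i<n. \<Sum>j<n. u i * (u j * (((Y t i * Y t j) * (Y t k * Y t l)) / real m)))" for t
    proof -
      have "(ip n u (Y t))\<^sup>2 = (\<Sum>i<n. \<Sum>j<n. (u i * Y t i) * (u j * Y t j))"
        by (simp add: ip_def power2_eq_square sum_product)
      then show ?thesis
        by (simp only: sum_distrib_right sum_divide_distrib) (auto intro!: sum.cong simp: mult_ac)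
    qed
    then have "weighted m Y (\<lambda>t. (ip n u (Y t))\<^sup>2) k l =
        (\<Sum>t<m. \<Sum>i<n. \<Sum>j<n. u i * (u j * (((Y t i * Y t j) * (Y t k * Y t l)) / real m)))" by (simp add: weighted_def)
    also have "\<dots> = (\<Sum>i<n. \<Sum>t<m. \<Sum>j<n. u i * (u j * (((Y t i * Y t j) * (Y t k * Y t l)) / real m)))" by (rule sum.swap)
    also have "\<dots> = (\<Sum>i<n. \<Sum>j<n. \<Sum>t<m. u i * (u j * (((Y t i * Y t j) * (Y t k * Y t l)) / real m)))"
      by (intro sum.cong refl sum.swap)
    finally show ?thesis by (simp only: sum_distrib_left)
  qed
  have 1: "\<bar>weighted m Y (\<lambda>t. (ip n u (Y t))\<^sup>2) k l - (\<Sum>i<n. \<Sum>j<n. u i * (u j * X i j k l))\<bar> \<le> P (-824)"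
  proof -
    have "\<bar>\<Sum>i<n. \<Sum>j<n. u i * (u j * (?Xh i j - X i j k l))\<bar> \<le> P (-826 + 1 + 1)"
      by (intro sum_le mult_bounded u errX k l)
    moreover have "(\<Sum>i<n. \<Sum>j<n. u i * (u j * (?Xh i j - X i j k l))) =
        weighted m Y (\<lambda>t. (ip n u (Y t))\<^sup>2) k l - (\<Sum>i<n. \<Sum>j<n. u i * (u j * X i j k l))"
      unfolding w by (simp only: right_diff_distrib sum_subtractf)
    ultimately show ?thesis by simp
  qed
  have mv_err: "\<bar>mv n Ch u i - mv n C u i\<bar> \<le> P (-827)" if i: "i < n" for i
  proof -
    have "\<bar>\<Sum>j<n. u j * (Ch i j - C i j)\<bar> \<le> P (-828 + 1)" by (intro sum_le mult_bounded u Ch_err i)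
    then show ?thesis by (simp add: mv_def right_diff_distrib sum_subtractf mult.commute)
  qed
  have mv_le: "\<bar>mv n C u i\<bar> \<le> P 4" if i: "i < n" for i
  proof -
    have "\<bar>\<Sum>j<n. u j * C i j\<bar> \<le> P (3 + 1)" by (intro sum_le mult_bounded u C_le i)
    then show ?thesis by (simp add: mv_def mult.commute)
  qed
  have mvh_le: "\<bar>mv n Ch u i\<bar> \<le> P 5" if i: "i < n" for i
    using mv_err[OF i] mv_le[OF i] P_absorb[of 2 4] P_mono[of "-827" 4] by simp
  have q_err: "\<bar>ip n u (mv n Ch u) - ip n u (mv n C u)\<bar> \<le> P (-826)"
  proof -
    have "\<bar>\<Sum>j<n. u j * (mv n Ch u j - mv n C u j)\<bar> \<le> P (-827 + 1)" by (intro sum_le mult_bounded u mv_err)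
    then show ?thesis by (simp add: ip_def right_diff_distrib sum_subtractf)
  qed
  have q_le: "\<bar>ip n u (mv n C u)\<bar> \<le> P 5"
  proof -
    have "\<bar>\<Sum>j<n. u j * mv n C u j\<bar> \<le> P (4 + 1)" by (intro sum_le mult_bounded u mv_le)
    then show ?thesis by (simp add: ip_def)
  qed
  have 2: "\<bar>ip n u (mv n Ch u) * Ch k l - ip n u (mv n C u) * C k l\<bar> \<le> P (-820)"
    by (rule prod_err[OF q_err Ch_err Ch_le q_le]) (use k l in auto)
  have 3: "\<bar>mv n Ch u k * mv n Ch u l - mv n C u k * mv n C u l\<bar> \<le> P (-820)"
    by (rule prod_err[OF mv_err mv_err mvh_le mv_le]) (use k l in auto)
  have "est_H n m Y u k l - G = ((weighted m Y (\<lambda>t. (ip n u (Y t))\<^sup>2) k l - (\<Sum>i<n. \<Sum>j<n. u i * (u j * X i j k l)))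
      - (ip n u (mv n Ch u) * Ch k l - ip n u (mv n C u) * C k l)
      - 2 * (mv n Ch u k * mv n Ch u l - mv n C u k * mv n C u l)) / (-2)"
    unfolding G by (simp add: est_H_def field_simps)
  then have "\<bar>est_H n m Y u k l - G\<bar> \<le> 4 * P (-820)" using 1 2 3 P_mono[of "-824" "-820"] by simp
  also have "\<dots> \<le> P (-819)" using P_absorb[of 4 "-820"] by simp
  also have "\<dots> \<le> P (-810)" by (rule P_mono) simp
  finally show ?thesis .
qed

lemma est_M_err:
  assumes k: "k < n" and l: "l < n"
    and G: "\<And>i. i < n \<Longrightarrow> (\<Sum>i'<n. \<Sum>j<n. unitv i i' * (unitv i j * X i' j k l)) =
      ip n (unitv i) (mv n C (unitv i)) * C k l + 2 * (mv n C (unitv i) k * mv n C (unitv i) l) - 2 * G i"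
  shows "\<bar>est_M n m Y k l - (\<Sum>i<n. G i)\<bar> \<le> P (-800)"
proof -
  have "\<bar>est_H n m Y (unitv i) k l - G i\<bar> \<le> P (-810)" if i: "i < n" for i
    by (rule est_H_err[OF _ k l G[OF i]]) (simp add: unitv_def)
  then have "\<bar>\<Sum>i<n. est_H n m Y (unitv i) k l - G i\<bar> \<le> P (-810 + 1)" by (rule sum_le)
  also have "\<dots> \<le> P (-800)" by (rule P_mono) simp
  finally show ?thesis by (simp add: est_M_eq[OF k l] sum_subtractf)
qed

end

section \<open>Separation by random directions\<close>

definition rand_dir :: "nat \<Rightarrow> (nat \<Rightarrow> bool) \<Rightarrow> nat \<Rightarrow> real" where
  "rand_dir \<beta> b i = real (bits_value b (i * \<beta>) \<beta>) / 2 ^ \<beta>"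

lemma bits_value_less: "bits_value b o1 t < 2 ^ t"
  by (induction t) auto

lemma bits_value_cong: "(\<And>r. r < t \<Longrightarrow> b (o1 + r) = b' (o1 + r)) \<Longrightarrow> bits_value b o1 t = bits_value b' o1 t"
  by (induction t) auto

lemma bits_value_inj: "bits_value b o1 t = bits_value b' o1 t \<Longrightarrow> r < t \<Longrightarrow> b (o1 + r) = b' (o1 + r)"
proof (induction t)
  case (Suc t)
  have "bits_value b o1 (Suc t) mod 2 = bits_value b' o1 (Suc t) mod 2"
    "bits_value b o1 (Suc t) div 2 = bits_value b' o1 (Suc t) div 2" using Suc.prems by simp_all
  then have "b (o1 + t) = b' (o1 + t)" "bits_value b o1 t = bits_value b' o1 t" by (auto split: if_splits)
  then show ?case using Suc by (cases "r = t") auto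
qed simp

lemma rand_dir_bounds: "0 \<le> rand_dir \<beta> b i" "rand_dir \<beta> b i \<le> 1"
proof -
  have "real (bits_value b (i * \<beta>) \<beta>) < real (2 ^ \<beta>)" using bits_value_less by (simp only: of_nat_less_iff)
  then show "rand_dir \<beta> b i \<le> 1" by (simp add: rand_dir_def)
qed (simp add: rand_dir_def)

text \<open>Fix all bits except those of the coordinate k with |w_k| maximal. Distinct values of
  that coordinate move the inner product by at least |w_k| / 2^depth, but a bad direction confines
  it to modulus below half of this, so at most one value is bad.\<close>

lemma bad_direction:
  fixes w :: "nat \<Rightarrow> real" and \<beta> :: nat
  assumes n: "1 \<le> n"
  defines "B \<equiv> {b. \<exists>k<n. 2 * 2 ^ \<beta> * \<bar>ip n (rand_dir \<beta> b) w\<bar> < \<bar>w k\<bar>}"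
  shows "B \<in> sets coin_space" "measure coin_space B \<le> (1 / 2) ^ \<beta>"
proof -
  obtain k where k: "k < n" and max: "\<And>i. i < n \<Longrightarrow> \<bar>w i\<bar> \<le> \<bar>w k\<bar>"
  proof -
    have "Max ((\<lambda>i. \<bar>w i\<bar>) ` {..<n}) \<in> (\<lambda>i. \<bar>w i\<bar>) ` {..<n}" using n by (intro Max_in) (auto simp: lessThan_empty_iff)
    then obtain k where "k < n" "\<bar>w k\<bar> = Max ((\<lambda>i. \<bar>w i\<bar>) ` {..<n})" by auto
    then show ?thesis using that[of k] by (metis Max_ge finite_imageI finite_lessThan imageI lessThan_iff)
  qed
  let ?J = "{..<n * \<beta>}" and ?K = "{k * \<beta>..<k * \<beta> + \<beta>}"
  have idx: "i * \<beta> + r < n * \<beta>" if "i < n" "r < \<beta>" for i r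
  proof -
    have "i * \<beta> + r < Suc i * \<beta>" "Suc i * \<beta> \<le> n * \<beta>" using that mult_le_mono1[of "Suc i" n \<beta>] by simp_all
    then show ?thesis by (rule less_le_trans)
  qed
  have disj: "i * \<beta> + r \<notin> ?K" if ne: "i \<noteq> k" and r: "r < \<beta>" for i r
  proof
    assume *: "i * \<beta> + r \<in> ?K"
    consider "Suc i \<le> k" | "Suc k \<le> i" using ne by linarith
    then show False
    proof cases
      case 1
      then show False using * r mult_le_mono1[OF 1, of \<beta>] by simp
    next
      case 2
      then show False using * mult_le_mono1[OF 2, of \<beta>] by simp
    qed
  qed
  have K: "?K \<subseteq> ?J" using idx[OF k] by (auto simp: le_iff_add)
  have cK: "card ?K = \<beta>" by simp
  have fact1: "B \<in> sets coin_space \<and> measure coin_space B \<le> (1 / 2) ^ card ?K"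
  proof (intro conjI)
    have cong: "b' \<in> B" if eq: "\<And>j. j \<in> ?J \<Longrightarrow> b j = b' j" and b: "b \<in> B" for b b'
    proof -
      have "rand_dir \<beta> b i = rand_dir \<beta> b' i" if "i < n" for i
        unfolding rand_dir_def using eq idx[OF that] by (intro arg_cong[where f = "\<lambda>x. real x / 2 ^ \<beta>"] bits_value_cong) auto
      then have "ip n (rand_dir \<beta> b) w = ip n (rand_dir \<beta> b') w" by (intro ip_cong) auto
      then show ?thesis using b by (simp add: B_def)
    qed
    have det: "b j = b' j"
      if b: "b \<in> B" "b' \<in> B" and eq: "\<And>j. j \<in> ?J - ?K \<Longrightarrow> b j = b' j" and j: "j \<in> ?K" for b b' j
    proof -
      let ?r = "\<lambda>b. real (bits_value b (k * \<beta>) \<beta>)"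
      have other: "rand_dir \<beta> b i = rand_dir \<beta> b' i" if "i < n" "i \<noteq> k" for i
        unfolding rand_dir_def using eq idx[OF that(1)] disj[OF that(2)]
        by (intro arg_cong[where f = "\<lambda>x. real x / 2 ^ \<beta>"] bits_value_cong) auto
      have split: "ip n (rand_dir \<beta> b) w = ?r b / 2 ^ \<beta> * w k + (\<Sum>i\<in>{..<n} - {k}. rand_dir \<beta> b i * w i)" for b
        unfolding ip_def using k by (subst sum.remove[of _ k]) (auto simp: rand_dir_def)
      have "(\<Sum>i\<in>{..<n} - {k}. rand_dir \<beta> b i * w i) = (\<Sum>i\<in>{..<n} - {k}. rand_dir \<beta> b' i * w i)"
        using other by (intro sum.cong) auto
      then have "2 ^ \<beta> * (ip n (rand_dir \<beta> b) w - ip n (rand_dir \<beta> b') w) = (?r b - ?r b') * w k"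
        unfolding split by (simp add: field_simps)
      then have eq2: "\<bar>?r b - ?r b'\<bar> * \<bar>w k\<bar> = 2 ^ \<beta> * \<bar>ip n (rand_dir \<beta> b) w - ip n (rand_dir \<beta> b') w\<bar>"
        by (metis abs_mult abs_of_nonneg zero_le_numeral zero_le_power)
      have lt: "2 ^ \<beta> * \<bar>ip n (rand_dir \<beta> b) w\<bar> < \<bar>w k\<bar> / 2" if bB: "b \<in> B" for b
      proof -
        obtain i where "i < n" "2 * 2 ^ \<beta> * \<bar>ip n (rand_dir \<beta> b) w\<bar> < \<bar>w i\<bar>" using bB by (auto simp: B_def)
        then show ?thesis using max[of i] by linarith
      qed
      have "2 ^ \<beta> * \<bar>ip n (rand_dir \<beta> b) w - ip n (rand_dir \<beta> b') w\<bar> \<le>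
          2 ^ \<beta> * (\<bar>ip n (rand_dir \<beta> b) w\<bar> + \<bar>ip n (rand_dir \<beta> b') w\<bar>)" by (intro mult_left_mono) auto
      then have "\<bar>?r b - ?r b'\<bar> * \<bar>w k\<bar> < \<bar>w k\<bar>"
        unfolding eq2 using lt[OF b(1)] lt[OF b(2)] by (simp add: distrib_left)
      then have "\<bar>?r b - ?r b'\<bar> < 1" by (cases "w k = 0") auto
      then have "bits_value b (k * \<beta>) \<beta> = bits_value b' (k * \<beta>) \<beta>" by linarith
      from bits_value_inj[OF this, of "j - k * \<beta>"] j show ?thesis by auto
    qed
    show "B \<in> sets coin_space"
    proof (rule measure_determined_le(1)[OF finite_lessThan K])
      fix b b' :: "nat \<Rightarrow> bool"
      assume eq: "\<And>j. j \<in> ?J \<Longrightarrow> b j = b' j" and b: "b \<in> B"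
      show "b' \<in> B" using eq b by (rule cong[of b b'])
    next
      fix b b' :: "nat \<Rightarrow> bool" and j
      assume b: "b \<in> B" "b' \<in> B" and eq: "\<And>j. j \<in> ?J - ?K \<Longrightarrow> b j = b' j" and j: "j \<in> ?K"
      show "b j = b' j" using b eq j by (rule det[of b b'])
    qed
    show "measure coin_space B \<le> (1 / 2) ^ card ?K"
    proof (rule measure_determined_le(2)[OF finite_lessThan K])
      fix b b' :: "nat \<Rightarrow> bool"
      assume eq: "\<And>j. j \<in> ?J \<Longrightarrow> b j = b' j" and b: "b \<in> B"
      show "b' \<in> B" using eq b by (rule cong[of b b'])
    next
      fix b b' :: "nat \<Rightarrow> bool" and j
      assume b: "b \<in> B" "b' \<in> B" and eq: "\<And>j. j \<in> ?J - ?K \<Longrightarrow> b j = b' j" and j: "j \<in> ?K"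
      show "b j = b' j" using b eq j by (rule det[of b b'])
    qed
  qed
  then show "B \<in> sets coin_space" "measure coin_space B \<le> (1 / 2) ^ \<beta>" unfolding cK by auto
qed

text \<open>Union bound over the 2 n^2 signed pairs; a pair whose combination vanishes has an empty
  bad set.\<close>

lemma good_directions:
  fixes \<alpha> :: "nat \<Rightarrow> nat \<Rightarrow> real"
  assumes n: "1 \<le> n"
  shows "\<exists>G\<in>sets coin_space. 1 - 2 * (real n)\<^sup>2 / 2 ^ \<beta> \<le> measure coin_space G \<and>
    (\<forall>b\<in>G. \<forall>i<n. \<forall>j<n. \<forall>s\<in>{1, -1}. \<forall>k<n. \<bar>\<alpha> i k - s * \<alpha> j k\<bar> \<le>
      2 * 2 ^ \<beta> * \<bar>ip n (rand_dir \<beta> b) (\<lambda>k. \<alpha> i k - s * \<alpha> j k)\<bar>)"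
proof -
  interpret prob_space coin_space by (rule prob_space_coin_space)
  define B where "B = (\<lambda>(i, j, s). {b. \<exists>k<n. 2 * 2 ^ \<beta> * \<bar>ip n (rand_dir \<beta> b) (\<lambda>k. \<alpha> i k - s * \<alpha> j k)\<bar> < \<bar>\<alpha> i k - s * \<alpha> j k\<bar>})"
  let ?I = "{..<n} \<times> {..<n} \<times> {1, -1 :: real}"
  have B: "B x \<in> sets coin_space" "measure coin_space (B x) \<le> (1 / 2) ^ \<beta>" for x
    using bad_direction[OF n, of \<beta> "\<lambda>k. \<alpha> (fst x) k - snd (snd x) * \<alpha> (fst (snd x)) k"]
    by (simp_all add: B_def case_prod_unfold)
  have "measure coin_space (\<Union>x\<in>?I. B x) \<le> (\<Sum>x\<in>?I. measure coin_space (B x))"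
    by (rule finite_measure_subadditive_finite) (use B in auto)
  also have "\<dots> \<le> (\<Sum>x\<in>?I. (1 / 2) ^ \<beta>)" by (intro sum_mono B)
  also have "\<dots> = 2 * (real n)\<^sup>2 / 2 ^ \<beta>" 
  proof -
    have c: "card ?I = 2 * n * n" by (simp add: card_cartesian_product)
    show ?thesis unfolding sum_constant c by (simp add: power2_eq_square power_one_over)
  qed
  finally have m: "measure coin_space (\<Union>x\<in>?I. B x) \<le> 2 * (real n)\<^sup>2 / 2 ^ \<beta>" .
  have U: "(\<Union>x\<in>?I. B x) \<in> sets coin_space" using B by auto
  let ?G = "space coin_space - (\<Union>x\<in>?I. B x)"
  have "?G \<in> sets coin_space" using U by auto
  moreover have "1 - 2 * (real n)\<^sup>2 / 2 ^ \<beta> \<le> measure coin_space ?G" using prob_compl[OF U] m by simp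
  moreover have "\<forall>b\<in>?G. \<forall>i<n. \<forall>j<n. \<forall>s\<in>{1, -1}. \<forall>k<n. \<bar>\<alpha> i k - s * \<alpha> j k\<bar> \<le>
      2 * 2 ^ \<beta> * \<bar>ip n (rand_dir \<beta> b) (\<lambda>k. \<alpha> i k - s * \<alpha> j k)\<bar>"
  proof (intro ballI allI impI)
    fix b i j k and s :: real
    assume b: "b \<in> ?G" "i < n" "j < n" "s \<in> {1, -1}" and k: "k < n"
    then have "b \<notin> B (i, j, s)" by auto
    then have "\<not> 2 * 2 ^ \<beta> * \<bar>ip n (rand_dir \<beta> b) (\<lambda>k. \<alpha> i k - s * \<alpha> j k)\<bar> < \<bar>\<alpha> i k - s * \<alpha> j k\<bar>"
      using k by (auto simp: B_def)
    then show "\<bar>\<alpha> i k - s * \<alpha> j k\<bar> \<le> 2 * 2 ^ \<beta> * \<bar>ip n (rand_dir \<beta> b) (\<lambda>k. \<alpha> i k - s * \<alpha> j k)\<bar>"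
      by linarith
  qed
  ultimately show ?thesis by blast
qed

section \<open>Smallest singular value and operator norm\<close>

lemma fun_inverse:
  fixes Z :: "nat \<Rightarrow> nat \<Rightarrow> real"
  assumes inj: "\<And>x. (\<And>i. i < n \<Longrightarrow> mv n Z x i = 0) \<Longrightarrow> (\<And>i. i < n \<Longrightarrow> x i = 0)"
  shows "\<exists>R. (\<forall>i<n. \<forall>j<n. (\<Sum>k<n. R i k * Z k j) = unitv i j) \<and> (\<forall>i<n. \<forall>j<n. (\<Sum>k<n. Z i k * R k j) = unitv i j)"
proof -
  define M where "M = mat n n (\<lambda>(i, j). Z i j)"
  have M: "M \<in> carrier_mat n n" by (simp add: M_def)
  have "det M \<noteq> 0"
  proof
    assume "det M = 0"
    then obtain v where v: "v \<in> carrier_vec n" "v \<noteq> 0\<^sub>v n" "M *\<^sub>v v = 0\<^sub>v n"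
      using det_0_iff_vec_prod_zero_field[OF M] by auto
    have "mv n Z (\<lambda>i. vec_index v i) i = 0" if i: "i < n" for i
    proof -
      have "mv n Z (\<lambda>i. vec_index v i) i = vec_index (M *\<^sub>v v) i"
        using i v(1) by (simp add: M_def mv_def scalar_prod_def atLeast0LessThan)
      then show ?thesis using v(3) i by simp
    qed
    then have "vec_index v i = 0" if "i < n" for i using inj[of "\<lambda>i. vec_index v i"] that by blast
    then show False using v(1,2) by (auto intro!: eq_vecI)
  qed
  from det_non_zero_imp_unit[OF M this, of "()"] obtain N where N: "N \<in> carrier_mat n n" "N * M = 1\<^sub>m n" "M * N = 1\<^sub>m n"
    by (auto simp: Units_def ring_mat_def)
  have "(\<Sum>k<n. N $$ (i, k) * Z k j) = unitv i j" if "i < n" "j < n" for i j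
  proof -
    have "(N * M) $$ (i, j) = (\<Sum>k<n. N $$ (i, k) * Z k j)"
      using that N(1) by (simp add: M_def scalar_prod_def atLeast0LessThan)
    then show ?thesis using N(2) that by (auto simp: unitv_def)
  qed
  moreover have "(\<Sum>k<n. Z i k * N $$ (k, j)) = unitv i j" if "i < n" "j < n" for i j
  proof -
    have "(M * N) $$ (i, j) = (\<Sum>k<n. Z i k * N $$ (k, j))"
      using that N(1) by (simp add: M_def scalar_prod_def atLeast0LessThan)
    then show ?thesis using N(3) that by (auto simp: unitv_def)
  qed
  ultimately show ?thesis by (intro exI[of _ "\<lambda>i j. N $$ (i, j)"]) auto
qed

lemma nrm_eq_0_iff: "nrm n x = 0 \<longleftrightarrow> (\<forall>i<n. x i = 0)"
  by (auto simp: nrm_def L2_set_eq_0_iff)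

lemma mv_left_inverse:
  assumes "\<And>i j. i < n \<Longrightarrow> j < n \<Longrightarrow> (\<Sum>k<n. R i k * Z k j) = unitv i j" "i < n"
  shows "mv n R (mv n Z x) i = x i"
proof -
  have "mv n R (mv n Z x) i = (\<Sum>k<n. \<Sum>j<n. R i k * (Z k j * x j))" by (simp add: mv_def sum_distrib_left)
  also have "\<dots> = (\<Sum>j<n. \<Sum>k<n. R i k * (Z k j * x j))" by (rule sum.swap)
  also have "\<dots> = (\<Sum>j<n. (\<Sum>k<n. R i k * Z k j) * x j)" unfolding sum_distrib_right by (simp add: mult_ac)
  also have "\<dots> = (\<Sum>j<n. unitv i j * x j)" using assms by (intro sum.cong) auto
  also have "\<dots> = x i" using ip_unitv[OF assms(2), of x] by (simp add: ip_def mult.commute)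
  finally show ?thesis .
qed

text \<open>If \<open>\<mu>\<close> is the infimum of the Rayleigh quotient of \<open>G = F\<^sup>T F\<close>, then \<open>G - \<mu> I\<close> is positive semidefinite
  with infimum 0 and therefore singular: otherwise the Cauchy--Schwarz inequality for the form would bound
  its Rayleigh quotient away from 0. So \<open>\<mu>\<close> is an eigenvalue; no compactness is needed.\<close>

lemma rayleigh_singular:
  fixes F :: "nat \<Rightarrow> nat \<Rightarrow> real"
  assumes n: "1 \<le> n"
  shows "\<exists>\<mu> x. 0 \<le> \<mu> \<and> (\<forall>w. \<mu> * (nrm n w)\<^sup>2 \<le> (nrm n (mv n F w))\<^sup>2) \<and> (\<exists>i<n. x i \<noteq> 0) \<and>
    (\<forall>i<n. mv n (tr F) (mv n F x) i = \<mu> * x i)"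
proof -
  define T where "T = {(nrm n (mv n F w))\<^sup>2 |w. nrm n w = 1}"
  define \<mu> where "\<mu> = Inf T"
  have T0: "\<And>t. t \<in> T \<Longrightarrow> 0 \<le> t" by (auto simp: T_def)
  have ne: "T \<noteq> {}" using nrm_unitv[of 0 n] n by (auto simp: T_def)
  have bdd: "bdd_below T" using T0 by (rule bdd_belowI)
  have \<mu>0: "0 \<le> \<mu>" unfolding \<mu>_def using ne T0 by (rule cInf_greatest)
  have scaled: "mv n F (\<lambda>i. c * w i) = (\<lambda>i. c * mv n F w i)" for c w
    by (rule ext) (simp add: mv_def sum_distrib_left mult_ac)
  have low: "\<mu> * (nrm n w)\<^sup>2 \<le> (nrm n (mv n F w))\<^sup>2" for w
  proof (cases "nrm n w = 0")
    case False
    let ?c = "1 / nrm n w"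
    have "nrm n (\<lambda>i. ?c * w i) = 1" using False unfolding nrm_scale by simp
    then have "(nrm n (mv n F (\<lambda>i. ?c * w i)))\<^sup>2 \<in> T" unfolding T_def by blast
    then have "\<mu> \<le> (nrm n (mv n F (\<lambda>i. ?c * w i)))\<^sup>2" unfolding \<mu>_def using bdd by (rule cInf_lower)
    also have "\<dots> = (nrm n (mv n F w))\<^sup>2 / (nrm n w)\<^sup>2" unfolding scaled nrm_scale by (simp add: power_divide)
    finally show ?thesis using False by (simp add: pos_le_divide_eq)
  qed simp
  define S where "S i j = (\<Sum>k<n. F k i * F k j) - (if i = j then \<mu> else 0)" for i j
  have S: "mv n S w i = mv n (tr F) (mv n F w) i - \<mu> * w i" if i: "i < n" for w i
  proof -
    have "mv n (tr F) (mv n F w) i = (\<Sum>k<n. \<Sum>j<n. F k i * (F k j * w j))" by (simp add: mv_def tr_def sum_distrib_left)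
    also have "\<dots> = (\<Sum>j<n. \<Sum>k<n. F k i * (F k j * w j))" by (rule sum.swap)
    also have "\<dots> = (\<Sum>j<n. (\<Sum>k<n. F k i * F k j) * w j)" unfolding sum_distrib_right by (simp add: mult_ac)
    finally have eq: "mv n (tr F) (mv n F w) i = (\<Sum>j<n. (\<Sum>k<n. F k i * F k j) * w j)" .
    have "(\<Sum>j<n. (if i = j then \<mu> else 0) * w j) = \<mu> * w i" using i by (simp add: if_distrib[of "\<lambda>c. c * _"] cong: if_cong)
    then show ?thesis unfolding eq by (simp add: mv_def S_def left_diff_distrib sum_subtractf)
  qed
  have symS: "sym n S" by (simp add: sym_def S_def mult.commute)
  have form: "ip n w (mv n S w) = (nrm n (mv n F w))\<^sup>2 - \<mu> * (nrm n w)\<^sup>2" for w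
  proof -
    have "ip n w (mv n S w) = ip n w (\<lambda>i. mv n (tr F) (mv n F w) i - \<mu> * w i)" by (rule ip_cong) (simp_all add: S)
    also have "\<dots> = ip n (mv n F w) (mv n F w) - \<mu> * ip n w w" by (simp add: ip_diff_right ip_scale_right ip_mv)
    finally show ?thesis by (simp add: nrm_sq)
  qed
  have "\<exists>x. (\<exists>i<n. x i \<noteq> 0) \<and> (\<forall>i<n. mv n S x i = 0)"
  proof (rule ccontr)
    assume no: "\<not> ?thesis"
    then obtain R where R: "\<And>i j. i < n \<Longrightarrow> j < n \<Longrightarrow> (\<Sum>k<n. R i k * S k j) = unitv i j"
      using fun_inverse[of n S] by blast
    define r where "r = real n * (\<Sum>i<n. \<Sum>j<n. \<bar>R i j\<bar>) + 1"
    define K where "K = real n * (\<Sum>i<n. \<Sum>j<n. \<bar>S i j\<bar>) + 1"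
    have entry: "\<bar>Z i j\<bar> \<le> (\<Sum>i<n. \<Sum>j<n. \<bar>Z i j\<bar>)" if "i < n" "j < n" for Z :: "nat \<Rightarrow> nat \<Rightarrow> real" and i j
      using member_le_sum[of j "{..<n}" "\<lambda>j. \<bar>Z i j\<bar>"] member_le_sum[of i "{..<n}" "\<lambda>i. \<Sum>j<n. \<bar>Z i j\<bar>"] that
      by (auto simp: sum_nonneg)
    have pos: "0 \<le> (\<Sum>i<n. \<Sum>j<n. \<bar>Z i j\<bar>)" for Z :: "nat \<Rightarrow> nat \<Rightarrow> real" by (intro sum_nonneg) auto
    have rp: "0 < r" "0 < K" unfolding r_def K_def using pos[of R] pos[of S] by (simp_all add: add_nonneg_pos)
    have opR: "nrm n (mv n R w) \<le> r * nrm n w" for w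
    proof -
      have "nrm n (mv n R w) \<le> real n * (\<Sum>i<n. \<Sum>j<n. \<bar>R i j\<bar>) * nrm n w"
        by (rule nrm_mv_le[OF entry pos])
      also have "\<dots> \<le> r * nrm n w" by (intro mult_right_mono) (simp_all add: r_def)
      finally show ?thesis .
    qed
    have opS: "nrm n (mv n S w) \<le> K * nrm n w" for w
    proof -
      have "nrm n (mv n S w) \<le> real n * (\<Sum>i<n. \<Sum>j<n. \<bar>S i j\<bar>) * nrm n w"
        by (rule nrm_mv_le[OF entry pos])
      also have "\<dots> \<le> K * nrm n w" by (intro mult_right_mono) (simp_all add: K_def)
      finally show ?thesis .
    qed
    have "1 / (r\<^sup>2 * K) + \<mu> \<le> t" if "t \<in> T" for t
    proof -
      from that obtain x where x: "nrm n x = 1" "t = (nrm n (mv n F x))\<^sup>2" by (auto simp: T_def)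
      let ?y = "mv n S x"
      have "1 = nrm n (mv n R ?y)" using x(1) mv_left_inverse[OF R] by (metis (no_types, lifting) nrm_cong)
      also have "\<dots> \<le> r * nrm n ?y" by (rule opR)
      finally have "1\<^sup>2 \<le> (r * nrm n ?y)\<^sup>2" by (intro power_mono) auto
      then have b: "1 \<le> r\<^sup>2 * (nrm n ?y)\<^sup>2" by (simp add: power_mult_distrib)
      have c: "ip n ?y (mv n S ?y) \<le> K * (nrm n ?y)\<^sup>2"
      proof -
        have "ip n ?y (mv n S ?y) \<le> nrm n ?y * nrm n (mv n S ?y)" using abs_ip_le[of n ?y "mv n S ?y"] by linarith
        also have "\<dots> \<le> nrm n ?y * (K * nrm n ?y)" by (intro mult_left_mono opS) simp
        finally show ?thesis by (simp add: power2_eq_square mult_ac)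
      qed
      define z where "z i = x i - (1 / K) * ?y i" for i
      have "0 \<le> ip n z (mv n S z)" unfolding form using low[of z] by simp
      also have "ip n z (mv n S z) = ip n x ?y - 2 * (1 / K) * (nrm n ?y)\<^sup>2 + (1 / K)\<^sup>2 * ip n ?y (mv n S ?y)"
      proof -
        have Sz: "mv n S z = (\<lambda>i. ?y i - (1 / K) * mv n S ?y i)" unfolding z_def by (rule mv_diff_scale)
        have l: "ip n z w = ip n x w - (1 / K) * ip n ?y w" for w
          using ip_diff_right[of n w x "\<lambda>i. (1 / K) * ?y i"] ip_scale_right[of n w "1 / K" ?y]
          unfolding z_def by (simp add: ip_commute)
        have xy: "ip n x (mv n S ?y) = (nrm n ?y)\<^sup>2" by (simp add: nrm_sq ip_mv_sym[OF symS])
        show ?thesis unfolding Sz ip_diff_right ip_scale_right l xy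
          by (simp add: power2_eq_square algebra_simps flip: nrm_sq)
      qed
      finally have "2 * (1 / K) * (nrm n ?y)\<^sup>2 \<le> ip n x ?y + (1 / K)\<^sup>2 * ip n ?y (mv n S ?y)" by simp
      also have "(1 / K)\<^sup>2 * ip n ?y (mv n S ?y) \<le> (1 / K)\<^sup>2 * (K * (nrm n ?y)\<^sup>2)" by (intro mult_left_mono c) simp
      also have "\<dots> = (1 / K) * (nrm n ?y)\<^sup>2" using rp by (simp add: power2_eq_square)
      finally have "(1 / K) * (nrm n ?y)\<^sup>2 \<le> ip n x ?y" by simp
      moreover have "1 / (r\<^sup>2 * K) \<le> (1 / K) * (nrm n ?y)\<^sup>2" using b rp by (simp add: field_simps)
      ultimately have "1 / (r\<^sup>2 * K) \<le> ip n x ?y" by linarith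
      then show ?thesis using form[of x] x by simp
    qed
    then have "1 / (r\<^sup>2 * K) + \<mu> \<le> \<mu>" unfolding \<mu>_def using ne by (intro cInf_greatest) auto
    moreover have "0 < r\<^sup>2 * K" using rp by simp
    then have "0 < 1 / (r\<^sup>2 * K)" by simp
    ultimately show False by linarith
  qed
  then obtain x where x: "\<exists>i<n. x i \<noteq> 0" "\<forall>i<n. mv n S x i = 0" by blast
  then have "\<forall>i<n. mv n (tr F) (mv n F x) i = \<mu> * x i" using S by auto
  then show ?thesis using \<mu>0 low x(1) by blast
qed

text \<open>The unit vector e_j is admissible in the supremum; the crude entry bound serves to show
  that the supremum is over a bounded set.\<close>

lemma entry_le_op_norm:
  assumes M: "M \<in> carrier_mat n n" and j: "j < n"
  shows "sqrt (\<Sum>i<n. (M $$ (i, j))\<^sup>2) \<le> op_norm M"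
proof -
  let ?F = "\<lambda>i j. M $$ (i, j)"
  have mvF: "vec_index (M *\<^sub>v x) i = mv n ?F (\<lambda>i. vec_index x i) i" if "x \<in> carrier_vec n" "i < n" for x :: "real Matrix.vec" and i
    using that M by (simp add: mv_def scalar_prod_def atLeast0LessThan)
  have val: "sqrt ((M *\<^sub>v x) \<bullet> (M *\<^sub>v x)) = nrm n (mv n ?F (\<lambda>i. vec_index x i))" if "x \<in> carrier_vec n" for x :: "real Matrix.vec"
  proof -
    have "(M *\<^sub>v x) \<bullet> (M *\<^sub>v x) = (\<Sum>i<n. (mv n ?F (\<lambda>i. vec_index x i) i)\<^sup>2)"
      using that M mvF[OF that] by (simp add: scalar_prod_def atLeast0LessThan power2_eq_square)
    then show ?thesis by (simp add: nrm_def L2_set_def)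
  qed
  define B where "B = (\<Sum>i<n. \<Sum>j<n. \<bar>?F i j\<bar>)"
  have entry: "\<bar>?F i j\<bar> \<le> B" if "i < n" "j < n" for i j
    unfolding B_def using member_le_sum[of j "{..<n}" "\<lambda>j. \<bar>?F i j\<bar>"] member_le_sum[of i "{..<n}" "\<lambda>i. \<Sum>j<n. \<bar>?F i j\<bar>"] that
    by (auto simp: sum_nonneg)
  have B0: "0 \<le> B" unfolding B_def by (intro sum_nonneg) auto
  have bdd: "bdd_above ((\<lambda>x. sqrt ((M *\<^sub>v x) \<bullet> (M *\<^sub>v x))) ` {x \<in> carrier_vec (dim_col M). x \<bullet> x \<le> 1})"
  proof (rule bdd_aboveI2)
    fix x :: "real Matrix.vec" assume "x \<in> {x \<in> carrier_vec (dim_col M). x \<bullet> x \<le> 1}"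
    then have x: "x \<in> carrier_vec n" "x \<bullet> x \<le> 1" using M by auto
    have "(nrm n (\<lambda>i. vec_index x i))\<^sup>2 = x \<bullet> x" using x(1) by (simp add: nrm_sq ip_def scalar_prod_def atLeast0LessThan)
    then have "(nrm n (\<lambda>i. vec_index x i))\<^sup>2 \<le> 1\<^sup>2" using x(2) by simp
    then have "nrm n (\<lambda>i. vec_index x i) \<le> 1" by (rule power2_le_imp_le) simp
    then have "real n * B * nrm n (\<lambda>i. vec_index x i) \<le> real n * B * 1" using B0 by (intro mult_left_mono) auto
    then show "sqrt ((M *\<^sub>v x) \<bullet> (M *\<^sub>v x)) \<le> real n * B"
      unfolding val[OF x(1)] using nrm_mv_le[of n ?F B "\<lambda>i. vec_index x i", OF entry B0] by simp
  qed
  have u: "(unit_vec n j :: real Matrix.vec) \<in> {x \<in> carrier_vec (dim_col M). x \<bullet> x \<le> 1}"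
    using M j scalar_prod_left_unit[of "unit_vec n j :: real Matrix.vec" n j] by simp
  have "nrm n (mv n ?F (\<lambda>i. vec_index (unit_vec n j) i)) = sqrt (\<Sum>i<n. (M $$ (i, j))\<^sup>2)"
  proof -
    have "mv n ?F (\<lambda>i. vec_index (unit_vec n j) i) i = M $$ (i, j)" for i
      using j by (simp add: mv_def unit_vec_def if_distrib cong: if_cong)
    then show ?thesis by (simp add: nrm_def L2_set_def)
  qed
  then show ?thesis unfolding op_norm_def
    using cSUP_upper[OF u bdd] val[of "unit_vec n j"] by simp
qed

locale ica_instance = ica_model +
  assumes n1: "1 \<le> n" and lam: "0 < lambda_min A"
begin

text \<open>The infimum of the Rayleigh quotient is an eigenvalue of A^T A, hence at least the
  square of \<open>lambda_min A\<close>. The spectrum is finite as the zero set of the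
  characteristic polynomial, so \<open>Min\<close> has its intended meaning.\<close>

lemma lambda_lower: "lambda_min A * nrm n x \<le> nrm n (mv n Af x)"
proof -
  obtain \<mu> w where \<mu>: "0 \<le> \<mu>" "\<And>w. \<mu> * (nrm n w)\<^sup>2 \<le> (nrm n (mv n Af w))\<^sup>2" "\<exists>i<n. w i \<noteq> 0"
    "\<And>i. i < n \<Longrightarrow> mv n (tr Af) (mv n Af w) i = \<mu> * w i"
    using rayleigh_singular[OF n1, of Af] by blast
  let ?G = "transpose_mat A * A"
  have G: "?G \<in> carrier_mat n n" using A by simp
  have "eigenvalue ?G \<mu>"
    unfolding eigenvalue_def eigenvector_def
  proof (intro exI conjI)
    show "Matrix.vec n w \<in> carrier_vec (dim_row ?G)" using A by simp
    show "Matrix.vec n w \<noteq> 0\<^sub>v (dim_row ?G)"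
    proof
      assume eq: "Matrix.vec n w = 0\<^sub>v (dim_row ?G)"
      obtain i where i: "i < n" "w i \<noteq> 0" using \<mu>(3) by blast
      have "vec_index (Matrix.vec n w) i = vec_index (0\<^sub>v n :: real Matrix.vec) i" using eq A by simp
      then show False using i by simp
    qed
    show "?G *\<^sub>v Matrix.vec n w = \<mu> \<cdot>\<^sub>v Matrix.vec n w"
    proof (rule eq_vecI)
      fix i assume "i < dim_vec (\<mu> \<cdot>\<^sub>v Matrix.vec n w)"
      then have i: "i < n" by simp
      have "?G *\<^sub>v Matrix.vec n w = transpose_mat A *\<^sub>v (A *\<^sub>v Matrix.vec n w)"
        using A by (intro assoc_mult_mat_vec[of _ n n _ n]) auto
      also have "vec_index (\<dots>) i = mv n (tr Af) (mv n Af w) i"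
        using A i by (simp add: mv_def tr_def Af_def scalar_prod_def atLeast0LessThan)
      finally show "vec_index (?G *\<^sub>v Matrix.vec n w) i = vec_index (\<mu> \<cdot>\<^sub>v Matrix.vec n w) i" using \<mu>(4)[OF i] i by simp
    qed (use A in simp)
  qed
  moreover have fin: "finite {k. eigenvalue ?G k}"
  proof -
    have "char_poly ?G \<noteq> 0" using degree_monic_char_poly[OF G] by auto
    then show ?thesis unfolding eigenvalue_root_char_poly[OF G] by (rule poly_roots_finite)
  qed
  ultimately have "Min {k. eigenvalue ?G k} \<le> \<mu>" by (intro Min_le) auto
  moreover have "(lambda_min A)\<^sup>2 = Min {k. eigenvalue ?G k}"
    using lam unfolding lambda_min_def by simp
  ultimately have le: "(lambda_min A)\<^sup>2 \<le> \<mu>" by simp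
  have "(lambda_min A * nrm n x)\<^sup>2 \<le> \<mu> * (nrm n x)\<^sup>2"
    unfolding power_mult_distrib using le by (intro mult_right_mono) auto
  also have "\<dots> \<le> (nrm n (mv n Af x))\<^sup>2" by (rule \<mu>(2))
  finally show ?thesis by (rule power2_le_imp_le) simp
qed

text \<open>The dual basis consists of the rows of the inverse R. The bound for the transpose
  follows from |x|^2 = <R x, A^T x> together with the bound for A at R x.\<close>

lemma inverse_exists: "\<exists>B. \<forall>k<n. \<forall>j<n. mv n (tr Af) (B k) j = unitv k j"
  and lambda_lower_transpose: "lambda_min A * nrm n x \<le> nrm n (mv n (tr Af) x)"
proof -
  have inj: "x i = 0" if z: "\<And>i. i < n \<Longrightarrow> mv n Af x i = 0" and i: "i < n" for x i
  proof -
    have "nrm n (mv n Af x) = 0" using z by (simp add: nrm_eq_0_iff)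
    then have "lambda_min A * nrm n x \<le> 0" using lambda_lower[of x] by simp
    then have "nrm n x \<le> 0" using lam by (simp add: mult_le_0_iff)
    then have "nrm n x = 0" using nrm_nonneg[of n x] by linarith
    then show ?thesis using i by (simp add: nrm_eq_0_iff)
  qed
  obtain R where R: "\<And>i j. i < n \<Longrightarrow> j < n \<Longrightarrow> (\<Sum>k<n. R i k * Af k j) = unitv i j"
    "\<And>i j. i < n \<Longrightarrow> j < n \<Longrightarrow> (\<Sum>k<n. Af i k * R k j) = unitv i j"
    using fun_inverse[of n Af] inj by blast
  have "mv n (tr Af) (R k) j = unitv k j" if "k < n" "j < n" for k j
    using R(1)[OF that] by (simp add: mv_def tr_def mult.commute)
  then show "\<exists>B. \<forall>k<n. \<forall>j<n. mv n (tr Af) (B k) j = unitv k j" by blast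
  show "lambda_min A * nrm n x \<le> nrm n (mv n (tr Af) x)"
  proof (cases "nrm n x = 0")
    case False
    have inv: "mv n Af (mv n R x) i = x i" if "i < n" for i using mv_left_inverse[OF R(2) that] .
    have "nrm n x * nrm n x = ip n x (mv n Af (mv n R x))"
      by (simp add: nrm_sq inv cong: ip_cong flip: power2_eq_square)
    also have "\<dots> = ip n (mv n R x) (mv n (tr Af) x)" by (metis ip_commute ip_mv)
    also have "\<dots> \<le> nrm n (mv n R x) * nrm n (mv n (tr Af) x)" using abs_ip_le[of n "mv n R x"] by (meson abs_le_D1)
    finally have "lambda_min A * (nrm n x * nrm n x) \<le> (lambda_min A * nrm n (mv n R x)) * nrm n (mv n (tr Af) x)"
      using lam by (simp add: mult.assoc)
    also have "lambda_min A * nrm n (mv n R x) \<le> nrm n x"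
      using lambda_lower[of "mv n R x"] nrm_cong[of n "mv n Af (mv n R x)" x] inv by simp
    then have "(lambda_min A * nrm n (mv n R x)) * nrm n (mv n (tr Af) x) \<le> nrm n x * nrm n (mv n (tr Af) x)"
      by (rule mult_right_mono) simp
    finally have "(lambda_min A * nrm n x) * nrm n x \<le> nrm n (mv n (tr Af) x) * nrm n x" by (simp add: mult_ac)
    moreover have "0 < nrm n x" using False nrm_nonneg[of n x] by linarith
    ultimately show ?thesis by (subst (asm) mult_le_cancel_right_pos)
  qed simp
qed

abbreviation S :: "real mat" where "S \<equiv> covariance_mat n N"

lemma cov_diag_nonneg: "0 \<le> cov i i"
  by (simp add: cov_def)

lemma V_le: "V \<le> real n * (op_norm A)\<^sup>2 + real n * op_norm S"
proof -
  have "(\<Sum>i<n. (Af i k)\<^sup>2) \<le> (op_norm A)\<^sup>2" if k: "k < n" for k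
  proof -
    have "(sqrt (\<Sum>i<n. (Af i k)\<^sup>2))\<^sup>2 \<le> (op_norm A)\<^sup>2"
      using entry_le_op_norm[OF A k] by (intro power_mono) (auto simp: Af_def sum_nonneg)
    then show ?thesis by (simp add: sum_nonneg)
  qed
  then have "(\<Sum>k<n. \<Sum>i<n. (Af i k)\<^sup>2) \<le> (\<Sum>k<n. (op_norm A)\<^sup>2)" by (intro sum_mono) auto
  then have 1: "(\<Sum>i<n. \<Sum>k<n. Af i k * Af i k) \<le> real n * (op_norm A)\<^sup>2"
    by (subst sum.swap) (simp add: power2_eq_square)
  have "cov i i \<le> op_norm S" if i: "i < n" for i
  proof -
    have S: "S \<in> carrier_mat n n" by (simp add: covariance_mat_def)
    have "(S $$ (i, i))\<^sup>2 \<le> (\<Sum>j<n. (S $$ (j, i))\<^sup>2)" using i by (intro member_le_sum) auto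
    then have "sqrt ((S $$ (i, i))\<^sup>2) \<le> op_norm S"
      using entry_le_op_norm[OF S i] real_sqrt_le_mono order.trans by blast
    then show ?thesis using covariance_mat_cov[OF i i] by simp
  qed
  then have "(\<Sum>i<n. cov i i) \<le> (\<Sum>i<n. op_norm S)" by (intro sum_mono) auto
  then show ?thesis using 1 by (simp add: V_def C_def sum.distrib)
qed

end

section \<open>Typical samples\<close>

context ica_instance
begin

lemma colsum_le_V: "(\<Sum>j<n. \<Sum>i<n. (Af i j)\<^sup>2) \<le> V"
proof -
  have "V = (\<Sum>i<n. \<Sum>j<n. (Af i j)\<^sup>2) + (\<Sum>i<n. cov i i)"
    by (simp add: V_def C_def sum.distrib power2_eq_square)
  moreover have "(\<Sum>i<n. \<Sum>j<n. (Af i j)\<^sup>2) = (\<Sum>j<n. \<Sum>i<n. (Af i j)\<^sup>2)" by (rule sum.swap)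
  moreover have "0 \<le> (\<Sum>i<n. cov i i)" by (simp add: cov_diag_nonneg sum_nonneg)
  ultimately show ?thesis by linarith
qed

lemma lambda_le_col: "j < n \<Longrightarrow> (lambda_min A)\<^sup>2 \<le> (\<Sum>i<n. (Af i j)\<^sup>2)"
proof -
  assume j: "j < n"
  have "mv n Af (unitv j) i = Af i j" for i using ip_unitv[OF j, of "Af i"] by (simp add: mv_def ip_def)
  then have "(nrm n (mv n Af (unitv j)))\<^sup>2 = (\<Sum>i<n. (Af i j)\<^sup>2)"
    unfolding nrm_sq ip_def by (simp add: power2_eq_square)
  moreover have "(lambda_min A)\<^sup>2 \<le> (nrm n (mv n Af (unitv j)))\<^sup>2"
    using lambda_lower[of "unitv j"] nrm_unitv[OF j] lam by (intro power_mono) auto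
  ultimately show ?thesis by simp
qed

lemma V_pos: "0 < V"
proof -
  have "0 < (lambda_min A)\<^sup>2" using lam by simp
  also have "\<dots> \<le> (\<Sum>i<n. (Af i 0)\<^sup>2)" using lambda_le_col[of 0] n1 by simp
  also have "\<dots> \<le> (\<Sum>j<n. \<Sum>i<n. (Af i j)\<^sup>2)"
    using n1 by (intro member_le_sum[of 0 "{..<n}" "\<lambda>j. \<Sum>i<n. (Af i j)\<^sup>2"]) (auto simp: sum_nonneg)
  also have "\<dots> \<le> V" by (rule colsum_le_V)
  finally show ?thesis .
qed

definition X4 :: "nat \<Rightarrow> nat \<Rightarrow> nat \<Rightarrow> nat \<Rightarrow> real" where
  "X4 i j k l = (\<integral>y. (y i * y j) * (y k * y l) \<partial>D)"

lemma X4_form: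
  assumes k: "k < n" and l: "l < n"
  shows "(\<Sum>i<n. \<Sum>j<n. u i * (u j * X4 i j k l)) =
    ip n u (mv n C u) * C k l + 2 * (mv n C u k * mv n C u l) - 2 * (\<Sum>a<n. (v u a)\<^sup>2 * (Af k a * Af l a))"
proof -
  have "(ip n u y)\<^sup>2 * (y k * y l) = (\<Sum>i<n. \<Sum>j<n. u i * (u j * ((y i * y j) * (y k * y l))))" for y
    unfolding ip_def power2_eq_square sum_product unfolding sum_distrib_right by (intro sum.cong refl) (simp add: mult_ac)
  then have "(\<integral>y. (ip n u y)\<^sup>2 * (y k * y l) \<partial>D) =
      (\<integral>y. (\<Sum>i<n. \<Sum>j<n. u i * (u j * ((y i * y j) * (y k * y l)))) \<partial>D)" by simp
  also have "\<dots> = (\<Sum>i<n. \<integral>y. (\<Sum>j<n. u i * (u j * ((y i * y j) * (y k * y l)))) \<partial>D)"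
    by (intro Bochner_Integration.integral_sum Bochner_Integration.integrable_sum integrable_mult_right moment_1111(1) k l) auto
  also have "\<dots> = (\<Sum>i<n. \<Sum>j<n. \<integral>y. u i * (u j * ((y i * y j) * (y k * y l))) \<partial>D)"
    by (intro sum.cong refl Bochner_Integration.integral_sum integrable_mult_right moment_1111(1) k l) auto
  finally show ?thesis using moment_211(2)[OF k l, of u] by (simp add: X4_def q_def)
qed

text \<open>Deviations are measured in units of V and V^2. The failure probability is then free of
  the unknown sizes, and the condition can be imposed at every scale, however small W is compared
  with V.\<close>

definition concentrated :: "nat \<Rightarrow> (nat \<Rightarrow> nat \<Rightarrow> real) \<Rightarrow> bool" where
  "concentrated w Y \<longleftrightarrow>
    (\<forall>i<n. \<forall>j<n. \<bar>(\<Sum>t<w ^ 1700. (Y t i * Y t j) / real (w ^ 1700)) - C i j\<bar> < V / real w ^ 830) \<and>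
    (\<forall>i<n. \<forall>j<n. \<forall>k<n. \<forall>l<n.
      \<bar>(\<Sum>t<w ^ 1700. ((Y t i * Y t j) * (Y t k * Y t l)) / real (w ^ 1700)) - X4 i j k l\<bar> < V\<^sup>2 / real w ^ 830)"

abbreviation stream :: "(nat \<Rightarrow> nat \<Rightarrow> real) measure" where "stream \<equiv> Pi\<^sub>M UNIV (\<lambda>_. D)"

lemma prob_space_stream: "prob_space stream"
  by (rule prob_space_PiM) (rule prob_space_D)

lemma stream_measurable: "i < n \<Longrightarrow> (\<lambda>y. y t i) \<in> borel_measurable stream"
  by (rule measurable_compose[of "\<lambda>y. y t" stream D "\<lambda>x. x i"]) (auto intro: measurable_component_singleton D_component)

text \<open>The powers of V cancel in Chebyshev, and 1700 - 2 times 830 = 40 leaves W^(-40) per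
  event. This beats the n^2 + n^4 events and the factor n^4 of the eighth moments.\<close>

lemma concentration_failure:
  assumes w: "16 \<le> w" "n \<le> w"
  shows "{y \<in> space stream. \<not> concentrated w (\<lambda>t. y (off + t))} \<in> sets stream" (is "?B \<in> _")
    and "measure stream {y \<in> space stream. \<not> concentrated w (\<lambda>t. y (off + t))} \<le> 1 / real w"
proof -
  interpret M: prob_space stream by (rule prob_space_stream)
  note [measurable] = stream_measurable
  define I2 I4 where "I2 = {..<n} \<times> {..<n}" and "I4 = ({..<n} \<times> {..<n}) \<times> ({..<n} \<times> {..<n})"
  define T2 where "T2 y i j = \<bar>(\<Sum>t<w ^ 1700. (y (off + t) i * y (off + t) j) / real (w ^ 1700)) - C i j\<bar>" for y i j
  define T4 where "T4 y i j k l = \<bar>(\<Sum>t<w ^ 1700. ((y (off + t) i * y (off + t) j) * (y (off + t) k * y (off + t) l)) /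
    real (w ^ 1700)) - X4 i j k l\<bar>" for y i j k l
  define a2 a4 where "a2 = V / real w ^ 830" and "a4 = V\<^sup>2 / real w ^ 830"
  have a: "0 < a2" "0 < a4" using V_pos w by (simp_all add: a2_def a4_def)
  define B2 where "B2 = (\<lambda>(i, j). {y \<in> space stream. a2 \<le> T2 y i j})"
  define B4 where "B4 = (\<lambda>((i, j), (k, l)). {y \<in> space stream. a4 \<le> T4 y i j k l})"
  have conc: "concentrated w (\<lambda>t. y (off + t)) \<longleftrightarrow>
    (\<forall>i<n. \<forall>j<n. T2 y i j < a2) \<and> (\<forall>i<n. \<forall>j<n. \<forall>k<n. \<forall>l<n. T4 y i j k l < a4)" for y
    unfolding concentrated_def T2_def T4_def a2_def a4_def by (rule refl)
  have [measurable]: "(\<lambda>y. T2 y i j) \<in> borel_measurable stream" if "i < n" "j < n" for i j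
    unfolding T2_def using that by measurable
  have [measurable]: "(\<lambda>y. T4 y i j k l) \<in> borel_measurable stream" if "i < n" "j < n" "k < n" "l < n" for i j k l
    unfolding T4_def using that by measurable
  have fin: "finite I2" "finite I4" by (simp_all add: I2_def I4_def)
  have B2: "B2 p \<in> sets stream" if "p \<in> I2" for p using that by (auto simp: I2_def B2_def)
  have B4: "B4 p \<in> sets stream" if "p \<in> I4" for p using that by (auto simp: I4_def B4_def)
  have eq: "?B = (\<Union>p\<in>I2. B2 p) \<union> (\<Union>p\<in>I4. B4 p)"
  proof (rule Set.set_eqI)
    fix y
    have 2: "y \<in> (\<Union>p\<in>I2. B2 p) \<longleftrightarrow> y \<in> space stream \<and> (\<exists>i<n. \<exists>j<n. a2 \<le> T2 y i j)"
      unfolding UN_iff I2_def B2_def Bex_def split_paired_Ex mem_Sigma_iff case_prod_conv mem_Collect_eq lessThan_iff by blast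
    have 4: "y \<in> (\<Union>p\<in>I4. B4 p) \<longleftrightarrow> y \<in> space stream \<and> (\<exists>i<n. \<exists>j<n. \<exists>k<n. \<exists>l<n. a4 \<le> T4 y i j k l)"
      unfolding UN_iff I4_def B4_def Bex_def split_paired_Ex mem_Sigma_iff case_prod_conv mem_Collect_eq lessThan_iff by blast
    show "y \<in> ?B \<longleftrightarrow> y \<in> (\<Union>p\<in>I2. B2 p) \<union> (\<Union>p\<in>I4. B4 p)"
      unfolding Un_iff 2 4 conc mem_Collect_eq not_less[symmetric] by blast
  qed
  show "?B \<in> sets stream" unfolding eq using B2 B4 fin by (intro sets.Un sets.finite_UN) auto
  have m0: "0 < w ^ 1700" using w by simp
  define x where "x = real w ^ 830"
  have x: "0 < x" using w by (simp add: x_def)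
  have m: "real (w ^ 1700) = real w ^ 40 * x\<^sup>2" by (simp add: x_def flip: power_mult power_add)
  have m2: "measure stream (B2 p) \<le> 6 / real w ^ 40" if "p \<in> I2" for p
  proof -
    obtain i j where p: "p = (i, j)" "i < n" "j < n" using \<open>p \<in> I2\<close> by (auto simp: I2_def)
    have "measure stream (B2 p) \<le> 6 * V\<^sup>2 / (real (w ^ 1700) * a2\<^sup>2)"
      using block_chebyshev[OF prob_space_D _ moment_11(3,4)[OF p(2,3)] m0 a(1), of off] D_component[OF p(2)] D_component[OF p(3)]
      unfolding B2_def T2_def p(1) case_prod_conv moment_11(2)[OF p(2,3)] by (simp only: borel_measurable_times simp_thms)
    also have "\<dots> = 6 / real w ^ 40"
      unfolding m a2_def a4_def x_def[symmetric] using x V_pos by (simp add: power_divide)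
    finally show ?thesis .
  qed
  have m4: "measure stream (B4 p) \<le> 512 * (real n ^ 4 + 105) / real w ^ 40" if "p \<in> I4" for p
  proof -
    obtain i j k l where p: "p = ((i, j), (k, l))" "i < n" "j < n" "k < n" "l < n" using \<open>p \<in> I4\<close> by (auto simp: I4_def)
    have "measure stream (B4 p) \<le> 512 * (real n ^ 4 + 105) * V ^ 4 / (real (w ^ 1700) * a4\<^sup>2)"
      using block_chebyshev[OF prob_space_D _ moment_1111(2,3)[OF p(2-5)] m0 a(2), of off]
        D_component[OF p(2)] D_component[OF p(3)] D_component[OF p(4)] D_component[OF p(5)]
      unfolding B4_def T4_def p(1) case_prod_conv X4_def by (simp only: borel_measurable_times simp_thms)
    also have "\<dots> = 512 * (real n ^ 4 + 105) / real w ^ 40"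
      unfolding m a2_def a4_def x_def[symmetric] using x V_pos by (simp add: power_divide flip: power_mult)
    finally show ?thesis .
  qed
  have c: "card I2 = n ^ 2" "card I4 = n ^ 4"
    by (simp_all add: I2_def I4_def card_cartesian_product power2_eq_square power4_eq_xxxx)
  have "measure stream ?B \<le> measure stream (\<Union>p\<in>I2. B2 p) + measure stream (\<Union>p\<in>I4. B4 p)"
    unfolding eq using B2 B4 fin by (intro measure_Un_le sets.finite_UN) auto
  also have "\<dots> \<le> (\<Sum>p\<in>I2. 6 / real w ^ 40) + (\<Sum>p\<in>I4. 512 * (real n ^ 4 + 105) / real w ^ 40)"
  proof (rule add_mono)
    show "measure stream (\<Union>p\<in>I2. B2 p) \<le> (\<Sum>p\<in>I2. 6 / real w ^ 40)"
      using M.finite_measure_subadditive_finite[OF fin(1), of B2] B2 sum_mono[of I2 "\<lambda>p. measure stream (B2 p)", OF m2]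
      by (meson image_subsetI order.trans)
    show "measure stream (\<Union>p\<in>I4. B4 p) \<le> (\<Sum>p\<in>I4. 512 * (real n ^ 4 + 105) / real w ^ 40)"
      using M.finite_measure_subadditive_finite[OF fin(2), of B4] B4 sum_mono[of I4 "\<lambda>p. measure stream (B4 p)", OF m4]
      by (meson image_subsetI order.trans)
  qed
  also have "\<dots> = (real n ^ 2 * 6 + real n ^ 4 * (512 * (real n ^ 4 + 105))) / real w ^ 40"
    unfolding sum_constant c add_divide_distrib of_nat_power times_divide_eq_right ..
  also have "\<dots> \<le> real w ^ 39 / real w ^ 40"
  proof (rule divide_right_mono)
    have w': "16 \<le> real w" "real n \<le> real w" using w by simp_all
    have p: "real n ^ k \<le> real w ^ k" for k using w' by (intro power_mono) auto
    have e: "105 \<le> real w ^ 4" "512 \<le> real w ^ 3"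
      using power_mono[OF w'(1), of 4] power_mono[OF w'(1), of 3] by simp_all
    have "real n ^ 4 * (512 * (real n ^ 4 + 105)) \<le> real w ^ 4 * (real w ^ 3 * (real w ^ 4 + real w ^ 4))"
      using p[of 4] e by (intro mult_mono add_mono) auto
    also have "\<dots> = 2 * real w ^ 11" by (simp flip: power_add)
    finally have 1: "real n ^ 4 * (512 * (real n ^ 4 + 105)) \<le> 2 * real w ^ 11" .
    have "real n ^ 2 * 6 \<le> real w ^ 2 * real w" using p[of 2] w' by (intro mult_mono) auto
    also have "\<dots> = real w ^ 3" by (simp add: power2_eq_square power3_eq_cube)
    also have "\<dots> \<le> real w ^ 11" using w' by (intro power_increasing) auto
    finally have "real n ^ 2 * 6 + real n ^ 4 * (512 * (real n ^ 4 + 105)) \<le> 3 * real w ^ 11" using 1 by linarith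
    also have "\<dots> \<le> real w * real w ^ 11" using w' by (intro mult_right_mono) auto
    also have "\<dots> = real w ^ 12" by (simp flip: power_Suc)
    also have "\<dots> \<le> real w ^ 39" using w' by (intro power_increasing) auto
    finally show "real n ^ 2 * 6 + real n ^ 4 * (512 * (real n ^ 4 + 105)) \<le> real w ^ 39" .
  qed simp
  also have "\<dots> = 1 / real w"
    using w power_add[of "real w" 39 1] by (simp del: power_add)
  finally show "measure stream ?B \<le> 1 / real w" .
qed

text \<open>Round l fails with probability at most l^(-(c+3)). The power c yields (n + 1)^(-c), and
  the remaining l^3 exceeds 2 l (l - 1), whose reciprocals telescope.\<close>

lemma typical_samples:
  "\<exists>G\<in>sets stream. 1 - 1 / (2 * (real n + 1) ^ c) \<le> measure stream G \<and>
    (\<forall>y\<in>G. \<forall>L\<ge>n + 16. concentrated (L ^ (c + 3)) (block (c + 3) n y L))"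
proof -
  interpret M: prob_space stream by (rule prob_space_stream)
  let ?Q = "c + 3"
  define B where "B i = {y \<in> space stream. \<not> concentrated ((n + 16 + i) ^ ?Q) (block ?Q n y (n + 16 + i))}" for i
  define f where "f i = 1 / (real n + 15 + real i)" for i
  have blk: "block q n y L = (\<lambda>t. y (offset q n L + t))" for q y L by (rule ext) (simp add: block_def)
  have L: "16 \<le> (n + 16 + i) ^ ?Q" "n \<le> (n + 16 + i) ^ ?Q" for i
    using self_le_power[of "n + 16 + i" ?Q] by simp_all
  have B: "B i \<in> sets stream" for i unfolding B_def blk by (rule concentration_failure(1)[OF L])
  have le: "measure stream (B i) \<le> 1 / (2 * (real n + 1) ^ c) * (f i - f (Suc i))" for i
  proof -
    let ?l = "real n + 16 + real i"
    have "measure stream (B i) \<le> 1 / real ((n + 16 + i) ^ ?Q)"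
      unfolding B_def blk by (rule concentration_failure(2)[OF L])
    also have "\<dots> = 1 / (?l ^ c * ?l ^ 3)" by (simp add: power_add add_ac)
    also have "\<dots> \<le> 1 / ((real n + 1) ^ c * (2 * (?l * (?l - 1))))"
    proof (intro divide_left_mono mult_mono)
      have "2 * (?l * (?l - 1)) \<le> ?l * (?l * ?l)" using mult_mono[of 2 ?l "?l * (?l - 1)" "?l * ?l"] by (simp add: mult_left_mono mult_ac)
      then show "2 * (?l * (?l - 1)) \<le> ?l ^ 3" by (simp add: power3_eq_cube mult_ac)
      show "(real n + 1) ^ c \<le> ?l ^ c" by (intro power_mono) auto
    qed auto
    also have "\<dots> = 1 / (2 * (real n + 1) ^ c) * (1 / (?l * (?l - 1)))" by simp
    also have "1 / (?l * (?l - 1)) = f i - f (Suc i)"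
    proof -
      have "f (Suc i) = 1 / ?l" "f i = 1 / (?l - 1)" by (simp_all add: f_def algebra_simps)
      moreover have "?l - 1 \<noteq> 0" "?l \<noteq> 0" by linarith+
      ultimately show ?thesis by (simp add: diff_frac_eq)
    qed
    finally show ?thesis .
  qed
  have "f \<longlonglongrightarrow> 0" unfolding f_def
  proof (rule tendsto_divide_0[OF tendsto_const])
    show "filterlim (\<lambda>i. real n + 15 + real i) at_infinity sequentially"
      by (intro filterlim_at_top_imp_at_infinity filterlim_tendsto_add_at_top[OF tendsto_const] filterlim_real_sequentially)
  qed
  then have s: "(\<lambda>i. 1 / (2 * (real n + 1) ^ c) * (f i - f (Suc i))) sums (1 / (2 * (real n + 1) ^ c) * (f 0 - 0))"
    by (intro sums_mult telescope_sums')
  have sm: "summable (\<lambda>i. measure stream (B i))"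
    by (rule summable_comparison_test'[OF sums_summable[OF s], of 0]) (use le in auto)
  have "measure stream (\<Union>i. B i) \<le> (\<Sum>i. measure stream (B i))"
    by (rule M.finite_measure_subadditive_countably) (use B sm in auto)
  also have "\<dots> \<le> 1 / (2 * (real n + 1) ^ c) * (f 0 - 0)"
    using suminf_le[OF le sm sums_summable[OF s]] sums_unique[OF s] by simp
  also have "\<dots> \<le> 1 / (2 * (real n + 1) ^ c) * 1" by (intro mult_left_mono) (auto simp: f_def)
  finally have mB: "measure stream (\<Union>i. B i) \<le> 1 / (2 * (real n + 1) ^ c)" by simp
  have U: "(\<Union>i. B i) \<in> sets stream" using B by auto
  show ?thesis
  proof (intro bexI[of _ "space stream - (\<Union>i. B i)"] conjI ballI allI impI)
    show "1 - 1 / (2 * (real n + 1) ^ c) \<le> measure stream (space stream - (\<Union>i. B i))"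
      using M.prob_compl[OF U] mB by simp
    show "space stream - (\<Union>i. B i) \<in> sets stream" using U by (rule sets.compl_sets)
    fix y L assume y: "y \<in> space stream - (\<Union>i. B i)" and L: "n + 16 \<le> L"
    obtain i where i: "L = n + 16 + i" using L le_Suc_ex by blast
    have "y \<notin> B i" using y by blast
    then show "concentrated (L ^ ?Q) (block ?Q n y L)" using y by (auto simp: B_def i)
  qed
qed

end

section \<open>Correctness of typical runs\<close>

lemma est_H_cong: "(\<And>i. i < n \<Longrightarrow> u i = u' i) \<Longrightarrow> est_H n m Y u = est_H n m Y u'"
proof -
  assume u: "\<And>i. i < n \<Longrightarrow> u i = u' i"
  have 1: "ip n u z = ip n u' z" for z by (rule ip_cong) (use u in auto)
  have 2: "mv n Z u = mv n Z u'" for Z unfolding mv_def using u by (intro ext sum.cong) auto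
  show ?thesis unfolding est_H_def 1 2 ..
qed

lemma frobenius_le:
  assumes "\<And>i j. i < n \<Longrightarrow> j < n \<Longrightarrow> \<bar>X i j\<bar> \<le> B" and B: "0 \<le> B"
  shows "sqrt (\<Sum>i<n. \<Sum>j<n. (X i j)\<^sup>2) \<le> real n * B"
proof (rule real_le_lsqrt)
  have "(X i j)\<^sup>2 \<le> B\<^sup>2" if "i < n" "j < n" for i j
    using power_mono[OF assms(1)[OF that], of 2] by simp
  then have "(\<Sum>i<n. \<Sum>j<n. (X i j)\<^sup>2) \<le> (\<Sum>i<n. \<Sum>j<n. B\<^sup>2)" by (intro sum_mono) auto
  then show "(\<Sum>i<n. \<Sum>j<n. (X i j)\<^sup>2) \<le> (real n * B)\<^sup>2" by (simp add: power2_eq_square mult_ac)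
qed (use B in simp)

context ica_instance
begin

definition dual_basis :: "nat \<Rightarrow> nat \<Rightarrow> real" where
  "dual_basis = (SOME B. \<forall>k<n. \<forall>j<n. mv n (tr Af) (B k) j = unitv k j)"

lemma dual_basis: "k < n \<Longrightarrow> j < n \<Longrightarrow> mv n (tr Af) (dual_basis k) j = unitv k j"
  using someI_ex[OF inverse_exists] unfolding dual_basis_def by blast

lemma C_abs_le: "i < n \<Longrightarrow> j < n \<Longrightarrow> \<bar>C i j\<bar> \<le> 2 * V"
proof -
  assume i: "i < n" and j: "j < n"
  have "\<bar>C i j\<bar> \<le> (\<integral>y. \<bar>y i * y j\<bar> \<partial>D)"
    using integral_abs_bound[of D "\<lambda>y. y i * y j"] moment_11(2)[OF i j] by simp
  also have "\<dots> \<le> (\<integral>y. y i * y i + y j * y j \<partial>D)"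
    using abs_mult_le_squares
    by (intro integral_mono integrable_abs Bochner_Integration.integrable_add moment_11(1) i j) (simp add: power2_eq_square)
  also have "\<dots> = C i i + C j j" using moment_11(1,2) i j by simp
  finally show ?thesis using C_diag_le[OF i] C_diag_le[OF j] by linarith
qed

end

text \<open>One fixed outcome of samples and coins in the good events; everything in this locale is
  deterministic. The two parts of \<open>depth\<close> say that it is the number of bits after which
  \<open>random_bits\<close> stops.\<close>

locale ica_outcome = ica_instance +
  fixes c depth :: nat and \<epsilon> :: real and y :: "nat \<Rightarrow> nat \<Rightarrow> real" and b :: "nat \<Rightarrow> bool"
  assumes eps: "0 < \<epsilon>"
    and depth: "4 * (n + 1) ^ (c + 2) \<le> 2 ^ depth" "\<And>t. t < depth \<Longrightarrow> 2 ^ t < 4 * (n + 1) ^ (c + 2)"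
    and typical: "\<And>L. n + 16 \<le> L \<Longrightarrow> concentrated (L ^ (c + 3)) (block (c + 3) n y L)"
    and directions: "\<And>i j s k. i < n \<Longrightarrow> j < n \<Longrightarrow> s \<in> {1, -1} \<Longrightarrow> k < n \<Longrightarrow>
      \<bar>Af k i / nrm n (tr Af i) - s * (Af k j / nrm n (tr Af j))\<bar> \<le>
      2 * 2 ^ depth * \<bar>ip n (rand_dir depth b) (\<lambda>k. Af k i / nrm n (tr Af i) - s * (Af k j / nrm n (tr Af j)))\<bar>"
begin

definition w :: "nat \<Rightarrow> nat" where "w L = L ^ (c + 3)"

abbreviation Y :: "nat \<Rightarrow> nat \<Rightarrow> nat \<Rightarrow> real" where "Y L \<equiv> block (c + 3) n y L"

abbreviation m :: "nat \<Rightarrow> nat" where "m L \<equiv> w L ^ 1700"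

lemma w_ge: assumes "n + 16 \<le> L" shows "L \<le> w L" "16 \<le> w L" "n \<le> w L"
  using self_le_power[of L "c + 3"] assms by (simp_all add: w_def)

text \<open>By minimality 2 * 2^depth is below 16 (n + 1)^(c + 2), hence at most L^(c+3): the loss
  of the random direction is covered by one power of W, as \<open>usep\<close> demands.\<close>

lemma depth_le: assumes L: "n + 16 \<le> L" shows "2 * 2 ^ depth \<le> w L" "depth \<le> w L"
proof -
  have "1 \<le> (n + 1) ^ (c + 2)" by (rule one_le_power) simp
  then have "(2::nat) ^ 0 < 2 ^ depth" using depth(1) unfolding power_0 by linarith
  then have "depth \<noteq> 0" by (rule contrapos_pn) simp
  then obtain e where e: "depth = Suc e" by (cases depth) auto
  have "2 * 2 ^ depth \<le> 16 * (n + 1) ^ (c + 2)" using depth(2)[of e] by (simp add: e)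
  also have "\<dots> \<le> L * L ^ (c + 2)" using L by (intro mult_mono power_mono) auto
  also have "\<dots> = L ^ Suc (c + 2)" by (rule power_Suc[symmetric])
  also have "\<dots> = w L" unfolding w_def by (rule arg_cong[of _ _ "power L"]) simp
  finally show "2 * 2 ^ depth \<le> w L" .
  moreover have "depth \<le> 2 ^ depth" using less_exp[of depth] by simp
  ultimately show "depth \<le> w L" by linarith
qed

text \<open>Holds at every scale, before W and V can be compared, and is therefore what gives the
  trace test its meaning in both directions.\<close>

lemma trace_close:
  assumes L: "n + 16 \<le> L"
  shows "\<bar>est_trace n (m L) (Y L) - V\<bar> \<le> V / 2"
proof -
  have eq: "est_trace n (m L) (Y L) = (\<Sum>i<n. \<Sum>t<m L. (Y L t i * Y L t i) / real (m L))"
    unfolding est_trace_def ip_def sum_divide_distrib by (rule sum.swap)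
  have "\<bar>est_trace n (m L) (Y L) - V\<bar> \<le> (\<Sum>i<n. \<bar>(\<Sum>t<m L. (Y L t i * Y L t i) / real (m L)) - C i i\<bar>)"
    unfolding eq V_def sum_subtractf[symmetric] by (rule sum_abs)
  also have "\<dots> \<le> (\<Sum>i<n. V / real (w L) ^ 830)"
    using typical[OF L] unfolding concentrated_def w_def by (intro sum_mono) (auto intro: less_imp_le)
  also have "\<dots> = V * (real n / real (w L) ^ 830)" by simp
  also have "\<dots> \<le> V * (1 / 2)"
  proof (rule mult_left_mono)
    have "real n * 2 \<le> real (w L) * real (w L)" using w_ge[OF L] by (intro mult_mono) auto
    also have "\<dots> = real (w L) ^ 2" by (simp add: power2_eq_square)
    also have "\<dots> \<le> real (w L) ^ 830" using w_ge[OF L] by (intro power_increasing) auto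
    finally show "real n / real (w L) ^ 830 \<le> 1 / 2" using w_ge(2)[OF L] by (simp add: field_simps)
  qed (use V_pos in simp)
  finally show ?thesis by simp
qed

section \<open>Analysis at one scale that dominates the trace\<close>

context
  fixes L assumes L: "n + 16 \<le> L" and VL: "V \<le> 2 * real (w L)"
begin

lemma scale_w: "scale (real (w L))"
  by standard (use w_ge(2)[OF L] in simp)

interpretation scale "real (w L)" by (rule scale_w)

lemma V_P: "V \<le> P 2" "V\<^sup>2 \<le> P 4" "2 * V \<le> P 3"
proof -
  show 2: "V \<le> P 2" using VL P_absorb[of 2 1] by (simp add: P_1)
  show "V\<^sup>2 \<le> P 4" using P_mult_le[of V 2 V 2 4] 2 V_pos by (simp add: power2_eq_square)
  show "2 * V \<le> P 3" using 2 P_absorb[of 2 2] by simp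
qed

lemma good_block_w: "good_block (real (w L)) n (m L) (Y L) C X4"
proof
  have P: "P (-830) = 1 / real (w L) ^ 830" using P_neg_nat[of 830] by simp
  have e2: "V / real (w L) ^ 830 \<le> P (-828)"
    using P_mult_le[of V 2 "P (-830)" "-830" "-828"] V_P by (simp add: P)
  have e4: "V\<^sup>2 / real (w L) ^ 830 \<le> P (-826)"
    using P_mult_le[of "V\<^sup>2" 4 "P (-830)" "-830" "-826"] V_P by (simp add: P)
  show "real n \<le> real (w L)" using w_ge(3)[OF L] by simp
  show "\<bar>C i j\<bar> \<le> P 3" if "i < n" "j < n" for i j using C_abs_le[OF that] V_P by linarith
  show "\<bar>(\<Sum>t<m L. (Y L t i * Y L t j) / real (m L)) - C i j\<bar> \<le> P (-828)" if "i < n" "j < n" for i j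
    using typical[OF L] that e2 unfolding concentrated_def w_def by (meson less_imp_le order.trans)
  show "\<bar>(\<Sum>t<m L. ((Y L t i * Y L t j) * (Y L t k * Y L t l)) / real (m L)) - X4 i j k l\<bar> \<le> P (-826)"
    if "i < n" "j < n" "k < n" "l < n" for i j k l
    using typical[OF L] that e4 unfolding concentrated_def w_def by (meson less_imp_le order.trans)
qed

interpretation good_block "real (w L)" n "m L" "Y L" C X4 by (rule good_block_w)

lemma mixing_w: "mixing (real (w L)) n Af dual_basis"
  by standard (use n1 w_ge(3)[OF L] order.trans[OF colsum_le_V V_P(1)] dual_basis in auto)

interpretation mixing "real (w L)" n Af dual_basis by (rule mixing_w)

lemma gen_form: "(\<Sum>a<n. (v z a)\<^sup>2 * (Af k a * Af l a)) = gen (\<lambda>j. (ip n (tr Af j) z)\<^sup>2) k l"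
  by (simp add: gen_def v_def mv_def ip_def mult.assoc)

lemma estimate_w: "estimate (real (w L)) n Af dual_basis (w L) (est_M n (m L) (Y L))"
proof
  fix k l assume kl: "k < n" "l < n"
  have "(\<Sum>i<n. gen (\<lambda>j. (ip n (tr Af j) (unitv i))\<^sup>2) k l) = (\<Sum>i<n. \<Sum>j<n. (Af i j)\<^sup>2 * Af k j * Af l j)"
    by (simp add: gen_def ip_unitv tr_def)
  also have "\<dots> = (\<Sum>j<n. \<Sum>i<n. (Af i j)\<^sup>2 * Af k j * Af l j)" by (rule sum.swap)
  also have "\<dots> = gen d k l" by (simp add: gen_def d_def sum_distrib_right)
  finally have eq: "(\<Sum>i<n. gen (\<lambda>j. (ip n (tr Af j) (unitv i))\<^sup>2) k l) = gen d k l" .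
  show "\<bar>est_M n (m L) (Y L) k l - gen d k l\<bar> \<le> P (-800)"
    unfolding eq[symmetric] by (rule est_M_err[OF kl]) (use X4_form[OF kl] gen_form in simp)
qed (simp_all add: est_sym)

interpretation estimate "real (w L)" n Af dual_basis "w L" "est_M n (m L) (Y L)" by (rule estimate_w)

text \<open>Completeness of the stopping test: M = A diag(d) A^T with each d_j at least the square
  of lambda, so M is bounded below by the fourth power of lambda and \<open>not_accepted\<close>
  applies.\<close>

lemma passes_w:
  assumes tr: "est_trace n (m L) (Y L) < real (w L)" and \<epsilon>: "1 \<le> \<epsilon> * real (w L)"
    and big: "2 < lambda_min A ^ 4 * real (w L)"
  shows "passes (c + 3) n \<epsilon> y L"
proof -
  have low: "lambda_min A ^ 4 * nrm n x \<le> nrm n (mv n (gen d) x)" for x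
  proof -
    have "((lambda_min A)\<^sup>2 * nrm n (AT x))\<^sup>2 \<le> (nrm n (\<lambda>j. d j * AT x j))\<^sup>2"
    proof -
      have "(\<Sum>j<n. (lambda_min A)\<^sup>2 * AT x j * ((lambda_min A)\<^sup>2 * AT x j)) \<le> (\<Sum>j<n. d j * AT x j * (d j * AT x j))"
      proof (rule sum_mono)
        fix j assume "j \<in> {..<n}"
        then have "(lambda_min A)\<^sup>2 \<le> d j" using lambda_le_col[of j] by (simp add: d_def)
        then have "\<bar>(lambda_min A)\<^sup>2 * AT x j\<bar> \<le> \<bar>d j * AT x j\<bar>" by (simp add: abs_mult mult_right_mono d_nonneg)
        then show "(lambda_min A)\<^sup>2 * AT x j * ((lambda_min A)\<^sup>2 * AT x j) \<le> d j * AT x j * (d j * AT x j)"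
          by (metis abs_le_square_iff power2_eq_square)
      qed
      then show ?thesis
        unfolding power_mult_distrib nrm_sq by (simp add: ip_def sum_distrib_left power2_eq_square mult_ac)
    qed
    then have 1: "(lambda_min A)\<^sup>2 * nrm n (AT x) \<le> nrm n (\<lambda>j. d j * AT x j)" by (rule power2_le_imp_le) simp
    have "lambda_min A ^ 4 * nrm n x = lambda_min A * ((lambda_min A)\<^sup>2 * (lambda_min A * nrm n x))"
      by (simp add: power2_eq_square power4_eq_xxxx mult_ac)
    also have "\<dots> \<le> lambda_min A * ((lambda_min A)\<^sup>2 * nrm n (AT x))"
      using lam by (intro mult_left_mono lambda_lower_transpose) auto
    also have "\<dots> \<le> lambda_min A * nrm n (\<lambda>j. d j * AT x j)" using lam 1 by (intro mult_left_mono) auto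
    also have "\<dots> \<le> nrm n (mv n (gen d) x)" unfolding mv_gen by (rule lambda_lower)
    finally show ?thesis .
  qed
  have "\<not> accepted n (est_M n (m L) (Y L)) (real (w L) ^ 8) (w L ^ 20) k" if "k < n" for k
    using not_accepted[OF low big that] P_nat[of 8] by simp
  then show ?thesis unfolding passes_def using tr \<epsilon> by (simp add: w_def)
qed

lemma ica_w:
  assumes "passes (c + 3) n \<epsilon> y L"
  shows "ica (real (w L)) n Af dual_basis (w L) (est_M n (m L) (Y L)) (rand_dir depth b)
    (est_H n (m L) (Y L) (rand_dir depth b))"
proof
  have u: "\<bar>rand_dir depth b i\<bar> \<le> 1" for i using rand_dir_bounds[of depth b i] by simp
  then show "\<bar>rand_dir depth b i\<bar> \<le> 1" for i .
  fix k :: nat assume k: "k < n"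
  show "\<not> accepted n (est_M n (m L) (Y L)) (P 8) (w L ^ 20) k"
    using assms k P_nat[of 8] by (simp add: passes_def w_def)
  fix l assume l: "l < n"
  show "\<bar>est_H n (m L) (Y L) (rand_dir depth b) k l - gen (\<lambda>j. (ip n (tr Af j) (rand_dir depth b))\<^sup>2) k l\<bar> \<le> P (-800)"
    by (rule order.trans[OF est_H_err[OF u k l] P_mono]) (use X4_form[OF k l] gen_form in simp_all)
next
  fix i j k :: nat and s :: real
  let ?z = "\<lambda>k. Af k i / nrm n (tr Af i) - s * (Af k j / nrm n (tr Af j))"
  assume "i < n" "j < n" "i \<noteq> j" "k < n" "s = 1 \<or> s = - 1"
  then have "\<bar>?z k\<bar> \<le> 2 * 2 ^ depth * \<bar>ip n (rand_dir depth b) ?z\<bar>" by (intro directions) auto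
  also have "\<dots> \<le> real (w L) * \<bar>ip n (rand_dir depth b) ?z\<bar>"
    using of_nat_mono[OF depth_le(1)[OF L], where ?'a = real] by (intro mult_right_mono) simp_all
  finally show "\<bar>?z k\<bar> \<le> real (w L) * \<bar>ip n (rand_dir depth b) ?z\<bar>" .
qed (simp_all add: est_sym)

text \<open>All entry errors are at most W^(-9), while the precision is at least W^(-1). In A A^T
  the permutation disappears by reindexing and the signs because they square to 1.\<close>

lemma output_correct:
  assumes \<epsilon>: "1 \<le> \<epsilon> * real (w L)" and \<phi>: "bij_betw \<phi> {..<n} {..<n}"
    and X: "\<And>j. j < n \<Longrightarrow> \<exists>\<sigma>. (\<sigma> = 1 \<or> \<sigma> = - 1) \<and> (\<forall>r<n. \<bar>X r j - \<sigma> * Af r (\<phi> j)\<bar> \<le> P (-14))"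
    and Z: "\<And>i j. i < n \<Longrightarrow> j < n \<Longrightarrow> Z i j = est_cov (m L) (Y L) i j - (\<Sum>l<n. X i l * X j l)"
  shows "recovers_mixing n \<epsilon> A (mat n n (\<lambda>(i, j). X i j))" "recovers_covariance \<epsilon> S (mat n n (\<lambda>(i, j). Z i j))"
proof -
  obtain \<sigma> where \<sigma>: "\<And>j. j < n \<Longrightarrow> \<sigma> j = 1 \<or> \<sigma> j = - 1"
    "\<And>r j. r < n \<Longrightarrow> j < n \<Longrightarrow> \<bar>X r j - \<sigma> j * Af r (\<phi> j)\<bar> \<le> P (-14)"
    using X by metis
  have \<phi>n: "\<phi> j < n" if "j < n" for j using \<phi> that by (auto simp: bij_betw_def)
  have \<epsilon>P: "P (-1) \<le> \<epsilon>" using P_neg_nat[of 1] \<epsilon> scale.W16[OF scale_w] by (simp add: divide_le_eq)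
  have frob: "sqrt (\<Sum>i<n. \<Sum>j<n. (E i j)\<^sup>2) \<le> \<epsilon>" if "\<And>i j. i < n \<Longrightarrow> j < n \<Longrightarrow> \<bar>E i j\<bar> \<le> P (-9)" for E
  proof -
    have "sqrt (\<Sum>i<n. \<Sum>j<n. (E i j)\<^sup>2) \<le> real n * P (-9)" by (rule frobenius_le) (use that in auto)
    also have "\<dots> \<le> P (-8)" using n_mult[of "P (-9)" "-9"] by simp
    also have "\<dots> \<le> P (-1)" by (rule P_mono) simp
    finally show ?thesis using \<epsilon>P by linarith
  qed
  define p where "p j = (if j < n then \<phi> j else j)" for j
  have "bij_betw p {..<n} {..<n}" using \<phi> by (rule iffD1[OF bij_betw_cong, rotated]) (simp add: p_def)
  then have p: "p permutes {..<n}" by (rule bij_imp_permutes) (simp add: p_def)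
  show "recovers_mixing n \<epsilon> A (mat n n (\<lambda>(i, j). X i j))"
    unfolding recovers_mixing_iff[OF A]
  proof (intro bexI conjI)
    show "p \<in> {p. p permutes {..<n}}" using p by simp
    show "(\<lambda>j\<in>{..<n}. \<sigma> j) \<in> {..<n} \<rightarrow>\<^sub>E {1, -1}" using \<sigma>(1) by auto
    show "sqrt (\<Sum>i<n. \<Sum>j<n. (X i j - A $$ (i, p j) * restrict \<sigma> {..<n} j)\<^sup>2) \<le> \<epsilon>"
    proof (rule frob)
      fix i j assume ij: "i < n" "j < n"
      have "\<bar>X i j - A $$ (i, p j) * restrict \<sigma> {..<n} j\<bar> = \<bar>X i j - \<sigma> j * Af i (\<phi> j)\<bar>"
        using ij by (simp add: p_def Af_def mult.commute)
      also have "\<dots> \<le> P (-14)" using \<sigma>(2) ij by simp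
      also have "\<dots> \<le> P (-9)" by (rule P_mono) simp
      finally show "\<bar>X i j - A $$ (i, p j) * restrict \<sigma> {..<n} j\<bar> \<le> P (-9)" .
    qed
  qed
  have S: "S \<in> carrier_mat n n" by (simp add: covariance_mat_def)
  show "recovers_covariance \<epsilon> S (mat n n (\<lambda>(i, j). Z i j))"
    unfolding recovers_covariance_iff[OF S]
  proof (rule frob)
    fix i j assume ij: "i < n" "j < n"
    have "(\<Sum>l<n. Af i l * Af j l) = (\<Sum>l<n. Af i (\<phi> l) * Af j (\<phi> l))"
      using sum.reindex_bij_betw[OF \<phi>, of "\<lambda>l. Af i l * Af j l"] by simp
    also have "\<dots> = (\<Sum>l<n. (\<sigma> l * Af i (\<phi> l)) * (\<sigma> l * Af j (\<phi> l)))"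
    proof (rule sum.cong)
      fix l assume "l \<in> {..<n}"
      then show "Af i (\<phi> l) * Af j (\<phi> l) = (\<sigma> l * Af i (\<phi> l)) * (\<sigma> l * Af j (\<phi> l))" using \<sigma>(1)[of l] by auto
    qed simp
    finally have eq: "(\<Sum>l<n. Af i l * Af j l) = (\<Sum>l<n. (\<sigma> l * Af i (\<phi> l)) * (\<sigma> l * Af j (\<phi> l)))" .
    have "\<bar>\<Sum>l<n. X i l * X j l - (\<sigma> l * Af i (\<phi> l)) * (\<sigma> l * Af j (\<phi> l))\<bar> \<le> P (-11 + 1)"
    proof (rule sum_le)
      fix l assume l: "l < n"
      have a: "\<bar>\<sigma> l * Af r (\<phi> l)\<bar> \<le> P 1" if "r < n" for r
        using A_le[OF that \<phi>n[OF l]] \<sigma>(1)[OF l] by auto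
      have x: "\<bar>X r l\<bar> \<le> P 2" if "r < n" for r
        using a[OF that] \<sigma>(2)[OF that l] P_add_le[of "P 1" 1 "P (-14)" "-14" 2] by simp
      show "\<bar>X i l * X j l - (\<sigma> l * Af i (\<phi> l)) * (\<sigma> l * Af j (\<phi> l))\<bar> \<le> P (-11)"
        using prod_err[OF \<sigma>(2)[OF ij(1) l] \<sigma>(2)[OF ij(2) l] x[OF ij(2)] a[OF ij(1)], of "-11"] by simp
    qed
    then have "\<bar>(\<Sum>l<n. X i l * X j l) - (\<Sum>l<n. Af i l * Af j l)\<bar> \<le> P (-10)"
      unfolding eq sum_subtractf by simp
    moreover have "\<bar>est_cov (m L) (Y L) i j - C i j\<bar> \<le> P (-828)" by (rule Ch_err[OF ij])
    moreover have "S $$ (i, j) = C i j - (\<Sum>l<n. Af i l * Af j l)" using covariance_mat_cov[OF ij] by (simp add: C_def)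
    moreover have "P (-828) + P (-10) \<le> P (-9)" by (rule P_add_le[of _ "-828" _ "-10"]) auto
    ultimately show "\<bar>Z i j - S $$ (i, j)\<bar> \<le> P (-9)" unfolding Z[OF ij] by linarith
  qed
qed

end

lemma V_le_if_passes: "n + 16 \<le> L \<Longrightarrow> passes (c + 3) n \<epsilon> y L \<Longrightarrow> V \<le> 2 * real (w L)"
proof -
  assume L: "n + 16 \<le> L" and "passes (c + 3) n \<epsilon> y L"
  then have "est_trace n (m L) (Y L) < real (w L)" unfolding passes_def w_def by blast
  then show ?thesis using trace_close[OF L] V_pos by linarith
qed

text \<open>L is any passing scale and serves only to bound the iterations. The program stops at the
  least passing scale K, possibly earlier than expected, and accuracy is established at K from its
  own test.\<close>

lemma run_correct:
  assumes L: "n + 16 \<le> L" "passes (c + 3) n \<epsilon> y L"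
  shows "\<exists>s. bs n y b (m L) (program c (c + 3)) (init_state n \<epsilon>) s \<and>
    recovers_mixing n \<epsilon> A (matrix_of n s 1) \<and> recovers_covariance \<epsilon> S (matrix_of n s 2)"
proof -
  define K where "K = (LEAST L. n + 16 \<le> L \<and> passes (c + 3) n \<epsilon> y L)"
  have K: "n + 16 \<le> K" "passes (c + 3) n \<epsilon> y K"
    using LeastI[of "\<lambda>L. n + 16 \<le> L \<and> passes (c + 3) n \<epsilon> y L"] L unfolding K_def by blast+
  have first: "\<not> passes (c + 3) n \<epsilon> y l" if "n + 16 \<le> l" "l < K" for l
    using not_less_Least[of l "\<lambda>L. n + 16 \<le> L \<and> passes (c + 3) n \<epsilon> y L"] that unfolding K_def by blast
  have KL: "K \<le> L" unfolding K_def using L by (intro Least_le) simp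
  have wKL: "w K \<le> w L" using KL by (simp add: w_def power_mono)
  have mKL: "m K \<le> m L" using wKL by (simp add: power_mono)
  have wm: "w L \<le> m L" using w_ge(2)[OF L(1)] by (intro self_le_power) auto
  have VK: "V \<le> 2 * real (w K)" by (rule V_le_if_passes[OF K])
  have \<epsilon>: "1 \<le> \<epsilon> * real (w K)" using K(2) by (simp add: passes_def w_def)
  interpret machine n y b "m L" by standard (use w_ge(3)[OF L(1)] wm in linarith)
  define G where "G s \<longleftrightarrow> (\<exists>\<phi>. bij_betw \<phi> {..<n} {..<n} \<and> (\<forall>j<n. \<exists>\<sigma>. (\<sigma> = 1 \<or> \<sigma> = - 1) \<and>
    (\<forall>r<n. \<bar>arr n s 1 r j - \<sigma> * Af r (\<phi> j)\<bar> \<le> pw (real (w K)) (-14))))" for s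
  have "Wp (program c (c + 3)) (\<lambda>s. \<exists>r. G r \<and> reals s 1 = reals r 1 \<and> (\<forall>i<n. \<forall>j<n. arr n s 2 i j =
    est_cov ((K ^ (c + 3)) ^ 1700) (block (c + 3) n y K) i j - (\<Sum>l<n. arr n s 1 i l * arr n s 1 j l))) (init_state n \<epsilon>)"
  proof (rule wp_program[OF n1 _ depth _ K first])
    show "depth \<le> m L" using depth_le(2)[OF L(1)] wm by linarith
    show "(K ^ (c + 3)) ^ 1700 \<le> m L" using mKL by (simp add: w_def)
    fix s u assume s: "ints s 0 = n" "ints s 1 = K" and est: "estimates (c + 3) u K s"
      and u: "\<And>i. i < n \<Longrightarrow> u i = real (bits_value b (i * depth) depth) / 2 ^ depth"
    have H: "est_H n (m K) (Y K) u = est_H n (m K) (Y K) (rand_dir depth b)"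
      by (rule est_H_cong) (simp add: u rand_dir_def)
    interpret R: ica_run "real (w K)" n Af dual_basis "w K" "est_M n (m K) (Y K)" "rand_dir depth b"
      "est_H n (m K) (Y K) (rand_dir depth b)" y b "m L" "c + 3" K
      by (intro ica_run.intro ica_w[OF K(1) VK K(2)] machine_axioms, standard) (use mKL in \<open>simp_all add: w_def\<close>)
    show "Wp (scan (c + 3)) G s"
      unfolding G_def R.good_def[symmetric]
      by (rule R.wp_scan[OF s]) (use est in \<open>simp add: estimates_def H[symmetric] w_def[symmetric]\<close>)
  qed auto
  then obtain s r where bs: "bs n y b (m L) (program c (c + 3)) (init_state n \<epsilon>) s" and r: "G r" "reals s 1 = reals r 1"
    and Z: "\<And>i j. i < n \<Longrightarrow> j < n \<Longrightarrow> arr n s 2 i j =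
      est_cov (m K) (Y K) i j - (\<Sum>l<n. arr n s 1 i l * arr n s 1 j l)"
    unfolding wp_def by (auto simp: w_def)
  have "G s" using r by (simp add: G_def arr_def)
  then obtain \<phi> where \<phi>: "bij_betw \<phi> {..<n} {..<n}"
    "\<And>j. j < n \<Longrightarrow> \<exists>\<sigma>. (\<sigma> = 1 \<or> \<sigma> = - 1) \<and> (\<forall>r<n. \<bar>arr n s 1 r j - \<sigma> * Af r (\<phi> j)\<bar> \<le> pw (real (w K)) (-14))"
    unfolding G_def by blast
  have mat: "matrix_of n s a = mat n n (\<lambda>(i, j). arr n s a i j)" for a by (simp add: matrix_of_def arr_def)
  note correct = output_correct[where X = "arr n s 1" and Z = "arr n s 2", OF K(1) VK \<epsilon> \<phi>(1)]
  have "recovers_mixing n \<epsilon> A (matrix_of n s 1)" unfolding mat by (rule correct(1)) (use \<phi>(2) Z in auto)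
  moreover have "recovers_covariance \<epsilon> S (matrix_of n s 2)" unfolding mat by (rule correct(2)) (use \<phi>(2) Z in auto)
  ultimately show ?thesis using bs by blast
qed

end

section \<open>Success probability and running time\<close>

lemma op_norm_nonneg: "M \<in> carrier_mat n n \<Longrightarrow> 1 \<le> n \<Longrightarrow> 0 \<le> op_norm M"
proof -
  assume M: "M \<in> carrier_mat n n" and n: "1 \<le> n"
  have "0 \<le> sqrt (\<Sum>i<n. (M $$ (i, 0))\<^sup>2)" by (simp add: sum_nonneg)
  also have "\<dots> \<le> op_norm M" using entry_le_op_norm[OF M, of 0] n by simp
  finally show ?thesis .
qed

context ica_instance
begin

definition parameters :: "real \<Rightarrow> real" where
  "parameters \<epsilon> = 1 + real n + 1 / \<epsilon> + op_norm A + op_norm S + 1 / lambda_min A"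

text \<open>Since W is at least L, the summands meet the requirements of \<open>passes_w\<close>: 2
  V for the trace, whose estimate is at most 3 V / 2, and a constant 3 above the 2 needed for
  conditioning.\<close>

definition threshold :: "real \<Rightarrow> nat" where
  "threshold \<epsilon> = n + 16 + nat \<lceil>2 * V\<rceil> + nat \<lceil>1 / \<epsilon>\<rceil> + nat \<lceil>3 / lambda_min A ^ 4\<rceil>"

lemma threshold_le:
  assumes eps: "0 < \<epsilon>"
  shows "real (threshold \<epsilon>) \<le> 40 * parameters \<epsilon> ^ 4"
proof -
  define x where "x = parameters \<epsilon>"
  have op: "0 \<le> op_norm A" "0 \<le> op_norm S"
    using op_norm_nonneg[OF A n1] op_norm_nonneg[of S n] n1 by (simp_all add: covariance_mat_def)
  have inv: "0 < 1 / \<epsilon>" "0 < 1 / lambda_min A" using eps lam by simp_all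
  have x: "1 \<le> x" "real n \<le> x" "1 / \<epsilon> \<le> x" "op_norm A \<le> x" "op_norm S \<le> x" "1 / lambda_min A \<le> x"
    unfolding x_def parameters_def using op inv by linarith+
  have up: "x ^ k \<le> x ^ 4" if "k \<le> 4" for k using x that by (intro power_increasing) auto
  have "V \<le> real n * (op_norm A)\<^sup>2 + real n * op_norm S" by (rule V_le)
  also have "\<dots> \<le> x * x\<^sup>2 + x * x" using x op by (intro add_mono mult_mono power_mono) auto
  also have "\<dots> = x ^ 3 + x ^ 2" by (simp add: power2_eq_square power3_eq_cube)
  also have "\<dots> \<le> 2 * x ^ 4" using up[of 3] up[of 2] by simp
  finally have V: "V \<le> 2 * x ^ 4" .
  have l: "3 / lambda_min A ^ 4 \<le> 3 * x ^ 4"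
    using power_mono[OF x(6), of 4] inv by (simp add: power_divide)
  have c: "real (nat \<lceil>z\<rceil>) \<le> z + 1" if "0 \<le> z" for z :: real using that by linarith
  have "real (threshold \<epsilon>) \<le> real n + 16 + (2 * V + 1) + (1 / \<epsilon> + 1) + (3 / lambda_min A ^ 4 + 1)"
    unfolding threshold_def of_nat_add of_nat_numeral using V_pos inv lam by (intro add_mono c order.refl) auto
  also have "\<dots> \<le> 40 * x ^ 4" using V l x up[of 1] up[of 0] by simp
  finally show ?thesis by (simp add: x_def)
qed

end

lemma (in ica_outcome) threshold_passes: "passes (c + 3) n \<epsilon> y (threshold \<epsilon>)"
proof -
  let ?L = "threshold \<epsilon>"
  have L: "n + 16 \<le> ?L" by (simp add: threshold_def)
  have c: "z \<le> real (nat \<lceil>z\<rceil>)" for z :: real by (rule real_nat_ceiling_ge)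
  have "2 * V + (1 / \<epsilon> + 3 / lambda_min A ^ 4) \<le> real ?L"
    unfolding threshold_def of_nat_add of_nat_numeral using c[of "2 * V"] c[of "1 / \<epsilon>"] c[of "3 / lambda_min A ^ 4"] by linarith
  also have "real ?L \<le> real (w ?L)" using w_ge(1)[OF L] by simp
  finally have le: "2 * V + (1 / \<epsilon> + 3 / lambda_min A ^ 4) \<le> real (w ?L)" .
  have pos: "0 < 1 / \<epsilon>" "0 < 3 / lambda_min A ^ 4" using eps lam by simp_all
  show ?thesis
  proof (rule passes_w[OF L])
    show "V \<le> 2 * real (w ?L)" using le pos V_pos by linarith
    show "est_trace n (m ?L) (Y ?L) < real (w ?L)" using trace_close[OF L] le pos V_pos by linarith
    have "1 / \<epsilon> \<le> real (w ?L)" using le pos V_pos by linarith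
    then show "1 \<le> \<epsilon> * real (w ?L)" using eps by (simp add: divide_le_eq mult.commute)
    have "3 / lambda_min A ^ 4 \<le> real (w ?L)" using le pos V_pos by linarith
    then have "3 \<le> lambda_min A ^ 4 * real (w ?L)" using lam by (simp add: divide_le_eq mult.commute)
    then show "2 < lambda_min A ^ 4 * real (w ?L)" by linarith
  qed
qed

context ica_instance
begin

lemma success_probability:
  assumes eps: "0 < \<epsilon>"
    and time: "\<And>n W. 1 \<le> W \<Longrightarrow> n \<le> W \<Longrightarrow> time_bound n W (program c (c + 3)) \<le> K * W ^ e"
    and E: "E = (c + 3) * 1700 * e"
  shows "1 - 1 / (real n + 1) ^ c \<le> measure (ica_space n A N)
    {\<omega> \<in> space (ica_space n A N). succeeds (program c (c + 3)) n \<epsilon> A S (real K * 40 ^ E * parameters \<epsilon> ^ (4 * E)) \<omega>}"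
proof -
  let ?T = "real K * 40 ^ E * parameters \<epsilon> ^ (4 * E)"
  let ?L = "threshold \<epsilon>"
  let ?M = "stream \<Otimes>\<^sub>M coin_space"
  interpret Y: prob_space stream by (rule prob_space_stream)
  interpret B: prob_space coin_space by (rule prob_space_coin_space)
  interpret YB: pair_prob_space stream coin_space ..
  have M: "ica_space n A N = ?M" by (simp add: ica_space_def)
  define depth where "depth = (LEAST t. 4 * (n + 1) ^ (c + 2) \<le> (2::nat) ^ t)"
  have depth: "4 * (n + 1) ^ (c + 2) \<le> (2::nat) ^ depth" unfolding depth_def
    by (rule LeastI[of _ "4 * (n + 1) ^ (c + 2)"]) (rule less_imp_le[OF less_exp])
  have depth': "2 ^ t < 4 * (n + 1) ^ (c + 2)" if "t < depth" for t
    using not_less_Least[OF that[unfolded depth_def]] by simp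
  obtain G1 where G1: "G1 \<in> sets stream" "1 - 1 / (2 * (real n + 1) ^ c) \<le> measure stream G1"
    "\<And>y L. y \<in> G1 \<Longrightarrow> n + 16 \<le> L \<Longrightarrow> concentrated (L ^ (c + 3)) (block (c + 3) n y L)"
    using typical_samples[of c] by blast
  obtain G2 where G2: "G2 \<in> sets coin_space" "1 - 2 * (real n)\<^sup>2 / 2 ^ depth \<le> measure coin_space G2"
    "\<And>b i j s k. b \<in> G2 \<Longrightarrow> i < n \<Longrightarrow> j < n \<Longrightarrow> s \<in> {1, -1} \<Longrightarrow> k < n \<Longrightarrow>
      \<bar>Af k i / nrm n (tr Af i) - s * (Af k j / nrm n (tr Af j))\<bar> \<le>
      2 * 2 ^ depth * \<bar>ip n (rand_dir depth b) (\<lambda>k. Af k i / nrm n (tr Af i) - s * (Af k j / nrm n (tr Af j)))\<bar>"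
    using good_directions[OF n1, of depth "\<lambda>i k. Af k i / nrm n (tr Af i)"] by blast
  have sub: "G1 \<times> G2 \<subseteq> {\<omega> \<in> space ?M. succeeds (program c (c + 3)) n \<epsilon> A S ?T \<omega>}"
  proof (intro subsetI, clarify)
    fix y b assume yb: "y \<in> G1" "b \<in> G2"
    interpret ica_outcome n N A c depth \<epsilon> y b
      by standard (use eps depth depth' G1(3)[OF yb(1)] G2(3)[OF yb(2)] in auto)
    have L: "n + 16 \<le> ?L" by (simp add: threshold_def)
    obtain s where s: "bs n y b (m ?L) (program c (c + 3)) (init_state n \<epsilon>) s"
      "recovers_mixing n \<epsilon> A (matrix_of n s 1)" "recovers_covariance \<epsilon> S (matrix_of n s 2)"
      using run_correct[OF L threshold_passes] by blast
    obtain t where t: "t \<le> time_bound n (m ?L) (program c (c + 3))" "exec n y b (program c (c + 3)) (init_state n \<epsilon>) t s"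
      using bs_imp_exec[OF s(1)] by blast
    have "w ?L \<le> m ?L" using w_ge(2)[OF L] by (intro self_le_power) auto
    then have "time_bound n (m ?L) (program c (c + 3)) \<le> K * m ?L ^ e"
      using w_ge[OF L] by (intro time) auto
    also have "m ?L ^ e = ?L ^ E" unfolding E w_def by (simp only: power_mult mult.assoc)
    finally have "real t \<le> real K * real ?L ^ E" using t(1) by (metis of_nat_le_iff of_nat_mult of_nat_power order.trans)
    also have "\<dots> \<le> real K * (40 * parameters \<epsilon> ^ 4) ^ E"
      using threshold_le[OF eps] by (intro mult_left_mono power_mono) auto
    also have "\<dots> = ?T" by (simp add: power_mult_distrib power_mult)
    finally have T: "real t \<le> ?T" .
    moreover have "samples s \<le> t" using exec_samples_le[OF t(2)] by (simp add: init_state_def)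
    then have "real (samples s) \<le> ?T" using T by linarith
    moreover have "(y, b) \<in> space ?M" using sets.sets_into_space[OF G1(1)] sets.sets_into_space[OF G2(1)] yb
      by (auto simp: space_pair_measure)
    ultimately show "(y, b) \<in> space ?M \<and> succeeds (program c (c + 3)) n \<epsilon> A S ?T (y, b)"
      unfolding succeeds_def using t(2) s(2,3) by auto
  qed
  have meas: "{\<omega> \<in> space ?M. succeeds (program c (c + 3)) n \<epsilon> A S ?T \<omega>} \<in> sets ?M"
  proof (rule sets_succeeds[OF A])
    show "S \<in> carrier_mat n n" by (simp add: covariance_mat_def)
    show "(\<lambda>w. fst w t i) \<in> borel_measurable ?M" if "i < n" for t i
      by (rule measurable_compose[OF measurable_fst stream_measurable[OF that]])
    show "(\<lambda>w. snd w t) \<in> ?M \<rightarrow>\<^sub>M count_space UNIV" for t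
    proof (rule measurable_compose[OF measurable_snd])
      have "(\<lambda>b. b t) \<in> coin_space \<rightarrow>\<^sub>M measure_pmf (bernoulli_pmf (1/2))"
        by (rule measurable_component_singleton) simp
      then show "(\<lambda>b. b t) \<in> coin_space \<rightarrow>\<^sub>M count_space UNIV" by simp
    qed
  qed
  \<comment> \<open>Half of the permitted failure probability for the samples and half for the
    coins; by independence both good events occur with probability at least the square of 1 -
    \<open>\<delta>\<close>.\<close>
  define \<delta> where "\<delta> = 1 / (2 * (real n + 1) ^ c)"
  have \<delta>: "0 < \<delta>" "\<delta> \<le> 1"
  proof -
    have "1 \<le> (real n + 1) ^ c" by (rule one_le_power) simp
    then have "1 \<le> 2 * (real n + 1) ^ c" by linarith
    then show "0 < \<delta>" "\<delta> \<le> 1" by (simp_all add: \<delta>_def)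
  qed
  have d: "2 * (real n)\<^sup>2 / 2 ^ depth \<le> \<delta>"
  proof -
    have "real (4 * (n + 1) ^ (c + 2)) \<le> real (2 ^ depth)" using depth of_nat_le_iff by blast
    then have "4 * ((real n + 1) ^ c * (real n + 1)\<^sup>2) \<le> 2 ^ depth" by (simp only: of_nat_mult of_nat_power of_nat_add power_add of_nat_numeral of_nat_1)
    moreover have "0 < 4 * ((real n + 1) ^ c * (real n + 1)\<^sup>2)" by simp
    ultimately have "2 * (real n)\<^sup>2 / 2 ^ depth \<le> 2 * (real n + 1)\<^sup>2 / (4 * ((real n + 1) ^ c * (real n + 1)\<^sup>2))"
      by (intro frac_le mult_left_mono power_mono) auto
    also have "\<dots> = \<delta>" by (simp add: \<delta>_def)
    finally show ?thesis .
  qed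
  have "1 - 1 / (real n + 1) ^ c = 1 - 2 * \<delta>" by (simp add: \<delta>_def)
  also have "\<dots> \<le> (1 - \<delta>) * (1 - \<delta>)" using \<delta> by (simp add: algebra_simps)
  also have "\<dots> \<le> measure stream G1 * measure coin_space G2"
    using G1(2) G2(2) d \<delta> by (intro mult_mono) (auto simp: \<delta>_def)
  also have "\<dots> = measure ?M (G1 \<times> G2)"
    unfolding measure_def using G1(1) G2(1) by (simp add: B.emeasure_pair_measure_Times enn2real_mult)
  also have "\<dots> \<le> measure ?M {\<omega> \<in> space ?M. succeeds (program c (c + 3)) n \<epsilon> A S ?T \<omega>}"
    by (rule YB.finite_measure_mono[OF sub meas])
  finally show ?thesis unfolding M .
qed

end

theorem theorem3p1:
  fixes c :: nat
  shows "\<exists>(prog :: com) (K :: real) (d :: nat).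
    \<forall>(n :: nat) (\<epsilon> :: real) (A :: real mat) (N :: (nat \<Rightarrow> real) measure) (S :: real mat).
      n \<ge> 1 \<longrightarrow> \<epsilon> > 0 \<longrightarrow> A \<in> carrier_mat n n \<longrightarrow> lambda_min A > 0 \<longrightarrow>
      gaussian_vector n N \<longrightarrow> centered n N \<longrightarrow> covariance_mat n N = S \<longrightarrow>
      measure (ica_space n A N)
        {\<omega> \<in> space (ica_space n A N).
          succeeds prog n \<epsilon> A S
            (K * (1 + real n + 1 / \<epsilon> + op_norm A + op_norm S + 1 / lambda_min A) ^ d) \<omega>}
        \<ge> 1 - 1 / (real n + 1) ^ c"
proof -
  obtain K e where time: "\<And>n W. 1 \<le> W \<Longrightarrow> n \<le> W \<Longrightarrow> time_bound n W (program c (c + 3)) \<le> K * W ^ e"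
    using time_bound_poly[of "program c (c + 3)"] by blast
  define E where "E = (c + 3) * 1700 * e"
  show ?thesis
  proof (intro exI allI impI)
    fix n :: nat and \<epsilon> :: real and A :: "real mat" and N :: "(nat \<Rightarrow> real) measure" and S :: "real mat"
    assume *: "n \<ge> 1" "\<epsilon> > 0" "A \<in> carrier_mat n n" "lambda_min A > 0"
      "gaussian_vector n N" "centered n N" "covariance_mat n N = S"
    interpret ica_instance n N A by standard (use * in auto)
    show "measure (ica_space n A N)
        {\<omega> \<in> space (ica_space n A N).
          succeeds (program c (c + 3)) n \<epsilon> A S
            (real K * 40 ^ E * (1 + real n + 1 / \<epsilon> + op_norm A + op_norm S + 1 / lambda_min A) ^ (4 * E)) \<omega>}
        \<ge> 1 - 1 / (real n + 1) ^ c"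
      using success_probability[OF *(2) time E_def] unfolding parameters_def *(7) .
  qed
qed

end
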